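(* Let $r,s\in\mathbb N_0$. The Lie derivative commutes with the embedding $\iota^r_s:\mathcal D'^r_s(M)\to\hat{\mathcal E}^r_s(M)$, i.e. for all smooth vector fields $X$ on $M$ and all $v\in\mathcal D'^r_s(M)$, $$\hat{\mathrm L}_X\,\iota^r_s(v)=\iota^r_s(\mathrm L_Xv)$$ (equality in the basic space $\hat{\mathcal E}^r_s(M)$).
   Context: $M$ is an orientable (with fixed orientation), paracompact, smooth Hausdorff manifold of finite dimension $n$. $\mathfrak X(M)$: smooth vector fields; $\Omega^n_{\mathrm c}(M)$: compactly supported smooth $n$-forms; $\mathcal T^r_s(M)$: smooth sections of the bundle $\mathrm T^r_sM$ of tensors with $r$ contravariant and $s$ covariant slots. Section spaces $\Gamma(M,E)$ carry the (F)-topology (uniform convergence of all derivatives on compact sets in charts), and $\Gamma_{\mathrm c}(M,E)$ the usual (LF) inductive limit topology. $\mathcal D'^r_s(M):=(\mathcal T^s_r(M)\otimes_{C^\infty(M)}\Omega^n_{\mathrm c}(M))'$ (topological dual for the (LF)-topology); the action is written $\langle v,\tilde t\otimes\omega\rangle$, and $\langle \mathrm L_Xv,\tilde t\otimes\omega\rangle=-\langle v,\mathrm L_X(\tilde t\otimes\omega)\rangle$. Smoothness is in the sense of convenient calculus (Kriegl–Michor): maps between locally convex spaces (or manifolds modelled on them) are smooth iff they map smooth curves to smooth curves. Basic space. $\hat{\mathcal A}_0(M):=\{\omega\in\Omega^n_{\mathrm c}(M):\int_M\omega=1\}$. $\mathrm{TO}(M,M)$ is the vector bundle over $M\times M$ with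 fiber $\mathrm L(\mathrm T_pM,\mathrm T_qM)$ at $(p,q)$, and $\hat{\mathcal B}(M):=\Gamma_{\mathrm c}(\mathrm{TO}(M,M))$; both carry their (LF)-topologies. $\hat{\mathcal E}^r_s(M):=\{u\in C^\infty(\hat{\mathcal A}_0(M)\times M\times\hat{\mathcal B}(M),\mathrm T^r_sM): u(\omega,p,A)\in(\mathrm T^r_s)_pM\}$; $u(\omega,A)$ denotes the tensor field $p\mapsto u(\omega,p,A)$. Embedding. For $A\in\hat{\mathcal B}(M)$, $A^s_r(p,q):(\mathrm T^s_r)_pM\to(\mathrm T^s_r)_qM$ is the linear map $w_1\otimes\dots\otimes w_s\otimes\beta^1\otimes\dots\otimes\beta^r\mapsto A(p,q)w_1\otimes\dots\otimes A(p,q)w_s\otimes A(q,p)^{\mathrm{ad}}\beta^1\otimes\dots\otimes A(q,p)^{\mathrm{ad}}\beta^r$ ($w_i\in\mathrm T_pM$, $\beta^j\in\mathrm T^*_pM$, $^{\mathrm{ad}}$ = adjoint). $\iota^r_s(v)\in\hat{\mathcal E}^r_s(M)$ is given by $\iota^r_s(v)(\omega,p,A)\cdot\tilde t(p):=\langle v(\cdot),(A^s_r(p,\cdot)\,\tilde t(p))\otimes\omega(\cdot)\rangle$ for all $\tilde t\in\mathcal T^s_r(M)$. Lie derivative. For $X\in\mathfrak X(M)$ with (local) flow $\mathrm{Fl}^X_\tau$ and $A\in\hat{\mathcal B}(M)$, $\mathrm L_XA(p,q):=\frac{d}{d\tau}|_{0}(\mathrm T_q\mathrm{Fl}^X_\tau)^{-1}\circ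 A(\mathrm{Fl}^X_\tau p,\mathrm{Fl}^X_\tau q)\circ\mathrm T_p\mathrm{Fl}^X_\tau$. For $u\in\hat{\mathcal E}^r_s(M)$: $(\hat{\mathrm L}_Xu)(\omega,p,A):=\mathrm L_X(u(\omega,A))(p)-\mathrm d_1u(\omega,p,A)(\mathrm L_X\omega)-\mathrm d_3u(\omega,p,A)(\mathrm L_XA)$, where $\mathrm d_i$ is the differential in the $i$-th slot. *)

theory Defs
  imports "HOL-Analysis.Analysis" "HOL-Library.Function_Algebras"
begin

section \<open>Pointwise real vector space structure on functions\<close>

instantiation "fun" :: (type, real_vector) real_vector
begin

definition "scaleR a f = (\<lambda>x. a *\<^sub>R f x)"

instance
  by standard (simp_all add: scaleR_fun_def fun_eq_iff scaleR_add_right scaleR_add_left)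

end

lemma scaleR_fun_apply [simp]: "(a *\<^sub>R f) x = a *\<^sub>R f x"
  by (simp add: scaleR_fun_def)


section \<open>Smooth functions between Euclidean spaces\<close>

primrec partials ::
  "'e list \<Rightarrow> ('e::euclidean_space \<Rightarrow> 'b::real_normed_vector) \<Rightarrow> 'e \<Rightarrow> 'b" where
  "partials [] f = f"
| "partials (v # vs) f = (\<lambda>x. frechet_derivative (partials vs f) (at x) v)"

text \<open>Intended for open sets only.\<close>

definition smooth_on :: "'e set \<Rightarrow> ('e::euclidean_space \<Rightarrow> 'b::real_normed_vector) \<Rightarrow> bool" where
  "smooth_on U f \<longleftrightarrow>
    (\<forall>vs. set vs \<subseteq> Basis \<longrightarrow> (\<forall>x\<in>U. partials vs f differentiable (at x)))"


section \<open>Oriented smooth manifolds\<close>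

definition paracompact_space :: "'a topology \<Rightarrow> bool" where
  "paracompact_space X \<longleftrightarrow>
    (\<forall>\<U>. (\<forall>U\<in>\<U>. openin X U) \<and> \<Union>\<U> = topspace X \<longrightarrow>
      (\<exists>\<V>. (\<forall>V\<in>\<V>. openin X V \<and> (\<exists>U\<in>\<U>. V \<subseteq> U)) \<and> \<Union>\<V> = topspace X \<and>
           locally_finite_in X \<V>))"

text \<open>
  The manifold is the whole type \<open>'a\<close>; its dimension is the cardinality of the index type \<open>'n\<close>.
  A chart is a pair of its domain and its coordinate map, whose values off the domain are
  irrelevant.
\<close>

type_synonym ('a, 'n) chart = "'a set \<times> ('a \<Rightarrow> real^'n)"

definition chart_inv :: "('a, 'n::finite) chart \<Rightarrow> real^'n \<Rightarrow> 'a" where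
  "chart_inv c = inv_into (fst c) (snd c)"

definition is_chart :: "('a::topological_space, 'n::finite) chart \<Rightarrow> bool" where
  "is_chart c \<longleftrightarrow> open (fst c) \<and> open (snd c ` fst c) \<and>
    homeomorphism (fst c) (snd c ` fst c) (snd c) (chart_inv c)"

definition charts_at :: "('a, 'n::finite) chart set \<Rightarrow> 'a \<Rightarrow> ('a, 'n) chart set" where
  "charts_at \<A> p = {c \<in> \<A>. p \<in> fst c}"

definition chart_at :: "('a, 'n::finite) chart set \<Rightarrow> 'a \<Rightarrow> ('a, 'n) chart" where
  "chart_at \<A> p = (SOME c. c \<in> charts_at \<A> p)"

text \<open>Matrix of the tangent map of \<open>f\<close> at \<open>p\<close>, from the chart \<open>c\<close> at \<open>p\<close> to the chart \<open>d\<close> at \<open>f p\<close>.\<close>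

definition tangent_matrix ::
  "('a \<Rightarrow> 'a) \<Rightarrow> ('a, 'n::finite) chart \<Rightarrow> ('a, 'n) chart \<Rightarrow> 'a \<Rightarrow> real^'n^'n" where
  "tangent_matrix f c d p = matrix (frechet_derivative (snd d \<circ> f \<circ> chart_inv c) (at (snd c p)))"

abbreviation jac :: "('a, 'n::finite) chart \<Rightarrow> ('a, 'n) chart \<Rightarrow> 'a \<Rightarrow> real^'n^'n" where
  "jac c d p \<equiv> tangent_matrix (\<lambda>q. q) c d p"

text \<open>
  Smooth structure and orientation are both carried by an atlas of positively oriented charts. It
  need not be maximal: none of the notions below changes when further compatible, positively
  oriented charts are added.
\<close>

definition oriented_smooth_atlas :: "('a::topological_space, 'n::finite) chart set \<Rightarrow> bool" where
  "oriented_smooth_atlas \<A> \<longleftrightarrow>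
    (\<forall>c\<in>\<A>. is_chart c) \<and> (\<Union>c\<in>\<A>. fst c) = UNIV \<and>
    (\<forall>c\<in>\<A>. \<forall>d\<in>\<A>. smooth_on (snd c ` (fst c \<inter> fst d)) (snd d \<circ> chart_inv c) \<and>
      (\<forall>p\<in>fst c \<inter> fst d. det (jac c d p) > 0))"

definition smooth_function :: "('a, 'n::finite) chart set \<Rightarrow> ('a \<Rightarrow> real) \<Rightarrow> bool" where
  "smooth_function \<A> f \<longleftrightarrow> (\<forall>c\<in>\<A>. smooth_on (snd c ` fst c) (f \<circ> chart_inv c))"

definition smooth_curve_in_manifold ::
  "('a::topological_space, 'n::finite) chart set \<Rightarrow> (real \<Rightarrow> 'a) \<Rightarrow> bool" where
  "smooth_curve_in_manifold \<A> \<gamma> \<longleftrightarrow> continuous_on UNIV \<gamma> \<and>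
    (\<forall>c\<in>\<A>. smooth_on {t. \<gamma> t \<in> fst c} (snd c \<circ> \<gamma>))"

definition supp :: "('a::topological_space \<Rightarrow> 'b::zero) \<Rightarrow> 'a set" where
  "supp f = closure {p. f p \<noteq> 0}"


section \<open>Tensors\<close>

text \<open>
  Components of an \<open>(r,s)\<close>-tensor: the first list holds the \<open>r\<close> upper (contravariant) indices, the
  second one the \<open>s\<close> lower (covariant) indices.
\<close>

type_synonym 'n components = "'n list \<Rightarrow> 'n list \<Rightarrow> real"

text \<open>
  The linear map applying \<open>F\<close> to every contravariant factor and the adjoint (transpose) of \<open>G\<close> to
  every covariant factor.
\<close>

definition tensor_map ::
  "nat \<Rightarrow> nat \<Rightarrow> real^'n^'n \<Rightarrow> real^'n^'n \<Rightarrow> 'n::finite components \<Rightarrow> 'n components" where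
  "tensor_map r s F G t I J =
    (if length I = r \<and> length J = s
     then \<Sum>K\<in>{K. length K = r}. \<Sum>L\<in>{L. length L = s}.
            (\<Prod>a<r. F $ (I ! a) $ (K ! a)) * (\<Prod>b<s. G $ (L ! b) $ (J ! b)) * t K L
     else 0)"

text \<open>
  The representation of \<open>GL(n)\<close> to which \<open>T\<^sup>r\<^sub>sM \<otimes> (\<Lambda>\<^sup>nT\<^sup>*M)\<^sup>\<otimes>\<^sup>w\<close> is associated. Only \<open>w = 0\<close> (tensors) and
  \<open>w = 1\<close> (tensor-valued \<open>n\<close>-forms) occur below; \<open>r = s = 0\<close>, \<open>w = 1\<close> are the \<open>n\<close>-forms, whose
  component in \<open>c\<close> is the coefficient of \<open>dx\<^sub>1 \<and> \<dots> \<and> dx\<^sub>n\<close>.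
\<close>

definition tensor_action ::
  "nat \<Rightarrow> nat \<Rightarrow> nat \<Rightarrow> real^'n^'n \<Rightarrow> 'n::finite components \<Rightarrow> 'n components" where
  "tensor_action r s w F t = (1 / det F) ^ w *\<^sub>R tensor_map r s F (matrix_inv F) t"

text \<open>
  An element of a fibre over \<open>p\<close> is given by its components in all charts at \<open>p\<close>, subject to the
  transformation law (and \<open>0\<close> at all irrelevant arguments).
\<close>

type_synonym ('a, 'n) tensor = "('a, 'n) chart \<Rightarrow> 'n components"

definition tensor_fibre ::
  "('a, 'n::finite) chart set \<Rightarrow> nat \<Rightarrow> nat \<Rightarrow> nat \<Rightarrow> 'a \<Rightarrow> ('a, 'n) tensor set" where
  "tensor_fibre \<A> r s w p =
    {t. (\<forall>c\<in>charts_at \<A> p. \<forall>d\<in>charts_at \<A> p. t d = tensor_action r s w (jac c d p) (t c)) \<and>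
        (\<forall>c. c \<notin> charts_at \<A> p \<longrightarrow> t c = 0)}"

text \<open>\<open>\<Gamma>(M, T\<^sup>r\<^sub>sM \<otimes> (\<Lambda>\<^sup>nT\<^sup>*M)\<^sup>\<otimes>\<^sup>w)\<close>, and the sections with support in \<open>K\<close>.\<close>

definition tensor_sections ::
  "('a, 'n::finite) chart set \<Rightarrow> nat \<Rightarrow> nat \<Rightarrow> nat \<Rightarrow> ('a \<Rightarrow> ('a, 'n) tensor) set" where
  "tensor_sections \<A> r s w =
    {t. (\<forall>p. t p \<in> tensor_fibre \<A> r s w p) \<and>
        (\<forall>c\<in>\<A>. \<forall>I J. smooth_on (snd c ` fst c) (\<lambda>x. t (chart_inv c x) c I J))}"

definition tensor_sections_in ::
  "('a::topological_space, 'n::finite) chart set \<Rightarrow> nat \<Rightarrow> nat \<Rightarrow> nat \<Rightarrow> 'a set \<Rightarrow>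
    ('a \<Rightarrow> ('a, 'n) tensor) set" where
  "tensor_sections_in \<A> r s w K = {t \<in> tensor_sections \<A> r s w. supp t \<subseteq> K}"

definition tensor_csections ::
  "('a::topological_space, 'n::finite) chart set \<Rightarrow> nat \<Rightarrow> nat \<Rightarrow> nat \<Rightarrow>
    ('a \<Rightarrow> ('a, 'n) tensor) set" where
  "tensor_csections \<A> r s w = {t \<in> tensor_sections \<A> r s w. compact (supp t)}"

abbreviation vector_fields :: "('a, 'n::finite) chart set \<Rightarrow> ('a \<Rightarrow> ('a, 'n) tensor) set" where
  "vector_fields \<A> \<equiv> tensor_sections \<A> 1 0 0"

abbreviation compact_forms ::
  "('a::topological_space, 'n::finite) chart set \<Rightarrow> ('a \<Rightarrow> ('a, 'n) tensor) set" where
  "compact_forms \<A> \<equiv> tensor_csections \<A> 0 0 1"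

text \<open>Duality pairing of \<open>(T\<^sup>r\<^sub>s)\<^sub>pM\<close> with \<open>(T\<^sup>s\<^sub>r)\<^sub>pM\<close>.\<close>

definition contraction ::
  "('a, 'n::finite) chart set \<Rightarrow> nat \<Rightarrow> nat \<Rightarrow> 'a \<Rightarrow> ('a, 'n) tensor \<Rightarrow> ('a, 'n) tensor \<Rightarrow> real" where
  "contraction \<A> r s p z t =
    (\<Sum>I\<in>{I. length I = r}. \<Sum>J\<in>{J. length J = s}.
       z (chart_at \<A> p) I J * t (chart_at \<A> p) J I)"

text \<open>Tensor product of a tensor with an \<open>n\<close>-form over the same point.\<close>

definition tensor_form :: "('a, 'n) tensor \<Rightarrow> ('a, 'n) tensor \<Rightarrow> ('a, 'n) tensor" where
  "tensor_form t \<omega> = (\<lambda>c I J. t c I J * \<omega> c [] [])"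

text \<open>Integration of compactly supported \<open>n\<close>-forms, by a partition of unity subordinate to finitely many charts.\<close>

definition form_integral ::
  "('a::topological_space, 'n::finite) chart set \<Rightarrow> ('a \<Rightarrow> ('a, 'n) tensor) \<Rightarrow> real" where
  "form_integral \<A> \<omega> = (THE i. \<exists>C \<theta>. finite C \<and> C \<subseteq> \<A> \<and>
     (\<forall>c\<in>C. smooth_function \<A> (\<theta> c) \<and> compact (supp (\<theta> c)) \<and> supp (\<theta> c) \<subseteq> fst c) \<and>
     (\<forall>p\<in>supp \<omega>. (\<Sum>c\<in>C. \<theta> c p) = 1) \<and>
     i = (\<Sum>c\<in>C. LINT x:snd c ` fst c|lborel. \<theta> c (chart_inv c x) * \<omega> (chart_inv c x) c [] []))"


section \<open>The bundle \<open>TO(M,M)\<close>\<close>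

text \<open>
  \<open>A p q c d\<close> is the matrix of \<open>A(p,q) : T\<^sub>pM \<rightarrow> T\<^sub>qM\<close> with respect to the charts \<open>c\<close> at \<open>p\<close>
  and \<open>d\<close> at \<open>q\<close>.
\<close>

type_synonym ('a, 'n) two_point = "('a, 'n) chart \<Rightarrow> ('a, 'n) chart \<Rightarrow> real^'n^'n"

definition TO_fibre ::
  "('a, 'n::finite) chart set \<Rightarrow> 'a \<Rightarrow> 'a \<Rightarrow> ('a, 'n) two_point set" where
  "TO_fibre \<A> p q =
    {B. (\<forall>c\<in>charts_at \<A> p. \<forall>c'\<in>charts_at \<A> p. \<forall>d\<in>charts_at \<A> q. \<forall>d'\<in>charts_at \<A> q.
           B c' d' = jac d d' q ** B c d ** jac c' c p) \<and>
        (\<forall>c d. c \<notin> charts_at \<A> p \<or> d \<notin> charts_at \<A> q \<longrightarrow> B c d = 0)}"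

definition TO_sections ::
  "('a, 'n::finite) chart set \<Rightarrow> ('a \<Rightarrow> 'a \<Rightarrow> ('a, 'n) two_point) set" where
  "TO_sections \<A> =
    {A. (\<forall>p q. A p q \<in> TO_fibre \<A> p q) \<and>
        (\<forall>c\<in>\<A>. \<forall>d\<in>\<A>. smooth_on ((snd c ` fst c) \<times> (snd d ` fst d))
           (\<lambda>(x, y). A (chart_inv c x) (chart_inv d y) c d))}"

definition TO_sections_in ::
  "('a::topological_space, 'n::finite) chart set \<Rightarrow> ('a \<times> 'a) set \<Rightarrow>
    ('a \<Rightarrow> 'a \<Rightarrow> ('a, 'n) two_point) set" where
  "TO_sections_in \<A> K = {A \<in> TO_sections \<A>. supp (\<lambda>(p, q). A p q) \<subseteq> K}"

text \<open>\<open>\<Gamma>\<^sub>c(TO(M,M))\<close>\<close>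

definition B_hat ::
  "('a::topological_space, 'n::finite) chart set \<Rightarrow> ('a \<Rightarrow> 'a \<Rightarrow> ('a, 'n) two_point) set" where
  "B_hat \<A> = {A \<in> TO_sections \<A>. compact (supp (\<lambda>(p, q). A p q))}"


section \<open>(LF)-topologies, distributions and smooth curves\<close>

text \<open>
  The finest locally convex topology on \<open>\<Union>\<F>\<close> for which the inclusions of all \<open>F \<in> \<F>\<close> are
  continuous, each \<open>F\<close> carrying the topology given by the seminorms in \<open>P\<close>; \<open>\<F>\<close> is to be a directed
  family of subspaces. A convex set is a neighbourhood of \<open>0\<close> iff it meets every \<open>F\<close> in one.
\<close>

definition seminorm_nhd_0 :: "('v \<Rightarrow> real) set \<Rightarrow> 'v set \<Rightarrow> 'v set \<Rightarrow> bool" where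
  "seminorm_nhd_0 P F U \<longleftrightarrow>
    (\<exists>S e. finite S \<and> S \<subseteq> P \<and> e > 0 \<and> {y\<in>F. \<forall>\<rho>\<in>S. \<rho> y < e} \<subseteq> U)"

definition lf_open :: "('v::real_vector \<Rightarrow> real) set \<Rightarrow> 'v set set \<Rightarrow> 'v set \<Rightarrow> bool" where
  "lf_open P \<F> W \<longleftrightarrow> W \<subseteq> \<Union>\<F> \<and>
    (\<forall>x\<in>W. \<exists>U. convex U \<and> (\<forall>F\<in>\<F>. seminorm_nhd_0 P F U) \<and> (\<forall>y\<in>U \<inter> \<Union>\<F>. x + y \<in> W))"

definition lf_topology :: "('v::real_vector \<Rightarrow> real) set \<Rightarrow> 'v set set \<Rightarrow> 'v topology" where
  "lf_topology P \<F> = topology (lf_open P \<F>)"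

lemma seminorm_nhd_0_Int:
  assumes "seminorm_nhd_0 P F U1" "seminorm_nhd_0 P F U2"
  shows "seminorm_nhd_0 P F (U1 \<inter> U2)"
proof -
  obtain S1 e1 where 1: "finite S1" "S1 \<subseteq> P" "e1 > 0" "{y\<in>F. \<forall>\<rho>\<in>S1. \<rho> y < e1} \<subseteq> U1"
    using assms(1) unfolding seminorm_nhd_0_def by blast
  obtain S2 e2 where 2: "finite S2" "S2 \<subseteq> P" "e2 > 0" "{y\<in>F. \<forall>\<rho>\<in>S2. \<rho> y < e2} \<subseteq> U2"
    using assms(2) unfolding seminorm_nhd_0_def by blast
  have "{y\<in>F. \<forall>\<rho>\<in>S1 \<union> S2. \<rho> y < min e1 e2} \<subseteq> U1 \<inter> U2"
    using 1(4) 2(4) by (simp add: subset_iff)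
  moreover have "finite (S1 \<union> S2)" "S1 \<union> S2 \<subseteq> P" "min e1 e2 > 0"
    using 1 2 by simp_all
  ultimately show ?thesis
    unfolding seminorm_nhd_0_def by blast
qed

lemma istopology_lf_open: "istopology (lf_open P \<F>)"
  unfolding istopology_def
proof (intro conjI allI impI)
  fix W1 W2
  assume W1: "lf_open P \<F> W1" and W2: "lf_open P \<F> W2"
  show "lf_open P \<F> (W1 \<inter> W2)"
    unfolding lf_open_def
  proof (intro conjI ballI)
    show "W1 \<inter> W2 \<subseteq> \<Union>\<F>"
      using W1 unfolding lf_open_def by blast
  next
    fix x
    assume x: "x \<in> W1 \<inter> W2"
    obtain U1 where U1: "convex U1" "\<forall>F\<in>\<F>. seminorm_nhd_0 P F U1" "\<forall>y\<in>U1 \<inter> \<Union>\<F>. x + y \<in> W1"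
      using W1 x unfolding lf_open_def by blast
    obtain U2 where U2: "convex U2" "\<forall>F\<in>\<F>. seminorm_nhd_0 P F U2" "\<forall>y\<in>U2 \<inter> \<Union>\<F>. x + y \<in> W2"
      using W2 x unfolding lf_open_def by blast
    have "convex (U1 \<inter> U2)"
      by (rule convex_Int[OF U1(1) U2(1)])
    moreover have "\<forall>F\<in>\<F>. seminorm_nhd_0 P F (U1 \<inter> U2)"
      using U1(2) U2(2) by (blast intro: seminorm_nhd_0_Int)
    moreover have "\<forall>y\<in>(U1 \<inter> U2) \<inter> \<Union>\<F>. x + y \<in> W1 \<inter> W2"
      using U1(3) U2(3) by blast
    ultimately show "\<exists>U. convex U \<and> (\<forall>F\<in>\<F>. seminorm_nhd_0 P F U) \<and>
        (\<forall>y\<in>U \<inter> \<Union>\<F>. x + y \<in> W1 \<inter> W2)"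
      by blast
  qed
next
  fix \<W>
  assume W: "\<forall>W\<in>\<W>. lf_open P \<F> W"
  show "lf_open P \<F> (\<Union>\<W>)"
    unfolding lf_open_def
  proof (intro conjI ballI)
    show "\<Union>\<W> \<subseteq> \<Union>\<F>"
      using W unfolding lf_open_def by (intro Union_least) blast
  next
    fix x
    assume "x \<in> \<Union>\<W>"
    then obtain W0 where W0: "W0 \<in> \<W>" "x \<in> W0"
      by (rule UnionE)
    from W0(1) W have "lf_open P \<F> W0"
      by simp
    with W0(2) obtain U where U: "convex U" "\<forall>F\<in>\<F>. seminorm_nhd_0 P F U"
        "\<forall>y\<in>U \<inter> \<Union>\<F>. x + y \<in> W0"
      unfolding lf_open_def by blast
    from U(3) W0(1) have "\<forall>y\<in>U \<inter> \<Union>\<F>. x + y \<in> \<Union>\<W>"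
      by blast
    with U(1,2) show "\<exists>U. convex U \<and> (\<forall>F\<in>\<F>. seminorm_nhd_0 P F U) \<and>
        (\<forall>y\<in>U \<inter> \<Union>\<F>. x + y \<in> \<Union>\<W>)"
      by blast
  qed
qed

lemma openin_lf_topology: "openin (lf_topology P \<F>) W \<longleftrightarrow> lf_open P \<F> W"
  by (simp add: lf_topology_def topology_inverse'[OF istopology_lf_open])

definition tensor_seminorms ::
  "('a::topological_space, 'n::finite) chart set \<Rightarrow> (('a \<Rightarrow> ('a, 'n) tensor) \<Rightarrow> real) set" where
  "tensor_seminorms \<A> =
    {\<lambda>t. SUP p\<in>K. \<bar>partials vs (\<lambda>x. t (chart_inv c x) c I J) (snd c p)\<bar> | c K I J vs.
       c \<in> \<A> \<and> compact K \<and> K \<noteq> {} \<and> K \<subseteq> fst c \<and> set vs \<subseteq> Basis}"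

definition tensor_lf ::
  "('a::topological_space, 'n::finite) chart set \<Rightarrow> nat \<Rightarrow> nat \<Rightarrow> nat \<Rightarrow>
    ('a \<Rightarrow> ('a, 'n) tensor) topology" where
  "tensor_lf \<A> r s w =
    lf_topology (tensor_seminorms \<A>) (tensor_sections_in \<A> r s w ` {K. compact K})"

definition TO_seminorms ::
  "('a::topological_space, 'n::finite) chart set \<Rightarrow>
    (('a \<Rightarrow> 'a \<Rightarrow> ('a, 'n) two_point) \<Rightarrow> real) set" where
  "TO_seminorms \<A> =
    {\<lambda>A. SUP (p, q)\<in>K. norm (partials vs (\<lambda>(x, y). A (chart_inv c x) (chart_inv d y) c d)
           (snd c p, snd d q)) | c d K vs.
       c \<in> \<A> \<and> d \<in> \<A> \<and> compact K \<and> K \<noteq> {} \<and> K \<subseteq> fst c \<times> fst d \<and> set vs \<subseteq> Basis}"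

definition TO_lf ::
  "('a::topological_space, 'n::finite) chart set \<Rightarrow>
    ('a \<Rightarrow> 'a \<Rightarrow> ('a, 'n) two_point) topology" where
  "TO_lf \<A> = lf_topology (TO_seminorms \<A>) (TO_sections_in \<A> ` {K. compact K})"

text \<open>
  The dual of \<open>T\<^sup>s\<^sub>r(M) \<otimes> \<Omega>\<^sup>n\<^sub>c(M) = \<Gamma>\<^sub>c(M, T\<^sup>s\<^sub>rM \<otimes> \<Lambda>\<^sup>nT\<^sup>*M)\<close>; the values of \<open>v\<close> off this space are
  irrelevant.
\<close>

definition distributions ::
  "('a::topological_space, 'n::finite) chart set \<Rightarrow> nat \<Rightarrow> nat \<Rightarrow>
    (('a \<Rightarrow> ('a, 'n) tensor) \<Rightarrow> real) set" where
  "distributions \<A> r s =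
    {v. (\<forall>\<sigma>\<in>tensor_csections \<A> s r 1. \<forall>\<tau>\<in>tensor_csections \<A> s r 1. v (\<sigma> + \<tau>) = v \<sigma> + v \<tau>) \<and>
        (\<forall>a. \<forall>\<sigma>\<in>tensor_csections \<A> s r 1. v (a *\<^sub>R \<sigma>) = a * v \<sigma>) \<and>
        continuous_map (tensor_lf \<A> s r 1) euclideanreal v}"

text \<open>Smooth curves in a topological vector space; \<open>D k\<close> is the \<open>k\<close>-th derivative.\<close>

definition smooth_curve :: "'v::real_vector topology \<Rightarrow> (real \<Rightarrow> 'v) \<Rightarrow> bool" where
  "smooth_curve T \<gamma> \<longleftrightarrow>
    (\<exists>D :: nat \<Rightarrow> real \<Rightarrow> 'v. D 0 = \<gamma> \<and> (\<forall>t. \<gamma> t \<in> topspace T) \<and>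
       (\<forall>k t. limitin T (\<lambda>h. (1 / h) *\<^sub>R (D k (t + h) - D k t)) (D (Suc k) t) (at 0)))"


section \<open>Flows and Lie derivatives\<close>

definition integral_curve ::
  "('a::topological_space, 'n::finite) chart set \<Rightarrow> ('a \<Rightarrow> ('a, 'n) tensor) \<Rightarrow>
    real set \<Rightarrow> (real \<Rightarrow> 'a) \<Rightarrow> bool" where
  "integral_curve \<A> X T \<gamma> \<longleftrightarrow> open T \<and> connected T \<and> continuous_on T \<gamma> \<and>
    (\<forall>t\<in>T. \<forall>c\<in>charts_at \<A> (\<gamma> t).
       ((snd c \<circ> \<gamma>) has_vector_derivative (\<chi> i. X (\<gamma> t) c [i] [])) (at t))"

text \<open>Only meaningful where the maximal integral curve through \<open>p\<close> is defined at time \<open>\<tau>\<close>.\<close>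

definition flow ::
  "('a::topological_space, 'n::finite) chart set \<Rightarrow> ('a \<Rightarrow> ('a, 'n) tensor) \<Rightarrow>
    real \<Rightarrow> 'a \<Rightarrow> 'a" where
  "flow \<A> X \<tau> p =
    (THE q. \<exists>T \<gamma>. integral_curve \<A> X T \<gamma> \<and> 0 \<in> T \<and> \<tau> \<in> T \<and> \<gamma> 0 = p \<and> \<gamma> \<tau> = q)"

definition pullback ::
  "('a, 'n::finite) chart set \<Rightarrow> nat \<Rightarrow> nat \<Rightarrow> nat \<Rightarrow> ('a \<Rightarrow> 'a) \<Rightarrow>
    ('a \<Rightarrow> ('a, 'n) tensor) \<Rightarrow> 'a \<Rightarrow> ('a, 'n) tensor" where
  "pullback \<A> r s w f t p =
    (\<lambda>c. if c \<in> charts_at \<A> p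
         then (let d = chart_at \<A> (f p) in
               tensor_action r s w (matrix_inv (tangent_matrix f c d p)) (t (f p) d))
         else 0)"

definition lie ::
  "('a::topological_space, 'n::finite) chart set \<Rightarrow> nat \<Rightarrow> nat \<Rightarrow> nat \<Rightarrow>
    ('a \<Rightarrow> ('a, 'n) tensor) \<Rightarrow> ('a \<Rightarrow> ('a, 'n) tensor) \<Rightarrow> 'a \<Rightarrow> ('a, 'n) tensor" where
  "lie \<A> r s w X t p = (\<lambda>c I J. deriv (\<lambda>\<tau>. pullback \<A> r s w (flow \<A> X \<tau>) t p c I J) 0)"

definition dist_lie ::
  "('a::topological_space, 'n::finite) chart set \<Rightarrow> nat \<Rightarrow> nat \<Rightarrow> ('a \<Rightarrow> ('a, 'n) tensor) \<Rightarrow>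
    (('a \<Rightarrow> ('a, 'n) tensor) \<Rightarrow> real) \<Rightarrow> (('a \<Rightarrow> ('a, 'n) tensor) \<Rightarrow> real)" where
  "dist_lie \<A> r s X v = (\<lambda>\<sigma>. - v (lie \<A> s r 1 X \<sigma>))"

definition TO_pullback ::
  "('a, 'n::finite) chart set \<Rightarrow> ('a \<Rightarrow> 'a) \<Rightarrow>
    ('a \<Rightarrow> 'a \<Rightarrow> ('a, 'n) two_point) \<Rightarrow> 'a \<Rightarrow> 'a \<Rightarrow> ('a, 'n) two_point" where
  "TO_pullback \<A> f A p q =
    (\<lambda>c d. if c \<in> charts_at \<A> p \<and> d \<in> charts_at \<A> q
           then (let c' = chart_at \<A> (f p); d' = chart_at \<A> (f q) in
                 matrix_inv (tangent_matrix f d d' q) ** A (f p) (f q) c' d' **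
                 tangent_matrix f c c' p)
           else 0)"

definition TO_lie ::
  "('a::topological_space, 'n::finite) chart set \<Rightarrow> ('a \<Rightarrow> ('a, 'n) tensor) \<Rightarrow>
    ('a \<Rightarrow> 'a \<Rightarrow> ('a, 'n) two_point) \<Rightarrow> 'a \<Rightarrow> 'a \<Rightarrow> ('a, 'n) two_point" where
  "TO_lie \<A> X A p q =
    (\<lambda>c d. vector_derivative (\<lambda>\<tau>. TO_pullback \<A> (flow \<A> X \<tau>) A p q c d) (at 0))"


section \<open>The basic space\<close>

definition A_hat0 ::
  "('a::topological_space, 'n::finite) chart set \<Rightarrow> ('a \<Rightarrow> ('a, 'n) tensor) set" where
  "A_hat0 \<A> = {\<omega> \<in> compact_forms \<A>. form_integral \<A> \<omega> = 1}"

text \<open>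
  Elements are represented by total functions; only the values at \<open>\<omega> \<in> A_hat0 \<A>\<close>, \<open>A \<in> B_hat \<A>\<close> matter.
  Smoothness is convenient smoothness: smooth curves are mapped to smooth curves. As
  \<open>t \<mapsto> u (\<omega> t) (p t) (A t)\<close> is a curve in \<open>T\<^sup>r\<^sub>sM\<close> over the smooth curve \<open>p\<close>, its smoothness is that of
  its fibre components in the local trivialisations.
\<close>

type_synonym ('a, 'n) basic =
  "('a \<Rightarrow> ('a, 'n) tensor) \<Rightarrow> 'a \<Rightarrow> ('a \<Rightarrow> 'a \<Rightarrow> ('a, 'n) two_point) \<Rightarrow> ('a, 'n) tensor"

definition basic_space ::
  "('a::topological_space, 'n::finite) chart set \<Rightarrow> nat \<Rightarrow> nat \<Rightarrow> ('a, 'n) basic set" where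
  "basic_space \<A> r s =
    {u. (\<forall>\<omega>\<in>A_hat0 \<A>. \<forall>p. \<forall>A\<in>B_hat \<A>. u \<omega> p A \<in> tensor_fibre \<A> r s 0 p) \<and>
        (\<forall>\<omega> p A. smooth_curve (tensor_lf \<A> 0 0 1) \<omega> \<longrightarrow> (\<forall>t. \<omega> t \<in> A_hat0 \<A>) \<longrightarrow>
           smooth_curve_in_manifold \<A> p \<longrightarrow> smooth_curve (TO_lf \<A>) A \<longrightarrow>
           (\<forall>c\<in>\<A>. \<forall>I J. smooth_on {t. p t \<in> fst c} (\<lambda>t. u (\<omega> t) (p t) (A t) c I J)))}"

text \<open>Equality in the basic space: both sides are elements of it and agree on its domain.\<close>

definition basic_eq ::
  "('a::topological_space, 'n::finite) chart set \<Rightarrow> nat \<Rightarrow> nat \<Rightarrow>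
    ('a, 'n) basic \<Rightarrow> ('a, 'n) basic \<Rightarrow> bool" where
  "basic_eq \<A> r s u u' \<longleftrightarrow> u \<in> basic_space \<A> r s \<and> u' \<in> basic_space \<A> r s \<and>
    (\<forall>\<omega>\<in>A_hat0 \<A>. \<forall>p. \<forall>A\<in>B_hat \<A>. u \<omega> p A = u' \<omega> p A)"

definition d1 ::
  "('a, 'n) basic \<Rightarrow> ('a \<Rightarrow> ('a, 'n) tensor) \<Rightarrow> 'a \<Rightarrow> ('a \<Rightarrow> 'a \<Rightarrow> ('a, 'n::finite) two_point) \<Rightarrow>
    ('a \<Rightarrow> ('a, 'n) tensor) \<Rightarrow> ('a, 'n) tensor" where
  "d1 u \<omega> p A \<eta> = (\<lambda>c I J. deriv (\<lambda>t. u (\<omega> + t *\<^sub>R \<eta>) p A c I J) 0)"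

definition d3 ::
  "('a, 'n) basic \<Rightarrow> ('a \<Rightarrow> ('a, 'n) tensor) \<Rightarrow> 'a \<Rightarrow> ('a \<Rightarrow> 'a \<Rightarrow> ('a, 'n::finite) two_point) \<Rightarrow>
    ('a \<Rightarrow> 'a \<Rightarrow> ('a, 'n) two_point) \<Rightarrow> ('a, 'n) tensor" where
  "d3 u \<omega> p A B = (\<lambda>c I J. deriv (\<lambda>t. u \<omega> p (A + t *\<^sub>R B) c I J) 0)"

definition lie_hat ::
  "('a::topological_space, 'n::finite) chart set \<Rightarrow> nat \<Rightarrow> nat \<Rightarrow> ('a \<Rightarrow> ('a, 'n) tensor) \<Rightarrow>
    ('a, 'n) basic \<Rightarrow> ('a, 'n) basic" where
  "lie_hat \<A> r s X u \<omega> p A =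
    lie \<A> r s 0 X (\<lambda>q. u \<omega> q A) p - d1 u \<omega> p A (lie \<A> 0 0 1 X \<omega>) - d3 u \<omega> p A (TO_lie \<A> X A)"


section \<open>The embedding\<close>

text \<open>The map \<open>A\<^sup>s\<^sub>r(p,q) : (T\<^sup>s\<^sub>r)\<^sub>pM \<rightarrow> (T\<^sup>s\<^sub>r)\<^sub>qM\<close>; note the adjoint of \<open>A(q,p)\<close> on covariant factors.\<close>

definition spread ::
  "('a, 'n::finite) chart set \<Rightarrow> nat \<Rightarrow> nat \<Rightarrow> ('a \<Rightarrow> 'a \<Rightarrow> ('a, 'n) two_point) \<Rightarrow> 'a \<Rightarrow> 'a \<Rightarrow>
    ('a, 'n) tensor \<Rightarrow> ('a, 'n) tensor" where
  "spread \<A> s r A p q t =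
    (\<lambda>d. if d \<in> charts_at \<A> q
         then (let c = chart_at \<A> p in tensor_map s r (A p q c d) (A q p d c) (t c))
         else 0)"

definition iota ::
  "('a::topological_space, 'n::finite) chart set \<Rightarrow> nat \<Rightarrow> nat \<Rightarrow>
    (('a \<Rightarrow> ('a, 'n) tensor) \<Rightarrow> real) \<Rightarrow> ('a, 'n) basic" where
  "iota \<A> r s v \<omega> p A =
    (THE z. z \<in> tensor_fibre \<A> r s 0 p \<and>
      (\<forall>t\<in>tensor_sections \<A> s r 0.
         contraction \<A> r s p z (t p) = v (\<lambda>q. tensor_form (spread \<A> s r A p q (t p)) (\<omega> q))))"

end

(*
  Both sides are evaluated in charts. Pairing iota(v)(omega, p, A) with a basis tensor at p gives v
  applied to a compactly supported section sigma that depends smoothly on (omega, p, A), and a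
  distribution may be differentiated under the bracket for smooth families of sections with
  supports in a common compact set. Hence every term of the Lie derivative of iota(v) is v applied
  to an explicit section, and the claim reduces to a pointwise identity of sections at q: with
  G(a, b) the value obtained by flowing p for time a and q for time b, it states that the
  derivative of G(tau, tau) at 0, computed by the product rule from the Lie derivatives of A and
  omega, is the sum of the partial derivatives, which are the Lie derivative at p and that of sigma
  at q.

  The derivative of the flow in the space variable is obtained by solving the flow and the
  variational equation simultaneously. Smooth curves in the (LF)-spaces are jointly smooth in charts
  and, M being paracompact, locally supported in one compact set; this gives the smoothness of
  iota(v).
*)
theory Submission
  imports Defs
begin

section \<open>Calculus of smooth functions\<close>

text \<open>Lie derivatives are defined by differentiating pullbacks, and a pullback is read in a
  chart chosen at the flowed point, so nothing is visibly differentiable in time. The remedy is to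
  describe the flow near p in one fixed chart by a coordinate curve and a tangent matrix, and to let
  the transformation laws absorb the chosen charts. The infinitesimal actions that result are kept
  as derivatives at the identity matrix and never expanded into signs and contractions; the final
  product rule becomes a comparison of two curves of matrices with equal velocity at 0. The section
  sigma carries two tensor structures: for fixed q it is of type (r,s) in p, for fixed p of type
  (s,r) with values in n-forms in q. Frame changes at q multiply A(p,q) on the left and A(q,p) on
  the right, those at p do the opposite; this is why the coefficients need two composition laws.
  Supports are governed by omega, since sigma vanishes wherever omega does; so it is the curves of
  forms that have to be confined to a compact set locally in time, while A contributes joint
  smoothness.\<close>

lemma partials_append: "partials (us @ vs) f = partials us (partials vs f)"
  by (induction us) auto

lemma frechet_derivative_cong_open:
  assumes "open U" "x \<in> U" "\<And>y. y \<in> U \<Longrightarrow> f y = g y"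
  shows "frechet_derivative f (at x) = frechet_derivative g (at x)"
proof -
  have "(f has_derivative D) (at x) \<longleftrightarrow> (g has_derivative D) (at x)" for D
    using assms by (metis has_derivative_transform_within_open)
  then show ?thesis
    unfolding frechet_derivative_def by simp
qed

lemma differentiable_cong_open:
  assumes "open U" "x \<in> U" "\<And>y. y \<in> U \<Longrightarrow> f y = g y"
  shows "f differentiable (at x) \<longleftrightarrow> g differentiable (at x)"
  unfolding differentiable_def
  using assms by (metis has_derivative_transform_within_open)

lemma partials_cong_open:
  assumes "open U" "x \<in> U" "\<And>y. y \<in> U \<Longrightarrow> f y = g y"
  shows "partials vs f x = partials vs g x"
  using assms(2)
proof (induction vs arbitrary: x)
  case (Cons v vs)
  have "frechet_derivative (partials vs f) (at x) = frechet_derivative (partials vs g) (at x)"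
    by (rule frechet_derivative_cong_open[OF assms(1) Cons.prems]) (rule Cons.IH)
  then show ?case by simp
qed (use assms in simp)

text \<open>Finite order supplies an induction variable: product and chain rule express a first
  derivative of the result through first derivatives of the ingredients, which have one order
  less.\<close>

definition ksmooth :: "nat \<Rightarrow> 'e set \<Rightarrow> ('e::euclidean_space \<Rightarrow> 'b::real_normed_vector) \<Rightarrow> bool" where
  "ksmooth k U f \<longleftrightarrow> (\<forall>vs. set vs \<subseteq> Basis \<and> length vs \<le> k \<longrightarrow>
     (\<forall>x\<in>U. partials vs f differentiable (at x)))"

lemma smooth_on_ksmooth: "smooth_on U f \<longleftrightarrow> (\<forall>k. ksmooth k U f)"
  unfolding smooth_on_def ksmooth_def by auto

lemma ksmooth_0: "ksmooth 0 U f \<longleftrightarrow> (\<forall>x\<in>U. f differentiable (at x))"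
  unfolding ksmooth_def by auto

lemma ksmooth_Suc:
  fixes f :: "'e::euclidean_space \<Rightarrow> 'b::real_normed_vector"
  shows "ksmooth (Suc k) U f \<longleftrightarrow> (\<forall>x\<in>U. f differentiable (at x)) \<and>
     (\<forall>b\<in>Basis. ksmooth k U (\<lambda>x. frechet_derivative f (at x) b))"
proof (intro iffI conjI ballI)
  fix x assume "ksmooth (Suc k) U f" "x \<in> U"
  then show "f differentiable (at x)"
    unfolding ksmooth_def by (metis empty_set empty_subsetI le0 list.size(3) partials.simps(1))
next
  fix b :: 'e
  assume *: "ksmooth (Suc k) U f" "b \<in> Basis"
  show "ksmooth k U (\<lambda>x. frechet_derivative f (at x) b)"
    unfolding ksmooth_def
  proof (intro allI impI ballI)
    fix vs :: "'e list" and x assume vs: "set vs \<subseteq> Basis \<and> length vs \<le> k" "x \<in> U"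
    then have "partials (vs @ [b]) f differentiable (at x)"
      using * unfolding ksmooth_def by auto
    then show "partials vs (\<lambda>x. frechet_derivative f (at x) b) differentiable (at x)"
      by (simp add: partials_append)
  qed
next
  assume *: "(\<forall>x\<in>U. f differentiable (at x)) \<and>
     (\<forall>b\<in>Basis. ksmooth k U (\<lambda>x. frechet_derivative f (at x) b))"
  show "ksmooth (Suc k) U f"
    unfolding ksmooth_def
  proof (intro allI impI ballI)
    fix vs :: "'e list" and x assume vs: "set vs \<subseteq> Basis \<and> length vs \<le> Suc k" "x \<in> U"
    show "partials vs f differentiable (at x)"
    \<comment> \<open>The last entry of the list is differentiated first, so splitting at the end
      exposes a first derivative of f, to which the hypothesis of order k applies.\<close>
    proof (cases vs rule: rev_cases)
      case Nil
      then show ?thesis using * vs by auto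
    next
      case (snoc us b)
      then show ?thesis using * vs by (auto simp: partials_append ksmooth_def)
    qed
  qed
qed

lemma ksmooth_le: "ksmooth k U f \<Longrightarrow> j \<le> k \<Longrightarrow> ksmooth j U f"
  unfolding ksmooth_def by auto

lemma ksmooth_differentiable: "ksmooth k U f \<Longrightarrow> x \<in> U \<Longrightarrow> f differentiable (at x)"
  using ksmooth_le[of k U f 0] by (simp add: ksmooth_0)

lemma ksmooth_cong:
  assumes "open U" "\<And>y. y \<in> U \<Longrightarrow> f y = g y"
  shows "ksmooth k U f \<longleftrightarrow> ksmooth k U g"
proof -
  have "partials vs f differentiable (at x) \<longleftrightarrow> partials vs g differentiable (at x)" if "x \<in> U" for vs x
    by (rule differentiable_cong_open[OF assms(1) that]) (rule partials_cong_open[OF assms(1) _ assms(2)])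
  then show ?thesis
    unfolding ksmooth_def by simp
qed

text \<open>Since \<open>frechet_derivative\<close> is a choice term, calculations supply an
  explicit D instead; openness of U lets D replace the chosen derivative in all further
  partials.\<close>

lemma ksmooth_SucI:
  fixes f :: "'e::euclidean_space \<Rightarrow> 'b::real_normed_vector"
  assumes "open U"
    and "\<And>x. x \<in> U \<Longrightarrow> (f has_derivative D x) (at x)"
    and "\<And>b. b \<in> Basis \<Longrightarrow> ksmooth k U (\<lambda>x. D x b)"
  shows "ksmooth (Suc k) U f"
proof -
  have "frechet_derivative f (at x) = D x" if "x \<in> U" for x
    using assms(2)[OF that] frechet_derivative_at by metis
  then have "ksmooth k U (\<lambda>x. frechet_derivative f (at x) b) \<longleftrightarrow> ksmooth k U (\<lambda>x. D x b)" for b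
    by (intro ksmooth_cong assms(1)) auto
  then show ?thesis
    using assms(2,3) by (auto simp: ksmooth_Suc differentiable_def)
qed

lemma ksmooth_has_derivative:
  assumes "ksmooth k U f" "x \<in> U"
  shows "(f has_derivative frechet_derivative f (at x)) (at x)"
  using ksmooth_differentiable[OF assms] frechet_derivative_works by blast

lemma ksmooth_const: "open U \<Longrightarrow> ksmooth k U (\<lambda>x. c)"
  by (induction k arbitrary: c)
     (auto simp: ksmooth_0 intro!: ksmooth_SucI[where D = "\<lambda>x h. 0"])

lemma ksmooth_bounded_linear:
  fixes f :: "'e::euclidean_space \<Rightarrow> 'b::real_normed_vector"
  assumes "open U" "bounded_linear L" "ksmooth k U f"
  shows "ksmooth k U (\<lambda>x. L (f x))"
  using assms(3)
proof (induction k arbitrary: f)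
  case 0
  then show ?case
    using bounded_linear.has_derivative[OF assms(2)] unfolding ksmooth_0 differentiable_def
    by blast
next
  case (Suc k)
  show ?case
  proof (rule ksmooth_SucI[OF assms(1)])
    fix x assume "x \<in> U"
    then show "((\<lambda>x. L (f x)) has_derivative (\<lambda>h. L (frechet_derivative f (at x) h))) (at x)"
      by (intro bounded_linear.has_derivative[OF assms(2)] ksmooth_has_derivative[OF Suc.prems])
  next
    fix b :: 'e assume "b \<in> Basis"
    then show "ksmooth k U (\<lambda>x. L (frechet_derivative f (at x) b))"
      using Suc.prems by (intro Suc.IH) (simp add: ksmooth_Suc)
  qed
qed

lemma ksmooth_add:
  fixes f :: "'e::euclidean_space \<Rightarrow> 'b::real_normed_vector"
  assumes "open U" "ksmooth k U f" "ksmooth k U g"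
  shows "ksmooth k U (\<lambda>x. f x + g x)"
  using assms(2,3)
proof (induction k arbitrary: f g)
  case 0
  then show ?case by (simp add: ksmooth_0)
next
  case (Suc k)
  show ?case
  proof (rule ksmooth_SucI[OF assms(1)])
    fix x assume "x \<in> U"
    then show "((\<lambda>x. f x + g x) has_derivative
        (\<lambda>h. frechet_derivative f (at x) h + frechet_derivative g (at x) h)) (at x)"
      by (intro has_derivative_add ksmooth_has_derivative[OF Suc.prems(1)]
           ksmooth_has_derivative[OF Suc.prems(2)])
  next
    fix b :: 'e assume "b \<in> Basis"
    then show "ksmooth k U (\<lambda>x. frechet_derivative f (at x) b + frechet_derivative g (at x) b)"
      using Suc.prems by (intro Suc.IH) (simp_all add: ksmooth_Suc)
  qed
qed

lemma ksmooth_sum: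
  assumes "open U" "\<And>i. i \<in> I \<Longrightarrow> ksmooth k U (f i)"
  shows "ksmooth k U (\<lambda>x. \<Sum>i\<in>I. f i x)"
  using assms(2)
  by (induction I rule: infinite_finite_induct)
     (auto intro!: ksmooth_const ksmooth_add assms(1))

lemma ksmooth_bilinear:
  fixes f :: "'e::euclidean_space \<Rightarrow> 'b::real_normed_vector"
  assumes "open U" "bounded_bilinear B" "ksmooth k U f" "ksmooth k U g"
  shows "ksmooth k U (\<lambda>x. B (f x) (g x))"
  using assms(3,4)
proof (induction k arbitrary: f g)
  case 0
  then show ?case
    using bounded_bilinear.FDERIV[OF assms(2)] unfolding ksmooth_0 differentiable_def
    by blast
next
  case (Suc k)
  show ?case
  proof (rule ksmooth_SucI[OF assms(1)])
    fix x assume "x \<in> U"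
    then show "((\<lambda>x. B (f x) (g x)) has_derivative
        (\<lambda>h. B (f x) (frechet_derivative g (at x) h) + B (frechet_derivative f (at x) h) (g x))) (at x)"
      by (intro bounded_bilinear.FDERIV[OF assms(2)] ksmooth_has_derivative[OF Suc.prems(1)]
           ksmooth_has_derivative[OF Suc.prems(2)])
  next
    fix b :: 'e assume b: "b \<in> Basis"
    show "ksmooth k U (\<lambda>x. B (f x) (frechet_derivative g (at x) b) + B (frechet_derivative f (at x) b) (g x))"
      by (rule ksmooth_add[OF assms(1)]; rule Suc.IH)
         (use Suc.prems b in \<open>auto simp: ksmooth_Suc[of k U f] ksmooth_Suc[of k U g] intro: ksmooth_le[of "Suc k" _ _ k]\<close>)
  qed
qed

text \<open>Makes directions constant: a derivative in a direction that varies with the point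
  becomes a combination of partial derivatives, each of which is covered by a smoothness
  hypothesis.\<close>

lemma frechet_derivative_Basis_expand:
  assumes "f differentiable (at x)"
  shows "frechet_derivative f (at x) h = (\<Sum>i\<in>Basis. (h \<bullet> i) *\<^sub>R frechet_derivative f (at x) i)"
proof -
  interpret bounded_linear "frechet_derivative f (at x)"
    using assms frechet_derivative_works has_derivative_bounded_linear by blast
  have "frechet_derivative f (at x) h = frechet_derivative f (at x) (\<Sum>i\<in>Basis. (h \<bullet> i) *\<^sub>R i)"
    by (simp add: euclidean_representation)
  then show ?thesis by (simp add: sum scaleR)
qed

lemma ksmooth_compose:
  fixes f :: "'e::euclidean_space \<Rightarrow> 'b::euclidean_space"
  assumes "open U" "open V" "ksmooth k V g" "ksmooth k U f" "\<And>x. x \<in> U \<Longrightarrow> f x \<in> V"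
  shows "ksmooth k U (\<lambda>x. g (f x))"
  using assms(3,4)
proof (induction k arbitrary: g)
  case 0
  then show ?case
    unfolding ksmooth_0 using assms(5) by (metis differentiable_compose)
next
  case (Suc k)
  note dg = ksmooth_differentiable[OF Suc.prems(1)]
  show ?case
  proof (rule ksmooth_SucI[OF assms(1)])
    fix x assume x: "x \<in> U"
    have "((\<lambda>x. g (f x)) has_derivative
        (\<lambda>h. frechet_derivative g (at (f x)) (frechet_derivative f (at x) h))) (at x)"
      using has_derivative_compose[OF ksmooth_has_derivative[OF Suc.prems(2) x]
          ksmooth_has_derivative[OF Suc.prems(1) assms(5)[OF x]]] .
    \<comment> \<open>The chain rule differentiates g in a direction depending on x. In basis form
      this is a sum of products of functions of order k, and the induction hypothesis handles the
      partials of g composed with f.\<close>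
    then show "((\<lambda>x. g (f x)) has_derivative (\<lambda>h. \<Sum>i\<in>Basis. (frechet_derivative f (at x) h \<bullet> i) *\<^sub>R
        frechet_derivative g (at (f x)) i)) (at x)"
      by (subst (asm) frechet_derivative_Basis_expand[OF dg[OF assms(5)[OF x]]])
  next
    fix b :: 'e assume b: "b \<in> Basis"
    have kf: "ksmooth k U f"
      using Suc.prems(2) by (rule ksmooth_le) simp
    show "ksmooth k U (\<lambda>x. \<Sum>i\<in>Basis. (frechet_derivative f (at x) b \<bullet> i) *\<^sub>R
        frechet_derivative g (at (f x)) i)"
    proof (intro ksmooth_sum[OF assms(1)] ksmooth_bilinear[OF assms(1) bounded_bilinear_scaleR])
      fix i :: 'b assume i: "i \<in> Basis"
      show "ksmooth k U (\<lambda>x. frechet_derivative f (at x) b \<bullet> i)"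
        using Suc.prems(2) b
        by (intro ksmooth_bounded_linear[OF assms(1) bounded_linear_inner_left]) (simp add: ksmooth_Suc)
      have "ksmooth k V (\<lambda>y. frechet_derivative g (at y) i)"
        using Suc.prems(1) i by (simp add: ksmooth_Suc)
      then show "ksmooth k U (\<lambda>x. frechet_derivative g (at (f x)) i)"
        by (rule Suc.IH) (rule kf)
    qed
  qed
qed

section \<open>Smoothness of all orders and its closure properties\<close>

lemma smooth_on_iff:
  fixes f :: "'e::euclidean_space \<Rightarrow> 'b::real_normed_vector"
  shows "smooth_on U f \<longleftrightarrow> (\<forall>x\<in>U. f differentiable (at x)) \<and>
     (\<forall>b\<in>Basis. smooth_on U (\<lambda>x. frechet_derivative f (at x) b))"
  unfolding smooth_on_ksmooth
proof safe
  fix x assume "\<forall>k. ksmooth k U f" "x \<in> U" 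
  then show "f differentiable at x" by (metis ksmooth_differentiable)
next
  fix b :: 'e and k assume "\<forall>k. ksmooth k U f" "b \<in> Basis"
  then show "ksmooth k U (\<lambda>x. frechet_derivative f (at x) b)" by (metis ksmooth_Suc)
next
  fix k assume "\<forall>x\<in>U. f differentiable at x" 
    "\<forall>b\<in>Basis. \<forall>k. ksmooth k U (\<lambda>x. frechet_derivative f (at x) b)"
  then show "ksmooth k U f" 
    by (cases k) (auto simp: ksmooth_Suc ksmooth_0)
qed

text \<open>Iterating the closure of P under partial derivatives gives every finite order. This
  replaces the computation of higher derivatives for classes that contain their own partials: curves
  in (LF)-spaces, and distributions applied to families of sections.\<close>

lemma smooth_on_coinduct [consumes 2, case_names differentiable partial]:
  assumes "P f" "open U"
    and diff: "\<And>f x. P f \<Longrightarrow> x \<in> U \<Longrightarrow> f differentiable (at x)"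
    and part: "\<And>f b. P f \<Longrightarrow> b \<in> Basis \<Longrightarrow> \<exists>g. P g \<and> (\<forall>x\<in>U. frechet_derivative f (at x) b = g x)"
  shows "smooth_on U f"
proof -
  have "ksmooth k U f" if "P f" for k f
    using that
  proof (induction k arbitrary: f)
    case 0
    then show ?case using diff by (simp add: ksmooth_0)
  next
    case (Suc k)
    have "ksmooth k U (\<lambda>x. frechet_derivative f (at x) b)" if b: "b \<in> Basis" for b
    proof -
      obtain g where g: "P g" "\<forall>x\<in>U. frechet_derivative f (at x) b = g x"
        using part[OF Suc.prems b] by blast
      then show ?thesis
        using ksmooth_cong[OF assms(2), of "\<lambda>x. frechet_derivative f (at x) b" g k] Suc.IH[OF g(1)] by simp
    qed
    then show ?case using diff[OF Suc.prems] by (simp add: ksmooth_Suc)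
  qed
  then show ?thesis using assms(1) by (simp add: smooth_on_ksmooth)
qed

lemma smooth_on_differentiable: "smooth_on U f \<Longrightarrow> x \<in> U \<Longrightarrow> f differentiable (at x)"
  using smooth_on_iff[of U f] by blast

lemma smooth_on_has_derivative:
  "smooth_on U f \<Longrightarrow> x \<in> U \<Longrightarrow> (f has_derivative frechet_derivative f (at x)) (at x)"
  using smooth_on_differentiable frechet_derivative_works by blast

lemma smooth_on_continuous_on: "smooth_on U f \<Longrightarrow> continuous_on U f"
  by (metis continuous_at_imp_continuous_on differentiable_imp_continuous_within smooth_on_differentiable)

lemma smooth_on_subset: "smooth_on U f \<Longrightarrow> V \<subseteq> U \<Longrightarrow> smooth_on V f"
  unfolding smooth_on_def by blast

lemma smooth_on_local:
  assumes "\<And>x. x \<in> U \<Longrightarrow> \<exists>V. x \<in> V \<and> smooth_on V f"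
  shows "smooth_on U f"
  using assms unfolding smooth_on_def by blast

lemma smooth_on_cong:
  assumes "open U" "\<And>y. y \<in> U \<Longrightarrow> f y = g y"
  shows "smooth_on U f \<longleftrightarrow> smooth_on U g"
  using ksmooth_cong[OF assms] by (simp add: smooth_on_ksmooth)

lemma smooth_on_const [simp]: "open U \<Longrightarrow> smooth_on U (\<lambda>x. c)"
  by (simp add: smooth_on_ksmooth ksmooth_const)

lemma smooth_on_bounded_linear:
  "open U \<Longrightarrow> bounded_linear L \<Longrightarrow> smooth_on U f \<Longrightarrow> smooth_on U (\<lambda>x. L (f x))"
  by (simp add: smooth_on_ksmooth ksmooth_bounded_linear)

lemma smooth_on_linear:
  assumes "open U" "bounded_linear f" shows "smooth_on U f"
proof -
  have "frechet_derivative f (at x) = f" for x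
    using assms(2) bounded_linear_imp_has_derivative frechet_derivative_at by metis
  then show ?thesis
    using assms by (auto simp: smooth_on_iff[of U f] bounded_linear_imp_differentiable)
qed

lemma smooth_on_id: "open U \<Longrightarrow> smooth_on U (\<lambda>x. x)"
  by (rule smooth_on_linear) (simp_all add: bounded_linear_ident)

lemma smooth_on_add:
  "open U \<Longrightarrow> smooth_on U f \<Longrightarrow> smooth_on U g \<Longrightarrow> smooth_on U (\<lambda>x. f x + g x)"
  by (simp add: smooth_on_ksmooth ksmooth_add)

lemma smooth_on_minus:
  "open U \<Longrightarrow> smooth_on U f \<Longrightarrow> smooth_on U (\<lambda>x. - f x)"
  by (rule smooth_on_bounded_linear[OF _ bounded_linear_minus[OF bounded_linear_ident]])

lemma smooth_on_diff:
  "open U \<Longrightarrow> smooth_on U f \<Longrightarrow> smooth_on U g \<Longrightarrow> smooth_on U (\<lambda>x. f x - g x)"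
  using smooth_on_add[of U f "\<lambda>x. - g x"] smooth_on_minus[of U g] by simp

lemma smooth_on_sum:
  "open U \<Longrightarrow> (\<And>i. i \<in> I \<Longrightarrow> smooth_on U (f i)) \<Longrightarrow> smooth_on U (\<lambda>x. \<Sum>i\<in>I. f i x)"
  by (simp add: smooth_on_ksmooth ksmooth_sum)

lemma smooth_on_bilinear:
  "open U \<Longrightarrow> bounded_bilinear B \<Longrightarrow> smooth_on U f \<Longrightarrow> smooth_on U g \<Longrightarrow>
    smooth_on U (\<lambda>x. B (f x) (g x))"
  by (simp add: smooth_on_ksmooth ksmooth_bilinear)

lemma smooth_on_mult:
  fixes f g :: "'e::euclidean_space \<Rightarrow> 'b::real_normed_algebra"
  shows "open U \<Longrightarrow> smooth_on U f \<Longrightarrow> smooth_on U g \<Longrightarrow> smooth_on U (\<lambda>x. f x * g x)"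
  by (rule smooth_on_bilinear[OF _ bounded_bilinear_mult])

lemma smooth_on_scaleR:
  "open U \<Longrightarrow> smooth_on U f \<Longrightarrow> smooth_on U g \<Longrightarrow> smooth_on U (\<lambda>x. f x *\<^sub>R g x)"
  by (rule smooth_on_bilinear[OF _ bounded_bilinear_scaleR])

lemma smooth_on_prod:
  fixes f :: "'i \<Rightarrow> 'e::euclidean_space \<Rightarrow> real"
  shows "open U \<Longrightarrow> (\<And>i. i \<in> I \<Longrightarrow> smooth_on U (f i)) \<Longrightarrow> smooth_on U (\<lambda>x. \<Prod>i\<in>I. f i x)"
  by (induction I rule: infinite_finite_induct) (auto intro!: smooth_on_mult)

lemma smooth_on_compose:
  "open U \<Longrightarrow> open V \<Longrightarrow> smooth_on V g \<Longrightarrow> smooth_on U f \<Longrightarrow> (\<And>x. x \<in> U \<Longrightarrow> f x \<in> V) \<Longrightarrow>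
    smooth_on U (\<lambda>x. g (f x))"
  by (simp add: smooth_on_ksmooth ksmooth_compose)

lemma smooth_on_Pair:
  assumes "open U" "smooth_on U f" "smooth_on U g"
  shows "smooth_on U (\<lambda>x. (f x, g x))"
proof -
  have "bounded_linear (\<lambda>x. (x, 0))" "bounded_linear (\<lambda>x. (0, x))"
    by (intro bounded_linear_Pair bounded_linear_ident bounded_linear_zero)+
  then have "smooth_on U (\<lambda>x. (f x, 0) + (0, g x))"
    by (intro smooth_on_add assms smooth_on_bounded_linear[of U "\<lambda>x. (x, 0)" f]
      smooth_on_bounded_linear[of U "\<lambda>x. (0, x)" g])
  then show ?thesis by simp
qed

lemma smooth_on_fst: "open U \<Longrightarrow> smooth_on U fst"
  by (rule smooth_on_linear) (simp_all add: bounded_linear_fst)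

lemma smooth_on_snd: "open U \<Longrightarrow> smooth_on U snd"
  by (rule smooth_on_linear) (simp_all add: bounded_linear_snd)

lemma smooth_on_frechet_derivative:
  assumes "open U" "smooth_on U f"
  shows "smooth_on U (\<lambda>x. frechet_derivative f (at x) h)"
proof -
  have "smooth_on U (\<lambda>x. \<Sum>i\<in>Basis. (h \<bullet> i) *\<^sub>R frechet_derivative f (at x) i)"
    using assms by (intro smooth_on_sum smooth_on_scaleR smooth_on_const) (auto simp: smooth_on_iff[of U f])
  then show ?thesis
    by (rule iffD1[OF smooth_on_cong[OF assms(1)], rotated])
       (use assms(2) in \<open>auto intro!: frechet_derivative_Basis_expand[symmetric] smooth_on_differentiable\<close>)
qed

lemma smooth_on_partials: "open U \<Longrightarrow> smooth_on U f \<Longrightarrow> smooth_on U (partials vs f)"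
  by (induction vs) (auto intro!: smooth_on_frechet_derivative)

lemma smooth_on_vec_nth: "open U \<Longrightarrow> smooth_on U f \<Longrightarrow> smooth_on U (\<lambda>x. f x $ i)"
  by (rule smooth_on_bounded_linear[OF _ bounded_linear_vec_nth])

lemma smooth_on_vec_lambda:
  fixes f :: "'e::euclidean_space \<Rightarrow> 'i::finite \<Rightarrow> 'b::euclidean_space"
  assumes "open U" "\<And>i. smooth_on U (\<lambda>x. f x i)"
  shows "smooth_on U (\<lambda>x. \<chi> i. f x i)"
proof -
  have "linear (\<lambda>y::'b. axis i y :: 'b^'i)" for i
    by (rule linearI) (auto simp: vec_eq_iff axis_def)
  then have bl: "bounded_linear (\<lambda>y::'b. axis i y :: 'b^'i)" for i
    by (simp add: linear_linear)
  have "smooth_on U (\<lambda>x. \<Sum>i\<in>UNIV. axis i (f x i))"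
    by (intro smooth_on_sum assms(1) smooth_on_bounded_linear[OF assms(1) bl assms(2)])
  moreover have "(\<Sum>i\<in>UNIV. axis i (f x i)) = (\<chi> i. f x i)" for x
    by (simp add: vec_eq_iff axis_def if_distrib sum.delta cong: if_cong)
  ultimately show ?thesis by simp
qed

section \<open>Symmetry of second derivatives\<close>

lemma frechet_derivative_apply:
  "(f has_derivative D) (at x) \<Longrightarrow> frechet_derivative f (at x) h = D h"
  using frechet_derivative_at by metis

lemma smooth_on_line_deriv:
  fixes F :: "'e::euclidean_space \<Rightarrow> real"
  assumes "smooth_on U F" "z + u *\<^sub>R a \<in> U"
  shows "((\<lambda>u. F (z + u *\<^sub>R a)) has_real_derivative
    frechet_derivative F (at (z + u *\<^sub>R a)) a) (at u)"
proof -
  let ?D = "frechet_derivative F (at (z + u *\<^sub>R a))"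
  have F: "(F has_derivative ?D) (at (z + u *\<^sub>R a))"
    by (rule smooth_on_has_derivative[OF assms])
  have "((\<lambda>u. z + u *\<^sub>R a) has_derivative (\<lambda>h. h *\<^sub>R a)) (at u)"
    by (auto intro!: derivative_eq_intros)
  then have "((\<lambda>u. F (z + u *\<^sub>R a)) has_derivative (\<lambda>h. ?D (h *\<^sub>R a))) (at u)"
    by (rule has_derivative_compose[where f = "\<lambda>u. z + u *\<^sub>R a" and g = F, OF _ F])
  moreover have "?D (h *\<^sub>R a) = ?D a * h" for h
    using linear_cmul[OF has_derivative_linear[OF F]] by simp
  ultimately show ?thesis
    by (simp add: has_field_derivative_def)
qed

text \<open>Two applications of the mean value theorem: along a to the increment of F by
  \<open>s *\<^sub>R b\<close>, then along b to the derivative of F in the direction a. The bound on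
  s keeps the whole parallelogram in the ball.\<close>

lemma mixed_difference:
  fixes F :: "'e::euclidean_space \<Rightarrow> real"
  assumes F: "smooth_on (ball z \<rho>) F" and s: "s > 0" "s * (norm a + norm b) < \<rho>"
  shows "\<exists>y\<in>ball z \<rho>. F (z + s *\<^sub>R a + s *\<^sub>R b) - F (z + s *\<^sub>R a) - F (z + s *\<^sub>R b) + F z =
    s\<^sup>2 * frechet_derivative (\<lambda>w. frechet_derivative F (at w) a) (at y) b"
proof -
  have in_ball: "z + u *\<^sub>R a + w *\<^sub>R b \<in> ball z \<rho>" if "0 \<le> u" "u \<le> s" "0 \<le> w" "w \<le> s" for u w
  proof -
    have "norm (u *\<^sub>R a + w *\<^sub>R b) \<le> u * norm a + w * norm b"
      using norm_triangle_ineq[of "u *\<^sub>R a" "w *\<^sub>R b"] that by simp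
    also have "\<dots> \<le> s * norm a + s * norm b"
      using that by (intro add_mono mult_right_mono) auto
    finally have "norm (u *\<^sub>R a + w *\<^sub>R b) < \<rho>"
      using s by (simp add: algebra_simps)
    moreover have "dist z (z + u *\<^sub>R a + w *\<^sub>R b) = norm (u *\<^sub>R a + w *\<^sub>R b)"
      by (metis add.assoc dist_add_cancel dist_0_norm add.right_neutral)
    ultimately show ?thesis by simp
  qed
  define g where "g = (\<lambda>w. frechet_derivative F (at w) a)"
  have g: "smooth_on (ball z \<rho>) g"
    unfolding g_def by (rule smooth_on_frechet_derivative[OF open_ball F])
  have "\<exists>u. 0 < u \<and> u < s \<and> (F ((z + s *\<^sub>R b) + s *\<^sub>R a) - F (z + s *\<^sub>R a)) -
      (F ((z + s *\<^sub>R b) + 0 *\<^sub>R a) - F (z + 0 *\<^sub>R a)) =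
      (s - 0) * (g ((z + s *\<^sub>R b) + u *\<^sub>R a) - g (z + u *\<^sub>R a))"
  proof (rule MVT2[OF s(1)])
    fix u assume u: "0 \<le> u" "u \<le> s"
    have "z + s *\<^sub>R b + u *\<^sub>R a \<in> ball z \<rho>" "z + u *\<^sub>R a \<in> ball z \<rho>"
      using in_ball[OF u, of s] in_ball[OF u, of 0] s by (simp_all add: algebra_simps)
    then show "((\<lambda>u. F ((z + s *\<^sub>R b) + u *\<^sub>R a) - F (z + u *\<^sub>R a)) has_real_derivative
        g ((z + s *\<^sub>R b) + u *\<^sub>R a) - g (z + u *\<^sub>R a)) (at u)"
      unfolding g_def by (intro DERIV_diff smooth_on_line_deriv[OF F])
  qed
  then obtain u where u: "0 < u" "u < s" and
    1: "F (z + s *\<^sub>R b + s *\<^sub>R a) - F (z + s *\<^sub>R a) - (F (z + s *\<^sub>R b) - F z) =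
      s * (g (z + s *\<^sub>R b + u *\<^sub>R a) - g (z + u *\<^sub>R a))"
    by auto
  have "\<exists>w. 0 < w \<and> w < s \<and> g ((z + u *\<^sub>R a) + s *\<^sub>R b) - g ((z + u *\<^sub>R a) + 0 *\<^sub>R b) =
      (s - 0) * frechet_derivative g (at ((z + u *\<^sub>R a) + w *\<^sub>R b)) b"
    using in_ball u by (intro MVT2[OF s(1)] smooth_on_line_deriv[OF g]) auto
  then obtain w where w: "0 < w" "w < s" and
    2: "g (z + u *\<^sub>R a + s *\<^sub>R b) - g (z + u *\<^sub>R a) =
      s * frechet_derivative g (at (z + u *\<^sub>R a + w *\<^sub>R b)) b"
    by auto
  have 3: "z + s *\<^sub>R b + u *\<^sub>R a = z + u *\<^sub>R a + s *\<^sub>R b" "z + s *\<^sub>R b + s *\<^sub>R a = z + s *\<^sub>R a + s *\<^sub>R b"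
    by simp_all
  have "F (z + s *\<^sub>R a + s *\<^sub>R b) - F (z + s *\<^sub>R a) - F (z + s *\<^sub>R b) + F z =
      s\<^sup>2 * frechet_derivative g (at (z + u *\<^sub>R a + w *\<^sub>R b)) b"
    using 1[unfolded 3] unfolding 2 by (simp add: power2_eq_square)
  then show ?thesis
    using in_ball[of u w] u w unfolding g_def by auto
qed

text \<open>The second difference is symmetric in a and b, so one mixed derivative at some y1 equals
  the other at some y2, both as close to z as desired; continuity then excludes a gap at z.\<close>

lemma frechet_derivative_symmetric:
  fixes F :: "'e::euclidean_space \<Rightarrow> real"
  assumes "open U" "smooth_on U F" "z \<in> U"
  shows "frechet_derivative (\<lambda>w. frechet_derivative F (at w) a) (at z) b =
         frechet_derivative (\<lambda>w. frechet_derivative F (at w) b) (at z) a"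
    (is "?A z = ?B z")
proof (rule ccontr)
  assume neq: "?A z \<noteq> ?B z"
  define e where "e = \<bar>?A z - ?B z\<bar> / 2"
  have e: "e > 0" using neq by (simp add: e_def)
  have "continuous_on U ?A" "continuous_on U ?B"
    by (intro smooth_on_continuous_on smooth_on_frechet_derivative assms)+
  then have "isCont ?A z" "isCont ?B z"
    using assms(1,3) by (simp_all add: continuous_on_eq_continuous_at)
  then obtain d1 d2 where d: "d1 > 0" "d2 > 0"
    "\<And>y. dist y z < d1 \<Longrightarrow> dist (?A y) (?A z) < e" "\<And>y. dist y z < d2 \<Longrightarrow> dist (?B y) (?B z) < e"
    using e unfolding continuous_at_eps_delta by metis
  obtain d3 where d3: "d3 > 0" "ball z d3 \<subseteq> U"
    using assms(1,3) open_contains_ball by blast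
  define \<rho> where "\<rho> = min d3 (min d1 d2)"
  have \<rho>: "\<rho> > 0" "ball z \<rho> \<subseteq> U"
    using d d3 unfolding \<rho>_def by auto
  have F: "smooth_on (ball z \<rho>) F"
    using assms(2) \<rho>(2) by (rule smooth_on_subset)
  \<comment> \<open>Scaled so that the parallelogram fits into the ball; the added 1 covers a = b =
    0.\<close>
  define s where "s = \<rho> / (norm a + norm b + 1)"
  have n: "0 < norm a + norm b + 1"
    by (metis add_nonneg_pos norm_ge_zero add_nonneg_nonneg zero_less_one)
  have "(norm a + norm b) / (norm a + norm b + 1) < 1"
    using n by simp
  then have "\<rho> * ((norm a + norm b) / (norm a + norm b + 1)) < \<rho> * 1"
    using \<rho>(1) by (intro mult_strict_left_mono)
  then have s: "s > 0" "s * (norm a + norm b) < \<rho>" "s * (norm b + norm a) < \<rho>"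
    using \<rho> n unfolding s_def by (simp_all add: add.commute)
  obtain y1 where y1: "y1 \<in> ball z \<rho>"
    "F (z + s *\<^sub>R a + s *\<^sub>R b) - F (z + s *\<^sub>R a) - F (z + s *\<^sub>R b) + F z = s\<^sup>2 * ?A y1"
    using mixed_difference[OF F s(1,2)] by blast
  obtain y2 where y2: "y2 \<in> ball z \<rho>"
    "F (z + s *\<^sub>R b + s *\<^sub>R a) - F (z + s *\<^sub>R b) - F (z + s *\<^sub>R a) + F z = s\<^sup>2 * ?B y2"
    using mixed_difference[OF F s(1,3)] by blast
  have "z + s *\<^sub>R b + s *\<^sub>R a = z + s *\<^sub>R a + s *\<^sub>R b"
    by simp
  from y2(2)[unfolded this] have "s\<^sup>2 * ?A y1 = s\<^sup>2 * ?B y2"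
    using y1(2) by linarith
  then have "?A y1 = ?B y2"
    using s(1) by simp
  moreover have "dist (?A y1) (?A z) < e" "dist (?B y2) (?B z) < e"
    using d(3,4) y1(1) y2(1) by (simp_all add: \<rho>_def dist_commute)
  ultimately show False
    unfolding e_def dist_real_def by (smt (verit) field_sum_of_halves)
qed

text \<open>Used with a in the parameter directions and \<open>vs\<close> in the chart directions:
  differentiating a family of sections in its parameter then commutes with the partials occurring in
  the seminorms.\<close>

lemma partials_frechet_commute:
  fixes F :: "'e::euclidean_space \<Rightarrow> real"
  assumes "open U" "smooth_on U F" "z \<in> U"
  shows "frechet_derivative (partials vs F) (at z) a = partials vs (\<lambda>w. frechet_derivative F (at w) a) z"
  using assms(3)
proof (induction vs arbitrary: z)
  case (Cons v vs)
  have "frechet_derivative (partials (v # vs) F) (at z) a =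
      frechet_derivative (\<lambda>w. frechet_derivative (partials vs F) (at w) a) (at z) v"
    using frechet_derivative_symmetric[OF assms(1) smooth_on_partials[OF assms(1,2)] Cons.prems]
    by simp
  also have "frechet_derivative (\<lambda>w. frechet_derivative (partials vs F) (at w) a) (at z) =
      frechet_derivative (partials vs (\<lambda>w. frechet_derivative F (at w) a)) (at z)"
    by (rule frechet_derivative_cong_open[OF assms(1) Cons.prems Cons.IH])
  finally show ?case by simp
qed simp

text \<open>Restriction to a slice hides joint smoothness; padding the directions with 0 expresses
  the partials of the slice through partials of F, which are smooth in both variables.\<close>

lemma partials_slice:
  fixes F :: "'f::euclidean_space \<times> 'e::euclidean_space \<Rightarrow> 'b::real_normed_vector"
  assumes "open \<Omega>" "open V" "smooth_on (\<Omega> \<times> V) F" "\<xi> \<in> \<Omega>" "x \<in> V"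
  shows "partials vs (\<lambda>x. F (\<xi>, x)) x = partials (map (Pair 0) vs) F (\<xi>, x)"
  using assms(5)
proof (induction vs arbitrary: x)
  case (Cons v vs)
  let ?G = "partials (map (Pair 0) vs) F"
  have "(?G has_derivative frechet_derivative ?G (at (\<xi>, x))) (at (\<xi>, x))"
    by (rule smooth_on_has_derivative[OF smooth_on_partials[OF open_Times[OF assms(1,2)] assms(3)]])
       (use assms(4) Cons.prems in simp)
  moreover have "((\<lambda>x. (\<xi>, x)) has_derivative Pair 0) (at x)"
    by (auto intro!: derivative_eq_intros)
  ultimately have "((\<lambda>x. ?G (\<xi>, x)) has_derivative (\<lambda>h. frechet_derivative ?G (at (\<xi>, x)) (0, h))) (at x)"
    by (rule has_derivative_compose[rotated])
  then have "frechet_derivative (\<lambda>x. ?G (\<xi>, x)) (at x) = (\<lambda>h. frechet_derivative ?G (at (\<xi>, x)) (0, h))"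
    using frechet_derivative_at by metis
  moreover have "frechet_derivative (partials vs (\<lambda>x. F (\<xi>, x))) (at x) =
      frechet_derivative (\<lambda>x. ?G (\<xi>, x)) (at x)"
    by (rule frechet_derivative_cong_open[OF assms(2) Cons.prems Cons.IH])
  ultimately show ?case by simp
qed simp

lemma smooth_on_slice:
  assumes "open \<Omega>" "open V" "smooth_on (\<Omega> \<times> V) F" "\<xi> \<in> \<Omega>"
  shows "smooth_on V (\<lambda>x. F (\<xi>, x))"
  by (rule smooth_on_compose[OF assms(2) open_Times[OF assms(1,2)] assms(3)])
     (use assms in \<open>auto intro!: smooth_on_Pair smooth_on_id\<close>)

lemma smooth_on_slice1:
  assumes "open \<Omega>" "open V" "smooth_on (\<Omega> \<times> V) F" "x \<in> V"
  shows "smooth_on \<Omega> (\<lambda>\<xi>. F (\<xi>, x))"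
  by (rule smooth_on_compose[OF assms(1) open_Times[OF assms(1,2)] assms(3)])
     (use assms in \<open>auto intro!: smooth_on_Pair smooth_on_id\<close>)

lemma frechet_derivative_slice1:
  assumes "open \<Omega>" "open V" "smooth_on (\<Omega> \<times> V) F" "\<xi> \<in> \<Omega>" "x \<in> V"
  shows "((\<lambda>\<xi>. F (\<xi>, x)) has_derivative (\<lambda>h. frechet_derivative F (at (\<xi>, x)) (h, 0))) (at \<xi>)"
proof -
  have "(F has_derivative frechet_derivative F (at (\<xi>, x))) (at (\<xi>, x))"
    by (rule smooth_on_has_derivative[OF assms(3)]) (use assms(4,5) in simp)
  moreover have "((\<lambda>\<xi>. (\<xi>, x)) has_derivative (\<lambda>h. (h, 0))) (at \<xi>)"
    by (auto intro!: derivative_eq_intros)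
  ultimately show ?thesis
    by (rule has_derivative_compose[rotated])
qed

text \<open>By the mean value theorem the remainder is bounded by the oscillation of the parameter
  gradient between \<xi> and a point of the segment to \<eta>. Uniform continuity on a compact
  product makes it small simultaneously for all x in K, as the supremum seminorms demand.\<close>

lemma uniform_parameter_derivative:
  fixes G :: "'f::euclidean_space \<times> 'e::euclidean_space \<Rightarrow> real"
  assumes "open \<Omega>" "open V" "smooth_on (\<Omega> \<times> V) G" "\<xi> \<in> \<Omega>" "compact K" "K \<subseteq> V" "\<epsilon> > 0"
  shows "\<exists>\<delta>>0. \<forall>\<eta>. norm (\<eta> - \<xi>) < \<delta> \<longrightarrow> \<eta> \<in> \<Omega> \<and>
    (\<forall>x\<in>K. \<bar>G (\<eta>, x) - G (\<xi>, x) - frechet_derivative G (at (\<xi>, x)) (\<eta> - \<xi>, 0)\<bar> \<le> \<epsilon> * norm (\<eta> - \<xi>))"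
proof -
  obtain \<rho> where \<rho>: "\<rho> > 0" "cball \<xi> \<rho> \<subseteq> \<Omega>"
    using assms(1,4) open_contains_cball by blast
  \<comment> \<open>The gradient of G in the parameter variable; as a vector it turns continuity of
    the derivative into uniform continuity of a single function on a compact set.\<close>
  define g where "g z = (\<Sum>b\<in>Basis. frechet_derivative G (at z) (b, 0) *\<^sub>R b)" for z
  have op: "open (\<Omega> \<times> V)" by (rule open_Times[OF assms(1,2)])
  have gD: "g z \<bullet> h = frechet_derivative G (at z) (h, 0)" if "z \<in> \<Omega> \<times> V" for z h
  proof -
    interpret bounded_linear "frechet_derivative G (at z)"
      using smooth_on_has_derivative[OF assms(3) that] has_derivative_bounded_linear by blast
    have "(h, 0) = (\<Sum>b\<in>Basis. (h \<bullet> b) *\<^sub>R (b, 0::'e))"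
    proof (rule prod_eqI)
      show "fst (h, 0) = fst (\<Sum>b\<in>Basis. (h \<bullet> b) *\<^sub>R (b, 0::'e))"
        by (simp add: fst_sum euclidean_representation)
    qed (simp add: snd_sum)
    then have "frechet_derivative G (at z) (h, 0) =
        frechet_derivative G (at z) (\<Sum>b\<in>Basis. (h \<bullet> b) *\<^sub>R (b, 0))"
      by simp
    also have "\<dots> = g z \<bullet> h"
      unfolding sum scaleR g_def inner_sum_left inner_scaleR_left
      by (intro sum.cong refl) (simp add: inner_commute)
    finally show ?thesis by simp
  qed
  have "continuous_on (\<Omega> \<times> V) g"
    unfolding g_def
    by (intro continuous_on_sum continuous_on_scaleR continuous_on_const
        smooth_on_continuous_on[OF smooth_on_frechet_derivative[OF op assms(3)]])
  then have "continuous_on (cball \<xi> \<rho> \<times> K) g"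
    by (rule continuous_on_subset) (use \<rho>(2) assms(6) in auto)
  moreover have "compact (cball \<xi> \<rho> \<times> K)"
    by (intro compact_Times assms(5) compact_cball)
  ultimately have "uniformly_continuous_on (cball \<xi> \<rho> \<times> K) g"
    by (rule compact_uniformly_continuous)
  then obtain d where d: "d > 0"
    "\<And>z z'. z \<in> cball \<xi> \<rho> \<times> K \<Longrightarrow> z' \<in> cball \<xi> \<rho> \<times> K \<Longrightarrow> dist z' z < d \<Longrightarrow> dist (g z') (g z) < \<epsilon>"
    using assms(7) unfolding uniformly_continuous_on_def by metis
  show ?thesis
  proof (intro exI[of _ "min d \<rho>"] conjI allI impI ballI)
    fix \<eta> assume \<eta>: "norm (\<eta> - \<xi>) < min d \<rho>"
    then show "\<eta> \<in> \<Omega>"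
      using \<rho>(2) by (auto simp: dist_norm norm_minus_commute subset_iff)
    fix x assume x: "x \<in> K"
    have sub: "norm (u *\<^sub>R (\<eta> - \<xi>)) < min d \<rho>" if "0 \<le> u" "u \<le> 1" for u
    proof -
      have "u * norm (\<eta> - \<xi>) \<le> 1 * norm (\<eta> - \<xi>)"
        using that by (intro mult_right_mono) auto
      then show ?thesis using \<eta> that by simp
    qed
    have in_cball: "(\<xi> + u *\<^sub>R (\<eta> - \<xi>), x) \<in> cball \<xi> \<rho> \<times> K" if "0 \<le> u" "u \<le> 1" for u
      using sub[OF that] x by (simp add: dist_norm norm_minus_commute)
    have in_dom: "(\<xi> + u *\<^sub>R (\<eta> - \<xi>), x) \<in> \<Omega> \<times> V" if "0 \<le> u" "u \<le> 1" for u
      using in_cball[OF that] \<rho>(2) assms(6) by auto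
    have "\<exists>u. 0 < u \<and> u < 1 \<and> G (\<xi> + 1 *\<^sub>R (\<eta> - \<xi>), x) - G (\<xi> + 0 *\<^sub>R (\<eta> - \<xi>), x) =
      (1 - 0) * (g (\<xi> + u *\<^sub>R (\<eta> - \<xi>), x) \<bullet> (\<eta> - \<xi>))"
    proof (rule MVT2)
      fix u :: real assume u: "0 \<le> u" "u \<le> 1"
      have "((\<lambda>u. G ((\<xi>, x) + u *\<^sub>R (\<eta> - \<xi>, 0))) has_real_derivative
        frechet_derivative G (at ((\<xi>, x) + u *\<^sub>R (\<eta> - \<xi>, 0))) (\<eta> - \<xi>, 0)) (at u)"
        by (rule smooth_on_line_deriv[OF assms(3)]) (use in_dom[OF u] in simp)
      then show "((\<lambda>u. G (\<xi> + u *\<^sub>R (\<eta> - \<xi>), x)) has_real_derivative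
        g (\<xi> + u *\<^sub>R (\<eta> - \<xi>), x) \<bullet> (\<eta> - \<xi>)) (at u)"
        using gD[OF in_dom[OF u], of "\<eta> - \<xi>"] by simp
    qed simp
    then obtain u where u: "0 < u" "u < 1" "G (\<eta>, x) - G (\<xi>, x) = g (\<xi> + u *\<^sub>R (\<eta> - \<xi>), x) \<bullet> (\<eta> - \<xi>)"
      by auto
    have "(\<xi>, x) \<in> \<Omega> \<times> V" using in_dom[of 0] by simp
    then have "G (\<eta>, x) - G (\<xi>, x) - frechet_derivative G (at (\<xi>, x)) (\<eta> - \<xi>, 0) =
      (g (\<xi> + u *\<^sub>R (\<eta> - \<xi>), x) - g (\<xi>, x)) \<bullet> (\<eta> - \<xi>)"
      by (simp add: u(3) gD inner_diff_left)
    also have "\<bar>\<dots>\<bar> \<le> norm (g (\<xi> + u *\<^sub>R (\<eta> - \<xi>), x) - g (\<xi>, x)) * norm (\<eta> - \<xi>)"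
      by (rule Cauchy_Schwarz_ineq2)
    also have "\<dots> \<le> \<epsilon> * norm (\<eta> - \<xi>)"
    proof (intro mult_right_mono)
      have "dist (g (\<xi> + u *\<^sub>R (\<eta> - \<xi>), x)) (g (\<xi>, x)) < \<epsilon>"
        using in_cball[of u] in_cball[of 0] sub[of u] u
        by (intro d(2)) (simp_all add: dist_Pair_Pair dist_norm)
      then show "norm (g (\<xi> + u *\<^sub>R (\<eta> - \<xi>), x) - g (\<xi>, x)) \<le> \<epsilon>"
        by (simp add: dist_norm)
    qed simp
    finally show "\<bar>G (\<eta>, x) - G (\<xi>, x) - frechet_derivative G (at (\<xi>, x)) (\<eta> - \<xi>, 0)\<bar> \<le> \<epsilon> * norm (\<eta> - \<xi>)" .
  qed (use d \<rho> in auto)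
qed

section \<open>Partial derivatives of linear combinations and products\<close>

lemma partials_add:
  fixes f :: "'e::euclidean_space \<Rightarrow> 'b::real_normed_vector"
  assumes "open V" "smooth_on V f" "smooth_on V g" "x \<in> V"
  shows "partials vs (\<lambda>x. f x + g x) x = partials vs f x + partials vs g x"
  using assms(4)
proof (induction vs arbitrary: x)
  case (Cons v vs)
  have "((\<lambda>x. partials vs f x + partials vs g x) has_derivative
     (\<lambda>h. frechet_derivative (partials vs f) (at x) h + frechet_derivative (partials vs g) (at x) h)) (at x)"
    by (intro has_derivative_add smooth_on_has_derivative[OF smooth_on_partials[OF assms(1,2)] Cons.prems]
        smooth_on_has_derivative[OF smooth_on_partials[OF assms(1,3)] Cons.prems])
  then have "frechet_derivative (\<lambda>x. partials vs f x + partials vs g x) (at x) v =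
     frechet_derivative (partials vs f) (at x) v + frechet_derivative (partials vs g) (at x) v"
    by (rule frechet_derivative_apply)
  moreover have "frechet_derivative (partials vs (\<lambda>x. f x + g x)) (at x) =
      frechet_derivative (\<lambda>x. partials vs f x + partials vs g x) (at x)"
    by (rule frechet_derivative_cong_open[OF assms(1) Cons.prems Cons.IH])
  ultimately show ?case by simp
qed simp

lemma partials_bounded_linear:
  fixes f :: "'e::euclidean_space \<Rightarrow> 'b::real_normed_vector"
  assumes "bounded_linear L" "open V" "smooth_on V f" "x \<in> V"
  shows "partials vs (\<lambda>x. L (f x)) x = L (partials vs f x)"
  using assms(4)
proof (induction vs arbitrary: x)
  case (Cons v vs)
  have "((\<lambda>x. L (partials vs f x)) has_derivative
     (\<lambda>h. L (frechet_derivative (partials vs f) (at x) h))) (at x)"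
    by (rule bounded_linear.has_derivative[OF assms(1)
          smooth_on_has_derivative[OF smooth_on_partials[OF assms(2,3)] Cons.prems]])
  then have "frechet_derivative (\<lambda>x. L (partials vs f x)) (at x) v =
     L (frechet_derivative (partials vs f) (at x) v)"
    by (rule frechet_derivative_apply)
  moreover have "frechet_derivative (partials vs (\<lambda>x. L (f x))) (at x) =
      frechet_derivative (\<lambda>x. L (partials vs f x)) (at x)"
    by (rule frechet_derivative_cong_open[OF assms(2) Cons.prems Cons.IH])
  ultimately show ?case by simp
qed simp

lemma partials_scaleR:
  fixes f :: "'e::euclidean_space \<Rightarrow> 'b::real_normed_vector"
  assumes "open V" "smooth_on V f" "x \<in> V"
  shows "partials vs (\<lambda>x. a *\<^sub>R f x) x = a *\<^sub>R partials vs f x"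
  by (rule partials_bounded_linear[OF bounded_linear_scaleR_right assms])

lemma partials_diff:
  fixes f :: "'e::euclidean_space \<Rightarrow> 'b::real_normed_vector"
  assumes "open V" "smooth_on V f" "smooth_on V g" "x \<in> V"
  shows "partials vs (\<lambda>x. f x - g x) x = partials vs f x - partials vs g x"
  using partials_add[OF assms(1,2) smooth_on_minus[OF assms(1,3)] assms(4), of vs]
    partials_bounded_linear[OF bounded_linear_minus[OF bounded_linear_ident] assms(1,3,4), of vs]
  by simp

lemma partials_sum:
  assumes "open V" "x \<in> V" "\<And>i. i \<in> I \<Longrightarrow> smooth_on V (f i)"
  shows "partials vs (\<lambda>x. \<Sum>i\<in>I. f i x) x = (\<Sum>i\<in>I. partials vs (f i) x)"
  using assms(3)
proof (induction I rule: infinite_finite_induct)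
  case (insert i I)
  then show ?case
    using partials_add[OF assms(1) insert.prems smooth_on_sum[OF assms(1), of I f] assms(2)] by simp
next
  case empty
  have "partials vs (\<lambda>x. 0 *\<^sub>R 0) x = 0"
    by (subst partials_scaleR[OF assms(1) smooth_on_const[OF assms(1)] assms(2)]) simp
  then show ?case by simp
next
  case (infinite I)
  have "partials vs (\<lambda>x. 0 *\<^sub>R 0) x = 0"
    by (subst partials_scaleR[OF assms(1) smooth_on_const[OF assms(1)] assms(2)]) simp
  then show ?case using infinite by simp
qed

lemma finite_short_lists: "finite {ws :: 'e::euclidean_space list. set ws \<subseteq> Basis \<and> length ws \<le> n}"
  by (rule finite_lists_length_le) simp

text \<open>A Leibniz rule in the form of an estimate: C is independent of g, so multiplication by f
  is continuous for the seminorms. The innermost derivative is split off, and the induction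
  hypothesis is used for Df times g and for f times Dg.\<close>

lemma partials_mult_bound:
  fixes f :: "'e::euclidean_space \<Rightarrow> real"
  assumes "open V" "compact K" "K \<subseteq> V" "smooth_on V f" "set vs \<subseteq> Basis"
  shows "\<exists>C\<ge>0. \<forall>g. smooth_on V g \<longrightarrow> (\<forall>x\<in>K. \<bar>partials vs (\<lambda>x. f x * g x) x\<bar> \<le>
    C * (\<Sum>ws | set ws \<subseteq> Basis \<and> length ws \<le> length vs. \<bar>partials ws g x\<bar>))"
  using assms(4,5)
proof (induction vs arbitrary: f rule: rev_induct)
  case Nil
  obtain C where C: "\<And>x. x \<in> K \<Longrightarrow> norm (f x) \<le> C" "C > 0"
  proof -
    have "bounded (f ` K)"
      using assms(2,3) smooth_on_continuous_on[OF Nil(1)]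
      by (meson compact_continuous_image compact_imp_bounded continuous_on_subset)
    then show thesis using that unfolding bounded_pos by auto
  qed
  have W: "{ws. set ws \<subseteq> (Basis :: 'e set) \<and> length ws \<le> length ([] :: 'e list)} = {[]}" by auto
  show ?case
    unfolding W
    using C by (intro exI[of _ C]) (auto simp: abs_mult intro!: mult_right_mono)
next
  case (snoc v vs)
  let ?W = "\<lambda>n. {ws :: 'e list. set ws \<subseteq> Basis \<and> length ws \<le> n}"
  let ?Df = "\<lambda>x. frechet_derivative f (at x) v"
  have v: "v \<in> Basis" "set vs \<subseteq> Basis" using snoc.prems by auto
  have Df: "smooth_on V ?Df" by (intro smooth_on_frechet_derivative assms(1) snoc.prems)
  obtain C1 where C1: "C1 \<ge> 0" "\<And>g x. smooth_on V g \<Longrightarrow> x \<in> K \<Longrightarrow>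
      \<bar>partials vs (\<lambda>x. ?Df x * g x) x\<bar> \<le> C1 * (\<Sum>ws\<in>?W (length vs). \<bar>partials ws g x\<bar>)"
    using snoc.IH[OF Df v(2)] by blast
  obtain C2 where C2: "C2 \<ge> 0" "\<And>g x. smooth_on V g \<Longrightarrow> x \<in> K \<Longrightarrow>
      \<bar>partials vs (\<lambda>x. f x * g x) x\<bar> \<le> C2 * (\<Sum>ws\<in>?W (length vs). \<bar>partials ws g x\<bar>)"
    using snoc.IH[OF snoc.prems(1) v(2)] by blast
  \<comment> \<open>The number of words ws of length at most \<open>length vs\<close>; each of them,
    extended by v, occurs once in \<open>?T\<close>, which bounds the second sum by N times
    \<open>?T\<close>.\<close>
  define N where "N = real (card (?W (length vs)))"
  show ?case
  proof (intro exI[of _ "C1 + C2 * N"] conjI allI impI ballI)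
    show "C1 + C2 * N \<ge> 0" using C1 C2 by (simp add: N_def)
    fix g :: "'e \<Rightarrow> real" and x assume g: "smooth_on V g" and x: "x \<in> K"
    let ?T = "\<Sum>ws\<in>?W (length (vs @ [v])). \<bar>partials ws g x\<bar>"
    let ?Dg = "\<lambda>x. frechet_derivative g (at x) v"
    have Dg: "smooth_on V ?Dg" by (intro smooth_on_frechet_derivative assms(1) g)
    have xV: "x \<in> V" using x assms(3) by blast
    have "frechet_derivative (\<lambda>x. f x * g x) (at y) v = ?Df y * g y + f y * ?Dg y" if "y \<in> V" for y
    proof -
      have "((\<lambda>x. f x * g x) has_derivative
        (\<lambda>h. f y * frechet_derivative g (at y) h + frechet_derivative f (at y) h * g y)) (at y)"
        by (intro has_derivative_mult smooth_on_has_derivative[OF _ that] g snoc.prems)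
      then have "frechet_derivative (\<lambda>x. f x * g x) (at y) v =
        f y * frechet_derivative g (at y) v + frechet_derivative f (at y) v * g y"
        by (rule frechet_derivative_apply)
      then show ?thesis by simp
    qed
    then have "partials (vs @ [v]) (\<lambda>x. f x * g x) x = partials vs (\<lambda>y. ?Df y * g y + f y * ?Dg y) x"
      unfolding partials_append by (intro partials_cong_open[OF assms(1) xV]) simp
    also have "\<dots> = partials vs (\<lambda>y. ?Df y * g y) x + partials vs (\<lambda>y. f y * ?Dg y) x"
      by (intro partials_add[OF assms(1) _ _ xV] smooth_on_mult assms(1) Df Dg g snoc.prems)
    finally have 1: "\<bar>partials (vs @ [v]) (\<lambda>x. f x * g x) x\<bar> \<le>
        C1 * (\<Sum>ws\<in>?W (length vs). \<bar>partials ws g x\<bar>) + C2 * (\<Sum>ws\<in>?W (length vs). \<bar>partials ws ?Dg x\<bar>)"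
      using C1(2)[OF g x] C2(2)[OF Dg x] by linarith
    have 2: "(\<Sum>ws\<in>?W (length vs). \<bar>partials ws g x\<bar>) \<le> ?T"
      by (intro sum_mono2 finite_short_lists) auto
    have "(\<Sum>ws\<in>?W (length vs). \<bar>partials ws ?Dg x\<bar>) \<le> (\<Sum>ws\<in>?W (length vs). ?T)"
    proof (rule sum_mono)
      fix ws assume "ws \<in> ?W (length vs)"
      then have "ws @ [v] \<in> ?W (length (vs @ [v]))" using v by auto
      then have "\<bar>partials (ws @ [v]) g x\<bar> \<le> ?T"
        by (rule member_le_sum) (auto intro: finite_short_lists)
      then show "\<bar>partials ws ?Dg x\<bar> \<le> ?T" by (simp add: partials_append)
    qed
    then have 3: "(\<Sum>ws\<in>?W (length vs). \<bar>partials ws ?Dg x\<bar>) \<le> N * ?T"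
      by (simp add: N_def)
    have "C1 * (\<Sum>ws\<in>?W (length vs). \<bar>partials ws g x\<bar>) + C2 * (\<Sum>ws\<in>?W (length vs). \<bar>partials ws ?Dg x\<bar>)
       \<le> C1 * ?T + C2 * (N * ?T)"
      by (intro add_mono mult_left_mono 2 3 C1 C2)
    with 1 show "\<bar>partials (vs @ [v]) (\<lambda>x. f x * g x) x\<bar> \<le> (C1 + C2 * N) * ?T"
      by (simp add: algebra_simps)
  qed
qed

text \<open>Here \<open>f k\<close> is the k-th time derivative. Existence of both partial
  derivatives together with continuity of the one in x gives total differentiability, and the
  functions \<open>partials vs (f k t) x\<close> form a class closed under both kinds of
  derivatives.\<close>

lemma smooth_on_curve_family:
  fixes f :: "nat \<Rightarrow> real \<Rightarrow> 'e::euclidean_space \<Rightarrow> 'b::real_normed_vector"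
  assumes V: "open V"
    and sm: "\<And>k t. smooth_on V (f k t)"
    and dt: "\<And>k t x vs. set vs \<subseteq> Basis \<Longrightarrow> x \<in> V \<Longrightarrow>
      ((\<lambda>t. partials vs (f k t) x) has_vector_derivative partials vs (f (Suc k) t) x) (at t)"
    and ct: "\<And>k vs. set vs \<subseteq> Basis \<Longrightarrow> continuous_on (UNIV \<times> V) (\<lambda>(t, x). partials vs (f k t) x)"
  shows "smooth_on (UNIV \<times> V) (\<lambda>(t, x). f k t x)"
proof -
  define P where "P g \<longleftrightarrow> (\<exists>k vs. set vs \<subseteq> Basis \<and> g = (\<lambda>(t, x). partials vs (f k t) x))" for g
  have op: "open (UNIV \<times> V)" by (intro open_Times V open_UNIV)
  have der: "((\<lambda>(t, x). partials vs (f k t) x) has_derivative (\<lambda>(h, w). h *\<^sub>R partials vs (f (Suc k) t) x +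
      frechet_derivative (partials vs (f k t)) (at x) w)) (at (t, x))"
    if vs: "set vs \<subseteq> Basis" and x: "x \<in> V" for k vs t x
  proof -
    obtain \<rho> where \<rho>: "\<rho> > 0" "ball x \<rho> \<subseteq> V"
      using V x open_contains_ball by blast
    \<comment> \<open>The criterion wants the x-derivative as a bounded linear function; its
      continuity can be tested on basis vectors, where it is an instance of
      \<open>ct\<close>.\<close>
    define D where "D t x = Blinfun (frechet_derivative (partials vs (f k t)) (at x))" for t x
    have hd: "(partials vs (f k t) has_derivative frechet_derivative (partials vs (f k t)) (at y)) (at y)"
      if "y \<in> V" for t y
      by (intro smooth_on_has_derivative[OF smooth_on_partials[OF V sm]] that)
    have D: "blinfun_apply (D t y) = frechet_derivative (partials vs (f k t)) (at y)" if "y \<in> V" for t y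
      unfolding D_def by (rule bounded_linear_Blinfun_apply[OF has_derivative_bounded_linear[OF hd[OF that]]])
    have cD: "continuous_on (UNIV \<times> V) (\<lambda>(t, y). D t y)"
    proof (rule continuous_on_blinfun_componentwise)
      fix i :: 'e assume i: "i \<in> Basis"
      have "continuous_on (UNIV \<times> V) (\<lambda>(t, x). partials (i # vs) (f k t) x)"
        using vs i by (intro ct) auto
      then show "continuous_on (UNIV \<times> V) (\<lambda>z. blinfun_apply (case z of (t, y) \<Rightarrow> D t y) i)"
        by (rule continuous_on_eq) (auto simp: D)
    qed
    have "((\<lambda>(t, x). partials vs (f k t) x) has_derivative
        (\<lambda>(h, w). h *\<^sub>R partials vs (f (Suc k) t) x + D t x w)) (at (t, x) within UNIV \<times> ball x \<rho>)"
    proof (rule has_derivative_partialsI)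
      show "((\<lambda>t. partials vs (f k t) x) has_derivative (\<lambda>h. h *\<^sub>R partials vs (f (Suc k) t) x)) (at t within UNIV)"
        using dt[OF vs x] by (simp add: has_vector_derivative_def)
      fix t' y assume "y \<in> ball x \<rho>"
      then have y: "y \<in> V" using \<rho>(2) by blast
      show "(partials vs (f k t') has_derivative blinfun_apply (D t' y)) (at y within ball x \<rho>)"
        unfolding D[OF y] by (rule has_derivative_at_withinI[OF hd[OF y]])
    next
      show "continuous (at (t, x) within UNIV \<times> ball x \<rho>) (\<lambda>(t, y). D t y)"
      proof (rule continuous_at_imp_continuous_at_within)
        have "(t, x) \<in> UNIV \<times> V" using x by simp
        then show "continuous (at (t, x)) (\<lambda>(t, y). D t y)"
          by (rule bspec[OF continuous_on_eq_continuous_at[OF op, THEN iffD1, OF cD]])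
      qed
    qed (use \<rho> in auto)
    then show ?thesis
      using \<rho>(1) D[OF x] by (simp add: at_within_open[OF _ open_Times[OF open_UNIV open_ball]])
  qed
  have "P (\<lambda>(t, x). f k t x)"
    unfolding P_def by (intro exI[of _ k] exI[of _ "[]"]) auto
  then show ?thesis
    using op
  proof (induct rule: smooth_on_coinduct)
    case (differentiable g z)
    then obtain k vs where "set vs \<subseteq> Basis" "g = (\<lambda>(t, x). partials vs (f k t) x)"
      unfolding P_def by blast
    then show ?case
      using der[of vs "snd z" k "fst z"] differentiable(2) unfolding differentiable_def by auto
  next
    case (partial g b)
    then obtain k vs where vs: "set vs \<subseteq> Basis" and g: "g = (\<lambda>(t, x). partials vs (f k t) x)"
      unfolding P_def by blast
    have fd: "frechet_derivative g (at (t, x)) (h, w) = h *\<^sub>R partials vs (f (Suc k) t) x +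
      frechet_derivative (partials vs (f k t)) (at x) w" if "x \<in> V" for t x h w
      using frechet_derivative_at[OF der[OF vs that]] unfolding g by (metis case_prod_conv)
    consider "b = (1, 0)" | i where "b = (0, i)" "i \<in> Basis"
      using partial(2) by (auto simp: Basis_prod_def)
    then show ?case
    proof cases
      case 1
      have "frechet_derivative (partials vs (f k t)) (at x) 0 = 0" if "x \<in> V" for t x
        by (rule linear_0[OF has_derivative_linear[OF smooth_on_has_derivative[OF smooth_on_partials[OF V sm] that]]])
      then show ?thesis
        using 1 vs fd unfolding P_def
        by (intro exI[of _ "\<lambda>(t, x). partials vs (f (Suc k) t) x"] conjI exI[of _ "Suc k"] exI[of _ vs]) auto
    next
      case 2
      then show ?thesis
        using vs fd unfolding P_def
        by (intro exI[of _ "\<lambda>(t, x). partials (i # vs) (f k t) x"] conjI exI[of _ k] exI[of _ "i # vs"]) auto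
    qed
  qed
qed

text \<open>The powers make this family closed under differentiation.\<close>

definition flat :: "nat \<Rightarrow> real \<Rightarrow> real" where
  "flat m t = (if t > 0 then inverse t ^ m * exp (- inverse t) else 0)"

lemma flat_tendsto_0: "((\<lambda>t. flat m t) \<longlongrightarrow> 0) (at 0)"
proof -
  have "((\<lambda>t::real. inverse t ^ m / exp (inverse t)) \<longlongrightarrow> 0) (at_right 0)"
    by (rule filterlim_compose[OF tendsto_power_div_exp_0 filterlim_inverse_at_top_right])
  then have "((\<lambda>t. flat m t) \<longlongrightarrow> 0) (at_right 0)"
    by (rule Lim_transform_eventually) (auto simp: flat_def eventually_at_filter exp_minus field_simps)
  moreover have "((\<lambda>t. flat m t) \<longlongrightarrow> 0) (at_left 0)"
    by (rule tendsto_eventually) (auto simp: flat_def eventually_at_filter)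
  ultimately show ?thesis
    by (rule filterlim_split_at[rotated])
qed

lemma flat_has_derivative:
  "(flat m has_real_derivative (- real m * flat (m + 1) t + flat (m + 2) t)) (at t)"
proof -
  consider "t > 0" | "t < 0" | "t = 0" by linarith
  then show ?thesis
  proof cases
    case 1
    have "((\<lambda>t. inverse t ^ m * exp (- inverse t)) has_real_derivative
      (- real m * flat (m + 1) t + flat (m + 2) t)) (at t)"
    proof (cases m)
      case 0
      then show ?thesis
        using 1 by (auto intro!: derivative_eq_intros simp: flat_def field_simps power2_eq_square)
    next
      case (Suc j)
      have "(inverse has_real_derivative - (inverse t ^ 2)) (at t)"
        using DERIV_inverse[of t] 1 by (simp add: numeral_2_eq_2)
      then have "((\<lambda>t. inverse t ^ Suc j) has_real_derivative
        (1 + real j) * (- (inverse t ^ 2) * inverse t ^ j)) (at t)"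
        using DERIV_power_Suc by force
      moreover have "((\<lambda>t. exp (- inverse t)) has_real_derivative exp (- inverse t) * inverse t ^ 2) (at t)"
        using 1 by (auto intro!: derivative_eq_intros simp: power2_eq_square)
      ultimately have "((\<lambda>t. inverse t ^ Suc j * exp (- inverse t)) has_real_derivative
        (1 + real j) * (- (inverse t ^ 2) * inverse t ^ j) * exp (- inverse t) +
        exp (- inverse t) * inverse t ^ 2 * inverse t ^ Suc j) (at t)"
        by (rule DERIV_mult)
      then show ?thesis
        using 1 Suc by (simp add: flat_def power2_eq_square algebra_simps)
    qed
    then show ?thesis
      by (rule has_field_derivative_transform_within_open[where S = "{0<..}"])
         (use 1 in \<open>auto simp: flat_def\<close>)
  next
    case 2
    have "((\<lambda>t. 0) has_real_derivative (- real m * flat (m + 1) t + flat (m + 2) t)) (at t)"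
      using 2 by (simp add: flat_def)
    then show ?thesis
      by (rule has_field_derivative_transform_within_open[where S = "{..<0}"])
         (use 2 in \<open>auto simp: flat_def\<close>)
  next
    case 3
    \<comment> \<open>At 0 the difference quotient of \<open>flat m\<close> is
      \<open>flat (Suc m)\<close>, whose limit is known.\<close>
    have "((\<lambda>h. (flat m (0 + h) - flat m 0) / h) \<longlongrightarrow> 0) (at 0)"
      by (rule Lim_transform_eventually[OF flat_tendsto_0[of "Suc m"]])
         (auto simp: flat_def eventually_at_filter field_simps)
    then show ?thesis using 3 by (simp add: DERIV_def flat_def)
  qed
qed

lemma flat_smooth: "smooth_on UNIV (flat m)"
proof -
  have "ksmooth k UNIV (flat m)" for k m
  proof (induction k arbitrary: m)
    case 0
    then show ?case
      using flat_has_derivative unfolding ksmooth_0 differentiable_def has_field_derivative_def by blast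
  next
    case (Suc k)
    show ?case
    proof (rule ksmooth_SucI[OF open_UNIV])
      show "(flat m has_derivative (*) (- real m * flat (m + 1) t + flat (m + 2) t)) (at t)" for t
        using flat_has_derivative unfolding has_field_derivative_def .
      show "ksmooth k UNIV (\<lambda>t. (- real m * flat (m + 1) t + flat (m + 2) t) * b)" for b
        by (intro ksmooth_bilinear[OF open_UNIV bounded_bilinear_mult] ksmooth_add ksmooth_const Suc.IH open_UNIV)
    qed
  qed
  then show ?thesis by (simp add: smooth_on_ksmooth)
qed

lemma smooth_bump:
  fixes x0 :: "'e::euclidean_space"
  assumes "\<rho> > 0"
  obtains \<beta> :: "'e \<Rightarrow> real" where "smooth_on UNIV \<beta>" "\<beta> x0 = 1" "\<And>x. x \<notin> ball x0 \<rho> \<Longrightarrow> \<beta> x = 0"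
proof
  let ?b = "\<lambda>x. flat 0 (\<rho>\<^sup>2 - (x - x0) \<bullet> (x - x0)) * inverse (flat 0 (\<rho>\<^sup>2))"
  show "smooth_on UNIV ?b"
    by (intro smooth_on_mult smooth_on_const open_UNIV smooth_on_compose[OF open_UNIV open_UNIV flat_smooth]
        smooth_on_diff smooth_on_bilinear[OF _ bounded_bilinear_inner] smooth_on_id UNIV_I)
  show "?b x0 = 1"
    using assms by (simp add: flat_def)
  show "?b x = 0" if "x \<notin> ball x0 \<rho>" for x
  proof -
    have "\<rho> \<le> norm (x - x0)" using that by (simp add: dist_norm norm_minus_commute)
    then have "\<rho>\<^sup>2 \<le> (norm (x - x0))\<^sup>2" using assms by (intro power_mono) auto
    then show ?thesis by (simp add: flat_def power2_norm_eq_inner)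
  qed
qed

section \<open>Local flows\<close>

lemma has_vector_derivative_norm_diff_le:
  fixes w :: "real \<Rightarrow> 'b::real_normed_vector"
  assumes "convex S" "\<And>t. t \<in> S \<Longrightarrow> (w has_vector_derivative w' t) (at t within S)"
    "\<And>t. t \<in> S \<Longrightarrow> norm (w' t) \<le> B" "s \<in> S" "t \<in> S"
  shows "norm (w s - w t) \<le> B * \<bar>s - t\<bar>"
proof -
  have "norm (w s - w t) \<le> B * norm (s - t)"
  proof (rule differentiable_bound[OF assms(1) _ _ assms(4,5)])
    fix x assume x: "x \<in> S"
    show "(w has_derivative (\<lambda>h. h *\<^sub>R w' x)) (at x within S)"
      using assms(2)[OF x] by (simp add: has_vector_derivative_def)
    show "onorm (\<lambda>h. h *\<^sub>R w' x) \<le> B"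
    proof (rule onorm_bound)
      show "0 \<le> B" using assms(3)[OF x] norm_ge_zero order_trans by blast
      show "norm (h *\<^sub>R w' x) \<le> B * norm h" for h
        using mult_left_mono[OF assms(3)[OF x], of "\<bar>h\<bar>"] by (simp add: mult.commute)
    qed
  qed
  then show ?thesis by simp
qed

lemma small_time_gronwall:
  fixes w :: "real \<Rightarrow> 'b::real_normed_vector"
  assumes d: "d \<ge> 0" "L \<ge> 0" "d * L \<le> 1 / 2" "\<epsilon> \<ge> 0"
    and w: "\<And>t. t \<in> {-d..d} \<Longrightarrow> (w has_vector_derivative w' t) (at t within {-d..d})"
    and w': "\<And>t. t \<in> {-d..d} \<Longrightarrow> norm (w' t) \<le> L * norm (w t) + \<epsilon>"
    and t: "t \<in> {-d..d}"
  shows "norm (w t) \<le> 2 * (norm (w 0) + d * \<epsilon>)"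
proof -
  have "continuous_on {-d..d} w"
    using w by (rule continuous_on_vector_derivative)
  then have "continuous_on {-d..d} (\<lambda>t. norm (w t))"
    by (rule continuous_on_norm)
  then obtain m where m: "m \<in> {-d..d}" "\<And>t. t \<in> {-d..d} \<Longrightarrow> norm (w t) \<le> norm (w m)"
    using continuous_attains_sup[of "{-d..d}" "\<lambda>t. norm (w t)"] d(1) by auto
  have "norm (w m - w 0) \<le> (L * norm (w m) + \<epsilon>) * \<bar>m - 0\<bar>"
  proof (rule has_vector_derivative_norm_diff_le[OF _ w _ m(1)])
    fix t assume t: "t \<in> {-d..d}"
    have "norm (w' t) \<le> L * norm (w t) + \<epsilon>" by (rule w'[OF t])
    also have "\<dots> \<le> L * norm (w m) + \<epsilon>"
      using m(2)[OF t] d(2) by (simp add: mult_left_mono)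
    finally show "norm (w' t) \<le> L * norm (w m) + \<epsilon>" .
  qed (use d in auto)
  also have "\<dots> \<le> (L * norm (w m) + \<epsilon>) * d"
    using m(1) d by (intro mult_left_mono) auto
  also have "\<dots> = (d * L) * norm (w m) + d * \<epsilon>"
    by (simp add: algebra_simps)
  also have "\<dots> \<le> 1 / 2 * norm (w m) + d * \<epsilon>"
    using d by (intro add_right_mono mult_right_mono) auto
  finally have "norm (w m - w 0) \<le> 1 / 2 * norm (w m) + d * \<epsilon>" .
  moreover have "norm (w m) \<le> norm (w m - w 0) + norm (w 0)"
    using norm_triangle_sub[of "w m" "w 0"] by simp
  ultimately have "norm (w m) \<le> 2 * (norm (w 0) + d * \<epsilon>)"
    by simp
  then show ?thesis using m(2)[OF t] by simp
qed

text \<open>The global Lipschitz condition lets the contraction run on all bounded continuous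
  functions on the real line, a complete space; clamping time by \<open>cl\<close> to the interval
  makes the integral operator map this space to itself.\<close>

lemma picard:
  fixes g :: "'e::euclidean_space \<Rightarrow> 'e"
  assumes L: "L \<ge> 0" "\<And>x y. norm (g x - g y) \<le> L * norm (x - y)" and d: "d > 0" "d * L < 1"
  shows "\<exists>y. y 0 = x \<and> (\<forall>t\<in>{-d..d}. (y has_vector_derivative g (y t)) (at t within {-d..d}))"
proof -
  have cg: "continuous_on A g" for A
  proof (rule continuous_on_subset[of UNIV])
    have "L-lipschitz_on UNIV g"
      using L by (intro lipschitz_onI) (auto simp: dist_norm)
    then show "continuous_on UNIV g" by (rule lipschitz_on_continuous_on)
  qed simp
  \<comment> \<open>Both integrals start at -d, so that one formula covers negative and positive t;
    subtracting the integral up to 0 puts the initial value at time 0.\<close>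
  define I where "I u t = x + integral {-d..t} (\<lambda>s. g (u s)) - integral {-d..0} (\<lambda>s. g (u s))"
    for u :: "real \<Rightarrow> 'e" and t
  define cl where "cl t = max (-d) (min d t)" for t :: real
  have cl: "cl t \<in> {-d..d}" "t \<in> {-d..d} \<Longrightarrow> cl t = t" for t
    using d unfolding cl_def by auto
  have ccl: "continuous_on UNIV cl"
    unfolding cl_def by (intro continuous_intros)
  have I_deriv: "(I u has_vector_derivative g (u t)) (at t within {-d..d})"
    if "continuous_on UNIV u" "t \<in> {-d..d}" for u :: "real \<Rightarrow> 'e" and t
  proof -
    have "continuous_on {-d..d} (\<lambda>s. g (u s))"
      by (rule continuous_on_compose2[OF cg[of UNIV]]) (use that(1) continuous_on_subset in auto)
    from integral_has_vector_derivative[OF this that(2)]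
    show ?thesis
      unfolding I_def by (auto intro!: derivative_eq_intros)
  qed
  have I_0: "I u 0 = x" for u by (simp add: I_def)
  define P where "P u = Bcontfun (\<lambda>t. I (apply_bcontfun u) (cl t))" for u :: "real \<Rightarrow>\<^sub>C 'e"
  have P: "apply_bcontfun (P u) t = I (apply_bcontfun u) (cl t)" for u t
  proof -
    have cI: "continuous_on {-d..d} (I (apply_bcontfun u))"
      using I_deriv[of "apply_bcontfun u"] by (intro continuous_on_vector_derivative) auto
    have "continuous_on UNIV (\<lambda>t. I (apply_bcontfun u) (cl t))"
      by (rule continuous_on_compose2[OF cI ccl]) (use cl in auto)
    moreover have "bounded (range (\<lambda>t. I (apply_bcontfun u) (cl t)))"
    proof (rule bounded_subset)
      show "bounded (I (apply_bcontfun u) ` {-d..d})"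
        by (intro compact_imp_bounded compact_continuous_image cI) simp
    qed (use cl(1) in auto)
    ultimately show ?thesis
      unfolding P_def by (subst Bcontfun_inverse) (auto simp: bcontfun_def)
  qed
  have "\<exists>!u. P u = u"
  proof (rule banach_fix_type)
    show "\<forall>u w. dist (P u) (P w) \<le> (d * L) * dist u w"
    proof (intro allI dist_bound)
      fix u w :: "real \<Rightarrow>\<^sub>C 'e" and t
      let ?u = "apply_bcontfun u" and ?w = "apply_bcontfun w"
      have "norm ((I ?u (cl t) - I ?w (cl t)) - (I ?u 0 - I ?w 0)) \<le> (L * dist u w) * \<bar>cl t - 0\<bar>"
      proof (rule has_vector_derivative_norm_diff_le)
        fix s assume s: "s \<in> {-d..d}"
        show "((\<lambda>t. I ?u t - I ?w t) has_vector_derivative g (?u s) - g (?w s)) (at s within {-d..d})"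
          by (intro has_vector_derivative_diff I_deriv s) auto
        have "norm (g (?u s) - g (?w s)) \<le> L * dist (?u s) (?w s)"
          using L(2) by (simp add: dist_norm)
        also have "\<dots> \<le> L * dist u w"
          by (intro mult_left_mono dist_bounded L)
        finally show "norm (g (?u s) - g (?w s)) \<le> L * dist u w" .
      qed (use cl d in auto)
      also have "\<dots> \<le> (L * dist u w) * d"
        using cl(1)[of t] L by (intro mult_left_mono) auto
      finally show "dist (apply_bcontfun (P u) t) (apply_bcontfun (P w) t) \<le> d * L * dist u w"
        by (simp add: P I_0 dist_norm mult_ac)
    qed
  qed (use d L in auto)
  then obtain u where u: "P u = u" by blast
  let ?u = "apply_bcontfun u"
  have eq: "?u t = I ?u t" if "t \<in> {-d..d}" for t
    using P[of u t] cl(2)[OF that] by (simp add: u)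
  show ?thesis
  proof (intro exI[of _ ?u] conjI ballI)
    show "?u 0 = x" using eq[of 0] d by (simp add: I_0)
    fix t assume t: "t \<in> {-d..d}"
    show "(?u has_vector_derivative g (?u t)) (at t within {-d..d})"
      by (rule has_vector_derivative_transform[OF t eq I_deriv[OF _ t]]) auto
  qed
qed

text \<open>Precomposition with the nearest point map of the ball makes \<open>f\<close> globally Lipschitz.\<close>

lemma ode_local:
  fixes f :: "'e::euclidean_space \<Rightarrow> 'e"
  assumes R: "R > 0" and L: "L \<ge> 0"
    "\<And>x y. x \<in> cball x0 R \<Longrightarrow> y \<in> cball x0 R \<Longrightarrow> norm (f x - f y) \<le> L * norm (x - y)"
  shows "\<exists>\<delta>>0. \<exists>\<phi>. \<forall>x\<in>ball x0 (R / 2). \<phi> x 0 = x \<and>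
    (\<forall>t. \<bar>t\<bar> < \<delta> \<longrightarrow> \<phi> x t \<in> ball x0 R \<and> (\<phi> x has_vector_derivative f (\<phi> x t)) (at t))"
proof -
  let ?C = "cball x0 R"
  have ne: "?C \<noteq> {}" using R by auto
  define g where "g x = f (closest_point ?C x)" for x
  have cp: "closest_point ?C x \<in> ?C" for x
    by (rule closest_point_in_set) (use ne in auto)
  have gL: "norm (g x - g y) \<le> L * norm (x - y)" for x y
  proof -
    have "norm (g x - g y) \<le> L * norm (closest_point ?C x - closest_point ?C y)"
      unfolding g_def by (intro L(2) cp)
    also have "\<dots> \<le> L * norm (x - y)"
      using closest_point_lipschitz[of ?C x y] ne L(1) by (intro mult_left_mono) (auto simp: dist_norm)
    finally show ?thesis .
  qed
  define B where "B = norm (f x0) + L * R"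
  have B: "B \<ge> 0" using L R by (simp add: B_def)
  have gB: "norm (g x) \<le> B" for x
  proof -
    have "norm (g x - f x0) \<le> L * norm (closest_point ?C x - x0)"
      unfolding g_def using R by (intro L(2) cp) auto
    also have "\<dots> \<le> L * R"
      using cp[of x] L(1) by (intro mult_left_mono) (auto simp: dist_norm norm_minus_commute)
    finally show ?thesis
      unfolding B_def using norm_triangle_sub[of "g x" "f x0"] by linarith
  qed
  \<comment> \<open>The first bound makes \<open>d * L\<close> smaller than 1 for the contraction.
    The second keeps solutions with speed at most B that start in the half ball inside the ball of
    radius R.\<close>
  define d where "d = min (1 / (2 * (L + 1))) (R / (2 * (B + 1)))"
  have d0: "d > 0" using L B R by (simp add: d_def)
  have "d * L \<le> 1 / (2 * (L + 1)) * L"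
    using L by (intro mult_right_mono) (auto simp: d_def)
  also have "\<dots> < 1" using L by (simp add: field_simps)
  finally have dL: "d * L < 1" .
  have "d * B \<le> R / (2 * (B + 1)) * B"
    using B by (intro mult_right_mono) (auto simp: d_def)
  also have "\<dots> < R / 2" using B R by (simp add: field_simps)
  finally have dB: "B * d < R / 2" by (simp add: mult.commute)
  define \<phi> where "\<phi> x = (SOME y. y 0 = x \<and>
     (\<forall>t\<in>{-d..d}. (y has_vector_derivative g (y t)) (at t within {-d..d})))" for x
  have \<phi>: "\<phi> x 0 = x \<and> (\<forall>t\<in>{-d..d}. (\<phi> x has_vector_derivative g (\<phi> x t)) (at t within {-d..d}))" for x
    unfolding \<phi>_def by (rule someI_ex[OF picard[OF L(1) gL d0 dL]])
  show ?thesis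
  proof (intro exI[of _ d] exI[of _ \<phi>] conjI d0 ballI allI impI)
    fix x assume x: "x \<in> ball x0 (R / 2)"
    show "\<phi> x 0 = x" using \<phi> by blast
    fix t :: real assume "\<bar>t\<bar> < d"
    then have t: "t \<in> {-d..d}" "t \<in> {-d<..<d}" by auto
    have "norm (\<phi> x t - \<phi> x 0) \<le> B * \<bar>t - 0\<bar>"
      by (rule has_vector_derivative_norm_diff_le[where S = "{-d..d}" and w' = "\<lambda>t. g (\<phi> x t)"])
         (use \<phi> gB t d0 in auto)
    also have "\<dots> \<le> B * d" using t B by (intro mult_left_mono) auto
    finally have "norm (\<phi> x t - x) < R / 2" using dB \<phi> by simp
    then have "dist (\<phi> x t) x0 < R"
      using x dist_triangle[of "\<phi> x t" x0 x] by (simp add: dist_norm norm_minus_commute)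
    then show b: "\<phi> x t \<in> ball x0 R" by (simp add: dist_commute)
    have "(\<phi> x has_vector_derivative g (\<phi> x t)) (at t)"
    proof -
      have "(\<phi> x has_vector_derivative g (\<phi> x t)) (at t within {-d<..<d})"
      proof (rule has_vector_derivative_within_subset)
        show "(\<phi> x has_vector_derivative g (\<phi> x t)) (at t within {-d..d})"
          using \<phi>[of x] t(1) by blast
      qed auto
      then show ?thesis by (simp only: at_within_open[OF t(2) open_greaterThanLessThan])
    qed
    moreover have "g (\<phi> x t) = f (\<phi> x t)"
      unfolding g_def using b by (subst closest_point_self) auto
    ultimately show "(\<phi> x has_vector_derivative f (\<phi> x t)) (at t)" by simp
  qed
qed

lemma smooth_on_lipschitz_cball:
  fixes f :: "'e::euclidean_space \<Rightarrow> 'b::real_normed_vector"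
  assumes "open U" "smooth_on U f" "cball x0 R \<subseteq> U"
  obtains L where "L \<ge> 0"
    "\<And>x y. x \<in> cball x0 R \<Longrightarrow> y \<in> cball x0 R \<Longrightarrow> norm (f x - f y) \<le> L * norm (x - y)"
    "\<And>x h. x \<in> cball x0 R \<Longrightarrow> norm (frechet_derivative f (at x) h) \<le> L * norm h"
proof -
  have "\<exists>B. \<forall>x\<in>cball x0 R. norm (frechet_derivative f (at x) b) \<le> B" for b
  proof -
    have "continuous_on (cball x0 R) (\<lambda>x. frechet_derivative f (at x) b)"
      using smooth_on_continuous_on[OF smooth_on_frechet_derivative[OF assms(1,2)]] assms(3)
        continuous_on_subset by blast
    then have "bounded ((\<lambda>x. frechet_derivative f (at x) b) ` cball x0 R)"
      by (intro compact_imp_bounded compact_continuous_image) auto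
    then show ?thesis unfolding bounded_iff by auto
  qed
  then obtain B where B: "\<And>b x. x \<in> cball x0 R \<Longrightarrow> norm (frechet_derivative f (at x) b) \<le> B b"
    by metis
  define L where "L = (\<Sum>b\<in>Basis. \<bar>B b\<bar>)"
  have L0: "L \<ge> 0" by (simp add: L_def sum_nonneg)
  have L: "norm (frechet_derivative f (at x) h) \<le> L * norm h" if x: "x \<in> cball x0 R" for x h
  proof -
    have "f differentiable (at x)"
      by (rule smooth_on_differentiable[OF assms(2)]) (use x assms(3) in blast)
    from frechet_derivative_Basis_expand[OF this, of h]
    have "norm (frechet_derivative f (at x) h) \<le>
        (\<Sum>i\<in>Basis. norm ((h \<bullet> i) *\<^sub>R frechet_derivative f (at x) i))"
      using norm_sum by metis
    also have "\<dots> \<le> (\<Sum>i\<in>Basis. norm h * \<bar>B i\<bar>)"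
    proof (rule sum_mono)
      fix i :: 'e assume "i \<in> Basis"
      then have "\<bar>h \<bullet> i\<bar> \<le> norm h" by (rule Basis_le_norm)
      moreover have "norm (frechet_derivative f (at x) i) \<le> \<bar>B i\<bar>"
        using B[OF x, of i] by linarith
      ultimately show "norm ((h \<bullet> i) *\<^sub>R frechet_derivative f (at x) i) \<le> norm h * \<bar>B i\<bar>"
        by (simp add: mult_mono)
    qed
    also have "\<dots> = L * norm h" by (simp add: L_def sum_distrib_left mult.commute)
    finally show ?thesis .
  qed
  moreover have "norm (f x - f y) \<le> L * norm (x - y)" if "x \<in> cball x0 R" "y \<in> cball x0 R" for x y
  proof (rule differentiable_bound[OF convex_cball[of x0 R] _ _ that])
    fix z assume z: "z \<in> cball x0 R"
    show "(f has_derivative frechet_derivative f (at z)) (at z within cball x0 R)"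
      by (rule has_derivative_at_withinI[OF smooth_on_has_derivative[OF assms(2)]]) (use z assms(3) in blast)
    show "onorm (frechet_derivative f (at z)) \<le> L"
      by (rule onorm_bound[OF L0 L[OF z]])
  qed
  ultimately show thesis using that L0 by blast
qed

section \<open>Matrix-valued functions and the space derivative of a flow\<close>

lemma bounded_bilinear_matrix_mult:
  "bounded_bilinear ((**) :: real^'n^'m \<Rightarrow> real^'k^'n \<Rightarrow> real^'k^'m)"
proof -
  have "bilinear ((**) :: real^'n^'m \<Rightarrow> real^'k^'n \<Rightarrow> real^'k^'m)"
    unfolding bilinear_def
    by (auto intro!: linearI simp: vec_eq_iff matrix_matrix_mult_def sum.distrib algebra_simps sum_distrib_left)
  then show ?thesis by (simp add: bilinear_conv_bounded_bilinear)
qed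

lemma bounded_bilinear_matrix_vector_mult:
  "bounded_bilinear ((*v) :: real^'n^'m \<Rightarrow> real^'n \<Rightarrow> real^'m)"
proof -
  have "bilinear ((*v) :: real^'n^'m \<Rightarrow> real^'n \<Rightarrow> real^'m)"
    unfolding bilinear_def
    by (auto intro!: linearI simp: vec_eq_iff matrix_vector_mult_def sum.distrib algebra_simps sum_distrib_left)
  then show ?thesis by (simp add: bilinear_conv_bounded_bilinear)
qed

lemma smooth_on_matrix_frechet:
  fixes f :: "real^'n \<Rightarrow> real^'m"
  assumes "open U" "smooth_on U f"
  shows "smooth_on U (\<lambda>x. matrix (frechet_derivative f (at x)))"
  unfolding matrix_def
  by (intro smooth_on_vec_lambda assms smooth_on_vec_nth smooth_on_frechet_derivative)

lemma matrix_frechet_works: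
  fixes f :: "real^'n \<Rightarrow> real^'m"
  assumes "f differentiable (at x)"
  shows "matrix (frechet_derivative f (at x)) *v h = frechet_derivative f (at x) h"
proof -
  have "bounded_linear (frechet_derivative f (at x))"
    using assms frechet_derivative_works has_derivative_bounded_linear by blast
  from matrix_vector_mul(3)[OF this] show ?thesis by (rule fun_cong)
qed

lemma frechet_derivative_matrix:
  fixes f :: "real^'n \<Rightarrow> real^'m"
  assumes "(f has_derivative (\<lambda>h. M *v h)) (at x)"
  shows "matrix (frechet_derivative f (at x)) = M"
proof -
  have "frechet_derivative f (at x) = (\<lambda>h. M *v h)"
    using frechet_derivative_at[OF assms] by simp
  then show ?thesis by simp
qed

text \<open>
  \<open>\<Phi>\<close> comes from solving \<open>(x, M)' = (f x, Df x ** M)\<close>; that it is the derivative of the flow follows by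
  comparing \<open>\<phi> x t - \<phi> x0 t - \<Phi> t *v (x - x0)\<close> with the solution \<open>0\<close> of the variational equation.
\<close>

lemma smooth_local_flow:
  fixes f :: "real^'n \<Rightarrow> real^'n"
  assumes U: "open U" "x0 \<in> U" "smooth_on U f"
  obtains \<delta> \<rho> \<phi> \<Phi> where "\<delta> > 0" "\<rho> > 0"
    "\<And>x. x \<in> ball x0 \<rho> \<Longrightarrow> \<phi> x 0 = x"
    "\<And>x t. x \<in> ball x0 \<rho> \<Longrightarrow> \<bar>t\<bar> < \<delta> \<Longrightarrow> \<phi> x t \<in> U"
    "\<And>x t. x \<in> ball x0 \<rho> \<Longrightarrow> \<bar>t\<bar> < \<delta> \<Longrightarrow> (\<phi> x has_vector_derivative f (\<phi> x t)) (at t)"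
    "\<Phi> 0 = mat 1" "(\<Phi> has_vector_derivative matrix (frechet_derivative f (at x0))) (at 0)"
    "\<And>t. \<bar>t\<bar> < \<delta> \<Longrightarrow> ((\<lambda>x. \<phi> x t) has_derivative (\<lambda>h. \<Phi> t *v h)) (at x0)"
proof -
  define J where "J x = matrix (frechet_derivative f (at x))" for x
  define F where "F z = (f (fst z), J (fst z) ** snd z)" for z :: "(real^'n) \<times> (real^'n^'n)"
  have J: "J x *v h = frechet_derivative f (at x) h" if "x \<in> U" for x h
    unfolding J_def by (rule matrix_frechet_works[OF smooth_on_differentiable[OF U(3) that]])
  have sJ: "smooth_on U J"
    unfolding J_def by (rule smooth_on_matrix_frechet[OF U(1,3)])
  let ?W = "U \<times> (UNIV :: (real^'n^'n) set)"
  have opW: "open ?W" by (intro open_Times U open_UNIV)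
  have sF: "smooth_on ?W F"
    unfolding F_def
    by (intro smooth_on_Pair smooth_on_bilinear[OF _ bounded_bilinear_matrix_mult] smooth_on_fst smooth_on_snd
        smooth_on_compose[OF opW U(1,3)] smooth_on_compose[OF opW U(1) sJ] opW) auto
  obtain R where R: "R > 0" "cball (x0, mat 1) R \<subseteq> ?W"
  proof -
    have "(x0, mat 1) \<in> ?W" using U(2) by simp
    then show thesis using opW that unfolding open_contains_cball by blast
  qed
  have RU: "cball x0 R \<subseteq> U"
  proof
    fix x assume "x \<in> cball x0 R"
    then have "(x, mat 1) \<in> cball (x0, mat 1 :: real^'n^'n) R" by (simp add: dist_Pair_Pair)
    then show "x \<in> U" using R by blast
  qed
  obtain LF where LF: "LF \<ge> 0" "\<And>x y. x \<in> cball (x0, mat 1) R \<Longrightarrow> y \<in> cball (x0, mat 1) R \<Longrightarrow>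
      norm (F x - F y) \<le> LF * norm (x - y)"
    using smooth_on_lipschitz_cball[OF opW sF R(2)] by metis
  obtain \<delta>1 Y where \<delta>1: "\<delta>1 > 0" and Y: "\<And>z. z \<in> ball (x0, mat 1) (R / 2) \<Longrightarrow> Y z 0 = z"
    "\<And>z t. z \<in> ball (x0, mat 1) (R / 2) \<Longrightarrow> \<bar>t\<bar> < \<delta>1 \<Longrightarrow> Y z t \<in> ball (x0, mat 1) R"
    "\<And>z t. z \<in> ball (x0, mat 1) (R / 2) \<Longrightarrow> \<bar>t\<bar> < \<delta>1 \<Longrightarrow> (Y z has_vector_derivative F (Y z t)) (at t)"
  proof -
    obtain \<delta>1 Y where "\<delta>1 > 0" and Y: "\<forall>x\<in>ball (x0, mat 1) (R / 2). Y x 0 = x \<and>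
      (\<forall>t. \<bar>t\<bar> < \<delta>1 \<longrightarrow> Y x t \<in> ball (x0, mat 1) R \<and> (Y x has_vector_derivative F (Y x t)) (at t))"
      using ode_local[of R LF "(x0, mat 1)" F, OF R(1) LF] by blast
    then show thesis using that[of \<delta>1 Y] by blast
  qed
  obtain L1 where L1: "L1 \<ge> 0"
    "\<And>x y. x \<in> cball x0 R \<Longrightarrow> y \<in> cball x0 R \<Longrightarrow> norm (f x - f y) \<le> L1 * norm (x - y)"
    "\<And>x h. x \<in> cball x0 R \<Longrightarrow> norm (frechet_derivative f (at x) h) \<le> L1 * norm h"
    using smooth_on_lipschitz_cball[OF U(1,3) RU] by metis
  obtain L2 where L2: "L2 \<ge> 0"
    "\<And>x y. x \<in> cball x0 R \<Longrightarrow> y \<in> cball x0 R \<Longrightarrow> norm (J x - J y) \<le> L2 * norm (x - y)"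
    using smooth_on_lipschitz_cball[OF U(1) sJ RU] by metis
  obtain K where K: "K > 0" "\<And>(A::real^'n^'n) (h::real^'n). norm (A *v h) \<le> norm A * norm h * K"
    using bounded_bilinear.pos_bounded[OF bounded_bilinear_matrix_vector_mult[where 'n='n and 'm='n]] by blast
  define \<phi> where "\<phi> x t = fst (Y (x, mat 1) t)" for x t
  define \<Phi> where "\<Phi> t = snd (Y (x0, mat 1) t)" for t
  define \<rho> where "\<rho> = R / 2"
  \<comment> \<open>The second bound gives \<open>d * L1 \<le> 1 / 2\<close> for every time d below
    \<delta>, as the short-time Gronwall estimate requires.\<close>
  define \<delta> where "\<delta> = min \<delta>1 (1 / (2 * (L1 + 1)))"
  have zb: "(x, mat 1) \<in> ball (x0, mat 1 :: real^'n^'n) (R / 2)" if "x \<in> ball x0 \<rho>" for x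
    using that by (simp add: \<rho>_def dist_Pair_Pair)
  have \<rho>: "\<rho> > 0" "x0 \<in> ball x0 \<rho>" using R by (simp_all add: \<rho>_def)
  have \<delta>: "\<delta> > 0" using \<delta>1 L1 by (simp add: \<delta>_def)
  have \<delta>L: "d * L1 \<le> 1 / 2" if "d < \<delta>" "d \<ge> 0" for d
  proof -
    have "d * L1 \<le> 1 / (2 * (L1 + 1)) * L1"
      using L1 that by (intro mult_right_mono) (auto simp: \<delta>_def)
    also have "\<dots> \<le> 1 / 2" using L1 by (simp add: field_simps)
    finally show ?thesis .
  qed
  have \<phi>0: "\<phi> x 0 = x" if "x \<in> ball x0 \<rho>" for x
    unfolding \<phi>_def using Y(1)[OF zb[OF that]] by simp
  have \<phi>R: "\<phi> x t \<in> cball x0 R" if "x \<in> ball x0 \<rho>" "\<bar>t\<bar> < \<delta>" for x t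
  proof -
    have "dist (x0, mat 1) (Y (x, mat 1) t) < R"
      using Y(2)[OF zb[OF that(1)], of t] that(2) by (simp add: \<delta>_def)
    then show ?thesis
      using dist_fst_le[of "(x0, mat 1)" "Y (x, mat 1) t"] by (simp add: \<phi>_def)
  qed
  have \<phi>d: "(\<phi> x has_vector_derivative f (\<phi> x t)) (at t)" if "x \<in> ball x0 \<rho>" "\<bar>t\<bar> < \<delta>" for x t
    using bounded_linear.has_vector_derivative[OF bounded_linear_fst Y(3)[OF zb[OF that(1)]], of t] that(2)
    by (simp add: \<phi>_def[abs_def] F_def \<delta>_def)
  have \<Phi>d: "(\<Phi> has_vector_derivative J (\<phi> x0 t) ** \<Phi> t) (at t)" if "\<bar>t\<bar> < \<delta>" for t
    using bounded_linear.has_vector_derivative[OF bounded_linear_snd Y(3)[OF zb[OF \<rho>(2)]], of t] that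
    by (simp add: \<phi>_def \<Phi>_def[abs_def] F_def \<delta>_def)
  have \<Phi>0: "\<Phi> 0 = mat 1"
    unfolding \<Phi>_def using Y(1)[OF zb[OF \<rho>(2)]] by simp
  have lip: "norm (\<phi> x t - \<phi> x0 t) \<le> 2 * norm (x - x0)" if x: "x \<in> ball x0 \<rho>" and t: "\<bar>t\<bar> < \<delta>" for x t
  proof -
    have "norm (\<phi> x t - \<phi> x0 t) \<le> 2 * (norm (\<phi> x 0 - \<phi> x0 0) + \<bar>t\<bar> * 0)"
    proof (rule small_time_gronwall[of _ L1])
      fix s assume "s \<in> {-\<bar>t\<bar>..\<bar>t\<bar>}"
      then have s: "\<bar>s\<bar> < \<delta>" using t by auto
      show "((\<lambda>t. \<phi> x t - \<phi> x0 t) has_vector_derivative f (\<phi> x s) - f (\<phi> x0 s)) (at s within {-\<bar>t\<bar>..\<bar>t\<bar>})"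
        by (rule has_vector_derivative_at_within[OF has_vector_derivative_diff[OF \<phi>d[OF x s] \<phi>d[OF \<rho>(2) s]]])
      show "norm (f (\<phi> x s) - f (\<phi> x0 s)) \<le> L1 * norm (\<phi> x s - \<phi> x0 s) + 0"
        using L1(2)[OF \<phi>R[OF x s] \<phi>R[OF \<rho>(2) s]] by simp
    qed (use \<delta>L[of "\<bar>t\<bar>"] t L1 in auto)
    then show ?thesis by (simp add: \<phi>0[OF x] \<phi>0[OF \<rho>(2)])
  qed
  \<comment> \<open>A quadratic remainder from the Lipschitz constant L2 of the Jacobian along the
    segment; K is the constant of the matrix-vector product.\<close>
  have taylor: "norm (f b - f a - J a *v (b - a)) \<le> L2 * K * norm (b - a) ^ 2"
    if a: "a \<in> cball x0 R" and b: "b \<in> cball x0 R" for a b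
  proof -
    have seg: "closed_segment a b \<subseteq> cball x0 R"
      by (rule closed_segment_subset[OF a b convex_cball])
    have "norm (f b - f a - J a *v (b - a)) \<le> norm (b - a) * (L2 * K * norm (b - a))"
    proof (rule differentiable_bound_linearization[where S = "closed_segment a b"
          and f' = "\<lambda>x h. J x *v h" and f = f])
      fix x assume x: "x \<in> closed_segment a b"
      then have xR: "x \<in> cball x0 R" using seg by blast
      then have xU: "x \<in> U" using RU by blast
      have "frechet_derivative f (at x) = (*v) (J x)" using J[OF xU] by auto
      then show "(f has_derivative (\<lambda>h. J x *v h)) (at x within closed_segment a b)"
        using has_derivative_at_withinI[OF smooth_on_has_derivative[OF U(3) xU]] by simp
      have "norm ((J x - J a) *v h) \<le> L2 * K * norm (b - a) * norm h" for h
      proof -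
        have "norm (x - a) \<le> norm (b - a)" using segment_bound1[OF x] .
        then have "norm (J x - J a) \<le> L2 * norm (b - a)"
          using L2(2)[OF xR a] mult_left_mono[OF \<open>norm (x - a) \<le> norm (b - a)\<close> L2(1)] by linarith
        then have "norm (J x - J a) * norm h * K \<le> L2 * norm (b - a) * norm h * K"
          using K(1) by (intro mult_right_mono) auto
        with K(2)[of "J x - J a" h] show ?thesis by (simp add: mult_ac)
      qed
      then show "onorm ((\<lambda>h. J x *v h) - (\<lambda>h. J a *v h)) \<le> L2 * K * norm (b - a)"
        using L2 K by (intro onorm_bound) (auto simp: fun_diff_def matrix_vector_mult_diff_rdistrib)
    next
      fix t :: real assume t: "t \<in> {0..1}"
      have "a + t *\<^sub>R (b - a) = (1 - t) *\<^sub>R a + t *\<^sub>R b" by (simp add: algebra_simps)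
      then show "a + t *\<^sub>R (b - a) \<in> closed_segment a b"
        using t unfolding in_segment by auto
    qed simp
    then show ?thesis by (simp add: power2_eq_square mult_ac)
  qed
  show thesis
  proof (rule that[of \<delta> \<rho> \<phi> \<Phi>])
    show "(\<Phi> has_vector_derivative matrix (frechet_derivative f (at x0))) (at 0)"
      using \<Phi>d[of 0] \<delta> by (simp add: \<Phi>0 \<phi>0 \<rho> J_def)
    fix t :: real assume t: "\<bar>t\<bar> < \<delta>"
    \<comment> \<open>The factor 2 comes from the Gronwall estimate, the 4 is the square of the
      constant 2 in \<open>lip\<close>.\<close>
    define C where "C = 2 * (\<bar>t\<bar> * (4 * (L2 * K)))"
    have C: "C \<ge> 0" using L2 K by (simp add: C_def)
    have quad: "norm (\<phi> x t - \<phi> x0 t - \<Phi> t *v (x - x0)) \<le> C * norm (x - x0) ^ 2" if x: "x \<in> ball x0 \<rho>" for x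
    proof -
      define w where "w t = \<phi> x t - \<phi> x0 t - \<Phi> t *v (x - x0)" for t
      define w' where "w' t = f (\<phi> x t) - f (\<phi> x0 t) - (J (\<phi> x0 t) ** \<Phi> t) *v (x - x0)" for t
      have "norm (w t) \<le> 2 * (norm (w 0) + \<bar>t\<bar> * (4 * (L2 * K) * norm (x - x0) ^ 2))"
      proof (rule small_time_gronwall[of _ L1])
        fix s assume "s \<in> {-\<bar>t\<bar>..\<bar>t\<bar>}"
        then have s: "\<bar>s\<bar> < \<delta>" using t by auto
        have "((\<lambda>t. \<Phi> t *v (x - x0)) has_vector_derivative (J (\<phi> x0 s) ** \<Phi> s) *v (x - x0)) (at s)"
          by (rule bounded_linear.has_vector_derivative[OF
              bounded_bilinear.bounded_linear_left[OF bounded_bilinear_matrix_vector_mult] \<Phi>d[OF s]])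
        then show "(w has_vector_derivative w' s) (at s within {-\<bar>t\<bar>..\<bar>t\<bar>})"
          unfolding w_def w'_def
          by (rule has_vector_derivative_at_within[OF has_vector_derivative_diff[OF
                has_vector_derivative_diff[OF \<phi>d[OF x s] \<phi>d[OF \<rho>(2) s]]]])
        let ?a = "\<phi> x0 s" and ?b = "\<phi> x s"
        have aR: "?a \<in> cball x0 R" and bR: "?b \<in> cball x0 R" using \<phi>R x \<rho> s by blast+
        \<comment> \<open>So w solves the variational equation up to a Taylor remainder quadratic in
          \<open>norm (x - x0)\<close>, and starts at 0; Gronwall makes w itself quadratic.\<close>
        have "w' s = (f ?b - f ?a - J ?a *v (?b - ?a)) + J ?a *v w s"
          by (simp add: w'_def w_def matrix_vector_mult_diff_distrib matrix_vector_mul_assoc)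
        then have "norm (w' s) \<le> norm (f ?b - f ?a - J ?a *v (?b - ?a)) + norm (J ?a *v w s)"
          using norm_triangle_ineq by metis
        also have "norm (J ?a *v w s) \<le> L1 * norm (w s)"
          using L1(3)[OF aR] J RU aR by (metis subsetD)
        also have "norm (f ?b - f ?a - J ?a *v (?b - ?a)) \<le> L2 * K * norm (?b - ?a) ^ 2"
          by (rule taylor[OF aR bR])
        also have "\<dots> \<le> L2 * K * (2 * norm (x - x0)) ^ 2"
          using lip[OF x s] L2 K by (intro mult_left_mono power_mono) auto
        finally show "norm (w' s) \<le> L1 * norm (w s) + 4 * (L2 * K) * norm (x - x0) ^ 2"
          by (simp add: power2_eq_square mult_ac)
      qed (use \<delta>L[of "\<bar>t\<bar>"] t L1 L2 K in auto)
      moreover have "w 0 = 0" by (simp add: w_def \<phi>0[OF x] \<phi>0[OF \<rho>(2)] \<Phi>0)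
      ultimately show ?thesis by (simp add: w_def C_def mult_ac)
    qed
    show "((\<lambda>x. \<phi> x t) has_derivative (\<lambda>h. \<Phi> t *v h)) (at x0)"
      unfolding has_derivative_at_alt
    proof (intro conjI allI impI)
      show "bounded_linear (\<lambda>h. \<Phi> t *v h)" by simp
      fix e :: real assume e: "e > 0"
      show "\<exists>d>0. \<forall>y. norm (y - x0) < d \<longrightarrow>
          norm (\<phi> y t - \<phi> x0 t - \<Phi> t *v (y - x0)) \<le> e * norm (y - x0)"
      proof (intro exI[of _ "min \<rho> (e / (C + 1))"] conjI allI impI)
        show "0 < min \<rho> (e / (C + 1))" using \<rho> e C by simp
        fix y assume y: "norm (y - x0) < min \<rho> (e / (C + 1))"
        then have "y \<in> ball x0 \<rho>" by (simp add: dist_norm norm_minus_commute)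
        then have "norm (\<phi> y t - \<phi> x0 t - \<Phi> t *v (y - x0)) \<le> C * norm (y - x0) * norm (y - x0)"
          using quad by (simp add: power2_eq_square mult_ac)
        also have "\<dots> \<le> e * norm (y - x0)"
        proof (rule mult_right_mono)
          have "C * norm (y - x0) \<le> (C + 1) * (e / (C + 1))"
            using y C by (intro mult_mono) auto
          then show "C * norm (y - x0) \<le> e" using C by simp
        qed simp
        finally show "norm (\<phi> y t - \<phi> x0 t - \<Phi> t *v (y - x0)) \<le> e * norm (y - x0)" .
      qed
    qed
  qed (use \<delta> \<rho> \<phi>0 \<phi>R RU \<phi>d \<Phi>0 in auto)
qed

section \<open>Matrices and tensor components\<close>

lemma matrix_inv_works:
  fixes A :: "real^'n^'n"
  assumes "invertible A"
  shows "A ** matrix_inv A = mat 1" "matrix_inv A ** A = mat 1"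
proof -
  have "A ** matrix_inv A = mat 1 \<and> matrix_inv A ** A = mat 1"
    unfolding matrix_inv_def by (rule someI_ex) (use assms in \<open>simp add: invertible_def\<close>)
  then show "A ** matrix_inv A = mat 1" "matrix_inv A ** A = mat 1" by auto
qed

lemma matrix_inv_unique:
  fixes A :: "real^'n^'n"
  assumes "A ** B = mat 1" "B ** A = mat 1"
  shows "matrix_inv A = B" "invertible A"
proof -
  show inv: "invertible A" using assms by (auto simp: invertible_def)
  show "matrix_inv A = B"
    by (metis assms(1) inv matrix_inv_works(2) matrix_mul_assoc matrix_mul_lid matrix_mul_rid)
qed

lemma matrix_inv_mult:
  fixes A B :: "real^'n^'n"
  assumes "invertible A" "invertible B"
  shows "matrix_inv (A ** B) = matrix_inv B ** matrix_inv A"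
proof (rule matrix_inv_unique)
  show "A ** B ** (matrix_inv B ** matrix_inv A) = mat 1"
    by (metis assms matrix_inv_works(1) matrix_mul_assoc matrix_mul_rid)
  show "matrix_inv B ** matrix_inv A ** (A ** B) = mat 1"
    by (metis assms matrix_inv_works(2) matrix_mul_assoc matrix_mul_rid)
qed

lemma matrix_inv_inv:
  fixes A :: "real^'n^'n"
  assumes "invertible A"
  shows "matrix_inv (matrix_inv A) = A" "invertible (matrix_inv A)"
  using matrix_inv_unique[of "matrix_inv A" A] matrix_inv_works[OF assms] by auto

lemma matrix_inv_mat_1 [simp]: "matrix_inv (mat 1 :: real^'n^'n) = mat 1"
  by (rule matrix_inv_unique) simp_all

lemma invertible_mat_1 [simp]: "invertible (mat 1 :: real^'n^'n)"
  by (rule matrix_inv_unique(2)[of _ "mat 1"]) simp_all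

lemma det_matrix_inv:
  fixes A :: "real^'n^'n"
  assumes "invertible A"
  shows "1 / det (matrix_inv A) = det A"
proof -
  have "det A * det (matrix_inv A) = 1"
    using matrix_inv_works(1)[OF assms] by (metis det_I det_mul)
  then show ?thesis by (metis nonzero_eq_divide_eq mult_zero_right zero_neq_one)
qed

lemma smooth_on_det:
  fixes f :: "'e::euclidean_space \<Rightarrow> real^'n^'n"
  assumes "open U" "smooth_on U f"
  shows "smooth_on U (\<lambda>x. det (f x))"
  unfolding det_def
  by (intro smooth_on_sum smooth_on_mult smooth_on_prod smooth_on_const smooth_on_vec_nth assms)

text \<open>Cramer's rule for the columns of the inverse. It exhibits the entries as quotients of
  polynomials, from which differentiability of inversion follows.\<close>

lemma matrix_inv_component:
  fixes A :: "real^'n^'n"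
  assumes "det A \<noteq> 0"
  shows "matrix_inv A $ k $ j = det (\<chi> i l. if l = k then axis j 1 $ i else A $ i $ l) / det A"
proof -
  have "A *v (matrix_inv A *v axis j 1) = axis j 1"
    using matrix_inv_works(1)[of A] assms by (simp add: matrix_vector_mul_assoc invertible_det_nz)
  then have "matrix_inv A *v axis j 1 = (\<chi> k. det (\<chi> i l. if l = k then axis j 1 $ i else A $ i $ l) / det A)"
    using cramer[OF assms] by blast
  then have "(matrix_inv A *v axis j 1) $ k = det (\<chi> i l. if l = k then axis j 1 $ i else A $ i $ l) / det A"
    by simp
  then show ?thesis by (simp add: matrix_vector_mult_basis column_def)
qed

lemma open_det_nonzero: "open {A :: real^'n^'n. det A \<noteq> 0}"
proof -
  have "continuous_on UNIV (\<lambda>A :: real^'n^'n. det A)"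
    by (rule smooth_on_continuous_on[OF smooth_on_det[OF open_UNIV smooth_on_id[OF open_UNIV]]])
  then have "open ((\<lambda>A :: real^'n^'n. det A) -` (- {0}))"
    by (rule open_vimage[OF open_Compl[OF closed_singleton]])
  then show ?thesis by (simp add: vimage_def)
qed

lemma matrix_inv_component_differentiable:
  fixes A :: "real^'n^'n"
  assumes "invertible A"
  shows "(\<lambda>A. matrix_inv A $ k $ j) differentiable (at A)"
proof -
  have nz: "det A \<noteq> 0" using assms by (simp add: invertible_det_nz)
  have 1: "smooth_on UNIV (\<lambda>A::real^'n^'n. det (\<chi> i l. if l = k then axis j 1 $ i else A $ i $ l))"
  proof (intro smooth_on_det smooth_on_vec_lambda open_UNIV)
    show "smooth_on UNIV (\<lambda>A::real^'n^'n. if l = k then axis j 1 $ i else A $ i $ l)" for i l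
      by (cases "l = k") (auto intro!: smooth_on_vec_nth smooth_on_id)
  qed
  have 2: "smooth_on UNIV (\<lambda>A::real^'n^'n. det A)"
    by (intro smooth_on_det smooth_on_id open_UNIV)
  have "(\<lambda>A. det (\<chi> i l. if l = k then axis j 1 $ i else A $ i $ l) / det A) differentiable (at A)"
    by (intro differentiable_divide smooth_on_differentiable[OF 1] smooth_on_differentiable[OF 2] nz UNIV_I)
  then show ?thesis
    by (rule iffD2[OF differentiable_cong_open[OF open_det_nonzero], rotated 2])
       (use nz in \<open>auto simp: matrix_inv_component\<close>)
qed

lemma differentiable_vec_componentwise:
  fixes f :: "'e::real_normed_vector \<Rightarrow> real^'n^'m"
  assumes "\<And>i j. (\<lambda>x. f x $ i $ j) differentiable (at x)"
  shows "f differentiable (at x)"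
  by (rule iffD2[OF differentiable_componentwise_within])
     (use assms in \<open>auto simp: Basis_vec_def inner_axis\<close>)

lemma matrix_inv_differentiable:
  fixes A :: "real^'n^'n"
  assumes "invertible A"
  shows "matrix_inv differentiable (at A)"
  by (intro differentiable_vec_componentwise matrix_inv_component_differentiable assms)

section \<open>Entries of tensor powers of matrices and of tensor maps\<close>

definition wprod :: "nat \<Rightarrow> real^'n^'m \<Rightarrow> 'm list \<Rightarrow> 'n list \<Rightarrow> real" where
  "wprod r F I K = (\<Prod>a<r. F $ (I ! a) $ (K ! a))"

lemma finite_lists_len [simp]: "finite {K :: 'n::finite list. length K = r}"
  using finite_lists_length_eq[of "UNIV :: 'n set" r] by simp

lemma wprod_Suc: "wprod (Suc r) F (i # I) (k # K) = F $ i $ k * wprod r F I K"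
  unfolding wprod_def by (subst prod.lessThan_Suc_shift) simp

lemma sum_lists_Suc:
  fixes f :: "'n::finite list \<Rightarrow> real"
  shows "(\<Sum>K | length K = Suc r. f K) = (\<Sum>k\<in>UNIV. \<Sum>K | length K = r. f (k # K))"
proof -
  have "{K :: 'n list. length K = Suc r} = (\<lambda>(k, K). k # K) ` (UNIV \<times> {K. length K = r})"
    by (auto simp: length_Suc_conv image_iff)
  moreover have "inj_on (\<lambda>(k, K). k # K) (UNIV \<times> {K :: 'n list. length K = r})"
    by (auto simp: inj_on_def)
  ultimately show ?thesis
    by (simp add: sum.reindex sum.cartesian_product case_prod_unfold)
qed

text \<open>Functoriality of the tensor power. Splitting off the first index factors the sum over
  multi-indices into one matrix product and the same sum for r.\<close>

lemma wprod_mult: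
  fixes F :: "real^'n::finite^'m" and G :: "real^'k^'n"
  assumes "length I = r" "length J = r"
  shows "(\<Sum>K | length K = r. wprod r F I K * wprod r G K J) = wprod r (F ** G) I J"
  using assms
proof (induction r arbitrary: I J)
  case 0
  have "{K :: 'n list. length K = 0} = {[]}" by auto
  then show ?case by (simp add: wprod_def)
next
  case (Suc r)
  obtain i I' j J' where IJ: "I = i # I'" "J = j # J'" "length I' = r" "length J' = r"
    using Suc.prems by (metis length_Suc_conv)
  have "(\<Sum>K | length K = Suc r. wprod (Suc r) F I K * wprod (Suc r) G K J) =
      (\<Sum>k\<in>UNIV. \<Sum>K | length K = r. (F $ i $ k * G $ k $ j) * (wprod r F I' K * wprod r G K J'))"
    unfolding sum_lists_Suc IJ wprod_Suc by (simp add: mult_ac)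
  also have "\<dots> = (\<Sum>k\<in>UNIV. F $ i $ k * G $ k $ j) * (\<Sum>K | length K = r. wprod r F I' K * wprod r G K J')"
    by (simp add: sum_product)
  also have "\<dots> = wprod (Suc r) (F ** G) I J"
    unfolding IJ wprod_Suc Suc.IH[OF IJ(3,4)] by (simp add: matrix_matrix_mult_def)
  finally show ?case .
qed

lemma wprod_mat_1:
  assumes "length I = r" "length K = r"
  shows "wprod r (mat 1) I K = (if I = K then 1 else 0)"
  using assms
proof (induction r arbitrary: I K)
  case 0
  then show ?case by (simp add: wprod_def)
next
  case (Suc r)
  obtain i I' k K' where IK: "I = i # I'" "K = k # K'" "length I' = r" "length K' = r"
    using Suc.prems by (metis length_Suc_conv)
  show ?case
    unfolding IK wprod_Suc Suc.IH[OF IK(3,4)] by (simp add: mat_def)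
qed

text \<open>The matrix of \<open>tensor_map\<close> in multi-indices. It vanishes for wrong lengths
  in any of the four slots, so that the adjoint and composition laws hold without length
  conditions.\<close>

definition coef :: "nat \<Rightarrow> nat \<Rightarrow> real^'n^'n \<Rightarrow> real^'n^'n \<Rightarrow>
    'n list \<Rightarrow> 'n list \<Rightarrow> 'n list \<Rightarrow> 'n list \<Rightarrow> real" where
  "coef r s F G I J K L =
    (if length I = r \<and> length J = s \<and> length K = r \<and> length L = s then wprod r F I K * wprod s G L J else 0)"

lemma coef_eq_0: "length I \<noteq> r \<or> length J \<noteq> s \<or> length K \<noteq> r \<or> length L \<noteq> s \<Longrightarrow> coef r s F G I J K L = 0"
  unfolding coef_def by auto

lemma tensor_map_coef:
  "tensor_map r s F G t I J = (\<Sum>K | length K = r. \<Sum>L | length L = s. coef r s F G I J K L * t K L)"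
proof (cases "length I = r \<and> length J = s")
  case True
  then show ?thesis
    unfolding tensor_map_def coef_def wprod_def by (auto intro!: sum.cong)
next
  case False
  then show ?thesis unfolding tensor_map_def coef_def by auto
qed

text \<open>Contravariant factors compose in order; covariant ones act by transposes and therefore
  compose in reverse.\<close>

lemma coef_mult:
  fixes F1 G1 :: "real^'n::finite^'n"
  shows "(\<Sum>K | length K = r. \<Sum>L | length L = s. coef r s F1 G1 I J K L * coef r s F2 G2 K L M N) =
    coef r s (F1 ** F2) (G2 ** G1) I J M N"
proof (cases "length I = r \<and> length J = s \<and> length M = r \<and> length N = s")
  case True
  have "(\<Sum>K | length K = r. \<Sum>L | length L = s. coef r s F1 G1 I J K L * coef r s F2 G2 K L M N) =
    (\<Sum>K | length K = r. \<Sum>L | length L = s.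
      (wprod r F1 I K * wprod r F2 K M) * (wprod s G2 N L * wprod s G1 L J))"
    using True by (intro sum.cong refl) (simp add: coef_def)
  also have "\<dots> = wprod r (F1 ** F2) I M * wprod s (G2 ** G1) N J"
    using True by (simp add: sum_product[symmetric] wprod_mult)
  finally show ?thesis using True by (simp add: coef_def)
next
  case False
  then have "coef r s F1 G1 I J K L * coef r s F2 G2 K L M N = 0" for K L
    by (auto simp: coef_eq_0)
  then show ?thesis using False by (auto simp: coef_eq_0)
qed

text \<open>Duality of the types (r,s) and (s,r): the transpose of the map given by F and G is the
  map given by G and F.\<close>

lemma coef_adjoint: "coef r s F G I J K L = coef s r G F L K J I"
  unfolding coef_def by auto

text \<open>The law for frame changes at p: the first factor acts on the last two slots of the
  second, so F2, in the role of A(p,q), is multiplied on the right and G2, in the role of A(q,p), on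
  the left. Transposing the first factor reduces it to \<open>coef_mult\<close>.\<close>

lemma coef_mult_right:
  fixes F1 G1 :: "real^'n::finite^'n"
  shows "(\<Sum>M | length M = s. \<Sum>N | length N = r. coef r s F1 G1 I J N M * coef s r F2 G2 K L M N) =
    coef s r (F2 ** G1) (F1 ** G2) K L J I"
proof -
  have "(\<Sum>M | length M = s. \<Sum>N | length N = r. coef r s F1 G1 I J N M * coef s r F2 G2 K L M N) =
    (\<Sum>M | length M = s. \<Sum>N | length N = r. coef s r F2 G2 K L M N * coef s r G1 F1 M N J I)"
    by (subst coef_adjoint) (simp add: mult.commute)
  then show ?thesis by (simp add: coef_mult)
qed

lemma coef_mat_1:
  "coef r s (mat 1) (mat 1) I J K L = (if I = K \<and> J = L \<and> length I = r \<and> length J = s then 1 else 0)"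
  unfolding coef_def by (auto simp: wprod_mat_1)

lemma sum_coef_mat_1:
  fixes t :: "'n::finite list \<Rightarrow> 'n list \<Rightarrow> real"
  assumes "length I = r" "length J = s"
  shows "(\<Sum>K | length K = r. \<Sum>L | length L = s. coef r s (mat 1) (mat 1) I J K L * t K L) = t I J"
proof -
  have "(\<Sum>K | length K = r. \<Sum>L | length L = s. coef r s (mat 1) (mat 1) I J K L * t K L) =
      (\<Sum>K | length K = r. if K = I then (\<Sum>L | length L = s. if L = J then t K L else 0) else 0)"
    using assms by (intro sum.cong refl) (auto simp: coef_mat_1 if_distrib[of "\<lambda>x. x * _"] sum.delta' cong: if_cong)
  also have "\<dots> = t I J" using assms by (simp add: sum.delta)
  finally show ?thesis .
qed

lemma tensor_map_comp:
  fixes F1 :: "real^'n::finite^'n"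
  shows "tensor_map r s F1 G1 (tensor_map r s F2 G2 t) = tensor_map r s (F1 ** F2) (G2 ** G1) t"
proof (intro ext)
  fix I J
  let ?R = "{K :: 'n list. length K = r}" and ?S = "{L :: 'n list. length L = s}"
  have "tensor_map r s F1 G1 (tensor_map r s F2 G2 t) I J =
    (\<Sum>K\<in>?R. \<Sum>L\<in>?S. \<Sum>M\<in>?R. \<Sum>N\<in>?S. coef r s F1 G1 I J K L * coef r s F2 G2 K L M N * t M N)"
    by (simp add: tensor_map_coef sum_distrib_left mult.assoc)
  also have "\<dots> = (\<Sum>K\<in>?R. \<Sum>M\<in>?R. \<Sum>L\<in>?S. \<Sum>N\<in>?S. coef r s F1 G1 I J K L * coef r s F2 G2 K L M N * t M N)"
    by (rule sum.cong[OF refl]) (rule sum.swap)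
  also have "\<dots> = (\<Sum>M\<in>?R. \<Sum>K\<in>?R. \<Sum>L\<in>?S. \<Sum>N\<in>?S. coef r s F1 G1 I J K L * coef r s F2 G2 K L M N * t M N)"
    by (rule sum.swap)
  also have "\<dots> = (\<Sum>M\<in>?R. \<Sum>K\<in>?R. \<Sum>N\<in>?S. \<Sum>L\<in>?S. coef r s F1 G1 I J K L * coef r s F2 G2 K L M N * t M N)"
    by (rule sum.cong[OF refl], rule sum.cong[OF refl]) (rule sum.swap)
  also have "\<dots> = (\<Sum>M\<in>?R. \<Sum>N\<in>?S. \<Sum>K\<in>?R. \<Sum>L\<in>?S. coef r s F1 G1 I J K L * coef r s F2 G2 K L M N * t M N)"
    by (rule sum.cong[OF refl]) (rule sum.swap)
  also have "\<dots> = tensor_map r s (F1 ** F2) (G2 ** G1) t I J"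
    by (simp add: tensor_map_coef sum_distrib_right[symmetric] coef_mult)
  finally show "tensor_map r s F1 G1 (tensor_map r s F2 G2 t) I J = tensor_map r s (F1 ** F2) (G2 ** G1) t I J" .
qed

lemma tensor_map_add: "tensor_map r s F G (t + u) = tensor_map r s F G t + tensor_map r s F G u"
  by (intro ext) (simp add: tensor_map_coef algebra_simps sum.distrib)

lemma tensor_map_scaleR: "tensor_map r s F G (a *\<^sub>R t) = a *\<^sub>R tensor_map r s F G t"
  by (intro ext) (simp add: tensor_map_coef sum_distrib_left mult_ac)

lemma tensor_action_add: "tensor_action r s w F (t + u) = tensor_action r s w F t + tensor_action r s w F u"
  by (intro ext) (simp add: tensor_action_def tensor_map_add algebra_simps)

lemma tensor_action_scaleR: "tensor_action r s w F (a *\<^sub>R t) = a *\<^sub>R tensor_action r s w F t"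
  by (intro ext) (simp add: tensor_action_def tensor_map_scaleR mult_ac)

lemma tensor_action_apply:
  "tensor_action r s w F t I J =
    (1 / det F) ^ w * (\<Sum>K | length K = r. \<Sum>L | length L = s. coef r s F (matrix_inv F) I J K L * t K L)"
  by (simp add: tensor_action_def tensor_map_coef)

lemma tensor_action_comp:
  fixes F G :: "real^'n::finite^'n"
  assumes "invertible F" "invertible G"
  shows "tensor_action r s w F (tensor_action r s w G t) = tensor_action r s w (F ** G) t"
  by (intro ext)
     (simp add: tensor_action_def tensor_map_scaleR tensor_map_comp matrix_inv_mult assms det_mul power_mult_distrib power_divide)

lemma tensor_action_zero: "tensor_action r s w F 0 = 0"
  using tensor_action_scaleR[of r s w F 0 0] by simp

lemma tensor_action_eq_0: "length I \<noteq> r \<or> length J \<noteq> s \<Longrightarrow> tensor_action r s w F t I J = 0"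
  by (auto simp: tensor_action_def tensor_map_def)

lemma tensor_action_mat_1:
  assumes "\<And>I J. length I \<noteq> r \<or> length J \<noteq> s \<Longrightarrow> t I J = 0"
  shows "tensor_action r s w (mat 1) t = t"
proof (intro ext)
  fix I J
  show "tensor_action r s w (mat 1) t I J = t I J"
    using assms[of I J] sum_coef_mat_1[of I r J s t] tensor_action_eq_0[of I r J s w "mat 1" t]
    by (cases "length I = r \<and> length J = s") (auto simp: tensor_action_apply)
qed

text \<open>The matrix of \<open>tensor_action\<close> at \<open>matrix_inv M\<close>, with the
  double inverse and the reciprocal determinant already resolved; this form is visibly
  differentiable in M at invertible matrices.\<close>

definition pull_coef :: "nat \<Rightarrow> nat \<Rightarrow> nat \<Rightarrow> real^'n^'n \<Rightarrow>
    'n list \<Rightarrow> 'n list \<Rightarrow> 'n list \<Rightarrow> 'n list \<Rightarrow> real" where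
  "pull_coef r s w M I J K L = det M ^ w * coef r s (matrix_inv M) M I J K L"

lemma tensor_action_matrix_inv:
  fixes M :: "real^'n::finite^'n"
  assumes "invertible M"
  shows "tensor_action r s w (matrix_inv M) t I J =
    (\<Sum>K | length K = r. \<Sum>L | length L = s. pull_coef r s w M I J K L * t K L)"
  by (simp add: tensor_action_apply matrix_inv_inv[OF assms] det_matrix_inv[OF assms] pull_coef_def
      sum_distrib_left mult.assoc)

section \<open>Dependence of the coefficients on the matrices\<close>

lemma differentiable_prod:
  fixes f :: "'i \<Rightarrow> 'e::real_normed_vector \<Rightarrow> real"
  shows "(\<And>i. i \<in> I \<Longrightarrow> f i differentiable (at x)) \<Longrightarrow> (\<lambda>x. \<Prod>i\<in>I. f i x) differentiable (at x)"
  by (induction I rule: infinite_finite_induct) auto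

lemma wprod_differentiable:
  assumes "F differentiable (at x)"
  shows "(\<lambda>x. wprod r (F x :: real^'n^'m) I K) differentiable (at x)"
  unfolding wprod_def
proof (rule differentiable_prod)
  fix a
  have "bounded_linear (\<lambda>A :: real^'n^'m. A $ (I ! a) $ (K ! a))"
    by (intro bounded_linear_compose[OF bounded_linear_vec_nth bounded_linear_vec_nth])
  then show "(\<lambda>x. F x $ (I ! a) $ (K ! a)) differentiable (at x)"
    using assms bounded_linear.has_derivative unfolding differentiable_def by blast
qed

lemma coef_differentiable:
  assumes "F differentiable (at x)" "G differentiable (at x)"
  shows "(\<lambda>x. coef r s (F x) (G x) I J K L) differentiable (at x)"
  unfolding coef_def using assms
  by (cases "length I = r \<and> length J = s \<and> length K = r \<and> length L = s")
     (auto intro!: differentiable_mult wprod_differentiable)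

lemma smooth_on_coef:
  fixes F G :: "'e::euclidean_space \<Rightarrow> real^'n^'n"
  assumes "open U" "smooth_on U F" "smooth_on U G"
  shows "smooth_on U (\<lambda>x. coef r s (F x) (G x) I J K L)"
  unfolding coef_def wprod_def using assms
  by (cases "length I = r \<and> length J = s \<and> length K = r \<and> length L = s")
     (auto intro!: smooth_on_mult smooth_on_prod smooth_on_vec_nth)

lemma pull_coef_differentiable:
  fixes M :: "real^'n::finite^'n"
  assumes "invertible M"
  shows "(\<lambda>M. pull_coef r s w M I J K L) differentiable (at M)"
proof -
  have "smooth_on UNIV (\<lambda>A::real^'n^'n. det A)"
    by (intro smooth_on_det smooth_on_id open_UNIV)
  then have "det differentiable (at M)"
    by (simp add: smooth_on_differentiable)
  then show ?thesis
    unfolding pull_coef_def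
    by (intro differentiable_mult differentiable_power coef_differentiable differentiable_ident
        matrix_inv_differentiable[OF assms])
qed

section \<open>Charts, fibres and sections\<close>

abbreviation img :: "('a, 'n::finite) chart \<Rightarrow> (real^'n) set" where
  "img c \<equiv> snd c ` fst c"

lemma supp_closed: "closed (supp f)"
  by (simp add: supp_def)

lemma not_in_supp: "p \<notin> supp f \<Longrightarrow> f p = 0"
  unfolding supp_def using closure_subset[of "{p. f p \<noteq> 0}"] by blast

lemma supp_subsetI: "closed K \<Longrightarrow> (\<And>p. p \<notin> K \<Longrightarrow> f p = 0) \<Longrightarrow> supp f \<subseteq> K"
  unfolding supp_def by (rule closure_minimal) auto

locale manifold =
  fixes \<A> :: "('a::t2_space, 'n::finite) chart set"
  assumes atlas: "oriented_smooth_atlas \<A>"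
begin

lemma is_chart: "c \<in> \<A> \<Longrightarrow> is_chart c"
  using atlas by (simp add: oriented_smooth_atlas_def)

lemma open_chart: "c \<in> \<A> \<Longrightarrow> open (fst c)" "c \<in> \<A> \<Longrightarrow> open (img c)"
  using is_chart[of c] by (auto simp: is_chart_def)

lemma continuous_on_chart: "c \<in> \<A> \<Longrightarrow> continuous_on (fst c) (snd c)"
  and continuous_on_chart_inv: "c \<in> \<A> \<Longrightarrow> continuous_on (img c) (chart_inv c)"
  using is_chart[of c] by (auto simp: is_chart_def homeomorphism_def)

lemma chart_inv_left: "c \<in> \<A> \<Longrightarrow> p \<in> fst c \<Longrightarrow> chart_inv c (snd c p) = p"
  using is_chart[of c] by (auto simp: is_chart_def homeomorphism_def)

lemma chart_inv_right: "x \<in> img c \<Longrightarrow> snd c (chart_inv c x) = x"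
  and chart_inv_in: "x \<in> img c \<Longrightarrow> chart_inv c x \<in> fst c"
  by (simp_all add: chart_inv_def f_inv_into_f inv_into_into)

lemma charts_at_iff: "c \<in> charts_at \<A> p \<longleftrightarrow> c \<in> \<A> \<and> p \<in> fst c"
  by (simp add: charts_at_def)

lemma chart_at: "chart_at \<A> p \<in> charts_at \<A> p"
proof -
  have "(\<Union>c\<in>\<A>. fst c) = UNIV"
    using atlas by (simp add: oriented_smooth_atlas_def)
  then have "\<exists>c. c \<in> charts_at \<A> p"
    unfolding charts_at_def by blast
  then show ?thesis unfolding chart_at_def by (rule someI_ex)
qed

lemma chart_inv_charts_at: "c \<in> \<A> \<Longrightarrow> x \<in> img c \<Longrightarrow> c \<in> charts_at \<A> (chart_inv c x)"
  by (simp add: charts_at_iff chart_inv_in)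

lemma open_chart_image:
  assumes "c \<in> \<A>" "open N" "N \<subseteq> fst c"
  shows "open (snd c ` N)"
proof -
  have "open (chart_inv c -` N \<inter> img c)"
    using continuous_on_chart_inv[OF assms(1)] assms(2) open_chart(2)[OF assms(1)]
    by (simp add: continuous_on_open_vimage)
  moreover have "chart_inv c -` N \<inter> img c = snd c ` N"
  proof (intro equalityI subsetI)
    fix x assume "x \<in> chart_inv c -` N \<inter> img c"
    then have "x = snd c (chart_inv c x)" "chart_inv c x \<in> N" by (auto simp: chart_inv_right)
    then show "x \<in> snd c ` N" by blast
  next
    fix x assume "x \<in> snd c ` N"
    then show "x \<in> chart_inv c -` N \<inter> img c"
      using assms by (auto simp: chart_inv_left subset_iff)
  qed
  ultimately show ?thesis by simp
qed

lemma chart_preimage: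
  assumes "c \<in> \<A>" "open W"
  shows "open {p \<in> fst c. snd c p \<in> W}"
proof -
  have "open (snd c -` W \<inter> fst c)"
    using continuous_on_chart[OF assms(1)] assms(2) open_chart(1)[OF assms(1)]
    by (simp add: continuous_on_open_vimage)
  moreover have "snd c -` W \<inter> fst c = {p \<in> fst c. snd c p \<in> W}" by auto
  ultimately show ?thesis by simp
qed

lemma open_overlap: "c \<in> \<A> \<Longrightarrow> d \<in> \<A> \<Longrightarrow> open (snd c ` (fst c \<inter> fst d))"
  by (intro open_chart_image) (auto simp: open_chart)

lemma overlap_iff:
  assumes "c \<in> \<A>"
  shows "x \<in> snd c ` (fst c \<inter> fst d) \<longleftrightarrow> x \<in> img c \<and> chart_inv c x \<in> fst d"
proof
  assume "x \<in> snd c ` (fst c \<inter> fst d)"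
  then show "x \<in> img c \<and> chart_inv c x \<in> fst d" using assms by (auto simp: chart_inv_left)
next
  assume "x \<in> img c \<and> chart_inv c x \<in> fst d"
  then show "x \<in> snd c ` (fst c \<inter> fst d)"
    by (metis IntI chart_inv_in chart_inv_right image_eqI)
qed

lemma smooth_transition:
  assumes "c \<in> \<A>" "d \<in> \<A>"
  shows "smooth_on (snd c ` (fst c \<inter> fst d)) (\<lambda>x. snd d (chart_inv c x))"
  using atlas assms unfolding oriented_smooth_atlas_def comp_def by blast

lemma tangent_matrix_id: "jac c d p = matrix (frechet_derivative (\<lambda>x. snd d (chart_inv c x)) (at (snd c p)))"
  by (simp add: tangent_matrix_def comp_def)

lemma jac_has_derivative:
  assumes "c \<in> charts_at \<A> p" "d \<in> charts_at \<A> p"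
  shows "((\<lambda>x. snd d (chart_inv c x)) has_derivative (\<lambda>h. jac c d p *v h)) (at (snd c p))"
proof -
  have cd: "c \<in> \<A>" "d \<in> \<A>" "p \<in> fst c" "p \<in> fst d" using assms by (auto simp: charts_at_iff)
  have "(\<lambda>x. snd d (chart_inv c x)) differentiable (at (snd c p))"
    by (rule smooth_on_differentiable[OF smooth_transition[OF cd(1,2)]]) (use cd in auto)
  note matrix_frechet_works[OF this] this[unfolded frechet_derivative_works]
  then show ?thesis by (simp add: tangent_matrix_id)
qed

text \<open>The chain rule through the intermediate charts c and e. The neighbourhood N is what
  makes the coordinate expressions agree near p; with f the identity this yields the cocycle law,
  with f a flow map its tangent matrices in arbitrary charts.\<close>

lemma tangent_change:
  assumes c: "c \<in> charts_at \<A> p" and c': "c' \<in> charts_at \<A> p" and e: "e \<in> \<A>"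
    and d: "d \<in> charts_at \<A> (f p)"
    and M: "((\<lambda>x. snd e (f (chart_inv c x))) has_derivative (\<lambda>h. M *v h)) (at (snd c p))"
    and N: "open N" "p \<in> N" "N \<subseteq> fst c" "\<And>q. q \<in> N \<Longrightarrow> f q \<in> fst e"
  shows "tangent_matrix f c' d p = jac e d (f p) ** M ** jac c' c p"
proof -
  have e': "e \<in> charts_at \<A> (f p)" using e N by (simp add: charts_at_iff)
  have cA: "c \<in> \<A>" "p \<in> fst c" "c' \<in> \<A>" "p \<in> fst c'" using c c' by (auto simp: charts_at_iff)
  have 1: "((\<lambda>x. snd c (chart_inv c' x)) has_derivative (\<lambda>h. jac c' c p *v h)) (at (snd c' p))"
    by (rule jac_has_derivative[OF c' c])
  have M': "((\<lambda>x. snd e (f (chart_inv c x))) has_derivative (\<lambda>h. M *v h)) (at (snd c (chart_inv c' (snd c' p))))"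
    using M cA by (simp add: chart_inv_left)
  have 2: "((\<lambda>x. snd e (f (chart_inv c (snd c (chart_inv c' x))))) has_derivative
      (\<lambda>h. M *v (jac c' c p *v h))) (at (snd c' p))"
    by (rule has_derivative_compose[OF 1 M'])
  have 3: "((\<lambda>x. snd d (chart_inv e x)) has_derivative (\<lambda>h. jac e d (f p) *v h))
      (at (snd e (f (chart_inv c (snd c (chart_inv c' (snd c' p)))))))"
    using jac_has_derivative[OF e' d] cA by (simp add: chart_inv_left)
  have 4: "((\<lambda>x. snd d (chart_inv e (snd e (f (chart_inv c (snd c (chart_inv c' x))))))) has_derivative
      (\<lambda>h. jac e d (f p) *v (M *v (jac c' c p *v h)))) (at (snd c' p))"
    by (rule has_derivative_compose[OF 2 3])
  have "((\<lambda>x. snd d (f (chart_inv c' x))) has_derivative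
      (\<lambda>h. jac e d (f p) *v (M *v (jac c' c p *v h)))) (at (snd c' p))"
  proof (rule has_derivative_transform_within_open[OF 4])
    show "open (snd c' ` (N \<inter> fst c'))"
      using N cA by (intro open_chart_image) (auto simp: open_chart)
    fix x assume "x \<in> snd c' ` (N \<inter> fst c')"
    then obtain q where q: "q \<in> N" "q \<in> fst c'" "x = snd c' q" by auto
    then have "q \<in> fst c" "f q \<in> fst e" using N by auto
    then show "snd d (chart_inv e (snd e (f (chart_inv c (snd c (chart_inv c' x)))))) = snd d (f (chart_inv c' x))"
      using q cA e by (simp add: chart_inv_left)
  qed (use N cA in auto)
  then have "((\<lambda>x. snd d (f (chart_inv c' x))) has_derivative
      (\<lambda>h. (jac e d (f p) ** M ** jac c' c p) *v h)) (at (snd c' p))"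
    by (simp add: matrix_vector_mul_assoc matrix_mul_assoc)
  then show ?thesis
    unfolding tangent_matrix_def comp_def by (rule frechet_derivative_matrix)
qed

lemma jac_self [simp]:
  assumes "c \<in> charts_at \<A> p" shows "jac c c p = mat 1"
proof -
  have c: "c \<in> \<A>" "p \<in> fst c" using assms by (auto simp: charts_at_iff)
  have "((\<lambda>x. snd c (chart_inv c x)) has_derivative (\<lambda>h. h)) (at (snd c p))"
  proof (rule has_derivative_transform_within_open[OF has_derivative_ident open_chart(2)[OF c(1)]])
    show "snd c p \<in> img c" using c by simp
  qed (simp add: chart_inv_right)
  then have "((\<lambda>x. snd c (chart_inv c x)) has_derivative (\<lambda>h. mat 1 *v h)) (at (snd c p))"
    by simp
  then show ?thesis unfolding tangent_matrix_id by (rule frechet_derivative_matrix)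
qed

lemma jac_cocycle:
  assumes "c \<in> charts_at \<A> p" "d \<in> charts_at \<A> p" "e \<in> charts_at \<A> p"
  shows "jac d e p ** jac c d p = jac c e p"
proof -
  have c: "c \<in> \<A>" "p \<in> fst c" "d \<in> \<A>" "p \<in> fst d" using assms by (auto simp: charts_at_iff)
  have "jac c e p = jac d e p ** jac c d p ** jac c c p"
    by (rule tangent_change[where N = "fst c \<inter> fst d" and f = "\<lambda>q. q"])
       (use assms c jac_has_derivative[OF assms(1,2)] in \<open>auto simp: open_chart\<close>)
  then show ?thesis using assms by simp
qed

lemma jac_inverse:
  assumes "c \<in> charts_at \<A> p" "d \<in> charts_at \<A> p"
  shows "matrix_inv (jac c d p) = jac d c p" "invertible (jac c d p)"
  using matrix_inv_unique[of "jac c d p" "jac d c p"] jac_cocycle assms by simp_all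

lemma smooth_jac:
  assumes "c \<in> \<A>" "d \<in> \<A>"
  shows "smooth_on (snd c ` (fst c \<inter> fst d)) (\<lambda>x. jac c d (chart_inv c x))"
proof -
  have "smooth_on (snd c ` (fst c \<inter> fst d)) (\<lambda>x. matrix (frechet_derivative (\<lambda>x. snd d (chart_inv c x)) (at x)))"
    by (intro smooth_on_matrix_frechet open_overlap smooth_transition assms)
  then show ?thesis
    by (rule iffD1[OF smooth_on_cong[OF open_overlap[OF assms]], rotated])
       (auto simp: tangent_matrix_id overlap_iff[OF assms(1)] chart_inv_right)
qed

lemma smooth_jac':
  assumes "c \<in> \<A>" "d \<in> \<A>"
  shows "smooth_on (snd d ` (fst c \<inter> fst d)) (\<lambda>x. jac c d (chart_inv d x))"
proof -
  have eq: "fst c \<inter> fst d = fst d \<inter> fst c" by auto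
  have in_dom: "snd c (chart_inv d x) \<in> snd c ` (fst c \<inter> fst d)" "chart_inv d x \<in> fst c"
    if "x \<in> snd d ` (fst c \<inter> fst d)" for x
    using that overlap_iff[OF assms(2), of x c] unfolding eq by (auto simp: chart_inv_in)
  have "smooth_on (snd d ` (fst c \<inter> fst d)) (\<lambda>x. jac c d (chart_inv c (snd c (chart_inv d x))))"
    by (rule smooth_on_compose[OF _ open_overlap[OF assms] smooth_jac[OF assms]])
       (use open_overlap[OF assms(2,1)] smooth_transition[OF assms(2,1)] in_dom in \<open>simp_all add: eq[symmetric]\<close>)
  then show ?thesis
    by (rule iffD1[OF smooth_on_cong[OF open_overlap[OF assms(2,1), folded eq]], rotated])
       (simp add: chart_inv_left[OF assms(1)] in_dom)
qed

section \<open>Tensor fibres and spaces of sections\<close>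

lemma fibre_transform:
  "t \<in> tensor_fibre \<A> r s w p \<Longrightarrow> c \<in> charts_at \<A> p \<Longrightarrow> d \<in> charts_at \<A> p \<Longrightarrow>
    t d = tensor_action r s w (jac c d p) (t c)"
  unfolding tensor_fibre_def by blast

lemma fibre_outside: "t \<in> tensor_fibre \<A> r s w p \<Longrightarrow> c \<notin> charts_at \<A> p \<Longrightarrow> t c = 0"
  unfolding tensor_fibre_def by blast

lemma fibre_length:
  assumes "t \<in> tensor_fibre \<A> r s w p" "length I \<noteq> r \<or> length J \<noteq> s"
  shows "t c I J = 0"
proof (cases "c \<in> charts_at \<A> p")
  case True
  show ?thesis
    by (subst fibre_transform[OF assms(1) True True]) (rule tensor_action_eq_0[OF assms(2)])
next
  case False
  then show ?thesis using fibre_outside[OF assms(1)] by simp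
qed

lemma fibre_eqI:
  assumes "t \<in> tensor_fibre \<A> r s w p" "t' \<in> tensor_fibre \<A> r s w p" "c \<in> charts_at \<A> p" "t c = t' c"
  shows "t = t'"
proof
  fix d
  show "t d = t' d"
    using fibre_transform[OF assms(1,3), of d] fibre_transform[OF assms(2,3), of d]
      fibre_outside[OF assms(1)] fibre_outside[OF assms(2)] assms(4)
    by (cases "d \<in> charts_at \<A> p") auto
qed

text \<open>The cocycle identity reduces the transformation law between all pairs of charts to the
  law starting from one chart c.\<close>

lemma fibreI:
  assumes c: "c \<in> charts_at \<A> p"
    and len: "\<And>I J. length I \<noteq> r \<or> length J \<noteq> s \<Longrightarrow> t c I J = 0"
    and tr: "\<And>d. d \<in> charts_at \<A> p \<Longrightarrow> t d = tensor_action r s w (jac c d p) (t c)"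
    and out: "\<And>d. d \<notin> charts_at \<A> p \<Longrightarrow> t d = 0"
  shows "t \<in> tensor_fibre \<A> r s w p"
  unfolding tensor_fibre_def
proof (intro CollectI conjI ballI allI impI)
  fix d e assume d: "d \<in> charts_at \<A> p" and e: "e \<in> charts_at \<A> p"
  have "tensor_action r s w (jac d e p) (t d) = tensor_action r s w (jac d e p ** jac c d p) (t c)"
    using jac_inverse c d e by (simp add: tr[OF d] tensor_action_comp)
  then show "t e = tensor_action r s w (jac d e p) (t d)"
    using jac_cocycle[OF c d e] tr[OF e] by simp
qed (rule out)

lemma zero_fibre: "0 \<in> tensor_fibre \<A> r s w p"
  unfolding tensor_fibre_def by (auto simp: tensor_action_zero)

lemma fibre_add:
  assumes "t \<in> tensor_fibre \<A> r s w p" "u \<in> tensor_fibre \<A> r s w p"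
  shows "t + u \<in> tensor_fibre \<A> r s w p"
proof (rule fibreI[OF chart_at])
  fix d assume d: "d \<in> charts_at \<A> p"
  show "(t + u) d = tensor_action r s w (jac (chart_at \<A> p) d p) ((t + u) (chart_at \<A> p))"
    unfolding plus_fun_apply[of t u d] plus_fun_apply[of t u "chart_at \<A> p"] fibre_transform[OF assms(1) chart_at d] fibre_transform[OF assms(2) chart_at d]
    by (rule tensor_action_add[symmetric])
qed (simp_all add: fibre_length[OF assms(1)] fibre_length[OF assms(2)] fibre_outside[OF assms(1)] fibre_outside[OF assms(2)])

lemma fibre_scaleR:
  assumes "t \<in> tensor_fibre \<A> r s w p"
  shows "a *\<^sub>R t \<in> tensor_fibre \<A> r s w p"
proof (rule fibreI[OF chart_at])
  fix d assume d: "d \<in> charts_at \<A> p"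
  show "(a *\<^sub>R t) d = tensor_action r s w (jac (chart_at \<A> p) d p) ((a *\<^sub>R t) (chart_at \<A> p))"
    unfolding scaleR_fun_apply[of a t d] scaleR_fun_apply[of a t "chart_at \<A> p"] fibre_transform[OF assms chart_at d]
    by (rule tensor_action_scaleR[symmetric])
qed (simp_all add: fibre_length[OF assms] fibre_outside[OF assms] fun_eq_iff)

lemma section_fibre: "t \<in> tensor_sections \<A> r s w \<Longrightarrow> t p \<in> tensor_fibre \<A> r s w p"
  unfolding tensor_sections_def by blast

lemma section_smooth:
  "t \<in> tensor_sections \<A> r s w \<Longrightarrow> c \<in> \<A> \<Longrightarrow> smooth_on (img c) (\<lambda>x. t (chart_inv c x) c I J)"
  unfolding tensor_sections_def by blast

lemma sections_add: "t \<in> tensor_sections \<A> r s w \<Longrightarrow> u \<in> tensor_sections \<A> r s w \<Longrightarrow> t + u \<in> tensor_sections \<A> r s w"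
  unfolding tensor_sections_def by (auto intro!: fibre_add smooth_on_add open_chart)

lemma sections_scaleR: "t \<in> tensor_sections \<A> r s w \<Longrightarrow> a *\<^sub>R t \<in> tensor_sections \<A> r s w"
  unfolding tensor_sections_def
  by (auto intro!: fibre_scaleR smooth_on_mult smooth_on_const open_chart)

lemma sections_zero: "0 \<in> tensor_sections \<A> r s w"
  unfolding tensor_sections_def by (auto intro!: zero_fibre simp: open_chart)

lemma sections_in_iff:
  assumes "closed K"
  shows "t \<in> tensor_sections_in \<A> r s w K \<longleftrightarrow> t \<in> tensor_sections \<A> r s w \<and> (\<forall>p. p \<notin> K \<longrightarrow> t p = 0)"
  unfolding tensor_sections_in_def using supp_subsetI[OF assms, of t] not_in_supp[of _ t] by blast

lemma sections_in_mono: "K \<subseteq> K' \<Longrightarrow> tensor_sections_in \<A> r s w K \<subseteq> tensor_sections_in \<A> r s w K'"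
  unfolding tensor_sections_in_def by auto

lemma sections_in_add:
  assumes "compact K" "t \<in> tensor_sections_in \<A> r s w K" "u \<in> tensor_sections_in \<A> r s w K"
  shows "t + u \<in> tensor_sections_in \<A> r s w K"
  using assms by (auto simp: sections_in_iff[OF compact_imp_closed[OF assms(1)]] sections_add)

lemma sections_in_scaleR:
  assumes "compact K" "t \<in> tensor_sections_in \<A> r s w K"
  shows "a *\<^sub>R t \<in> tensor_sections_in \<A> r s w K"
  using assms by (auto simp: sections_in_iff[OF compact_imp_closed[OF assms(1)]] sections_scaleR fun_eq_iff)

lemma csections_iff: "t \<in> tensor_csections \<A> r s w \<longleftrightarrow> (\<exists>K. compact K \<and> t \<in> tensor_sections_in \<A> r s w K)"
proof
  assume "t \<in> tensor_csections \<A> r s w"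
  then show "\<exists>K. compact K \<and> t \<in> tensor_sections_in \<A> r s w K"
    unfolding tensor_csections_def tensor_sections_in_def by blast
next
  assume "\<exists>K. compact K \<and> t \<in> tensor_sections_in \<A> r s w K"
  then obtain K where K: "compact K" "t \<in> tensor_sections_in \<A> r s w K" by blast
  then have "compact (K \<inter> supp t)" by (intro compact_Int_closed supp_closed)
  moreover have "K \<inter> supp t = supp t" using K(2) unfolding tensor_sections_in_def by auto
  ultimately show "t \<in> tensor_csections \<A> r s w"
    using K(2) unfolding tensor_csections_def tensor_sections_in_def by simp
qed

lemma csections_Union: "tensor_csections \<A> r s w = \<Union> (tensor_sections_in \<A> r s w ` {K. compact K})"
  using csections_iff by auto

lemma csections_add:
  assumes "t \<in> tensor_csections \<A> r s w" "u \<in> tensor_csections \<A> r s w"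
  shows "t + u \<in> tensor_csections \<A> r s w"
proof -
  obtain K K' where K: "compact K" "t \<in> tensor_sections_in \<A> r s w K" 
    "compact K'" "u \<in> tensor_sections_in \<A> r s w K'"
    using assms unfolding csections_iff by blast
  then have "t \<in> tensor_sections_in \<A> r s w (K \<union> K')" "u \<in> tensor_sections_in \<A> r s w (K \<union> K')"
    using sections_in_mono by blast+
  with K show ?thesis
    unfolding csections_iff by (meson compact_Un sections_in_add)
qed

lemma csections_scaleR: "t \<in> tensor_csections \<A> r s w \<Longrightarrow> a *\<^sub>R t \<in> tensor_csections \<A> r s w"
  unfolding csections_iff using sections_in_scaleR by blast

lemma csections_zero: "0 \<in> tensor_csections \<A> r s w"
  unfolding csections_iff using sections_zero
  by (intro exI[of _ "{}"]) (auto simp: sections_in_iff)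

lemma csections_sum:
  "(\<And>i. i \<in> I \<Longrightarrow> t i \<in> tensor_csections \<A> r s w) \<Longrightarrow> (\<Sum>i\<in>I. t i) \<in> tensor_csections \<A> r s w"
  by (induction I rule: infinite_finite_induct) (auto simp: csections_zero csections_add)

lemma csections_sections: "t \<in> tensor_csections \<A> r s w \<Longrightarrow> t \<in> tensor_sections \<A> r s w"
  unfolding tensor_csections_def by blast

text \<open>The definition of \<open>iota\<close> tests with values at p of global tensor fields;
  this shows that such values exhaust the fibre. The field has constant components in one chart, cut
  off by a bump function.\<close>

lemma section_extending:
  assumes t0: "t0 \<in> tensor_fibre \<A> r s 0 p"
  obtains t where "t \<in> tensor_sections \<A> r s 0" "t p = t0"
proof -
  obtain c where c: "c \<in> charts_at \<A> p" using chart_at by blast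
  then have cA: "c \<in> \<A>" "p \<in> fst c" by (auto simp: charts_at_iff)
  obtain \<rho> where \<rho>: "\<rho> > 0" "cball (snd c p) \<rho> \<subseteq> img c"
    using open_chart(2)[OF cA(1)] cA open_contains_cball by blast
  obtain \<beta> where \<beta>: "smooth_on UNIV \<beta>" "\<beta> (snd c p) = 1" "\<And>x. x \<notin> ball (snd c p) \<rho> \<Longrightarrow> \<beta> x = (0::real)"
    using smooth_bump[OF \<rho>(1), of "snd c p"] by metis
  define S where "S = chart_inv c ` cball (snd c p) \<rho>"
  have S: "closed S" "S \<subseteq> fst c"
  proof -
    have "compact S"
      unfolding S_def using continuous_on_subset[OF continuous_on_chart_inv[OF cA(1)] \<rho>(2)]
      by (intro compact_continuous_image) auto
    then show "closed S" by (rule compact_imp_closed)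
    show "S \<subseteq> fst c"
      unfolding S_def by (rule image_subsetI, rule chart_inv_in, rule subsetD[OF \<rho>(2)])
  qed
  define t where "t q d = (if d \<in> charts_at \<A> q \<and> q \<in> fst c
    then \<beta> (snd c q) *\<^sub>R tensor_action r s 0 (jac c d q) (t0 c) else 0)" for q d
  have t_out: "t q = 0" if "q \<notin> S" for q
  proof
    fix d
    show "t q d = 0 d"
    proof (cases "q \<in> fst c")
      case True
      have "snd c q \<notin> ball (snd c p) \<rho>"
      proof
        assume "snd c q \<in> ball (snd c p) \<rho>"
        then have "chart_inv c (snd c q) \<in> S" unfolding S_def by auto
        then show False using that chart_inv_left[OF cA(1) True] by simp
      qed
      then show ?thesis using \<beta>(3) by (auto simp: t_def)
    qed (simp add: t_def)
  qed
  show thesis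
  proof (rule that)
    have len: "tensor_action r s 0 (mat 1) (t0 c) = t0 c"
      by (rule tensor_action_mat_1) (rule fibre_length[OF t0])
    show "t p = t0"
    proof
      fix d
      show "t p d = t0 d"
        using fibre_transform[OF t0 c, of d] fibre_outside[OF t0, of d] cA \<beta>(2)
        by (cases "d \<in> charts_at \<A> p") (auto simp: t_def)
    qed
    show "t \<in> tensor_sections \<A> r s 0"
      unfolding tensor_sections_def
    proof (intro CollectI conjI allI ballI)
      fix q
      show "t q \<in> tensor_fibre \<A> r s 0 q"
      proof (cases "q \<in> fst c")
        case True
        then have cq: "c \<in> charts_at \<A> q" using cA by (simp add: charts_at_iff)
        show ?thesis
        proof (rule fibreI[OF cq])
          fix I J :: "'n list" assume "length I \<noteq> r \<or> length J \<noteq> s"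
          then show "t q c I J = 0" by (simp add: t_def tensor_action_eq_0)
        next
          fix d assume "d \<in> charts_at \<A> q"
          then show "t q d = tensor_action r s 0 (jac c d q) (t q c)"
            using cq True by (simp add: t_def len tensor_action_scaleR)
        qed (simp add: t_def)
      next
        case False
        then have "t q = 0" using t_out S by blast
        then show ?thesis by (simp add: zero_fibre)
      qed
    next
      fix d I J assume d: "d \<in> \<A>"
      show "smooth_on (img d) (\<lambda>x. t (chart_inv d x) d I J)"
      proof (rule smooth_on_local)
        fix x assume x: "x \<in> img d"
        show "\<exists>V. x \<in> V \<and> smooth_on V (\<lambda>x. t (chart_inv d x) d I J)"
        \<comment> \<open>The domain of c and the complement of S cover the manifold, and both are
          open: S is compact, hence closed in a Hausdorff space. Off S the field is zero.\<close>
        proof (cases "chart_inv d x \<in> fst c")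
          case True
          let ?V = "snd d ` (fst c \<inter> fst d)"
          have eq: "fst c \<inter> fst d = fst d \<inter> fst c" by auto
          have op: "open ?V" using open_overlap[OF d cA(1)] by (simp add: eq)
          have V: "x \<in> ?V \<longleftrightarrow> x \<in> img d \<and> chart_inv d x \<in> fst c" for x
            using overlap_iff[OF d, of x c] by (simp add: eq)
          have "smooth_on ?V (\<lambda>x. jac d c (chart_inv d x))"
            using smooth_jac[OF d cA(1)] by (simp add: eq)
          then have "smooth_on ?V (\<lambda>x. \<beta> (snd c (chart_inv d x)) * (\<Sum>K | length K = r. \<Sum>L | length L = s.
              coef r s (jac c d (chart_inv d x)) (jac d c (chart_inv d x)) I J K L * t0 c K L))"
            using smooth_transition[OF d cA(1)]
            by (intro smooth_on_mult smooth_on_sum smooth_on_const smooth_on_coef smooth_jac' op cA d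
                smooth_on_compose[OF op open_UNIV \<beta>(1)]) (simp_all add: eq)
          moreover have "t (chart_inv d x) d I J = \<beta> (snd c (chart_inv d x)) *
              (\<Sum>K | length K = r. \<Sum>L | length L = s.
              coef r s (jac c d (chart_inv d x)) (jac d c (chart_inv d x)) I J K L * t0 c K L)" if "x \<in> ?V" for x
            using that[unfolded V] d cA(1)
            by (simp add: t_def charts_at_iff chart_inv_in tensor_action_apply jac_inverse)
          ultimately have "smooth_on ?V (\<lambda>x. t (chart_inv d x) d I J)"
            by (rule iffD2[OF smooth_on_cong[OF op], rotated])
          then show ?thesis using True x V by blast
        next
          case False
          let ?V = "snd d ` (fst d - S)"
          have op: "open ?V"
            by (intro open_chart_image d) (auto intro: open_Diff open_chart d S)
          have "chart_inv d x \<in> fst d - S" using False S(2) chart_inv_in[OF x] by blast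
          then have V: "x \<in> ?V" using chart_inv_right[OF x] by (metis image_eqI)
          have "t (chart_inv d x) d I J = 0" if xV: "x \<in> ?V" for x
          proof -
            obtain q where "q \<in> fst d - S" "x = snd d q" using xV by blast
            then show ?thesis using t_out[of q] chart_inv_left[OF d, of q] by simp
          qed
          then have "smooth_on ?V (\<lambda>x. t (chart_inv d x) d I J)"
            by (rule iffD2[OF smooth_on_cong[OF op] smooth_on_const[OF op]])
          with V show ?thesis by (intro exI[of _ ?V] conjI)
        qed
      qed
    qed
  qed
qed

end

section \<open>Flows and Lie derivatives in charts\<close>

lemma has_vector_derivative_compose_frechet:
  assumes "(g has_vector_derivative g') (at t)" "f differentiable (at (g t))"
  shows "((\<lambda>t. f (g t)) has_vector_derivative frechet_derivative f (at (g t)) g') (at t)"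
proof -
  have f: "(f has_derivative frechet_derivative f (at (g t))) (at (g t))"
    using assms(2) frechet_derivative_works by blast
  have "((\<lambda>t. f (g t)) has_derivative (\<lambda>h. frechet_derivative f (at (g t)) (h *\<^sub>R g'))) (at t)"
    by (rule has_derivative_compose[OF assms(1)[unfolded has_vector_derivative_def] f])
  then show ?thesis
    unfolding has_vector_derivative_def
    by (simp add: linear_cmul[OF has_derivative_linear[OF f]])
qed

lemma has_vector_derivative_eventually:
  assumes "(f has_vector_derivative D) (at x)" "\<forall>\<^sub>F t in nhds x. f t = g t"
  shows "(g has_vector_derivative D) (at x)"
proof -
  obtain S where "open S" "x \<in> S" "\<And>t. t \<in> S \<Longrightarrow> f t = g t"
    using assms(2) unfolding eventually_nhds by blast
  then show ?thesis by (rule has_vector_derivative_transform_within_open[OF assms(1)])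
qed

lemma has_real_derivative_eventually:
  assumes "(f has_real_derivative D) (at x)" "\<forall>\<^sub>F t in nhds x. f t = g t"
  shows "(g has_real_derivative D) (at x)"
  using has_vector_derivative_eventually[OF _ assms(2)] assms(1)
  by (simp add: has_real_derivative_iff_has_vector_derivative)

lemma smooth_on_frechet_apply:
  assumes "open U" "smooth_on U f" "smooth_on U h"
  shows "smooth_on U (\<lambda>x. frechet_derivative f (at x) (h x))"
proof -
  have "smooth_on U (\<lambda>x. \<Sum>i\<in>Basis. (h x \<bullet> i) *\<^sub>R frechet_derivative f (at x) i)"
    by (intro smooth_on_sum smooth_on_scaleR smooth_on_frechet_derivative assms
        smooth_on_bounded_linear[OF assms(1) bounded_linear_inner_left])
  then show ?thesis
    by (rule iffD1[OF smooth_on_cong[OF assms(1)], rotated])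
       (rule frechet_derivative_Basis_expand[symmetric], rule smooth_on_differentiable[OF assms(2)])
qed

locale manifold_field = manifold \<A> for \<A> :: "('a::t2_space, 'n::finite) chart set" +
  fixes X :: "'a \<Rightarrow> ('a, 'n) tensor"
  assumes X: "X \<in> vector_fields \<A>"
begin

definition vf :: "('a, 'n) chart \<Rightarrow> real^'n \<Rightarrow> real^'n" where
  "vf c x = (\<chi> i. X (chart_inv c x) c [i] [])"

definition dvf :: "('a, 'n) chart \<Rightarrow> real^'n \<Rightarrow> real^'n^'n" where
  "dvf c x = matrix (frechet_derivative (vf c) (at x))"

lemma vf_smooth: "c \<in> \<A> \<Longrightarrow> smooth_on (img c) (vf c)"
  unfolding vf_def by (intro smooth_on_vec_lambda open_chart section_smooth[OF X])

lemma dvf_smooth: "c \<in> \<A> \<Longrightarrow> smooth_on (img c) (dvf c)"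
  unfolding dvf_def by (intro smooth_on_matrix_frechet open_chart vf_smooth)

lemma vf_transform:
  assumes "c \<in> charts_at \<A> p" "d \<in> charts_at \<A> p"
  shows "vf d (snd d p) = jac c d p *v vf c (snd c p)"
proof -
  have "chart_inv c (snd c p) = p" "chart_inv d (snd d p) = p"
    using assms by (auto simp: charts_at_iff chart_inv_left)
  moreover have "X p d [i] [] = (\<Sum>k\<in>UNIV. jac c d p $ i $ k * X p c [k] [])" for i
  proof -
    have "X p d [i] [] = (\<Sum>K | length K = Suc 0. \<Sum>L | length L = 0.
        coef 1 0 (jac c d p) (matrix_inv (jac c d p)) [i] [] K L * X p c K L)"
      by (subst fibre_transform[OF section_fibre[OF X] assms]) (simp add: tensor_action_apply)
    also have "\<dots> = (\<Sum>k\<in>UNIV. jac c d p $ i $ k * X p c [k] [])"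
      unfolding sum_lists_Suc by (simp add: coef_def wprod_def)
    finally show ?thesis .
  qed
  ultimately show ?thesis
    by (simp add: vf_def vec_eq_iff matrix_vector_mult_def)
qed

lemma integral_curve_deriv:
  assumes "integral_curve \<A> X T \<gamma>" "t \<in> T" "c \<in> charts_at \<A> (\<gamma> t)"
  shows "((\<lambda>t. snd c (\<gamma> t)) has_vector_derivative vf c (snd c (\<gamma> t))) (at t)"
proof -
  have "vf c (snd c (\<gamma> t)) = (\<chi> i. X (\<gamma> t) c [i] [])"
    using assms(3) by (simp add: vf_def charts_at_iff chart_inv_left)
  then show ?thesis
    using assms unfolding integral_curve_def comp_def by simp
qed

text \<open>In a chart around the common point both curves solve an equation with Lipschitz
  right-hand side, and the Gronwall estimate with initial difference 0 and no inhomogeneity forces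
  them to coincide.\<close>

lemma integral_curve_unique_local:
  assumes \<gamma>1: "integral_curve \<A> X T1 \<gamma>1" and \<gamma>2: "integral_curve \<A> X T2 \<gamma>2"
    and t0: "t0 \<in> T1" "t0 \<in> T2" "\<gamma>1 t0 = \<gamma>2 t0"
  obtains \<epsilon> where "\<epsilon> > 0" "\<And>t. \<bar>t - t0\<bar> \<le> \<epsilon> \<Longrightarrow> t \<in> T1 \<inter> T2 \<and> \<gamma>1 t = \<gamma>2 t"
proof -
  obtain c where c: "c \<in> charts_at \<A> (\<gamma>1 t0)" using chart_at by blast
  then have cA: "c \<in> \<A>" "\<gamma>1 t0 \<in> fst c" by (auto simp: charts_at_iff)
  define x0 where "x0 = snd c (\<gamma>1 t0)"
  have "x0 \<in> img c" using cA by (simp add: x0_def)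
  then obtain R where R: "R > 0" "cball x0 R \<subseteq> img c"
    using open_chart(2)[OF cA(1)] open_contains_cball by blast
  obtain L where L: "L \<ge> 0" "\<And>x y. x \<in> cball x0 R \<Longrightarrow> y \<in> cball x0 R \<Longrightarrow>
      norm (vf c x - vf c y) \<le> L * norm (x - y)"
    using smooth_on_lipschitz_cball[OF open_chart(2) vf_smooth R(2)] cA by metis
  define N where "N = {p \<in> fst c. snd c p \<in> ball x0 R}"
  have N: "open N" unfolding N_def by (intro chart_preimage cA open_ball)
  have near: "\<exists>\<epsilon>>0. \<forall>t. \<bar>t - t0\<bar> < \<epsilon> \<longrightarrow> t \<in> T \<and> \<gamma> t \<in> N"
    if "integral_curve \<A> X T \<gamma>" "t0 \<in> T" "\<gamma> t0 = \<gamma>1 t0" for T \<gamma>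
  proof -
    have "open T" "continuous_on T \<gamma>" using that(1) by (auto simp: integral_curve_def)
    then have "open (\<gamma> -` N \<inter> T)" using N by (simp add: continuous_on_open_vimage)
    moreover have "t0 \<in> \<gamma> -` N \<inter> T"
      using that cA R by (simp add: N_def x0_def)
    ultimately obtain \<epsilon> where "\<epsilon> > 0" "\<And>t. dist t t0 < \<epsilon> \<Longrightarrow> t \<in> \<gamma> -` N \<inter> T"
      unfolding open_dist by metis
    then show ?thesis
      by (intro exI[of _ \<epsilon>]) (auto simp: dist_real_def)
  qed
  obtain \<epsilon>1 where e1: "\<epsilon>1 > 0" "\<And>t. \<bar>t - t0\<bar> < \<epsilon>1 \<Longrightarrow> t \<in> T1 \<and> \<gamma>1 t \<in> N"
    using near[OF \<gamma>1 t0(1)] by blast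
  obtain \<epsilon>2 where e2: "\<epsilon>2 > 0" "\<And>t. \<bar>t - t0\<bar> < \<epsilon>2 \<Longrightarrow> t \<in> T2 \<and> \<gamma>2 t \<in> N"
    using near[OF \<gamma>2 t0(2)] t0(3) by auto
  \<comment> \<open>The halves keep the closed interval inside the two open ones; the last term
    gives \<open>\<epsilon> * L \<le> 1 / 2\<close> for the Gronwall estimate.\<close>
  define \<epsilon> where "\<epsilon> = min (min (\<epsilon>1 / 2) (\<epsilon>2 / 2)) (1 / (2 * (L + 1)))"
  have \<epsilon>: "\<epsilon> > 0" "\<epsilon> < \<epsilon>1" "\<epsilon> < \<epsilon>2" using e1(1) e2(1) L(1) by (auto simp: \<epsilon>_def)
  have "\<epsilon> * L \<le> 1 / (2 * (L + 1)) * L"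
    using L(1) by (intro mult_right_mono) (auto simp: \<epsilon>_def)
  also have "\<dots> \<le> 1 / 2" using L(1) by (simp add: field_simps)
  finally have eL: "\<epsilon> * L \<le> 1 / 2" .
  show thesis
  proof (rule that[OF \<epsilon>(1)])
    fix t assume t: "\<bar>t - t0\<bar> \<le> \<epsilon>"
    define w where "w s = snd c (\<gamma>1 (t0 + s)) - snd c (\<gamma>2 (t0 + s))" for s
    have d: "((\<lambda>s. snd c (\<gamma> (t0 + s))) has_vector_derivative vf c (snd c (\<gamma> (t0 + s)))) (at s)"
      if "integral_curve \<A> X T \<gamma>" "t0 + s \<in> T" "\<gamma> (t0 + s) \<in> N" for T \<gamma> s
    proof -
      have c': "c \<in> charts_at \<A> (\<gamma> (t0 + s))" using that(3) cA by (simp add: N_def charts_at_iff)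
      have "((+) t0 has_vector_derivative 1) (at s)"
        by (auto intro!: derivative_eq_intros)
      from vector_diff_chain_at[OF this integral_curve_deriv[OF that(1,2) c']]
      show ?thesis by (simp add: comp_def)
    qed
    have "norm (w (t - t0)) \<le> 2 * (norm (w 0) + \<epsilon> * 0)"
    proof (rule small_time_gronwall[where L = L])
      fix s assume "s \<in> {-\<epsilon>..\<epsilon>}"
      then have s: "\<bar>s\<bar> < \<epsilon>1" "\<bar>s\<bar> < \<epsilon>2" using \<epsilon> by auto
      have N1: "t0 + s \<in> T1" "\<gamma>1 (t0 + s) \<in> N" using e1(2)[of "t0 + s"] s by auto
      have N2: "t0 + s \<in> T2" "\<gamma>2 (t0 + s) \<in> N" using e2(2)[of "t0 + s"] s by auto
      show "(w has_vector_derivative vf c (snd c (\<gamma>1 (t0 + s))) - vf c (snd c (\<gamma>2 (t0 + s)))) (at s within {-\<epsilon>..\<epsilon>})"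
        unfolding w_def
        by (rule has_vector_derivative_at_within[OF has_vector_derivative_diff[OF d[OF \<gamma>1 N1] d[OF \<gamma>2 N2]]])
      show "norm (vf c (snd c (\<gamma>1 (t0 + s))) - vf c (snd c (\<gamma>2 (t0 + s)))) \<le> L * norm (w s) + 0"
        unfolding w_def add_0_right using N1 N2 by (intro L(2)) (auto simp: N_def)
    qed (use \<epsilon> L eL t in auto)
    then have "snd c (\<gamma>1 t) = snd c (\<gamma>2 t)" by (simp add: w_def t0)
    moreover have "\<gamma>1 t \<in> fst c" "\<gamma>2 t \<in> fst c" "t \<in> T1" "t \<in> T2"
      using e1(2)[of t] e2(2)[of t] t \<epsilon> by (auto simp: N_def)
    ultimately show "t \<in> T1 \<inter> T2 \<and> \<gamma>1 t = \<gamma>2 t"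
      using chart_inv_left[OF cA(1), of "\<gamma>1 t"] chart_inv_left[OF cA(1), of "\<gamma>2 t"] by (metis IntI)
  qed
qed

text \<open>On the intersection of the two intervals, which is connected, agreement is an open
  condition by local uniqueness and disagreement is one by the Hausdorff property.\<close>

lemma integral_curve_unique:
  assumes \<gamma>1: "integral_curve \<A> X T1 \<gamma>1" and \<gamma>2: "integral_curve \<A> X T2 \<gamma>2"
    and 0: "0 \<in> T1" "0 \<in> T2" "\<gamma>1 0 = \<gamma>2 0" and \<tau>: "\<tau> \<in> T1" "\<tau> \<in> T2"
  shows "\<gamma>1 \<tau> = \<gamma>2 \<tau>"
proof (rule ccontr)
  assume neq: "\<gamma>1 \<tau> \<noteq> \<gamma>2 \<tau>"
  let ?T = "T1 \<inter> T2"
  let ?E = "{t \<in> ?T. \<gamma>1 t = \<gamma>2 t}" and ?D = "{t \<in> ?T. \<gamma>1 t \<noteq> \<gamma>2 t}"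
  have T: "open T1" "connected T1" "continuous_on T1 \<gamma>1" "open T2" "connected T2" "continuous_on T2 \<gamma>2"
    using \<gamma>1 \<gamma>2 by (auto simp: integral_curve_def)
  have "connected ?T"
    using T(2,5) is_interval_Int by (simp add: is_interval_connected_1[symmetric])
  moreover have "open ?E"
  proof (subst open_dist, intro ballI)
    fix t0 assume "t0 \<in> ?E"
    then obtain \<epsilon> where "\<epsilon> > 0" "\<And>t. \<bar>t - t0\<bar> \<le> \<epsilon> \<Longrightarrow> t \<in> T1 \<inter> T2 \<and> \<gamma>1 t = \<gamma>2 t"
      using integral_curve_unique_local[OF \<gamma>1 \<gamma>2, of t0] by blast
    then show "\<exists>e>0. \<forall>y. dist y t0 < e \<longrightarrow> y \<in> ?E"
      by (intro exI[of _ \<epsilon>]) (auto simp: dist_real_def)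
  qed
  moreover have "open ?D"
  proof (subst open_subopen, intro ballI)
    fix t0 assume t0: "t0 \<in> ?D"
    then obtain U V where UV: "open U" "open V" "\<gamma>1 t0 \<in> U" "\<gamma>2 t0 \<in> V" "U \<inter> V = {}"
      using hausdorff[of "\<gamma>1 t0" "\<gamma>2 t0"] by blast
    let ?W = "(\<gamma>1 -` U \<inter> T1) \<inter> (\<gamma>2 -` V \<inter> T2)"
    have "open ?W"
      using T UV by (intro open_Int[of "\<gamma>1 -` U \<inter> T1" "\<gamma>2 -` V \<inter> T2"]) (simp_all add: continuous_on_open_vimage)
    moreover have "t0 \<in> ?W" "?W \<subseteq> ?D" using t0 UV by auto
    ultimately show "\<exists>T. open T \<and> t0 \<in> T \<and> T \<subseteq> ?D" by (intro exI[of _ ?W] conjI)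
  qed
  ultimately have "?E \<inter> ?T = {} \<or> ?D \<inter> ?T = {}"
    by (intro connectedD) auto
  then show False using 0 \<tau> neq by blast
qed

text \<open>Uniqueness makes the definite description in \<open>flow\<close> well defined, so any
  integral curve through p computes the flow, whatever its interval of definition.\<close>

lemma flow_eq:
  assumes "integral_curve \<A> X T \<gamma>" "0 \<in> T" "\<tau> \<in> T" "\<gamma> 0 = p"
  shows "flow \<A> X \<tau> p = \<gamma> \<tau>"
  unfolding flow_def
proof (rule the_equality)
  show "\<exists>T \<gamma>'. integral_curve \<A> X T \<gamma>' \<and> 0 \<in> T \<and> \<tau> \<in> T \<and> \<gamma>' 0 = p \<and> \<gamma>' \<tau> = \<gamma> \<tau>"
    using assms by blast
  fix q assume "\<exists>T \<gamma>. integral_curve \<A> X T \<gamma> \<and> 0 \<in> T \<and> \<tau> \<in> T \<and> \<gamma> 0 = p \<and> \<gamma> \<tau> = q"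
  then obtain T' \<gamma>' where *: "integral_curve \<A> X T' \<gamma>'" "0 \<in> T'" "\<tau> \<in> T'" "\<gamma>' 0 = p" "\<gamma>' \<tau> = q"
    by blast
  have "\<gamma>' \<tau> = \<gamma> \<tau>"
    by (rule integral_curve_unique[OF *(1) assms(1)]) (use * assms in simp_all)
  then show "q = \<gamma> \<tau>" using *(5) by simp
qed

lemma integral_curve_chart:
  assumes c: "c \<in> \<A>" and \<delta>: "\<delta> > 0"
    and in_img: "\<And>t. \<bar>t\<bar> < \<delta> \<Longrightarrow> y t \<in> img c"
    and y: "\<And>t. \<bar>t\<bar> < \<delta> \<Longrightarrow> (y has_vector_derivative vf c (y t)) (at t)"
  shows "integral_curve \<A> X {-\<delta><..<\<delta>} (\<lambda>t. chart_inv c (y t))"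
  unfolding integral_curve_def
proof (intro conjI ballI)
  have "continuous_on {-\<delta><..<\<delta>} y"
    by (rule continuous_at_imp_continuous_on, intro ballI, rule has_vector_derivative_continuous[OF y]) auto
  then show "continuous_on {-\<delta><..<\<delta>} (\<lambda>t. chart_inv c (y t))"
    by (rule continuous_on_compose2[OF continuous_on_chart_inv[OF c]]) (use in_img in auto)
  fix t d assume t: "t \<in> {-\<delta><..<\<delta>}" and d: "d \<in> charts_at \<A> (chart_inv c (y t))"
  have abs_t: "\<bar>t\<bar> < \<delta>" using t by auto
  let ?p = "chart_inv c (y t)"
  have cp: "c \<in> charts_at \<A> ?p" using c in_img[OF abs_t] by (simp add: chart_inv_charts_at)
  have yt: "snd c ?p = y t" using in_img[OF abs_t] by (simp add: chart_inv_right)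
  have "((\<lambda>x. snd d (chart_inv c x)) has_derivative (\<lambda>h. jac c d ?p *v h)) (at (y t))"
    using jac_has_derivative[OF cp d] by (simp only: yt)
  from has_derivative_compose[OF y[OF abs_t, unfolded has_vector_derivative_def] this]
  have "((\<lambda>t. snd d (chart_inv c (y t))) has_vector_derivative jac c d ?p *v vf c (y t)) (at t)"
    by (simp add: has_vector_derivative_def matrix_vector_mult_scaleR)
  moreover have "jac c d ?p *v vf c (y t) = vf d (snd d ?p)"
    using vf_transform[OF cp d] by (simp add: yt)
  moreover have "vf d (snd d ?p) = (\<chi> i. X ?p d [i] [])"
    using d by (simp add: vf_def charts_at_iff chart_inv_left)
  ultimately show "((snd d \<circ> (\<lambda>t. chart_inv c (y t))) has_vector_derivative (\<chi> i. X ?p d [i] [])) (at t)"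
    by (simp add: comp_def)
qed auto

text \<open>
  In the chart \<open>c\<close>, the curve \<open>y\<close> is the flow line of \<open>p\<close> and \<open>\<Phi> \<tau>\<close> is the tangent map at \<open>p\<close> of the
  flow at time \<open>\<tau>\<close>.
\<close>

definition flow_data ::
  "('a, 'n) chart \<Rightarrow> 'a \<Rightarrow> real \<Rightarrow> (real \<Rightarrow> real^'n) \<Rightarrow> (real \<Rightarrow> real^'n^'n) \<Rightarrow> bool" where
  "flow_data c p \<delta> y \<Phi> \<longleftrightarrow> c \<in> charts_at \<A> p \<and> \<delta> > 0 \<and>
    (\<forall>\<tau>. \<bar>\<tau>\<bar> < \<delta> \<longrightarrow> y \<tau> \<in> img c \<and> flow \<A> X \<tau> p = chart_inv c (y \<tau>) \<and> invertible (\<Phi> \<tau>) \<and>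
      (\<forall>c'\<in>charts_at \<A> p. \<forall>d\<in>charts_at \<A> (chart_inv c (y \<tau>)).
        tangent_matrix (flow \<A> X \<tau>) c' d p = jac c d (chart_inv c (y \<tau>)) ** \<Phi> \<tau> ** jac c' c p)) \<and>
    y 0 = snd c p \<and> (y has_vector_derivative vf c (snd c p)) (at 0) \<and>
    \<Phi> 0 = mat 1 \<and> (\<Phi> has_vector_derivative dvf c (snd c p)) (at 0)"

lemma flow_data_exists:
  assumes c: "c \<in> charts_at \<A> p"
  obtains \<delta> y \<Phi> where "flow_data c p \<delta> y \<Phi>"
proof -
  have cA: "c \<in> \<A>" "p \<in> fst c" using c by (auto simp: charts_at_iff)
  obtain \<delta> \<rho> \<phi> \<Phi> where \<delta>: "\<delta> > 0" "\<rho> > 0"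
    "\<And>x. x \<in> ball (snd c p) \<rho> \<Longrightarrow> \<phi> x 0 = x"
    "\<And>x t. x \<in> ball (snd c p) \<rho> \<Longrightarrow> \<bar>t\<bar> < \<delta> \<Longrightarrow> \<phi> x t \<in> img c"
    "\<And>x t. x \<in> ball (snd c p) \<rho> \<Longrightarrow> \<bar>t\<bar> < \<delta> \<Longrightarrow> (\<phi> x has_vector_derivative vf c (\<phi> x t)) (at t)"
    and \<Phi>: "\<Phi> 0 = mat 1" "(\<Phi> has_vector_derivative dvf c (snd c p)) (at 0)"
    "\<And>t. \<bar>t\<bar> < \<delta> \<Longrightarrow> ((\<lambda>x. \<phi> x t) has_derivative (\<lambda>h. \<Phi> t *v h)) (at (snd c p))"
  proof (rule smooth_local_flow[OF open_chart(2)[OF cA(1)] imageI[OF cA(2)] vf_smooth[OF cA(1)],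
        folded dvf_def], goal_cases)
    case (1 \<delta> \<rho> \<phi> \<Phi>)
    show ?case by (rule that) (fact 1)+
  qed
  have "(\<Phi> \<longlongrightarrow> \<Phi> 0) (nhds 0)"
    using has_vector_derivative_continuous[OF \<Phi>(2)]
    by (simp add: isCont_def tendsto_at_iff_tendsto_nhds)
  moreover have "\<Phi> 0 \<in> {A. det A \<noteq> 0}" by (simp add: \<Phi>(1))
  ultimately have "\<forall>\<^sub>F t in nhds 0. \<Phi> t \<in> {A. det A \<noteq> 0}"
    by (rule topological_tendstoD[OF _ open_det_nonzero])
  then obtain \<epsilon> where \<epsilon>: "\<epsilon> > 0" "\<And>t. \<bar>t\<bar> < \<epsilon> \<Longrightarrow> \<Phi> t \<in> {A. det A \<noteq> 0}"
    unfolding eventually_nhds_metric by (auto simp: dist_real_def)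
  \<comment> \<open>Besides the existence time \<delta>, \<epsilon> enters to keep \<Phi>
    invertible, as the inverse of the tangent map occurs in the pullback.\<close>
  define \<eta> where "\<eta> = min \<delta> \<epsilon>"
  have \<eta>: "\<eta> > 0" using \<delta> \<epsilon> by (simp add: \<eta>_def)
  have x0: "snd c p \<in> ball (snd c p) \<rho>" using \<delta> by simp
  have fl: "flow \<A> X \<tau> q = chart_inv c (\<phi> (snd c q) \<tau>)"
    if "\<bar>\<tau>\<bar> < \<delta>" "q \<in> fst c" "snd c q \<in> ball (snd c p) \<rho>" for \<tau> q
  proof (rule flow_eq[where T = "{-\<delta><..<\<delta>}" and \<gamma> = "\<lambda>t. chart_inv c (\<phi> (snd c q) t)"])
    show "integral_curve \<A> X {-\<delta><..<\<delta>} (\<lambda>t. chart_inv c (\<phi> (snd c q) t))"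
      by (rule integral_curve_chart[OF cA(1) \<delta>(1) \<delta>(4)[OF that(3)] \<delta>(5)[OF that(3)]])
  qed (use that \<delta> cA in \<open>auto simp: chart_inv_left\<close>)
  have "flow_data c p \<eta> (\<phi> (snd c p)) \<Phi>"
    unfolding flow_data_def
  proof (intro conjI allI impI ballI c \<eta> \<Phi>(1,2) \<delta>(3)[OF x0])
    show "(\<phi> (snd c p) has_vector_derivative vf c (snd c p)) (at 0)"
      using \<delta>(5)[OF x0, of 0] \<delta>(1) \<delta>(3)[OF x0] by simp
    fix \<tau> assume \<tau>: "\<bar>\<tau>\<bar> < \<eta>"
    then have \<tau>': "\<bar>\<tau>\<bar> < \<delta>" "\<bar>\<tau>\<bar> < \<epsilon>" by (auto simp: \<eta>_def)
    show "\<phi> (snd c p) \<tau> \<in> img c" by (rule \<delta>(4)[OF x0 \<tau>'(1)])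
    show flp: "flow \<A> X \<tau> p = chart_inv c (\<phi> (snd c p) \<tau>)" by (rule fl[OF \<tau>'(1) cA(2) x0])
    show "invertible (\<Phi> \<tau>)" using \<epsilon>(2)[OF \<tau>'(2)] by (simp add: invertible_det_nz)
    fix c' d assume c': "c' \<in> charts_at \<A> p" and d: "d \<in> charts_at \<A> (chart_inv c (\<phi> (snd c p) \<tau>))"
    \<comment> \<open>On this neighbourhood of p the flow at the fixed time \<tau> stays in the
      domain of c, so its coordinate expression is the local flow of the vector field in the
      chart.\<close>
    let ?N = "{q \<in> fst c. snd c q \<in> ball (snd c p) \<rho>}"
    have M: "((\<lambda>x. snd c (flow \<A> X \<tau> (chart_inv c x))) has_derivative (\<lambda>h. \<Phi> \<tau> *v h)) (at (snd c p))"
    proof (rule has_derivative_transform_within_open[OF \<Phi>(3)[OF \<tau>'(1)]])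
      show "open (snd c ` ?N)"
        by (intro open_chart_image cA chart_preimage open_ball) auto
      show "snd c p \<in> snd c ` ?N" using cA x0 by auto
      fix x assume "x \<in> snd c ` ?N"
      then have x: "x \<in> ball (snd c p) \<rho>" "chart_inv c x \<in> fst c" "snd c (chart_inv c x) = x"
        using cA(1) by (auto simp: chart_inv_left)
      then show "\<phi> x \<tau> = snd c (flow \<A> X \<tau> (chart_inv c x))"
        using fl[OF \<tau>'(1) x(2)] \<delta>(4)[OF x(1) \<tau>'(1)] by (simp add: chart_inv_right)
    qed
    show "tangent_matrix (flow \<A> X \<tau>) c' d p =
        jac c d (chart_inv c (\<phi> (snd c p) \<tau>)) ** \<Phi> \<tau> ** jac c' c p"
      unfolding flp[symmetric]
    proof (rule tangent_change[where f = "flow \<A> X \<tau>" and N = "?N", OF c c' cA(1) _ M])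
      show "d \<in> charts_at \<A> (flow \<A> X \<tau> p)" using d flp by simp
      show "open ?N" by (intro cA chart_preimage open_ball)
      show "flow \<A> X \<tau> q \<in> fst c" if "q \<in> ?N" for q
        using that fl[OF \<tau>'(1), of q] \<delta>(4)[OF _ \<tau>'(1), of "snd c q"] by (auto intro: chart_inv_in)
    qed (use cA x0 in auto)
  qed
  then show thesis by (rule that)
qed

lemma flow_dataD:
  assumes "flow_data c p \<delta> y \<Phi>"
  shows "c \<in> charts_at \<A> p" "\<delta> > 0" "y 0 = snd c p" "(y has_vector_derivative vf c (snd c p)) (at 0)"
    "\<Phi> 0 = mat 1" "(\<Phi> has_vector_derivative dvf c (snd c p)) (at 0)"
    "\<And>\<tau>. \<bar>\<tau>\<bar> < \<delta> \<Longrightarrow> y \<tau> \<in> img c" "\<And>\<tau>. \<bar>\<tau>\<bar> < \<delta> \<Longrightarrow> flow \<A> X \<tau> p = chart_inv c (y \<tau>)"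
    "\<And>\<tau>. \<bar>\<tau>\<bar> < \<delta> \<Longrightarrow> invertible (\<Phi> \<tau>)"
    "\<And>\<tau> c' d. \<bar>\<tau>\<bar> < \<delta> \<Longrightarrow> c' \<in> charts_at \<A> p \<Longrightarrow> d \<in> charts_at \<A> (chart_inv c (y \<tau>)) \<Longrightarrow>
      tangent_matrix (flow \<A> X \<tau>) c' d p = jac c d (chart_inv c (y \<tau>)) ** \<Phi> \<tau> ** jac c' c p"
    "c \<in> \<A>" "p \<in> fst c" "chart_inv c (snd c p) = p"
    "\<And>\<tau>. \<bar>\<tau>\<bar> < \<delta> \<Longrightarrow> c \<in> charts_at \<A> (chart_inv c (y \<tau>))"
  using assms by (auto simp: flow_data_def charts_at_iff chart_inv_left chart_inv_in)

section \<open>Pullback along the flow and the Lie derivative in a chart\<close>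

lemma eventually_abs_less: "(\<delta>::real) > 0 \<Longrightarrow> \<forall>\<^sub>F \<tau> in nhds 0. \<bar>\<tau>\<bar> < \<delta>"
  by (rule eventually_nhds_metric[THEN iffD2]) (auto simp: dist_norm)

text \<open>The chart that \<open>pullback\<close> chooses at the flowed point may jump with \<tau>.
  The transformation law of t replaces it by c, and the expression becomes a product of functions
  differentiable in \<tau>, followed by a fixed change of charts at p.\<close>

lemma pullback_flow:
  assumes fd: "flow_data c p \<delta> y \<Phi>" and \<tau>: "\<bar>\<tau>\<bar> < \<delta>" and c': "c' \<in> charts_at \<A> p"
    and t: "t (chart_inv c (y \<tau>)) \<in> tensor_fibre \<A> r s w (chart_inv c (y \<tau>))"
  shows "pullback \<A> r s w (flow \<A> X \<tau>) t p c' =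
    tensor_action r s w (jac c c' p) (tensor_action r s w (matrix_inv (\<Phi> \<tau>)) (t (chart_inv c (y \<tau>)) c))"
proof -
  note fdD = flow_dataD[OF fd]
  let ?q = "chart_inv c (y \<tau>)" and ?d = "chart_at \<A> (chart_inv c (y \<tau>))"
  have c: "c \<in> charts_at \<A> p" and cq: "c \<in> charts_at \<A> ?q" and d: "?d \<in> charts_at \<A> ?q"
    using fdD(1) fdD(14)[OF \<tau>] chart_at by blast+
  have inv: "invertible (jac c ?d ?q)" "invertible (\<Phi> \<tau>)" "invertible (jac c' c p)" "invertible (jac c c' p)"
    "invertible (jac ?d c ?q)"
    using jac_inverse(2) c c' cq d fdD(9)[OF \<tau>] by auto
  have "matrix_inv (tangent_matrix (flow \<A> X \<tau>) c' ?d p) = jac c c' p ** (matrix_inv (\<Phi> \<tau>) ** jac ?d c ?q)"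
    unfolding fdD(10)[OF \<tau> c' d]
    using inv jac_inverse(1)[OF cq d] jac_inverse(1)[OF c' c]
    by (simp add: matrix_inv_mult invertible_mult)
  then have "pullback \<A> r s w (flow \<A> X \<tau>) t p c' =
      tensor_action r s w (jac c c' p ** (matrix_inv (\<Phi> \<tau>) ** jac ?d c ?q)) (t ?q ?d)"
    using c' by (simp add: pullback_def fdD(8)[OF \<tau>] Let_def)
  also have "\<dots> = tensor_action r s w (jac c c' p) (tensor_action r s w (matrix_inv (\<Phi> \<tau>))
      (tensor_action r s w (jac ?d c ?q) (t ?q ?d)))"
    using inv matrix_inv_inv(2)[OF inv(2)] by (simp add: tensor_action_comp invertible_mult)
  also have "tensor_action r s w (jac ?d c ?q) (t ?q ?d) = t ?q c"
    by (rule fibre_transform[OF t d cq, symmetric])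
  finally show ?thesis .
qed

text \<open>The infinitesimal action of the matrix Lie algebra on tensors of weight w. It stays
  unevaluated; linearity in M is what the later estimates use.\<close>

definition lie_coef :: "nat \<Rightarrow> nat \<Rightarrow> nat \<Rightarrow> real^'n^'n \<Rightarrow>
    'n list \<Rightarrow> 'n list \<Rightarrow> 'n list \<Rightarrow> 'n list \<Rightarrow> real" where
  "lie_coef r s w M I J K L = frechet_derivative (\<lambda>M. pull_coef r s w M I J K L) (at (mat 1)) M"

text \<open>The coordinate formula of the Lie derivative: a term of order zero from the derivative
  of the field, plus the derivative along the field. The second coefficient is a Kronecker delta,
  left in place so that both terms have the shape delivered by the product rule.\<close>

definition lie_expr :: "nat \<Rightarrow> nat \<Rightarrow> nat \<Rightarrow> ('a \<Rightarrow> ('a, 'n) tensor) \<Rightarrow>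
    ('a, 'n) chart \<Rightarrow> 'n list \<Rightarrow> 'n list \<Rightarrow> real^'n \<Rightarrow> real" where
  "lie_expr r s w t c I J x = (\<Sum>K | length K = r. \<Sum>L | length L = s.
     lie_coef r s w (dvf c x) I J K L * t (chart_inv c x) c K L +
     coef r s (mat 1) (mat 1) I J K L * frechet_derivative (\<lambda>x. t (chart_inv c x) c K L) (at x) (vf c x))"

text \<open>Only components in the fixed chart c enter, so t may be any family of differentiable
  component functions. This allows its use for the section sigma as a function of p with q
  frozen.\<close>

lemma pull_curve_derivative:
  assumes fd: "flow_data c p \<delta> y \<Phi>"
    and t: "\<And>K L. (\<lambda>x. t (chart_inv c x) c K L) differentiable (at (snd c p))"
  shows "((\<lambda>\<tau>. tensor_action r s w (matrix_inv (\<Phi> \<tau>)) (t (chart_inv c (y \<tau>)) c) I J)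
    has_real_derivative lie_expr r s w t c I J (snd c p)) (at 0)"
proof -
  note fdD = flow_dataD[OF fd]
  have inv1: "invertible (\<Phi> 0)" by (simp add: fdD(5))
  have "((\<lambda>\<tau>. \<Sum>K | length K = r. \<Sum>L | length L = s. pull_coef r s w (\<Phi> \<tau>) I J K L * t (chart_inv c (y \<tau>)) c K L)
    has_real_derivative lie_expr r s w t c I J (snd c p)) (at 0)"
    unfolding lie_expr_def
  proof (intro DERIV_sum)
    fix K L
    have "((\<lambda>\<tau>. pull_coef r s w (\<Phi> \<tau>) I J K L) has_vector_derivative
        lie_coef r s w (dvf c (snd c p)) I J K L) (at 0)"
      using has_vector_derivative_compose_frechet[OF fdD(6) pull_coef_differentiable[OF inv1]]
      by (simp add: lie_coef_def fdD(5))
    moreover have "((\<lambda>\<tau>. t (chart_inv c (y \<tau>)) c K L) has_vector_derivative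
        frechet_derivative (\<lambda>x. t (chart_inv c x) c K L) (at (snd c p)) (vf c (snd c p))) (at 0)"
      using has_vector_derivative_compose_frechet[OF fdD(4), of "\<lambda>x. t (chart_inv c x) c K L"] t
      by (simp add: fdD(3))
    ultimately show "((\<lambda>\<tau>. pull_coef r s w (\<Phi> \<tau>) I J K L * t (chart_inv c (y \<tau>)) c K L) has_real_derivative
        lie_coef r s w (dvf c (snd c p)) I J K L * t (chart_inv c (snd c p)) c K L +
        coef r s (mat 1) (mat 1) I J K L *
        frechet_derivative (\<lambda>x. t (chart_inv c x) c K L) (at (snd c p)) (vf c (snd c p))) (at 0)"
      unfolding has_real_derivative_iff_has_vector_derivative[symmetric]
      by (rule DERIV_cong[OF DERIV_mult]) (simp add: fdD(3,5) pull_coef_def)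
  qed
  moreover have "\<forall>\<^sub>F \<tau> in nhds 0. (\<Sum>K | length K = r. \<Sum>L | length L = s.
      pull_coef r s w (\<Phi> \<tau>) I J K L * t (chart_inv c (y \<tau>)) c K L) =
      tensor_action r s w (matrix_inv (\<Phi> \<tau>)) (t (chart_inv c (y \<tau>)) c) I J"
    using eventually_abs_less[OF fdD(2)] by eventually_elim (simp add: tensor_action_matrix_inv fdD(9))
  ultimately show ?thesis
    by (rule has_real_derivative_eventually)
qed

text \<open>The derivative is computed in c and read in c'. Comparing two such charts shows that the
  Lie derivative again obeys the tensor law.\<close>

lemma lie_pullback_derivative:
  assumes c: "c \<in> charts_at \<A> p" and c': "c' \<in> charts_at \<A> p"
    and fib: "\<And>q. t q \<in> tensor_fibre \<A> r s w q"
    and t: "\<And>K L. (\<lambda>x. t (chart_inv c x) c K L) differentiable (at (snd c p))"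
  shows "((\<lambda>\<tau>. pullback \<A> r s w (flow \<A> X \<tau>) t p c' I J) has_real_derivative
    tensor_action r s w (jac c c' p) (\<lambda>I J. lie_expr r s w t c I J (snd c p)) I J) (at 0)"
proof -
  obtain \<delta> y \<Phi> where fd: "flow_data c p \<delta> y \<Phi>" using flow_data_exists[OF c] by blast
  have "((\<lambda>\<tau>. tensor_action r s w (jac c c' p)
        (tensor_action r s w (matrix_inv (\<Phi> \<tau>)) (t (chart_inv c (y \<tau>)) c)) I J) has_real_derivative
      tensor_action r s w (jac c c' p) (\<lambda>I J. lie_expr r s w t c I J (snd c p)) I J) (at 0)"
    unfolding tensor_action_apply[where F = "jac c c' p"]
    by (intro DERIV_cmult DERIV_sum pull_curve_derivative[where t = t, OF fd t])
  moreover have "\<forall>\<^sub>F \<tau> in nhds 0. tensor_action r s w (jac c c' p)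
        (tensor_action r s w (matrix_inv (\<Phi> \<tau>)) (t (chart_inv c (y \<tau>)) c)) I J =
      pullback \<A> r s w (flow \<A> X \<tau>) t p c' I J"
    using eventually_abs_less[OF flow_dataD(2)[OF fd]]
    by eventually_elim (simp add: pullback_flow[where t = t, OF fd _ c' fib])
  ultimately show ?thesis
    by (rule has_real_derivative_eventually)
qed

lemma lie_expr_length:
  assumes "length I \<noteq> r \<or> length J \<noteq> s"
  shows "lie_expr r s w t c I J x = 0"
proof -
  have z: "pull_coef r s w M I J K L = 0" for M K L
    using assms by (auto simp: pull_coef_def coef_eq_0)
  have "lie_coef r s w M I J K L = 0" for M K L
    unfolding lie_coef_def z using frechet_derivative_apply[OF has_derivative_const] by simp
  moreover have "coef r s (mat 1) (mat 1) I J K L = 0" for K L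
    using assms by (auto simp: coef_eq_0)
  ultimately show ?thesis by (simp add: lie_expr_def)
qed

lemma lie_eq:
  assumes c: "c \<in> charts_at \<A> p"
    and fib: "\<And>q. t q \<in> tensor_fibre \<A> r s w q"
    and t: "\<And>K L. (\<lambda>x. t (chart_inv c x) c K L) differentiable (at (snd c p))"
  shows "lie \<A> r s w X t p c I J = lie_expr r s w t c I J (snd c p)"
proof -
  have "lie \<A> r s w X t p c I J =
      tensor_action r s w (jac c c p) (\<lambda>I J. lie_expr r s w t c I J (snd c p)) I J"
    unfolding lie_def by (rule DERIV_imp_deriv[OF lie_pullback_derivative[where t = t, OF c c fib t]])
  also have "\<dots> = lie_expr r s w t c I J (snd c p)"
    by (subst jac_self[OF c], subst tensor_action_mat_1) (auto simp: lie_expr_length)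
  finally show ?thesis .
qed

lemma lie_outside: "c \<notin> charts_at \<A> p \<Longrightarrow> lie \<A> r s w X t p c = 0"
  unfolding lie_def pullback_def by (simp add: fun_eq_iff)

lemma lie_fibre:
  assumes c: "c \<in> charts_at \<A> p"
    and fib: "\<And>q. t q \<in> tensor_fibre \<A> r s w q"
    and t: "\<And>K L. (\<lambda>x. t (chart_inv c x) c K L) differentiable (at (snd c p))"
  shows "lie \<A> r s w X t p \<in> tensor_fibre \<A> r s w p"
proof (rule fibreI[OF c])
  fix I J :: "'n list" assume "length I \<noteq> r \<or> length J \<noteq> s"
  then show "lie \<A> r s w X t p c I J = 0"
    by (simp add: lie_eq[where t = t, OF c fib t] lie_expr_length)
next
  fix d assume d: "d \<in> charts_at \<A> p"
  have "lie \<A> r s w X t p c = (\<lambda>I J. lie_expr r s w t c I J (snd c p))"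
    by (intro ext) (rule lie_eq[where t = t, OF c fib t])
  moreover have "lie \<A> r s w X t p d I J =
      tensor_action r s w (jac c d p) (\<lambda>I J. lie_expr r s w t c I J (snd c p)) I J" for I J
    unfolding lie_def by (rule DERIV_imp_deriv[OF lie_pullback_derivative[where t = t, OF c d fib t]])
  ultimately show "lie \<A> r s w X t p d = tensor_action r s w (jac c d p) (lie \<A> r s w X t p c)"
    by (intro ext) (simp only:)
qed (rule lie_outside)

lemma lie_coef_linear: "bounded_linear (\<lambda>M. lie_coef r s w M I J K L)"
  unfolding lie_coef_def
  using pull_coef_differentiable[OF invertible_mat_1] frechet_derivative_works has_derivative_bounded_linear
  by blast

lemma lie_expr_smooth:
  assumes c: "c \<in> \<A>" and t: "\<And>K L. smooth_on (img c) (\<lambda>x. t (chart_inv c x) c K L)"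
  shows "smooth_on (img c) (lie_expr r s w t c I J)"
  unfolding lie_expr_def
  by (intro smooth_on_sum smooth_on_add smooth_on_mult smooth_on_const open_chart c t
      smooth_on_frechet_apply vf_smooth smooth_on_bounded_linear[OF _ lie_coef_linear] dvf_smooth)

lemma lie_section:
  assumes t: "t \<in> tensor_sections \<A> r s w"
  shows "lie \<A> r s w X t \<in> tensor_sections \<A> r s w"
    and "c \<in> \<A> \<Longrightarrow> x \<in> img c \<Longrightarrow> lie \<A> r s w X t (chart_inv c x) c I J = lie_expr r s w t c I J x"
proof -
  note fib = section_fibre[OF t]
  have d: "(\<lambda>x. t (chart_inv c x) c K L) differentiable (at x)" if "c \<in> \<A>" "x \<in> img c" for c K L x
    by (rule smooth_on_differentiable[OF section_smooth[OF t that(1)] that(2)])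
  have eq: "lie \<A> r s w X t (chart_inv c x) c I J = lie_expr r s w t c I J x"
    if "c \<in> \<A>" "x \<in> img c" for c x I J
    using lie_eq[OF chart_inv_charts_at[OF that] fib] d[OF that] by (simp add: chart_inv_right[OF that(2)])
  then show "c \<in> \<A> \<Longrightarrow> x \<in> img c \<Longrightarrow> lie \<A> r s w X t (chart_inv c x) c I J = lie_expr r s w t c I J x" .
  show "lie \<A> r s w X t \<in> tensor_sections \<A> r s w"
    unfolding tensor_sections_def
  proof (intro CollectI conjI allI ballI)
    fix p
    have c: "chart_at \<A> p \<in> charts_at \<A> p" by (rule chart_at)
    show "lie \<A> r s w X t p \<in> tensor_fibre \<A> r s w p"
      by (rule lie_fibre[OF c fib d]) (use c in \<open>auto simp: charts_at_iff\<close>)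
  next
    fix c I J assume c: "c \<in> \<A>"
    show "smooth_on (img c) (\<lambda>x. lie \<A> r s w X t (chart_inv c x) c I J)"
      by (rule iffD2[OF smooth_on_cong[OF open_chart(2)[OF c] eq[OF c]] lie_expr_smooth[where t = t, OF c section_smooth[OF t c]]])
  qed
qed

lemma lie_expr_local:
  assumes "c \<in> \<A>" "x \<in> img c" "open N" "chart_inv c x \<in> N" "\<And>q. q \<in> N \<Longrightarrow> t q = 0"
  shows "lie_expr r s w t c I J x = 0"
proof -
  let ?V = "snd c ` (fst c \<inter> N)"
  have V: "open ?V" by (intro open_chart_image assms) (auto intro: open_chart assms)
  have "chart_inv c x \<in> fst c \<inter> N" using chart_inv_in[OF assms(2)] assms(4) by simp
  then have x: "x \<in> ?V" using chart_inv_right[OF assms(2)] by (metis image_eqI)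
  have "frechet_derivative (\<lambda>x. t (chart_inv c x) c K L) (at x) h = 0" for K L h
  proof -
    have "frechet_derivative (\<lambda>x. t (chart_inv c x) c K L) (at x) = frechet_derivative (\<lambda>x. 0) (at x)"
      by (rule frechet_derivative_cong_open[OF V x]) (use assms in \<open>auto simp: chart_inv_left\<close>)
    then show ?thesis using frechet_derivative_apply[OF has_derivative_const, of 0 x h] by simp
  qed
  then show ?thesis by (simp add: lie_expr_def assms(5)[OF assms(4)])
qed

lemma lie_section_in:
  assumes K: "compact K" and t: "t \<in> tensor_sections_in \<A> r s w K"
  shows "lie \<A> r s w X t \<in> tensor_sections_in \<A> r s w K"
proof -
  have K': "closed K" using K by (rule compact_imp_closed)
  have ts: "t \<in> tensor_sections \<A> r s w" and t0: "\<And>p. p \<notin> K \<Longrightarrow> t p = 0"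
    using t sections_in_iff[OF K'] by auto
  have "lie \<A> r s w X t p = 0" if p: "p \<notin> K" for p
  proof (intro ext)
    fix c I J
    show "lie \<A> r s w X t p c I J = 0 c I J"
    proof (cases "c \<in> charts_at \<A> p")
      case True
      then have c: "c \<in> \<A>" "snd c p \<in> img c" "chart_inv c (snd c p) = p"
        by (auto simp: charts_at_iff chart_inv_left)
      have "lie_expr r s w t c I J (snd c p) = 0"
        by (rule lie_expr_local[OF c(1,2), of "- K"]) (use K' p t0 c in auto)
      then show ?thesis using lie_section(2)[OF ts c(1,2)] c(3) by simp
    qed (simp add: lie_outside)
  qed
  then show ?thesis using lie_section(1)[OF ts] by (simp add: sections_in_iff[OF K'])
qed

lemma lie_csection: "t \<in> tensor_csections \<A> r s w \<Longrightarrow> lie \<A> r s w X t \<in> tensor_csections \<A> r s w"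
  unfolding csections_iff using lie_section_in by blast

end

section \<open>Two-point tensors and their Lie derivative\<close>

context manifold
begin

lemma TO_transform:
  assumes "A \<in> TO_sections \<A>" "c \<in> charts_at \<A> p" "c' \<in> charts_at \<A> p"
    "d \<in> charts_at \<A> q" "d' \<in> charts_at \<A> q"
  shows "A p q c' d' = jac d d' q ** A p q c d ** jac c' c p"
  using assms unfolding TO_sections_def TO_fibre_def by blast

lemma TO_outside:
  assumes "A \<in> TO_sections \<A>" "c \<notin> charts_at \<A> p \<or> d \<notin> charts_at \<A> q"
  shows "A p q c d = 0"
  using assms unfolding TO_sections_def TO_fibre_def by blast

lemma TO_smooth:
  assumes "A \<in> TO_sections \<A>" "c \<in> \<A>" "d \<in> \<A>"
  shows "smooth_on (img c \<times> img d) (\<lambda>z. A (chart_inv c (fst z)) (chart_inv d (snd z)) c d)"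
  using assms unfolding TO_sections_def case_prod_beta by blast

text \<open>As for tensor fibres, the cocycle identity reduces the law for all charts to the law
  from the chosen charts, in which B holds the matrices.\<close>

lemma TO_sectionsI:
  assumes tr: "\<And>p q c' d'. c' \<in> charts_at \<A> p \<Longrightarrow> d' \<in> charts_at \<A> q \<Longrightarrow>
      A p q c' d' = jac (chart_at \<A> q) d' q ** B p q ** jac c' (chart_at \<A> p) p"
    and out: "\<And>p q c d. c \<notin> charts_at \<A> p \<or> d \<notin> charts_at \<A> q \<Longrightarrow> A p q c d = 0"
    and sm: "\<And>c d. c \<in> \<A> \<Longrightarrow> d \<in> \<A> \<Longrightarrow>
      smooth_on (img c \<times> img d) (\<lambda>z. A (chart_inv c (fst z)) (chart_inv d (snd z)) c d)"
  shows "A \<in> TO_sections \<A>"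
  unfolding TO_sections_def TO_fibre_def case_prod_beta
proof (intro CollectI conjI allI ballI impI sm)
  fix p q c c' d d'
  assume c: "c \<in> charts_at \<A> p" "c' \<in> charts_at \<A> p" and d: "d \<in> charts_at \<A> q" "d' \<in> charts_at \<A> q"
  let ?c = "chart_at \<A> p" and ?d = "chart_at \<A> q"
  have "jac d d' q ** A p q c d ** jac c' c p =
      (jac d d' q ** jac ?d d q) ** B p q ** (jac c ?c p ** jac c' c p)"
    unfolding tr[OF c(1) d(1)] by (simp add: matrix_mul_assoc)
  also have "\<dots> = A p q c' d'"
    unfolding jac_cocycle[OF chart_at d] jac_cocycle[OF c(2,1) chart_at] tr[OF c(2) d(2)] ..
  finally show "A p q c' d' = jac d d' q ** A p q c d ** jac c' c p" ..
qed (use out in auto)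

lemma TO_add:
  assumes A: "A \<in> TO_sections \<A>" and B: "B \<in> TO_sections \<A>"
  shows "A + B \<in> TO_sections \<A>"
proof (rule TO_sectionsI[where B = "\<lambda>p q. (A + B) p q (chart_at \<A> p) (chart_at \<A> q)"])
  fix p q c' d' assume c': "c' \<in> charts_at \<A> p" and d': "d' \<in> charts_at \<A> q"
  show "(A + B) p q c' d' = jac (chart_at \<A> q) d' q ** (A + B) p q (chart_at \<A> p) (chart_at \<A> q) **
      jac c' (chart_at \<A> p) p"
    using TO_transform[OF A chart_at c' chart_at d'] TO_transform[OF B chart_at c' chart_at d']
    by (simp add: bounded_bilinear.add_left[OF bounded_bilinear_matrix_mult]
        bounded_bilinear.add_right[OF bounded_bilinear_matrix_mult])
next
  fix c d assume "c \<in> \<A>" "d \<in> \<A>"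
  then show "smooth_on (img c \<times> img d) (\<lambda>z. (A + B) (chart_inv c (fst z)) (chart_inv d (snd z)) c d)"
    by (simp add: smooth_on_add TO_smooth A B open_Times open_chart)
qed (auto simp: TO_outside[OF A] TO_outside[OF B])

lemma TO_scaleR:
  assumes A: "A \<in> TO_sections \<A>"
  shows "a *\<^sub>R A \<in> TO_sections \<A>"
proof (rule TO_sectionsI[where B = "\<lambda>p q. (a *\<^sub>R A) p q (chart_at \<A> p) (chart_at \<A> q)"])
  fix p q c' d' assume c': "c' \<in> charts_at \<A> p" and d': "d' \<in> charts_at \<A> q"
  show "(a *\<^sub>R A) p q c' d' = jac (chart_at \<A> q) d' q ** (a *\<^sub>R A) p q (chart_at \<A> p) (chart_at \<A> q) **
      jac c' (chart_at \<A> p) p"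
    using TO_transform[OF A chart_at c' chart_at d']
    by (simp add: bounded_bilinear.scaleR_left[OF bounded_bilinear_matrix_mult]
        bounded_bilinear.scaleR_right[OF bounded_bilinear_matrix_mult])
next
  fix c d assume "c \<in> \<A>" "d \<in> \<A>"
  then show "smooth_on (img c \<times> img d) (\<lambda>z. (a *\<^sub>R A) (chart_inv c (fst z)) (chart_inv d (snd z)) c d)"
    by (simp add: smooth_on_scaleR TO_smooth A open_Times open_chart)
qed (auto simp: TO_outside[OF A])

end

context manifold_field
begin

text \<open>The charts chosen at the two flowed points cancel by the cocycle identity, leaving fixed
  charts c and d in which the expression is differentiable in \<tau>.\<close>

lemma TO_pullback_flow:
  assumes fp: "flow_data c p \<delta>1 y \<Phi>" and fq: "flow_data d q \<delta>2 z \<Psi>"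
    and \<tau>: "\<bar>\<tau>\<bar> < \<delta>1" "\<bar>\<tau>\<bar> < \<delta>2" and A: "A \<in> TO_sections \<A>"
    and c': "c' \<in> charts_at \<A> p" and d': "d' \<in> charts_at \<A> q"
  shows "TO_pullback \<A> (flow \<A> X \<tau>) A p q c' d' =
    jac d d' q ** (matrix_inv (\<Psi> \<tau>) ** A (chart_inv c (y \<tau>)) (chart_inv d (z \<tau>)) c d ** \<Phi> \<tau>) ** jac c' c p"
proof -
  let ?p = "chart_inv c (y \<tau>)" and ?q = "chart_inv d (z \<tau>)"
  let ?c = "chart_at \<A> ?p" and ?d = "chart_at \<A> ?q"
  note pD = flow_dataD[OF fp] and qD = flow_dataD[OF fq]
  have c: "c \<in> charts_at \<A> p" "c \<in> charts_at \<A> ?p" and d: "d \<in> charts_at \<A> q" "d \<in> charts_at \<A> ?q"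
    using pD(1) pD(14)[OF \<tau>(1)] qD(1) qD(14)[OF \<tau>(2)] by blast+
  have inv: "matrix_inv (jac d ?d ?q ** \<Psi> \<tau> ** jac d' d q) = jac d d' q ** matrix_inv (\<Psi> \<tau>) ** jac ?d d ?q"
    using jac_inverse[OF d(2) chart_at] jac_inverse[OF d' d(1)] qD(9)[OF \<tau>(2)]
    by (simp add: matrix_inv_mult invertible_mult matrix_mul_assoc)
  have "TO_pullback \<A> (flow \<A> X \<tau>) A p q c' d' =
      jac d d' q ** matrix_inv (\<Psi> \<tau>) ** jac ?d d ?q ** (jac d ?d ?q ** A ?p ?q c d ** jac ?c c ?p) **
      (jac c ?c ?p ** \<Phi> \<tau> ** jac c' c p)"
    using c' d'
    by (simp add: TO_pullback_def pD(8)[OF \<tau>(1)] qD(8)[OF \<tau>(2)] Let_def pD(10)[OF \<tau>(1) c' chart_at]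
        qD(10)[OF \<tau>(2) d' chart_at] inv TO_transform[OF A c(2) chart_at d(2) chart_at])
  also have "\<dots> = jac d d' q ** (matrix_inv (\<Psi> \<tau>) ** (jac ?d d ?q ** jac d ?d ?q) ** A ?p ?q c d **
      (jac ?c c ?p ** jac c ?c ?p) ** \<Phi> \<tau>) ** jac c' c p"
    by (simp add: matrix_mul_assoc)
  also have "\<dots> = jac d d' q ** (matrix_inv (\<Psi> \<tau>) ** A ?p ?q c d ** \<Phi> \<tau>) ** jac c' c p"
    unfolding jac_cocycle[OF d(2) chart_at d(2)] jac_cocycle[OF c(2) chart_at c(2)] jac_self[OF c(2)] jac_self[OF d(2)]
    by simp
  finally show ?thesis .
qed

text \<open>This is M \<mapsto> - M; the arguments use it only through its linearity, so it is never
  computed.\<close>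

definition dinv :: "real^'n^'n \<Rightarrow> real^'n^'n" where
  "dinv M = frechet_derivative matrix_inv (at (mat 1)) M"

definition TO_lie_expr :: "('a \<Rightarrow> 'a \<Rightarrow> ('a, 'n) two_point) \<Rightarrow> ('a, 'n) chart \<Rightarrow> ('a, 'n) chart \<Rightarrow>
    (real^'n) \<times> (real^'n) \<Rightarrow> real^'n^'n" where
  "TO_lie_expr A c d z =
    dinv (dvf d (snd z)) ** A (chart_inv c (fst z)) (chart_inv d (snd z)) c d +
    frechet_derivative (\<lambda>z. A (chart_inv c (fst z)) (chart_inv d (snd z)) c d) (at z) (vf c (fst z), vf d (snd z)) +
    A (chart_inv c (fst z)) (chart_inv d (snd z)) c d ** dvf c (fst z)"

lemma TO_curve_derivative:
  assumes fp: "flow_data c p \<delta>1 y \<Phi>" and fq: "flow_data d q \<delta>2 z \<Psi>" and A: "A \<in> TO_sections \<A>"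
  shows "((\<lambda>\<tau>. matrix_inv (\<Psi> \<tau>) ** A (chart_inv c (y \<tau>)) (chart_inv d (z \<tau>)) c d ** \<Phi> \<tau>)
    has_vector_derivative TO_lie_expr A c d (snd c p, snd d q)) (at 0)"
proof -
  note pD = flow_dataD[OF fp] and qD = flow_dataD[OF fq]
  let ?A = "\<lambda>z. A (chart_inv c (fst z)) (chart_inv d (snd z)) c d"
  have inv: "((\<lambda>\<tau>. matrix_inv (\<Psi> \<tau>)) has_vector_derivative dinv (dvf d (snd d q))) (at 0)"
    using has_vector_derivative_compose_frechet[OF qD(6), of matrix_inv] matrix_inv_differentiable[OF invertible_mat_1]
    by (simp add: qD(5) dinv_def)
  have yz: "((\<lambda>\<tau>. (y \<tau>, z \<tau>)) has_vector_derivative (vf c (snd c p), vf d (snd d q))) (at 0)"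
    by (intro has_vector_derivative_Pair pD(4) qD(4))
  have "?A differentiable (at (y 0, z 0))"
    by (rule smooth_on_differentiable[OF TO_smooth[OF A]]) (use pD qD in auto)
  from has_vector_derivative_compose_frechet[OF yz this]
  have AA: "((\<lambda>\<tau>. A (chart_inv c (y \<tau>)) (chart_inv d (z \<tau>)) c d) has_vector_derivative
      frechet_derivative ?A (at (snd c p, snd d q)) (vf c (snd c p), vf d (snd d q))) (at 0)"
    by (simp add: pD(3) qD(3))
  from bounded_bilinear.has_vector_derivative[OF bounded_bilinear_matrix_mult
      bounded_bilinear.has_vector_derivative[OF bounded_bilinear_matrix_mult inv AA] pD(6)]
  show ?thesis
    by (simp add: TO_lie_expr_def pD(3,5,13) qD(3,5,13) algebra_simps)
qed

lemma TO_lie_eq: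
  assumes c: "c \<in> charts_at \<A> p" and d: "d \<in> charts_at \<A> q" and A: "A \<in> TO_sections \<A>"
    and c': "c' \<in> charts_at \<A> p" and d': "d' \<in> charts_at \<A> q"
  shows "TO_lie \<A> X A p q c' d' = jac d d' q ** TO_lie_expr A c d (snd c p, snd d q) ** jac c' c p"
proof -
  obtain \<delta>1 y \<Phi> where fp: "flow_data c p \<delta>1 y \<Phi>" using flow_data_exists[OF c] by blast
  obtain \<delta>2 z \<Psi> where fq: "flow_data d q \<delta>2 z \<Psi>" using flow_data_exists[OF d] by blast
  have bl: "bounded_linear (\<lambda>M. jac d d' q ** M ** jac c' c p)"
    by (rule bounded_linear_compose[OF bounded_bilinear.bounded_linear_left[OF bounded_bilinear_matrix_mult]
          bounded_bilinear.bounded_linear_right[OF bounded_bilinear_matrix_mult]])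
  have ev: "\<forall>\<^sub>F \<tau> in nhds 0. \<bar>\<tau>\<bar> < \<delta>1" "\<forall>\<^sub>F \<tau> in nhds 0. \<bar>\<tau>\<bar> < \<delta>2"
    using eventually_abs_less flow_dataD(2)[OF fp] flow_dataD(2)[OF fq] by blast+
  have "((\<lambda>\<tau>. TO_pullback \<A> (flow \<A> X \<tau>) A p q c' d') has_vector_derivative
      jac d d' q ** TO_lie_expr A c d (snd c p, snd d q) ** jac c' c p) (at 0)"
    by (rule has_vector_derivative_eventually[OF bounded_linear.has_vector_derivative[OF bl TO_curve_derivative[OF fp fq A]]])
       (use ev in eventually_elim, simp add: TO_pullback_flow[OF fp fq _ _ A c' d'])
  then show ?thesis
    unfolding TO_lie_def by (rule vector_derivative_at)
qed

lemma TO_lie_eq_self: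
  assumes c: "c \<in> charts_at \<A> p" and d: "d \<in> charts_at \<A> q" and A: "A \<in> TO_sections \<A>"
  shows "TO_lie \<A> X A p q c d = TO_lie_expr A c d (snd c p, snd d q)"
  using TO_lie_eq[OF c d A c d] by (simp add: jac_self[OF c] jac_self[OF d])

lemma dinv_linear: "bounded_linear dinv"
proof -
  have "(matrix_inv has_derivative dinv) (at (mat 1))"
    using matrix_inv_differentiable[OF invertible_mat_1] unfolding frechet_derivative_works dinv_def by simp
  then show ?thesis by (rule has_derivative_bounded_linear)
qed

lemma TO_lie_sections:
  assumes A: "A \<in> TO_sections \<A>"
  shows "TO_lie \<A> X A \<in> TO_sections \<A>"
proof (rule TO_sectionsI[where B = "\<lambda>p q. TO_lie_expr A (chart_at \<A> p) (chart_at \<A> q)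
    (snd (chart_at \<A> p) p, snd (chart_at \<A> q) q)"])
  fix p q c' d' assume "c' \<in> charts_at \<A> p" "d' \<in> charts_at \<A> q"
  then show "TO_lie \<A> X A p q c' d' = jac (chart_at \<A> q) d' q ** TO_lie_expr A (chart_at \<A> p) (chart_at \<A> q)
      (snd (chart_at \<A> p) p, snd (chart_at \<A> q) q) ** jac c' (chart_at \<A> p) p"
    by (rule TO_lie_eq[OF chart_at chart_at A])
next
  fix p q c d assume "c \<notin> charts_at \<A> p \<or> d \<notin> charts_at \<A> q"
  then have "TO_pullback \<A> (flow \<A> X \<tau>) A p q c d = 0" for \<tau> by (auto simp: TO_pullback_def)
  then show "TO_lie \<A> X A p q c d = 0"
    unfolding TO_lie_def by (simp add: vector_derivative_at[OF has_vector_derivative_const])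
next
  fix c d assume cd: "c \<in> \<A>" "d \<in> \<A>"
  let ?U = "img c \<times> img d"
  have op: "open ?U" by (intro open_Times open_chart cd)
  have s1: "smooth_on ?U (\<lambda>z. g (fst z))" if "smooth_on (img c) g" for g :: "real^'n \<Rightarrow> 'b::euclidean_space"
    by (rule smooth_on_compose[OF op open_chart(2)[OF cd(1)] that smooth_on_fst[OF op]]) auto
  have s2: "smooth_on ?U (\<lambda>z. g (snd z))" if "smooth_on (img d) g" for g :: "real^'n \<Rightarrow> 'b::euclidean_space"
    by (rule smooth_on_compose[OF op open_chart(2)[OF cd(2)] that smooth_on_snd[OF op]]) auto
  have "smooth_on ?U (TO_lie_expr A c d)"
    unfolding TO_lie_expr_def
    by (intro smooth_on_add op smooth_on_bilinear[OF op bounded_bilinear_matrix_mult]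
        smooth_on_bounded_linear[OF op dinv_linear] s1 s2 dvf_smooth vf_smooth smooth_on_frechet_apply smooth_on_Pair
        TO_smooth A cd)
  then show "smooth_on ?U (\<lambda>z. TO_lie \<A> X A (chart_inv c (fst z)) (chart_inv d (snd z)) c d)"
  proof (rule iffD2[OF smooth_on_cong[OF op], rotated])
    fix z assume "z \<in> ?U"
    then have "fst z \<in> img c" "snd z \<in> img d" by auto
    then show "TO_lie \<A> X A (chart_inv c (fst z)) (chart_inv d (snd z)) c d = TO_lie_expr A c d z"
      using cd by (simp add: TO_lie_eq_self[OF _ _ A] chart_inv_charts_at chart_inv_right)
  qed
qed

end

section \<open>Limits and continuity for (LF)-topologies\<close>

text \<open>Sections form a small subspace of the type of all functions, so vector space and
  seminorm axioms are stated relative to a carrier set.\<close>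

definition vsub :: "'v::real_vector set \<Rightarrow> bool" where
  "vsub E \<longleftrightarrow> 0 \<in> E \<and> (\<forall>x\<in>E. \<forall>y\<in>E. x + y \<in> E) \<and> (\<forall>a. \<forall>x\<in>E. a *\<^sub>R x \<in> E)"

definition seminorm_on :: "'v::real_vector set \<Rightarrow> ('v \<Rightarrow> real) \<Rightarrow> bool" where
  "seminorm_on E N \<longleftrightarrow> (\<forall>x\<in>E. \<forall>y\<in>E. N (x + y) \<le> N x + N y) \<and> (\<forall>a. \<forall>x\<in>E. N (a *\<^sub>R x) = \<bar>a\<bar> * N x)"

lemma vsub_diff: "vsub E \<Longrightarrow> x \<in> E \<Longrightarrow> y \<in> E \<Longrightarrow> x - y \<in> E"
proof -
  assume "vsub E" "x \<in> E" "y \<in> E"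
  then have "x + (-1) *\<^sub>R y \<in> E" unfolding vsub_def by blast
  then show ?thesis by simp
qed

lemma seminorm_on_nonneg:
  assumes "vsub E" "seminorm_on E N" "x \<in> E"
  shows "N 0 = 0" "N x \<ge> 0"
proof -
  have s: "\<And>x y. x \<in> E \<Longrightarrow> y \<in> E \<Longrightarrow> N (x + y) \<le> N x + N y" "\<And>a x. x \<in> E \<Longrightarrow> N (a *\<^sub>R x) = \<bar>a\<bar> * N x"
    using assms(2) unfolding seminorm_on_def by auto
  show 0: "N 0 = 0" using s(2)[of x 0] assms(3) by simp
  have "(-1) *\<^sub>R x \<in> E" using assms(1,3) unfolding vsub_def by blast
  from s(1)[OF assms(3) this] s(2)[OF assms(3), of "-1"] show "N x \<ge> 0"
    using 0 by simp
qed

lemma topspace_lf: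
  assumes "vsub (\<Union>\<F>)"
  shows "topspace (lf_topology P \<F>) = \<Union>\<F>"
proof (rule antisym)
  have "seminorm_nhd_0 P F UNIV" for F
    unfolding seminorm_nhd_0_def by (intro exI[of _ "{}"] exI[of _ 1]) auto
  then have "lf_open P \<F> (\<Union>\<F>)"
    unfolding lf_open_def using assms by (auto simp: vsub_def intro!: exI[of _ UNIV])
  then show "\<Union>\<F> \<subseteq> topspace (lf_topology P \<F>)"
    using openin_subset openin_lf_topology by blast
  have "lf_open P \<F> (topspace (lf_topology P \<F>))"
    using openin_topspace openin_lf_topology by blast
  then show "topspace (lf_topology P \<F>) \<subseteq> \<Union>\<F>"
    unfolding lf_open_def by blast
qed

text \<open>Balls of a seminorm are convex, and \<open>nhd\<close> says that they meet every step of
  the inductive limit in a neighbourhood of 0; the triangle inequality moves the centre.\<close>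

lemma lf_open_seminorm_ball:
  assumes E: "vsub (\<Union>\<F>)" and N: "seminorm_on (\<Union>\<F>) N"
    and nhd: "\<And>F e. F \<in> \<F> \<Longrightarrow> e > 0 \<Longrightarrow> seminorm_nhd_0 P F {y \<in> \<Union>\<F>. N y < e}"
    and l: "l \<in> \<Union>\<F>"
  shows "lf_open P \<F> {x \<in> \<Union>\<F>. N (x - l) < e}"
  unfolding lf_open_def
proof (intro conjI ballI)
  fix x assume x: "x \<in> {x \<in> \<Union>\<F>. N (x - l) < e}"
  define \<epsilon> where "\<epsilon> = e - N (x - l)"
  have \<epsilon>: "\<epsilon> > 0" using x by (simp add: \<epsilon>_def)
  have add: "\<And>x y. x \<in> \<Union>\<F> \<Longrightarrow> y \<in> \<Union>\<F> \<Longrightarrow> N (x + y) \<le> N x + N y"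
    and sc: "\<And>a x. x \<in> \<Union>\<F> \<Longrightarrow> N (a *\<^sub>R x) = \<bar>a\<bar> * N x"
    using N unfolding seminorm_on_def by auto
  have Ea: "\<And>x y. x \<in> \<Union>\<F> \<Longrightarrow> y \<in> \<Union>\<F> \<Longrightarrow> x + y \<in> \<Union>\<F>" and Es: "\<And>a x. x \<in> \<Union>\<F> \<Longrightarrow> a *\<^sub>R x \<in> \<Union>\<F>"
    using E unfolding vsub_def by auto
  show "\<exists>U. convex U \<and> (\<forall>F\<in>\<F>. seminorm_nhd_0 P F U) \<and> (\<forall>y\<in>U \<inter> \<Union>\<F>. x + y \<in> {x \<in> \<Union>\<F>. N (x - l) < e})"
  proof (intro exI[of _ "{y \<in> \<Union>\<F>. N y < \<epsilon>}"] conjI ballI nhd \<epsilon>)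
    show "convex {y \<in> \<Union>\<F>. N y < \<epsilon>}"
    proof (rule convexI, intro CollectI conjI)
      fix y z and a b :: real
      assume y: "y \<in> {y \<in> \<Union>\<F>. N y < \<epsilon>}" and z: "z \<in> {y \<in> \<Union>\<F>. N y < \<epsilon>}" and ab: "0 \<le> a" "0 \<le> b" "a + b = 1"
      have yE: "y \<in> \<Union>\<F>" and zE: "z \<in> \<Union>\<F>" using y z by blast+
      show "a *\<^sub>R y + b *\<^sub>R z \<in> \<Union>\<F>" by (intro Ea Es yE zE)
      have "N (a *\<^sub>R y + b *\<^sub>R z) \<le> a * N y + b * N z"
        using add[OF Es[OF yE, of a] Es[OF zE, of b]] ab sc[OF yE, of a] sc[OF zE, of b] by simp
      also have "\<dots> < \<epsilon>"
        using y z ab by (intro convex_bound_lt) auto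
      finally show "N (a *\<^sub>R y + b *\<^sub>R z) < \<epsilon>" .
    qed
    fix y assume y: "y \<in> {y \<in> \<Union>\<F>. N y < \<epsilon>} \<inter> \<Union>\<F>"
    have "N ((x - l) + y) \<le> N (x - l) + N y"
      by (rule add) (use x y l vsub_diff[OF E] in auto)
    then show "x + y \<in> {x \<in> \<Union>\<F>. N (x - l) < e}"
      using x y Ea by (auto simp: \<epsilon>_def algebra_simps)
  qed
qed auto

text \<open>Apart from membership in the underlying space, convergence in an (LF)-topology is
  exploited solely by testing it against seminorms that are continuous on each step.\<close>

lemma lf_limit_seminorm:
  assumes E: "vsub (\<Union>\<F>)" and N: "seminorm_on (\<Union>\<F>) N"
    and nhd: "\<And>F e. F \<in> \<F> \<Longrightarrow> e > 0 \<Longrightarrow> seminorm_nhd_0 P F {y \<in> \<Union>\<F>. N y < e}"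
    and lim: "limitin (lf_topology P \<F>) \<psi> l G"
  shows "((\<lambda>h. N (\<psi> h - l)) \<longlongrightarrow> 0) G"
proof (rule tendstoI)
  fix e :: real assume e: "e > 0"
  have l: "l \<in> \<Union>\<F>" using limitin_topspace[OF lim] topspace_lf[OF E] by blast
  let ?W = "{x \<in> \<Union>\<F>. N (x - l) < e}"
  have "openin (lf_topology P \<F>) ?W"
    unfolding openin_lf_topology by (rule lf_open_seminorm_ball[OF E N nhd l])
  moreover have "l \<in> ?W" using l e seminorm_on_nonneg[OF E N l] by simp
  ultimately have "\<forall>\<^sub>F h in G. \<psi> h \<in> ?W"
    using lim unfolding limitin_def by blast
  then show "\<forall>\<^sub>F h in G. dist (N (\<psi> h - l)) 0 < e"
  proof eventually_elim
    case (elim h)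
    then show ?case
      using seminorm_on_nonneg(2)[OF E N vsub_diff[OF E _ l]] by auto
  qed
qed

text \<open>The absolute value of v is itself a seminorm, and the preimage of an open set is a union
  of its balls.\<close>

lemma lf_continuousI:
  assumes E: "vsub (\<Union>\<F>)"
    and add: "\<And>x y. x \<in> \<Union>\<F> \<Longrightarrow> y \<in> \<Union>\<F> \<Longrightarrow> v (x + y) = v x + v y"
    and sc: "\<And>a x. x \<in> \<Union>\<F> \<Longrightarrow> v (a *\<^sub>R x) = a * v x"
    and nhd: "\<And>F e. F \<in> \<F> \<Longrightarrow> e > 0 \<Longrightarrow> seminorm_nhd_0 P F {y \<in> \<Union>\<F>. \<bar>v y\<bar> < e}"
  shows "continuous_map (lf_topology P \<F>) euclideanreal v"
  unfolding continuous_map_def topspace_lf[OF E]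
proof (intro conjI allI impI)
  fix W :: "real set" assume "openin euclidean W"
  then have W: "open W" by simp
  have N: "seminorm_on (\<Union>\<F>) (\<lambda>y. \<bar>v y\<bar>)"
    unfolding seminorm_on_def by (auto simp: add sc abs_mult simp del: Union_iff)
  show "openin (lf_topology P \<F>) {x \<in> \<Union>\<F>. v x \<in> W}"
  proof (subst openin_subopen, intro ballI)
    fix x assume x: "x \<in> {x \<in> \<Union>\<F>. v x \<in> W}"
    then obtain e where e: "e > 0" "\<And>y. dist y (v x) < e \<Longrightarrow> y \<in> W"
      using W unfolding open_dist by blast
    let ?B = "{y \<in> \<Union>\<F>. \<bar>v (y - x)\<bar> < e}"
    have v0: "v (0 *\<^sub>R x) = 0" using sc[of x 0] x by simp
    have "openin (lf_topology P \<F>) ?B"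
      unfolding openin_lf_topology by (rule lf_open_seminorm_ball[OF E N nhd]) (use x in auto)
    moreover have "x \<in> ?B" using x e v0 by simp
    moreover have "?B \<subseteq> {x \<in> \<Union>\<F>. v x \<in> W}"
    proof
      fix y assume y: "y \<in> ?B"
      have xE: "x \<in> \<Union>\<F>" and yE: "y \<in> \<Union>\<F>" using x y by blast+
      have "(-1) *\<^sub>R x \<in> \<Union>\<F>" using E xE unfolding vsub_def by blast
      from add[OF yE this] have "v (y + (-1) *\<^sub>R x) = v y + (-1) * v x"
        by (simp only: sc[OF xE])
      then have "dist (v y) (v x) < e" using y by (simp add: dist_real_def)
      then show "y \<in> {x \<in> \<Union>\<F>. v x \<in> W}" using e(2) y by blast
    qed
    ultimately show "\<exists>T. openin (lf_topology P \<F>) T \<and> x \<in> T \<and> T \<subseteq> {x \<in> \<Union>\<F>. v x \<in> W}"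
      by blast
  qed
qed auto

lemma lf_continuousD:
  assumes E: "vsub (\<Union>\<F>)" and v: "continuous_map (lf_topology P \<F>) euclideanreal v" and v0: "v 0 = 0"
    and F: "F \<in> \<F>" "e > 0"
  shows "\<exists>S d. finite S \<and> S \<subseteq> P \<and> d > 0 \<and> (\<forall>y\<in>F. (\<forall>\<rho>\<in>S. \<rho> y < d) \<longrightarrow> \<bar>v y\<bar> < e)"
proof -
  have "openin (lf_topology P \<F>) {x \<in> \<Union>\<F>. v x \<in> ball 0 e}"
  proof -
    have "openin euclideanreal (ball 0 e)" by simp
    then show ?thesis using v unfolding continuous_map_def topspace_lf[OF E] by blast
  qed
  moreover have "0 \<in> {x \<in> \<Union>\<F>. v x \<in> ball 0 e}"
    using E v0 F unfolding vsub_def by auto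
  ultimately obtain U where U: "seminorm_nhd_0 P F U" "\<And>y. y \<in> U \<inter> \<Union>\<F> \<Longrightarrow> 0 + y \<in> {x \<in> \<Union>\<F>. v x \<in> ball 0 e}"
    unfolding openin_lf_topology lf_open_def using F(1) by blast
  obtain S d where "finite S" "S \<subseteq> P" "d > 0" "{y \<in> F. \<forall>\<rho>\<in>S. \<rho> y < d} \<subseteq> U"
    using U(1) unfolding seminorm_nhd_0_def by blast
  moreover have "\<bar>v y\<bar> < e" if "y \<in> U" "y \<in> F" for y
    using U(2)[of y] that F(1) by (auto simp: dist_real_def)
  ultimately show ?thesis by blast
qed

text \<open>The quantitative form of continuity on a single step F. Unlike the neighbourhood
  condition it is stable under sums and multiples, and \<open>dominated_nhd\<close> converts it
  back.\<close>

definition dominated :: "('v \<Rightarrow> real) set \<Rightarrow> 'v set \<Rightarrow> ('v \<Rightarrow> real) \<Rightarrow> bool" where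
  "dominated P F g \<longleftrightarrow> (\<exists>S C. finite S \<and> S \<subseteq> P \<and> C \<ge> 0 \<and> (\<forall>y\<in>F. g y \<le> C * (\<Sum>\<rho>\<in>S. \<rho> y)))"

lemma dominated_zero: "dominated P F (\<lambda>y. 0)"
  unfolding dominated_def by (intro exI[of _ "{}"] exI[of _ 0]) auto

lemma dominated_mem: "\<rho> \<in> P \<Longrightarrow> dominated P F \<rho>"
  unfolding dominated_def by (intro exI[of _ "{\<rho>}"] exI[of _ 1]) auto

lemma dominated_le:
  assumes "dominated P F g" "\<And>y. y \<in> F \<Longrightarrow> f y \<le> g y"
  shows "dominated P F f"
  using assms unfolding dominated_def by (meson order_trans)

lemma dominated_mult:
  assumes "dominated P F g" "a \<ge> 0"
  shows "dominated P F (\<lambda>y. a * g y)"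
proof -
  obtain S C where "finite S" "S \<subseteq> P" "C \<ge> 0" "\<forall>y\<in>F. g y \<le> C * (\<Sum>\<rho>\<in>S. \<rho> y)"
    using assms(1) unfolding dominated_def by blast
  then show ?thesis
    unfolding dominated_def using assms(2)
    by (intro exI[of _ S] exI[of _ "a * C"]) (auto simp: mult.assoc intro!: mult_left_mono)
qed

lemma dominated_add:
  assumes pos: "\<And>\<rho> y. \<rho> \<in> P \<Longrightarrow> y \<in> F \<Longrightarrow> \<rho> y \<ge> 0"
    and f: "dominated P F f" and g: "dominated P F g"
  shows "dominated P F (\<lambda>y. f y + g y)"
proof -
  obtain S C where S: "finite S" "S \<subseteq> P" "C \<ge> 0" "\<And>y. y \<in> F \<Longrightarrow> f y \<le> C * (\<Sum>\<rho>\<in>S. \<rho> y)"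
    using f unfolding dominated_def by blast
  obtain S' C' where S': "finite S'" "S' \<subseteq> P" "C' \<ge> 0" "\<And>y. y \<in> F \<Longrightarrow> g y \<le> C' * (\<Sum>\<rho>\<in>S'. \<rho> y)"
    using g unfolding dominated_def by blast
  have "f y + g y \<le> (C + C') * (\<Sum>\<rho>\<in>S \<union> S'. \<rho> y)" if y: "y \<in> F" for y
  proof -
    have "(\<Sum>\<rho>\<in>S. \<rho> y) \<le> (\<Sum>\<rho>\<in>S \<union> S'. \<rho> y)" "(\<Sum>\<rho>\<in>S'. \<rho> y) \<le> (\<Sum>\<rho>\<in>S \<union> S'. \<rho> y)"
      using S S' pos y by (auto intro!: sum_mono2)
    then have "C * (\<Sum>\<rho>\<in>S. \<rho> y) + C' * (\<Sum>\<rho>\<in>S'. \<rho> y) \<le> C * (\<Sum>\<rho>\<in>S \<union> S'. \<rho> y) + C' * (\<Sum>\<rho>\<in>S \<union> S'. \<rho> y)"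
      using S S' by (intro add_mono mult_left_mono) auto
    then show ?thesis using S(4)[OF y] S'(4)[OF y] by (simp add: algebra_simps)
  qed
  then show ?thesis
    unfolding dominated_def using S S' by (intro exI[of _ "S \<union> S'"] exI[of _ "C + C'"]) auto
qed

lemma dominated_sum:
  assumes pos: "\<And>\<rho> y. \<rho> \<in> P \<Longrightarrow> y \<in> F \<Longrightarrow> \<rho> y \<ge> 0"
    and "\<And>i. i \<in> I \<Longrightarrow> dominated P F (f i)"
  shows "dominated P F (\<lambda>y. \<Sum>i\<in>I. f i y)"
  using assms(2)
proof (induction I rule: infinite_finite_induct)
  case (insert i I)
  have "dominated P F (\<lambda>y. f i y + (\<Sum>i\<in>I. f i y))"
    by (rule dominated_add) (use pos insert in auto)
  then show ?case using insert.hyps by simp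
qed (simp_all add: dominated_zero)

lemma dominated_nhd:
  assumes "dominated P F g" "e > 0" "F \<subseteq> E"
  shows "seminorm_nhd_0 P F {y \<in> E. g y < e}"
proof -
  obtain S C where S: "finite S" "S \<subseteq> P" "C \<ge> 0" "\<And>y. y \<in> F \<Longrightarrow> g y \<le> C * (\<Sum>\<rho>\<in>S. \<rho> y)"
    using assms(1) unfolding dominated_def by blast
  \<comment> \<open>The added ones keep the denominator positive when C or the cardinality of S is
    0, and make the final estimate strict.\<close>
  define d where "d = e / ((C + 1) * (real (card S) + 1))"
  have d: "d > 0" using S assms(2) by (simp add: d_def)
  have "g y < e" if y: "y \<in> F" "\<forall>\<rho>\<in>S. \<rho> y < d" for y
  proof -
    have "(\<Sum>\<rho>\<in>S. \<rho> y) \<le> (\<Sum>\<rho>\<in>S. d)" using y by (intro sum_mono) auto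
    also have "\<dots> = real (card S) * d" by simp
    finally have "g y \<le> C * (real (card S) * d)"
      using S(4)[OF y(1)] mult_left_mono[OF _ S(3)] order_trans by blast
    also have "\<dots> < (C + 1) * ((real (card S) + 1) * d)"
      using S(3) d by (intro mult_strict_mono' mult_strict_right_mono) auto
    also have "\<dots> = e" using S(3) by (simp add: d_def)
    finally show ?thesis .
  qed
  then show ?thesis
    unfolding seminorm_nhd_0_def using S d assms(3) by (intro exI[of _ S] exI[of _ d]) auto
qed

definition supn :: "'i set \<Rightarrow> ('i \<Rightarrow> 'b::real_normed_vector) \<Rightarrow> real" where
  "supn K f = (SUP p\<in>K. norm (f p))"

lemma supn_upper:
  assumes "compact K" "continuous_on K f" "p \<in> K"
  shows "norm (f p) \<le> supn K f"
proof -
  have "bounded (f ` K)" using assms(1,2) compact_continuous_image compact_imp_bounded by blast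
  then have "bdd_above ((\<lambda>p. norm (f p)) ` K)" unfolding bounded_iff bdd_above_def by blast
  then show ?thesis unfolding supn_def using assms(3) by (rule cSUP_upper2[OF _ _ order_refl])
qed

lemma supn_least: "K \<noteq> {} \<Longrightarrow> (\<And>p. p \<in> K \<Longrightarrow> norm (f p) \<le> B) \<Longrightarrow> supn K f \<le> B"
  unfolding supn_def by (rule cSUP_least)

lemma supn_add:
  assumes "compact K" "K \<noteq> {}" "continuous_on K f" "continuous_on K g"
  shows "supn K (\<lambda>p. f p + g p) \<le> supn K f + supn K g"
  using supn_upper[OF assms(1,3)] supn_upper[OF assms(1,4)]
  by (intro supn_least assms(2) order_trans[OF norm_triangle_ineq] add_mono)

lemma supn_scaleR:
  fixes f :: "'i::topological_space \<Rightarrow> 'b::real_normed_vector"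
  assumes K: "compact K" "K \<noteq> {}" "continuous_on K f"
  shows "supn K (\<lambda>p. a *\<^sub>R f p) = \<bar>a\<bar> * supn K f"
proof -
  have le: "supn K (\<lambda>p. a *\<^sub>R f p) \<le> \<bar>a\<bar> * supn K f" if "continuous_on K f" for a and f :: "'i \<Rightarrow> 'b"
    using supn_upper[OF K(1) that] by (intro supn_least K(2)) (simp add: mult_left_mono)
  show ?thesis
  proof (cases "a = 0")
    case True
    then show ?thesis using K(2) by (simp add: supn_def)
  next
    case False
    have "supn K (\<lambda>p. inverse a *\<^sub>R (a *\<^sub>R f p)) \<le> \<bar>inverse a\<bar> * supn K (\<lambda>p. a *\<^sub>R f p)"
      by (rule le) (intro continuous_on_scaleR continuous_on_const K)
    then have "supn K f \<le> \<bar>inverse a\<bar> * supn K (\<lambda>p. a *\<^sub>R f p)" using False by simp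
    then have "\<bar>a\<bar> * supn K f \<le> \<bar>a\<bar> * (\<bar>inverse a\<bar> * supn K (\<lambda>p. a *\<^sub>R f p))"
      by (rule mult_left_mono) simp
    also have "\<dots> = supn K (\<lambda>p. a *\<^sub>R f p)" using False by (simp add: abs_mult[symmetric] mult.assoc[symmetric])
    finally show ?thesis using le[OF K(3), of a] by linarith
  qed
qed

section \<open>Seminorms of sections and the bound for distributions\<close>

context manifold
begin

lemma vsub_csections: "vsub (tensor_csections \<A> r s w)"
  unfolding vsub_def using csections_zero csections_add csections_scaleR by blast

lemma topspace_tensor_lf: "topspace (tensor_lf \<A> r s w) = tensor_csections \<A> r s w"
  unfolding tensor_lf_def csections_Union
  by (rule topspace_lf) (rule vsub_csections[unfolded csections_Union])

definition tsn :: "('a, 'n) chart \<Rightarrow> 'a set \<Rightarrow> 'n list \<Rightarrow> 'n list \<Rightarrow> (real^'n) list \<Rightarrow>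
    ('a \<Rightarrow> ('a, 'n) tensor) \<Rightarrow> real" where
  "tsn c K I J vs t = supn K (\<lambda>p. partials vs (\<lambda>x. t (chart_inv c x) c I J) (snd c p))"

lemma tsn_seminorms:
  "tensor_seminorms \<A> = {tsn c K I J vs | c K I J vs. c \<in> \<A> \<and> compact K \<and> K \<noteq> {} \<and> K \<subseteq> fst c \<and> set vs \<subseteq> Basis}"
  unfolding tensor_seminorms_def tsn_def[abs_def] supn_def real_norm_def ..

lemma tsn_mem: "c \<in> \<A> \<Longrightarrow> compact K \<Longrightarrow> K \<noteq> {} \<Longrightarrow> K \<subseteq> fst c \<Longrightarrow> set vs \<subseteq> Basis \<Longrightarrow> tsn c K I J vs \<in> tensor_seminorms \<A>"
  unfolding tsn_seminorms by blast

lemma partials_chart_continuous: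
  assumes "c \<in> \<A>" "K \<subseteq> fst c" "smooth_on (img c) f"
  shows "continuous_on K (\<lambda>p. partials vs f (snd c p))"
  by (rule continuous_on_compose2[OF smooth_on_continuous_on[OF smooth_on_partials[OF open_chart(2) assms(3)]]
        continuous_on_subset[OF continuous_on_chart assms(2)]]) (use assms in auto)

lemma tsn_seminorm:
  assumes c: "c \<in> \<A>" and K: "compact K" "K \<noteq> {}" "K \<subseteq> fst c"
  shows "seminorm_on (tensor_sections \<A> r s w) (tsn c K I J vs)"
  unfolding seminorm_on_def
proof (intro conjI ballI allI)
  fix t u a assume t: "t \<in> tensor_sections \<A> r s w"
  note ct = partials_chart_continuous[OF c K(3) section_smooth[OF t c]]
  have inI: "snd c p \<in> img c" if "p \<in> K" for p using that K by auto
  have "tsn c K I J vs (a *\<^sub>R t) = supn K (\<lambda>p. a *\<^sub>R partials vs (\<lambda>x. t (chart_inv c x) c I J) (snd c p))"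
    unfolding tsn_def supn_def
    using partials_scaleR[OF open_chart(2)[OF c] section_smooth[OF t c] inI, of _ vs a I J] by simp
  also have "\<dots> = \<bar>a\<bar> * tsn c K I J vs t"
    unfolding tsn_def by (rule supn_scaleR[OF K(1,2) ct])
  finally show "tsn c K I J vs (a *\<^sub>R t) = \<bar>a\<bar> * tsn c K I J vs t" .
  assume u: "u \<in> tensor_sections \<A> r s w"
  note cu = partials_chart_continuous[OF c K(3) section_smooth[OF u c]]
  have "tsn c K I J vs (t + u) = supn K (\<lambda>p. partials vs (\<lambda>x. t (chart_inv c x) c I J) (snd c p) +
      partials vs (\<lambda>x. u (chart_inv c x) c I J) (snd c p))"
    unfolding tsn_def supn_def
    using partials_add[OF open_chart(2)[OF c] section_smooth[OF t c] section_smooth[OF u c] inI, of _ vs I J I J] by simp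
  also have "\<dots> \<le> tsn c K I J vs t + tsn c K I J vs u"
    unfolding tsn_def by (rule supn_add[OF K(1,2) ct cu])
  finally show "tsn c K I J vs (t + u) \<le> tsn c K I J vs t + tsn c K I J vs u" .
qed

lemma vsub_sections: "vsub (tensor_sections \<A> r s w)"
  unfolding vsub_def using sections_zero sections_add sections_scaleR by blast

lemma seminorms_pos: "\<rho> \<in> tensor_seminorms \<A> \<Longrightarrow> y \<in> tensor_sections \<A> r s w \<Longrightarrow> \<rho> y \<ge> 0"
proof -
  assume \<rho>: "\<rho> \<in> tensor_seminorms \<A>" and y: "y \<in> tensor_sections \<A> r s w"
  then obtain c K I J vs where "\<rho> = tsn c K I J vs" "c \<in> \<A>" "compact K" "K \<noteq> {}" "K \<subseteq> fst c"
    unfolding tsn_seminorms by blast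
  then show ?thesis
    using seminorm_on_nonneg(2)[OF vsub_sections tsn_seminorm y] by simp
qed

lemma seminorms_scale:
  "\<rho> \<in> tensor_seminorms \<A> \<Longrightarrow> y \<in> tensor_sections \<A> r s w \<Longrightarrow> \<rho> (a *\<^sub>R y) = \<bar>a\<bar> * \<rho> y"
proof -
  assume \<rho>: "\<rho> \<in> tensor_seminorms \<A>" and y: "y \<in> tensor_sections \<A> r s w"
  then obtain c K I J vs where "\<rho> = tsn c K I J vs" "c \<in> \<A>" "compact K" "K \<noteq> {}" "K \<subseteq> fst c"
    unfolding tsn_seminorms by blast
  then show ?thesis
    using tsn_seminorm[of c K r s w I J vs] y unfolding seminorm_on_def by simp
qed

lemma distribution_linear:
  assumes "v \<in> distributions \<A> r s" "\<sigma> \<in> tensor_csections \<A> s r 1"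
  shows "\<tau> \<in> tensor_csections \<A> s r 1 \<Longrightarrow> v (\<sigma> + \<tau>) = v \<sigma> + v \<tau>" "v (a *\<^sub>R \<sigma>) = a * v \<sigma>"
  using assms unfolding distributions_def by auto

lemma distribution_zero: "v \<in> distributions \<A> r s \<Longrightarrow> v 0 = 0"
  using distribution_linear(2)[of v r s 0 0] csections_zero by simp

lemma distribution_sum:
  assumes "v \<in> distributions \<A> r s" "\<And>i. i \<in> I \<Longrightarrow> \<sigma> i \<in> tensor_csections \<A> s r 1"
  shows "v (\<Sum>i\<in>I. a i *\<^sub>R \<sigma> i) = (\<Sum>i\<in>I. a i * v (\<sigma> i))"
  using assms(2)
  by (induction I rule: infinite_finite_induct)
     (auto simp: distribution_zero[OF assms(1)] distribution_linear[OF assms(1)] csections_sum csections_scaleR)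

text \<open>Continuity at 0 gives \<open>\<bar>v y\<bar> < 1\<close> where finitely many seminorms
  are below d; homogeneity of v and of the seminorms turns this into a linear estimate by their
  sum.\<close>

lemma distribution_bound:
  assumes v: "v \<in> distributions \<A> r s" and K: "compact K"
  shows "dominated (tensor_seminorms \<A>) (tensor_sections_in \<A> s r 1 K) (\<lambda>y. \<bar>v y\<bar>)"
proof -
  let ?F = "tensor_sections_in \<A> s r 1 K" and ?P = "tensor_seminorms \<A>"
  have "continuous_map (lf_topology ?P (tensor_sections_in \<A> s r 1 ` {K. compact K})) euclideanreal v"
    using v unfolding distributions_def tensor_lf_def by blast
  moreover have "vsub (\<Union> (tensor_sections_in \<A> s r 1 ` {K. compact K}))"
    using vsub_csections unfolding csections_Union .
  ultimately have "\<exists>S d. finite S \<and> S \<subseteq> ?P \<and> d > 0 \<and> (\<forall>y\<in>?F. (\<forall>\<rho>\<in>S. \<rho> y < d) \<longrightarrow> \<bar>v y\<bar> < 1)"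
    by (intro lf_continuousD distribution_zero[OF v]) (use K in auto)
  then obtain S d where "finite S \<and> S \<subseteq> ?P \<and> d > 0 \<and> (\<forall>y\<in>?F. (\<forall>\<rho>\<in>S. \<rho> y < d) \<longrightarrow> \<bar>v y\<bar> < 1)"
    by (elim exE)
  then have S: "finite S" "S \<subseteq> ?P" "d > 0"
    "\<And>y. y \<in> ?F \<Longrightarrow> (\<And>\<rho>. \<rho> \<in> S \<Longrightarrow> \<rho> y < d) \<Longrightarrow> \<bar>v y\<bar> < 1"
    by simp_all
  have "\<bar>v y\<bar> \<le> (1 / d) * (\<Sum>\<rho>\<in>S. \<rho> y)" if y: "y \<in> ?F" for y
  proof -
    have ys: "y \<in> tensor_sections \<A> s r 1" using y unfolding tensor_sections_in_def by blast
    have yc: "y \<in> tensor_csections \<A> s r 1" using y K csections_iff by blast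
    define R where "R = (\<Sum>\<rho>\<in>S. \<rho> y)"
    have pos: "\<rho> y \<ge> 0" if "\<rho> \<in> S" for \<rho> using seminorms_pos S(2) that ys by blast
    \<comment> \<open>The number m lies strictly above R because R may be 0; multiplying y by d / m
      brings all seminorms in S below d. The bound by R itself follows with
      \<open>dense_ge\<close>.\<close>
    have "\<bar>v y\<bar> \<le> m / d" if m: "R < m" for m
    proof -
      have R0: "R \<ge> 0" unfolding R_def by (intro sum_nonneg pos)
      have "\<bar>v ((d / m) *\<^sub>R y)\<bar> < 1"
      proof (rule S(4))
        show "(d / m) *\<^sub>R y \<in> ?F" by (rule sections_in_scaleR[OF K y])
        fix \<rho> assume \<rho>: "\<rho> \<in> S"
        have "\<rho> y \<le> R" unfolding R_def by (rule member_le_sum[OF \<rho> _ S(1)]) (use pos in auto)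
        then have "(d / m) * \<rho> y < (d / m) * m"
          using m R0 S(3) by (intro mult_strict_left_mono) auto
        then show "\<rho> ((d / m) *\<^sub>R y) < d"
          using seminorms_scale[OF subsetD[OF S(2) \<rho>] ys, of "d / m"] m R0 S(3) by simp
      qed
      then show ?thesis
        using distribution_linear(2)[OF v yc] m R0 S(3) by (simp add: abs_mult field_simps)
    qed
    then have "d * \<bar>v y\<bar> \<le> m" if "R < m" for m
      using that S(3) by (simp add: field_simps)
    then have "d * \<bar>v y\<bar> \<le> R" by (rule dense_ge)
    then show ?thesis using S(3) by (simp add: R_def field_simps)
  qed
  then show ?thesis unfolding dominated_def using S by (intro exI[of _ S] exI[of _ "1 / d"]) auto
qed

lemma distributionI:
  assumes add: "\<And>\<sigma> \<tau>. \<sigma> \<in> tensor_csections \<A> s r 1 \<Longrightarrow> \<tau> \<in> tensor_csections \<A> s r 1 \<Longrightarrow> v (\<sigma> + \<tau>) = v \<sigma> + v \<tau>"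
    and sc: "\<And>a \<sigma>. \<sigma> \<in> tensor_csections \<A> s r 1 \<Longrightarrow> v (a *\<^sub>R \<sigma>) = a * v \<sigma>"
    and dom: "\<And>K. compact K \<Longrightarrow> dominated (tensor_seminorms \<A>) (tensor_sections_in \<A> s r 1 K) (\<lambda>y. \<bar>v y\<bar>)"
  shows "v \<in> distributions \<A> r s"
proof -
  have "continuous_map (tensor_lf \<A> s r 1) euclideanreal v"
    unfolding tensor_lf_def
  proof (rule lf_continuousI, unfold csections_Union[symmetric])
    fix F e assume "F \<in> tensor_sections_in \<A> s r 1 ` {K. compact K}" "(e::real) > 0"
    then obtain K where K: "F = tensor_sections_in \<A> s r 1 K" "compact K" "e > 0" by blast
    show "seminorm_nhd_0 (tensor_seminorms \<A>) F {y \<in> tensor_csections \<A> s r 1. \<bar>v y\<bar> < e}"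
      unfolding K(1) by (rule dominated_nhd[OF dom[OF K(2)] K(3)]) (use csections_iff K(2) in blast)
  qed (use add sc vsub_csections in auto)
  then show ?thesis unfolding distributions_def using add sc by blast
qed

end

section \<open>Distributions applied to smooth families\<close>

lemma frechet_derivative_zero_on:
  assumes "open \<Omega>" "\<xi> \<in> \<Omega>" "\<And>\<eta>. \<eta> \<in> \<Omega> \<Longrightarrow> g \<eta> = 0"
  shows "frechet_derivative g (at \<xi>) e = 0"
proof -
  have "frechet_derivative g (at \<xi>) = frechet_derivative (\<lambda>\<eta>. 0) (at \<xi>)"
    by (rule frechet_derivative_cong_open[OF assms])
  then show ?thesis using frechet_derivative_apply[OF has_derivative_const, of 0 \<xi> e] by simp
qed

context manifold
begin

text \<open>The common compact K confines the family to one step of the inductive limit, where v is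
  bounded by finitely many seminorms.\<close>

definition smooth_family :: "'f::euclidean_space set \<Rightarrow> 'a set \<Rightarrow> nat \<Rightarrow> nat \<Rightarrow> nat \<Rightarrow>
    ('f \<Rightarrow> 'a \<Rightarrow> ('a, 'n) tensor) \<Rightarrow> bool" where
  "smooth_family \<Omega> K r s w \<sigma> \<longleftrightarrow> open \<Omega> \<and> compact K \<and>
    (\<forall>\<xi>\<in>\<Omega>. \<forall>p. \<sigma> \<xi> p \<in> tensor_fibre \<A> r s w p \<and> (p \<notin> K \<longrightarrow> \<sigma> \<xi> p = 0)) \<and>
    (\<forall>c\<in>\<A>. \<forall>I J. smooth_on (\<Omega> \<times> img c) (\<lambda>z. \<sigma> (fst z) (chart_inv c (snd z)) c I J))"

definition pder :: "('f::euclidean_space \<Rightarrow> 'a \<Rightarrow> ('a, 'n) tensor) \<Rightarrow> 'f \<Rightarrow> 'f \<Rightarrow> 'a \<Rightarrow> ('a, 'n) tensor" where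
  "pder \<sigma> e \<xi> = (\<lambda>q c I J. frechet_derivative (\<lambda>\<eta>. \<sigma> \<eta> q c I J) (at \<xi>) e)"

lemma smooth_familyD:
  assumes "smooth_family \<Omega> K r s w \<sigma>"
  shows "open \<Omega>" "compact K" "\<xi> \<in> \<Omega> \<Longrightarrow> \<sigma> \<xi> p \<in> tensor_fibre \<A> r s w p"
    "\<xi> \<in> \<Omega> \<Longrightarrow> p \<notin> K \<Longrightarrow> \<sigma> \<xi> p = 0"
    "c \<in> \<A> \<Longrightarrow> smooth_on (\<Omega> \<times> img c) (\<lambda>z. \<sigma> (fst z) (chart_inv c (snd z)) c I J)"
  using assms unfolding smooth_family_def by blast+

lemma family_section:
  assumes fam: "smooth_family \<Omega> K r s w \<sigma>" and \<xi>: "\<xi> \<in> \<Omega>"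
  shows "\<sigma> \<xi> \<in> tensor_sections_in \<A> r s w K"
proof -
  note famD = smooth_familyD[OF fam]
  have "smooth_on (img c) (\<lambda>x. \<sigma> \<xi> (chart_inv c x) c I J)" if c: "c \<in> \<A>" for c I J
    using smooth_on_slice[OF famD(1) open_chart(2)[OF c] famD(5)[OF c] \<xi>] by simp
  then have "\<sigma> \<xi> \<in> tensor_sections \<A> r s w"
    unfolding tensor_sections_def using famD(3)[OF \<xi>] by blast
  then show ?thesis
    using famD(4)[OF \<xi>] by (simp add: sections_in_iff[OF compact_imp_closed[OF famD(2)]])
qed

lemma family_csection: "smooth_family \<Omega> K r s w \<sigma> \<Longrightarrow> \<xi> \<in> \<Omega> \<Longrightarrow> \<sigma> \<xi> \<in> tensor_csections \<A> r s w"
  using family_section smooth_familyD(2) csections_iff by blast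

lemma family_component:
  assumes fam: "smooth_family \<Omega> K r s w \<sigma>"
  shows "smooth_on \<Omega> (\<lambda>\<eta>. \<sigma> \<eta> q c I J)"
proof (cases "c \<in> charts_at \<A> q")
  case True
  then have c: "c \<in> \<A>" "q \<in> fst c" by (auto simp: charts_at_iff)
  have "smooth_on \<Omega> (\<lambda>\<eta>. \<sigma> (fst (\<eta>, snd c q)) (chart_inv c (snd (\<eta>, snd c q))) c I J)"
    by (rule smooth_on_slice1[OF smooth_familyD(1)[OF fam] open_chart(2) smooth_familyD(5)[OF fam]]) (use c in auto)
  then show ?thesis using c by (simp add: chart_inv_left)
next
  case False
  note op = smooth_familyD(1)[OF fam]
  have "\<sigma> \<eta> q c I J = 0" if "\<eta> \<in> \<Omega>" for \<eta>
    using fibre_outside[OF smooth_familyD(3)[OF fam that] False] by simp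
  then show ?thesis by (rule iffD2[OF smooth_on_cong[OF op] smooth_on_const[OF op]])
qed

lemma pder_has_derivative:
  assumes "smooth_family \<Omega> K r s w \<sigma>" "\<xi> \<in> \<Omega>"
  shows "((\<lambda>\<eta>. \<sigma> \<eta> q c I J) has_derivative (\<lambda>e. pder \<sigma> e \<xi> q c I J)) (at \<xi>)"
  unfolding pder_def by (rule smooth_on_has_derivative[OF family_component[OF assms(1)] assms(2)])

lemma pder_chart:
  assumes fam: "smooth_family \<Omega> K r s w \<sigma>" and z: "fst z \<in> \<Omega>" "snd z \<in> img c" and c: "c \<in> \<A>"
  shows "pder \<sigma> e (fst z) (chart_inv c (snd z)) c I J =
    frechet_derivative (\<lambda>z. \<sigma> (fst z) (chart_inv c (snd z)) c I J) (at z) (e, 0)"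
  unfolding pder_def
  using frechet_derivative_apply[OF frechet_derivative_slice1[OF smooth_familyD(1)[OF fam] open_chart(2)[OF c]
        smooth_familyD(5)[OF fam c] z], of I J e] by simp

text \<open>The class of families with supports in K is closed under parameter derivatives: a
  component that vanishes for all parameters has derivative 0, and the transformation law is linear
  with coefficients independent of the parameter.\<close>

lemma pder_family:
  assumes fam: "smooth_family \<Omega> K r s w \<sigma>"
  shows "smooth_family \<Omega> K r s w (pder \<sigma> e)"
  unfolding smooth_family_def
proof (intro conjI ballI allI impI)
  note famD = smooth_familyD[OF fam]
  show "open \<Omega>" "compact K" by (rule famD)+
  fix \<xi> p assume \<xi>: "\<xi> \<in> \<Omega>"
  show "pder \<sigma> e \<xi> p = 0" if p: "p \<notin> K"
  proof (intro ext)
    fix c I J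
    have "frechet_derivative (\<lambda>\<eta>. \<sigma> \<eta> p c I J) (at \<xi>) e = 0"
      by (rule frechet_derivative_zero_on[OF famD(1) \<xi>]) (simp add: famD(4)[OF _ p])
    then show "pder \<sigma> e \<xi> p c I J = 0 c I J" by (simp add: pder_def)
  qed
  show "pder \<sigma> e \<xi> p \<in> tensor_fibre \<A> r s w p"
  proof (rule fibreI[OF chart_at])
    let ?c = "chart_at \<A> p"
    fix I J :: "'n list" assume l: "length I \<noteq> r \<or> length J \<noteq> s"
    show "pder \<sigma> e \<xi> p ?c I J = 0"
      unfolding pder_def by (rule frechet_derivative_zero_on[OF famD(1) \<xi> fibre_length[OF famD(3) l]])
  next
    fix d assume d: "d \<in> charts_at \<A> p"
    let ?c = "chart_at \<A> p"
    show "pder \<sigma> e \<xi> p d = tensor_action r s w (jac ?c d p) (pder \<sigma> e \<xi> p ?c)"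
    proof (intro ext)
      fix I J
      have "((\<lambda>\<eta>. tensor_action r s w (jac ?c d p) (\<sigma> \<eta> p ?c) I J) has_derivative
          (\<lambda>e. tensor_action r s w (jac ?c d p) (pder \<sigma> e \<xi> p ?c) I J)) (at \<xi>)"
        unfolding tensor_action_apply
        by (intro has_derivative_mult_right has_derivative_sum pder_has_derivative[OF fam \<xi>])
      then have "((\<lambda>\<eta>. \<sigma> \<eta> p d I J) has_derivative
          (\<lambda>e. tensor_action r s w (jac ?c d p) (pder \<sigma> e \<xi> p ?c) I J)) (at \<xi>)"
        by (rule has_derivative_transform_within_open[OF _ famD(1) \<xi>])
           (simp add: fibre_transform[OF famD(3) chart_at d])
      then show "pder \<sigma> e \<xi> p d I J = tensor_action r s w (jac ?c d p) (pder \<sigma> e \<xi> p ?c) I J"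
        by (subst pder_def) (rule frechet_derivative_apply)
    qed
  next
    fix d assume "d \<notin> charts_at \<A> p"
    then have "\<sigma> \<eta> p d I J = 0" if "\<eta> \<in> \<Omega>" for \<eta> I J
      using fibre_outside[OF famD(3)[OF that]] by simp
    then have "frechet_derivative (\<lambda>\<eta>. \<sigma> \<eta> p d I J) (at \<xi>) e = 0" for I J
      by (rule frechet_derivative_zero_on[OF famD(1) \<xi>])
    then show "pder \<sigma> e \<xi> p d = 0"
      by (simp add: pder_def fun_eq_iff)
  qed
next
  note famD = smooth_familyD[OF fam]
  fix c I J assume c: "c \<in> \<A>"
  have op: "open (\<Omega> \<times> img c)" by (intro open_Times famD open_chart c)
  show "smooth_on (\<Omega> \<times> img c) (\<lambda>z. pder \<sigma> e (fst z) (chart_inv c (snd z)) c I J)"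
    by (rule iffD2[OF smooth_on_cong[OF op] smooth_on_frechet_derivative[OF op famD(5)[OF c]]])
       (use pder_chart[OF fam _ _ c] in auto)
qed

text \<open>The first order remainder is a section supported in K, so v of it is bounded by finitely
  many seminorms. Each of them is small relative to the increment, because a chart partial of the
  family is again differentiable in the parameter, uniformly on compact sets.\<close>

lemma distribution_family_derivative:
  assumes v: "v \<in> distributions \<A> r s" and fam: "smooth_family \<Omega> K s r 1 \<sigma>" and \<xi>: "\<xi> \<in> \<Omega>"
  shows "((\<lambda>\<eta>. v (\<sigma> \<eta>)) has_derivative (\<lambda>e. v (pder \<sigma> e \<xi>))) (at \<xi>)"
  unfolding has_derivative_at_alt
proof (intro conjI allI impI)
  note famD = smooth_familyD[OF fam]
  have pcs: "pder \<sigma> e \<xi> \<in> tensor_csections \<A> s r 1" for e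
    by (rule family_csection[OF pder_family[OF fam] \<xi>])
  have lin: "linear (\<lambda>e. pder \<sigma> e \<xi> q c I J)" for q c I J
    by (rule has_derivative_linear[OF pder_has_derivative[OF fam \<xi>]])
  show "bounded_linear (\<lambda>e. v (pder \<sigma> e \<xi>))"
  proof -
    have "pder \<sigma> (e + e') \<xi> = pder \<sigma> e \<xi> + pder \<sigma> e' \<xi>" "pder \<sigma> (a *\<^sub>R e) \<xi> = a *\<^sub>R pder \<sigma> e \<xi>" for e e' a
      by (intro ext, simp add: linear_add[OF lin] linear_cmul[OF lin])+
    then have "linear (\<lambda>e. v (pder \<sigma> e \<xi>))"
      by (intro linearI) (simp_all add: distribution_linear(1)[OF v pcs pcs] distribution_linear(2)[OF v pcs])
    then show ?thesis by (simp add: linear_linear)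
  qed
  fix \<epsilon> :: real assume \<epsilon>: "\<epsilon> > 0"
  define rem where "rem \<eta> = \<sigma> \<eta> + ((-1) *\<^sub>R \<sigma> \<xi> + (-1) *\<^sub>R pder \<sigma> (\<eta> - \<xi>) \<xi>)" for \<eta>
  have rem_in: "rem \<eta> \<in> tensor_sections_in \<A> s r 1 K" if "\<eta> \<in> \<Omega>" for \<eta>
    unfolding rem_def
    by (intro sections_in_add sections_in_scaleR famD family_section[OF fam] family_section[OF pder_family[OF fam]] that \<xi>)
  have v_rem: "v (rem \<eta>) = v (\<sigma> \<eta>) - v (\<sigma> \<xi>) - v (pder \<sigma> (\<eta> - \<xi>) \<xi>)" if "\<eta> \<in> \<Omega>" for \<eta>
  proof -
    note m = distribution_linear(2)[OF v, where a = "-1"]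
    note cs = csections_scaleR[OF family_csection[OF fam \<xi>], where a = "-1"] csections_scaleR[OF pcs, where a = "-1"]
    show ?thesis
      unfolding rem_def distribution_linear(1)[OF v family_csection[OF fam that] csections_add[OF cs]]
        distribution_linear(1)[OF v cs] m[OF family_csection[OF fam \<xi>]] m[OF pcs] by simp
  qed
  obtain S C where S: "finite S" "S \<subseteq> tensor_seminorms \<A>" "C \<ge> 0"
    "\<And>y. y \<in> tensor_sections_in \<A> s r 1 K \<Longrightarrow> \<bar>v y\<bar> \<le> C * (\<Sum>\<rho>\<in>S. \<rho> y)"
    using distribution_bound[OF v famD(2)] unfolding dominated_def by blast
  \<comment> \<open>The tolerance for each single seminorm, chosen so that C times the sum over S
    stays below \<epsilon>.\<close>
  define \<epsilon>' where "\<epsilon>' = \<epsilon> / ((C + 1) * (real (card S) + 1))"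
  have \<epsilon>': "\<epsilon>' > 0" using \<epsilon> S(3) by (simp add: \<epsilon>'_def)
  have "\<forall>\<^sub>F \<eta> in nhds \<xi>. \<rho> (rem \<eta>) \<le> \<epsilon>' * norm (\<eta> - \<xi>)" if \<rho>: "\<rho> \<in> S" for \<rho>
  proof -
    have "\<rho> \<in> tensor_seminorms \<A>" using S(2) \<rho> by blast
    then obtain c L I J vs where c: "c \<in> \<A>" and L: "compact L" "L \<noteq> {}" "L \<subseteq> fst c" and vs: "set vs \<subseteq> Basis"
      and \<rho>_eq: "\<rho> = tsn c L I J vs"
      unfolding tsn_seminorms by blast
    let ?V = "img c"
    have V: "open ?V" by (rule open_chart(2)[OF c])
    have op: "open (\<Omega> \<times> ?V)" by (intro open_Times famD V)
    define F where "F z = \<sigma> (fst z) (chart_inv c (snd z)) c I J" for z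
    define G where "G = partials (map (Pair 0) vs) F"
    have F: "smooth_on (\<Omega> \<times> ?V) F" unfolding F_def by (rule famD(5)[OF c])
    have G: "smooth_on (\<Omega> \<times> ?V) G" unfolding G_def by (rule smooth_on_partials[OF op F])
    have cL: "compact (snd c ` L)" "snd c ` L \<subseteq> ?V"
      using compact_continuous_image[OF continuous_on_subset[OF continuous_on_chart[OF c] L(3)] L(1)] L(3) by auto
    obtain \<delta> where \<delta>: "\<delta> > 0" "\<And>\<eta>. norm (\<eta> - \<xi>) < \<delta> \<Longrightarrow> \<eta> \<in> \<Omega>"
      "\<And>\<eta> x. norm (\<eta> - \<xi>) < \<delta> \<Longrightarrow> x \<in> snd c ` L \<Longrightarrow>
        \<bar>G (\<eta>, x) - G (\<xi>, x) - frechet_derivative G (at (\<xi>, x)) (\<eta> - \<xi>, 0)\<bar> \<le> \<epsilon>' * norm (\<eta> - \<xi>)"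
      using uniform_parameter_derivative[OF famD(1) V G \<xi> cL \<epsilon>'] by blast
    have "\<rho> (rem \<eta>) \<le> \<epsilon>' * norm (\<eta> - \<xi>)" if \<eta>: "norm (\<eta> - \<xi>) < \<delta>" for \<eta>
      unfolding \<rho>_eq tsn_def
    proof (rule supn_least[OF L(2)])
      fix p assume p: "p \<in> L"
      let ?x = "snd c p" and ?h = "\<eta> - \<xi>"
      have x: "?x \<in> ?V" using p L(3) by auto
      have \<eta>\<Omega>: "\<eta> \<in> \<Omega>" by (rule \<delta>(2)[OF \<eta>])
      let ?DF = "\<lambda>z. frechet_derivative F (at z) (?h, 0)"
      have DF: "smooth_on (\<Omega> \<times> ?V) ?DF" by (rule smooth_on_frechet_derivative[OF op F])
      have eq: "rem \<eta> (chart_inv c x) c I J = F (\<eta>, x) - F (\<xi>, x) - ?DF (\<xi>, x)" if "x \<in> ?V" for x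
        using pder_chart[OF fam _ _ c, of "(\<xi>, x)"] \<xi> that by (simp add: rem_def F_def[abs_def])
      note sl = smooth_on_slice[OF famD(1) V]
      have "partials vs (\<lambda>x. rem \<eta> (chart_inv c x) c I J) ?x =
          partials vs (\<lambda>x. F (\<eta>, x) - F (\<xi>, x) - ?DF (\<xi>, x)) ?x"
        by (rule partials_cong_open[OF V x eq])
      also have "\<dots> = partials vs (\<lambda>x. F (\<eta>, x)) ?x - partials vs (\<lambda>x. F (\<xi>, x)) ?x - partials vs (\<lambda>x. ?DF (\<xi>, x)) ?x"
        using partials_diff[OF V smooth_on_diff[OF V sl[OF F \<eta>\<Omega>] sl[OF F \<xi>]] sl[OF DF \<xi>] x]
          partials_diff[OF V sl[OF F \<eta>\<Omega>] sl[OF F \<xi>] x] by simp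
      also have "\<dots> = G (\<eta>, ?x) - G (\<xi>, ?x) - partials (map (Pair 0) vs) ?DF (\<xi>, ?x)"
        unfolding G_def partials_slice[OF famD(1) V F \<eta>\<Omega> x] partials_slice[OF famD(1) V F \<xi> x]
          partials_slice[OF famD(1) V DF \<xi> x] ..
      \<comment> \<open>Chart and parameter derivatives commute, so the chart partial of the
        remainder is exactly the first order remainder of G.\<close>
      also have "partials (map (Pair 0) vs) ?DF (\<xi>, ?x) = frechet_derivative G (at (\<xi>, ?x)) (?h, 0)"
        unfolding G_def by (rule partials_frechet_commute[OF op F, symmetric]) (use \<xi> x in simp)
      finally show "norm (partials vs (\<lambda>x. rem \<eta> (chart_inv c x) c I J) ?x) \<le> \<epsilon>' * norm (\<eta> - \<xi>)"
        using \<delta>(3)[OF \<eta> imageI[OF p]] by simp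
    qed
    then show ?thesis
      unfolding eventually_nhds_metric using \<delta>(1) by (auto simp: dist_norm)
  qed
  then have "\<forall>\<^sub>F \<eta> in nhds \<xi>. \<forall>\<rho>\<in>S. \<rho> (rem \<eta>) \<le> \<epsilon>' * norm (\<eta> - \<xi>)"
    using S(1) by (simp add: eventually_ball_finite)
  moreover have "\<forall>\<^sub>F \<eta> in nhds \<xi>. \<eta> \<in> \<Omega>"
    by (rule eventually_nhds_in_open[OF famD(1) \<xi>])
  ultimately have "\<forall>\<^sub>F \<eta> in nhds \<xi>. norm (v (\<sigma> \<eta>) - v (\<sigma> \<xi>) - v (pder \<sigma> (\<eta> - \<xi>) \<xi>)) \<le> \<epsilon> * norm (\<eta> - \<xi>)"
  proof eventually_elim
    case (elim \<eta>)
    have "\<bar>v (rem \<eta>)\<bar> \<le> C * (\<Sum>\<rho>\<in>S. \<rho> (rem \<eta>))" by (rule S(4)[OF rem_in[OF elim(2)]])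
    also have "\<dots> \<le> C * (\<Sum>\<rho>\<in>S. \<epsilon>' * norm (\<eta> - \<xi>))"
      by (intro mult_left_mono sum_mono S(3)) (use elim(1) in auto)
    also have "\<dots> = (C * real (card S) * \<epsilon>') * norm (\<eta> - \<xi>)" by simp
    also have "\<dots> \<le> \<epsilon> * norm (\<eta> - \<xi>)"
    proof (rule mult_right_mono)
      have "C * real (card S) * \<epsilon>' \<le> (C + 1) * (real (card S) + 1) * \<epsilon>'"
        using S(3) \<epsilon>' by (intro mult_right_mono mult_mono) auto
      also have "\<dots> = \<epsilon>" using S(3) by (simp add: \<epsilon>'_def)
      finally show "C * real (card S) * \<epsilon>' \<le> \<epsilon>" .
    qed simp
    finally show ?case by (simp add: v_rem[OF elim(2)])
  qed
  then show "\<exists>d>0. \<forall>\<eta>. norm (\<eta> - \<xi>) < d \<longrightarrow>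
      norm (v (\<sigma> \<eta>) - v (\<sigma> \<xi>) - v (pder \<sigma> (\<eta> - \<xi>) \<xi>)) \<le> \<epsilon> * norm (\<eta> - \<xi>)"
    unfolding eventually_nhds_metric by (simp add: dist_norm)
qed

text \<open>Partial derivatives of such a function arise in the same way from the family
  \<open>pder \<tau> b\<close>, so the coinduction rule applies.\<close>

lemma distribution_family_smooth:
  assumes v: "v \<in> distributions \<A> r s" and fam: "smooth_family \<Omega> K s r 1 \<sigma>"
  shows "smooth_on \<Omega> (\<lambda>\<xi>. v (\<sigma> \<xi>))"
proof -
  define P where "P f \<longleftrightarrow> (\<exists>\<sigma>. smooth_family \<Omega> K s r 1 \<sigma> \<and> f = (\<lambda>\<xi>. v (\<sigma> \<xi>)))" for f :: "'b \<Rightarrow> real"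
  have "P (\<lambda>\<xi>. v (\<sigma> \<xi>))" unfolding P_def using fam by blast
  then show ?thesis
    using smooth_familyD(1)[OF fam]
  proof (induct rule: smooth_on_coinduct)
    case (differentiable f \<xi>)
    then obtain \<tau> where "smooth_family \<Omega> K s r 1 \<tau>" "f = (\<lambda>\<xi>. v (\<tau> \<xi>))" unfolding P_def by blast
    then show ?case
      using distribution_family_derivative[OF v _ differentiable(2)] unfolding differentiable_def by blast
  next
    case (partial f b)
    then obtain \<tau> where \<tau>: "smooth_family \<Omega> K s r 1 \<tau>" "f = (\<lambda>\<xi>. v (\<tau> \<xi>))" unfolding P_def by blast
    show ?case
    proof (intro exI[of _ "\<lambda>\<xi>. v (pder \<tau> b \<xi>)"] conjI ballI)
      show "P (\<lambda>\<xi>. v (pder \<tau> b \<xi>))"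
        unfolding P_def by (intro exI[of _ "pder \<tau> b"] conjI pder_family \<tau> refl)
      fix \<xi> assume "\<xi> \<in> \<Omega>"
      show "frechet_derivative f (at \<xi>) b = v (pder \<tau> b \<xi>)"
        unfolding \<tau>(2) by (rule frechet_derivative_apply[OF distribution_family_derivative[OF v \<tau>(1) \<open>\<xi> \<in> \<Omega>\<close>]])
    qed
  qed
qed

text \<open>One term of a differential operator with smooth coefficients: the Leibniz estimate
  bounds it by seminorms that apply further derivatives to the partial \<open>us\<close>.\<close>

lemma supn_term_dominated:
  fixes F :: "('a \<Rightarrow> ('a, 'n) tensor) set"
  assumes c: "c \<in> \<A>" and L: "compact L" "L \<noteq> {}" "L \<subseteq> fst c" and vs: "set vs \<subseteq> Basis"
    and a: "smooth_on (img c) a" and us: "set us \<subseteq> Basis" and F: "F \<subseteq> tensor_sections \<A> r s w"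
  shows "dominated (tensor_seminorms \<A>) F
    (\<lambda>y. supn L (\<lambda>p. partials vs (\<lambda>x. a x * partials us (\<lambda>x. y (chart_inv c x) c I J) x) (snd c p)))"
proof -
  let ?W = "{ws :: (real^'n) list. set ws \<subseteq> Basis \<and> length ws \<le> length vs}"
  have pos: "\<rho> y \<ge> 0" if "\<rho> \<in> tensor_seminorms \<A>" "y \<in> F" for \<rho> y
    using seminorms_pos that F by blast
  have cL: "compact (snd c ` L)" "snd c ` L \<subseteq> img c"
    using compact_continuous_image[OF continuous_on_subset[OF continuous_on_chart[OF c] L(3)] L(1)] L(3) by auto
  obtain C where C: "C \<ge> 0" "\<And>g x. smooth_on (img c) g \<Longrightarrow> x \<in> snd c ` L \<Longrightarrow>
      \<bar>partials vs (\<lambda>x. a x * g x) x\<bar> \<le> C * (\<Sum>ws\<in>?W. \<bar>partials ws g x\<bar>)"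
    using partials_mult_bound[OF open_chart(2)[OF c] cL a vs] by blast
  have dom: "dominated (tensor_seminorms \<A>) F (\<lambda>y. C * (\<Sum>ws\<in>?W. tsn c L I J (ws @ us) y))"
    by (intro dominated_mult C(1) dominated_sum dominated_mem tsn_mem c L) (use us pos in auto)
  show ?thesis
  proof (rule dominated_le[OF dom])
    fix y assume "y \<in> F"
    then have y: "y \<in> tensor_sections \<A> r s w" using F by blast
    let ?y = "\<lambda>x. y (chart_inv c x) c I J"
    have sy: "smooth_on (img c) ?y" by (rule section_smooth[OF y c])
    show "supn L (\<lambda>p. partials vs (\<lambda>x. a x * partials us ?y x) (snd c p)) \<le>
        C * (\<Sum>ws\<in>?W. tsn c L I J (ws @ us) y)"
    proof (rule supn_least[OF L(2)])
      fix p assume p: "p \<in> L"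
      have "norm (partials vs (\<lambda>x. a x * partials us ?y x) (snd c p)) \<le>
          C * (\<Sum>ws\<in>?W. \<bar>partials ws (partials us ?y) (snd c p)\<bar>)"
        using C(2)[OF smooth_on_partials[OF open_chart(2)[OF c] sy] imageI[OF p]] by simp
      also have "\<dots> \<le> C * (\<Sum>ws\<in>?W. tsn c L I J (ws @ us) y)"
      proof (intro mult_left_mono sum_mono C(1))
        fix ws assume "ws \<in> ?W"
        have "norm (partials (ws @ us) ?y (snd c p)) \<le> tsn c L I J (ws @ us) y"
          unfolding tsn_def by (rule supn_upper[OF L(1) partials_chart_continuous[OF c L(3) sy] p])
        then show "\<bar>partials ws (partials us ?y) (snd c p)\<bar> \<le> tsn c L I J (ws @ us) y"
          by (simp add: partials_append)
      qed
      finally show "norm (partials vs (\<lambda>x. a x * partials us ?y x) (snd c p)) \<le>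
        C * (\<Sum>ws\<in>?W. tsn c L I J (ws @ us) y)" .
    qed
  qed
qed

lemma supn_sum_dominated:
  assumes c: "c \<in> \<A>" and L: "compact L" "L \<noteq> {}" "L \<subseteq> fst c" and F: "F \<subseteq> tensor_sections \<A> r s w"
    and sm: "\<And>i y. i \<in> I \<Longrightarrow> y \<in> F \<Longrightarrow> smooth_on (img c) (f i y)"
    and dom: "\<And>i. i \<in> I \<Longrightarrow> dominated (tensor_seminorms \<A>) F (\<lambda>y. supn L (\<lambda>p. partials vs (f i y) (snd c p)))"
  shows "dominated (tensor_seminorms \<A>) F (\<lambda>y. supn L (\<lambda>p. partials vs (\<lambda>x. \<Sum>i\<in>I. f i y x) (snd c p)))"
proof -
  have "dominated (tensor_seminorms \<A>) F (\<lambda>y. \<Sum>i\<in>I. supn L (\<lambda>p. partials vs (f i y) (snd c p)))"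
    by (rule dominated_sum) (use seminorms_pos F dom in blast)+
  then show ?thesis
  proof (rule dominated_le)
    fix y assume y: "y \<in> F"
    show "supn L (\<lambda>p. partials vs (\<lambda>x. \<Sum>i\<in>I. f i y x) (snd c p)) \<le> (\<Sum>i\<in>I. supn L (\<lambda>p. partials vs (f i y) (snd c p)))"
    proof (rule supn_least[OF L(2)])
      fix p assume p: "p \<in> L"
      have "snd c p \<in> img c" using p L(3) by auto
      then have "partials vs (\<lambda>x. \<Sum>i\<in>I. f i y x) (snd c p) = (\<Sum>i\<in>I. partials vs (f i y) (snd c p))"
        by (rule partials_sum[OF open_chart(2)[OF c] _ sm[OF _ y]])
      also have "norm \<dots> \<le> (\<Sum>i\<in>I. supn L (\<lambda>p. partials vs (f i y) (snd c p)))"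
        by (intro sum_norm_le supn_upper L partials_chart_continuous c sm y p)
      finally show "norm (partials vs (\<lambda>x. \<Sum>i\<in>I. f i y x) (snd c p)) \<le>
          (\<Sum>i\<in>I. supn L (\<lambda>p. partials vs (f i y) (snd c p)))" .
    qed
  qed
qed

end

section \<open>Continuity of the Lie derivative on sections\<close>

context manifold_field
begin

lemma lie_add_scale:
  assumes t: "t \<in> tensor_sections \<A> r s w" and u: "u \<in> tensor_sections \<A> r s w"
  shows "lie \<A> r s w X (t + u) = lie \<A> r s w X t + lie \<A> r s w X u"
    and "lie \<A> r s w X (a *\<^sub>R t) = a *\<^sub>R lie \<A> r s w X t"
proof -
  have d: "(\<lambda>x. t (chart_inv c x) c K L) differentiable (at x)" if "t \<in> tensor_sections \<A> r s w" "c \<in> \<A>" "x \<in> img c" for t c K L x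
    by (rule smooth_on_differentiable[OF section_smooth[OF that(1,2)] that(3)])
  have fa: "frechet_derivative (\<lambda>x. t (chart_inv c x) c K L + u (chart_inv c x) c K L) (at x) h =
      frechet_derivative (\<lambda>x. t (chart_inv c x) c K L) (at x) h + frechet_derivative (\<lambda>x. u (chart_inv c x) c K L) (at x) h"
    if "c \<in> \<A>" "x \<in> img c" for c x K L h
    by (rule frechet_derivative_apply)
       (intro has_derivative_add; rule d[unfolded frechet_derivative_works]; fact)
  have fs: "frechet_derivative (\<lambda>x. a * t (chart_inv c x) c K L) (at x) h =
      a * frechet_derivative (\<lambda>x. t (chart_inv c x) c K L) (at x) h"
    if "c \<in> \<A>" "x \<in> img c" for c x K L h
    by (rule frechet_derivative_apply)
       (intro has_derivative_mult_right; rule d[unfolded frechet_derivative_works]; fact)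
  note ls = lie_section[OF sections_add[OF t u]] lie_section[OF sections_scaleR[OF t, of a]] lie_section[OF t] lie_section[OF u]
  have eq: "lie \<A> r s w X (t + u) p c I J = (lie \<A> r s w X t + lie \<A> r s w X u) p c I J \<and>
      lie \<A> r s w X (a *\<^sub>R t) p c I J = (a *\<^sub>R lie \<A> r s w X t) p c I J" for p c I J
  proof (cases "c \<in> charts_at \<A> p")
    case True
    then have c: "c \<in> \<A>" "snd c p \<in> img c" "chart_inv c (snd c p) = p"
      by (auto simp: charts_at_iff chart_inv_left)
    note l = ls(2,4,6,8)[OF c(1,2), unfolded c(3)]
    show ?thesis
      by (simp add: l lie_expr_def fa[OF c(1,2)] fs[OF c(1,2)] sum.distrib sum_distrib_left algebra_simps)
  next
    case False
    then show ?thesis by (simp add: lie_outside)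
  qed
  show "lie \<A> r s w X (t + u) = lie \<A> r s w X t + lie \<A> r s w X u"
    by (intro ext) (use eq in blast)
  show "lie \<A> r s w X (a *\<^sub>R t) = a *\<^sub>R lie \<A> r s w X t"
    by (intro ext) (use eq in blast)
qed

text \<open>Rewrites the Lie derivative as a first order operator, a sum over words
  \<open>us\<close> of length 0 or 1, the shape for which domination by seminorms has been
  shown.\<close>

lemma lie_expr_expand:
  assumes c: "c \<in> \<A>" and x: "x \<in> img c" and y: "y \<in> tensor_sections \<A> r s w"
  shows "lie_expr r s w y c I J x = (\<Sum>K | length K = r. \<Sum>L | length L = s. \<Sum>us\<in>insert [] ((\<lambda>b. [b]) ` Basis).
    (if us = [] then lie_coef r s w (dvf c x) I J K L else coef r s (mat 1) (mat 1) I J K L * (vf c x \<bullet> hd us)) *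
    partials us (\<lambda>x. y (chart_inv c x) c K L) x)"
  unfolding lie_expr_def
proof (intro sum.cong refl)
  fix K L :: "'n list"
  have d: "(\<lambda>x. y (chart_inv c x) c K L) differentiable (at x)"
    by (rule smooth_on_differentiable[OF section_smooth[OF y c] x])
  have inj: "inj_on (\<lambda>b :: real^'n. [b]) Basis" by (simp add: inj_on_def)
  have ni: "[] \<notin> (\<lambda>b :: real^'n. [b]) ` Basis" by auto
  show "lie_coef r s w (dvf c x) I J K L * y (chart_inv c x) c K L + coef r s (mat 1) (mat 1) I J K L *
      frechet_derivative (\<lambda>x. y (chart_inv c x) c K L) (at x) (vf c x) =
    (\<Sum>us\<in>insert [] ((\<lambda>b. [b]) ` Basis).
      (if us = [] then lie_coef r s w (dvf c x) I J K L else coef r s (mat 1) (mat 1) I J K L * (vf c x \<bullet> hd us)) *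
      partials us (\<lambda>x. y (chart_inv c x) c K L) x)"
    by (subst frechet_derivative_Basis_expand[OF d])
       (simp add: sum.insert[OF _ ni] sum.reindex[OF inj] sum_distrib_left mult.assoc)
qed

lemma lie_seminorm_dominated:
  assumes \<rho>: "\<rho> \<in> tensor_seminorms \<A>" and F: "F \<subseteq> tensor_sections \<A> r s w"
  shows "dominated (tensor_seminorms \<A>) F (\<lambda>y. \<rho> (lie \<A> r s w X y))"
proof -
  obtain c L I J vs where c: "c \<in> \<A>" and L: "compact L" "L \<noteq> {}" "L \<subseteq> fst c" and vs: "set vs \<subseteq> Basis"
    and \<rho>_eq: "\<rho> = tsn c L I J vs"
    using \<rho> unfolding tsn_seminorms by blast
  define a where "a K M us x = (if us = [] then lie_coef r s w (dvf c x) I J K M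
      else coef r s (mat 1) (mat 1) I J K M * (vf c x \<bullet> hd us))" for K M us x
  let ?B = "insert [] ((\<lambda>b :: real^'n. [b]) ` Basis)"
  let ?g = "\<lambda>y x. \<Sum>K | length K = r. \<Sum>M | length M = s. \<Sum>us\<in>?B. a K M us x * partials us (\<lambda>x. y (chart_inv c x) c K M) x"
  note op = open_chart(2)[OF c]
  have a: "smooth_on (img c) (a K M us)" for K M us
    unfolding a_def
    by (cases "us = []") (auto intro!: smooth_on_mult smooth_on_const op smooth_on_bounded_linear[OF op lie_coef_linear]
        smooth_on_bounded_linear[OF op bounded_linear_inner_left] dvf_smooth vf_smooth c)
  have t: "smooth_on (img c) (\<lambda>x. a K M us x * partials us (\<lambda>x. y (chart_inv c x) c K M) x)" if "y \<in> F" for y K M us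
    by (intro smooth_on_mult op a smooth_on_partials section_smooth[OF _ c]) (use that F in blast)
  have "dominated (tensor_seminorms \<A>) F (\<lambda>y. supn L (\<lambda>p. partials vs (?g y) (snd c p)))"
    by (intro supn_sum_dominated[OF c L F] smooth_on_sum op t supn_term_dominated[OF c L vs a _ F]) auto
  then show ?thesis
  proof (rule dominated_le)
    fix y assume "y \<in> F"
    then have y: "y \<in> tensor_sections \<A> r s w" using F by blast
    have "partials vs (\<lambda>x. lie \<A> r s w X y (chart_inv c x) c I J) (snd c p) = partials vs (?g y) (snd c p)"
      if p: "p \<in> L" for p
      by (rule partials_cong_open[OF op])
         (use p L(3) lie_section(2)[OF y c] lie_expr_expand[OF c _ y] in \<open>auto simp: a_def\<close>)
    then show "\<rho> (lie \<A> r s w X y) \<le> supn L (\<lambda>p. partials vs (?g y) (snd c p))"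
      unfolding \<rho>_eq tsn_def supn_def by simp
  qed
qed

text \<open>The Lie derivative maps each step of the inductive limit to itself, since it does not
  enlarge supports, and does so continuously; composing with v keeps the bound by finitely many
  seminorms.\<close>

lemma dist_lie_distribution:
  assumes v: "v \<in> distributions \<A> r s"
  shows "dist_lie \<A> r s X v \<in> distributions \<A> r s"
proof (rule distributionI)
  fix \<sigma> \<tau> assume st: "\<sigma> \<in> tensor_csections \<A> s r 1" "\<tau> \<in> tensor_csections \<A> s r 1"
  show "dist_lie \<A> r s X v (\<sigma> + \<tau>) = dist_lie \<A> r s X v \<sigma> + dist_lie \<A> r s X v \<tau>"
    using st by (simp add: dist_lie_def lie_add_scale csections_sections distribution_linear[OF v] lie_csection)
next
  fix a \<sigma> assume st: "\<sigma> \<in> tensor_csections \<A> s r 1"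
  show "dist_lie \<A> r s X v (a *\<^sub>R \<sigma>) = a * dist_lie \<A> r s X v \<sigma>"
    using st lie_add_scale(2)[OF csections_sections[OF st] csections_sections[OF st]]
    by (simp add: dist_lie_def distribution_linear[OF v] lie_csection)
next
  fix K :: "'a set" assume K: "compact K"
  let ?F = "tensor_sections_in \<A> s r 1 K"
  have F: "?F \<subseteq> tensor_sections \<A> s r 1" unfolding tensor_sections_in_def by blast
  obtain S C where S: "finite S" "S \<subseteq> tensor_seminorms \<A>" "C \<ge> 0"
    "\<And>y. y \<in> ?F \<Longrightarrow> \<bar>v y\<bar> \<le> C * (\<Sum>\<rho>\<in>S. \<rho> y)"
    using distribution_bound[OF v K] unfolding dominated_def by blast
  have "dominated (tensor_seminorms \<A>) ?F (\<lambda>y. C * (\<Sum>\<rho>\<in>S. \<rho> (lie \<A> s r 1 X y)))"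
    by (intro dominated_mult S(3) dominated_sum lie_seminorm_dominated[OF _ F]) (use seminorms_pos S(2) F in blast)+
  then show "dominated (tensor_seminorms \<A>) ?F (\<lambda>y. \<bar>dist_lie \<A> r s X v y\<bar>)"
    by (rule dominated_le) (use S(4)[OF lie_section_in[OF K]] in \<open>simp add: dist_lie_def\<close>)
qed

end

section \<open>Smooth curves in (LF)-spaces of sections\<close>

text \<open>The map \<open>comp\<close> reads an element in a chart, so that forms and two-point
  tensors are treated alike. Seminorms over singletons give the time derivatives of all partials,
  seminorms over closed balls give their joint continuity; the criterion for curve families does the
  rest.\<close>

lemma lf_curve_smooth:
  fixes comp :: "'v::real_vector \<Rightarrow> 'e::euclidean_space \<Rightarrow> 'b::real_normed_vector"
  assumes E: "vsub (\<Union>\<F>)" and V: "open V"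
    and sm: "\<And>y. y \<in> \<Union>\<F> \<Longrightarrow> smooth_on V (comp y)"
    and add: "\<And>x y. comp (x + y) = (\<lambda>z. comp x z + comp y z)"
    and sc: "\<And>a x. comp (a *\<^sub>R x) = (\<lambda>z. a *\<^sub>R comp x z)"
    and P: "\<And>C vs. compact C \<Longrightarrow> C \<noteq> {} \<Longrightarrow> C \<subseteq> V \<Longrightarrow> set vs \<subseteq> Basis \<Longrightarrow> (\<lambda>y. supn C (partials vs (comp y))) \<in> P"
    and \<gamma>: "smooth_curve (lf_topology P \<F>) \<gamma>"
  shows "smooth_on (UNIV \<times> V) (\<lambda>z. comp (\<gamma> (fst z)) (snd z))"
proof -
  obtain D where D0: "D 0 = \<gamma>" and D1: "\<And>t. \<gamma> t \<in> topspace (lf_topology P \<F>)"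
    and D: "\<And>k t. limitin (lf_topology P \<F>) (\<lambda>h. (1 / h) *\<^sub>R (D k (t + h) - D k t)) (D (Suc k) t) (at 0)"
    using \<gamma> unfolding smooth_curve_def by blast
  have DE: "D k t \<in> \<Union>\<F>" for k t
    using D0 D1[of t] limitin_topspace[OF D] unfolding topspace_lf[OF E] by (cases k) auto
  have DE': "D k t - D k' t' \<in> \<Union>\<F>" for k t k' t'
    by (intro vsub_diff[OF E] DE)
  have pa: "partials vs (comp (x + y)) z = partials vs (comp x) z + partials vs (comp y) z"
    if "x \<in> \<Union>\<F>" "y \<in> \<Union>\<F>" "z \<in> V" for x y z vs
    unfolding add by (rule partials_add[OF V sm[OF that(1)] sm[OF that(2)] that(3)])
  have ps: "partials vs (comp (a *\<^sub>R x)) z = a *\<^sub>R partials vs (comp x) z"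
    if "x \<in> \<Union>\<F>" "z \<in> V" for a x z vs
    unfolding sc by (rule partials_scaleR[OF V sm[OF that(1)] that(2)])
  have pd: "partials vs (comp (x - y)) z = partials vs (comp x) z - partials vs (comp y) z"
    if "x \<in> \<Union>\<F>" "y \<in> \<Union>\<F>" "z \<in> V" for x y z vs
  proof -
    have y': "(-1) *\<^sub>R y \<in> \<Union>\<F>" using E that(2) unfolding vsub_def by blast
    show ?thesis using pa[OF that(1) y' that(3), of vs] ps[OF that(2,3), of vs "-1"] by simp
  qed
  define N where "N C vs y = supn C (partials vs (comp y))" for C vs y
  have cont: "continuous_on C (partials vs (comp y))" if "y \<in> \<Union>\<F>" "C \<subseteq> V" for C vs y
    by (rule continuous_on_subset[OF smooth_on_continuous_on[OF smooth_on_partials[OF V sm[OF that(1)]]] that(2)])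
  have semi: "seminorm_on (\<Union>\<F>) (N C vs)" if C: "compact C" "C \<noteq> {}" "C \<subseteq> V" for C vs
    unfolding seminorm_on_def
  proof (intro conjI ballI allI)
    fix x a assume x: "x \<in> \<Union>\<F>"
    have "N C vs (a *\<^sub>R x) = supn C (\<lambda>z. a *\<^sub>R partials vs (comp x) z)"
      unfolding N_def supn_def using ps[OF x] C(3) by (auto intro!: SUP_cong)
    also have "\<dots> = \<bar>a\<bar> * N C vs x"
      unfolding N_def by (rule supn_scaleR[OF C(1,2) cont[OF x C(3)]])
    finally show "N C vs (a *\<^sub>R x) = \<bar>a\<bar> * N C vs x" .
    fix y assume y: "y \<in> \<Union>\<F>"
    have "N C vs (x + y) = supn C (\<lambda>z. partials vs (comp x) z + partials vs (comp y) z)"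
      unfolding N_def supn_def using pa[OF x y] C(3) by (auto intro!: SUP_cong)
    also have "\<dots> \<le> N C vs x + N C vs y"
      unfolding N_def by (rule supn_add[OF C(1,2) cont[OF x C(3)] cont[OF y C(3)]])
    finally show "N C vs (x + y) \<le> N C vs x + N C vs y" .
  qed
  have lim: "((\<lambda>h. N C vs ((1 / h) *\<^sub>R (D k (t + h) - D k t) - D (Suc k) t)) \<longlongrightarrow> 0) (at 0)"
    if C: "compact C" "C \<noteq> {}" "C \<subseteq> V" and vs: "set vs \<subseteq> Basis" for C vs k t
  proof (rule lf_limit_seminorm[OF E semi[OF C] _ D])
    fix F e assume "F \<in> \<F>" "(e::real) > 0"
    then show "seminorm_nhd_0 P F {y \<in> \<Union>\<F>. N C vs y < e}"
      unfolding N_def by (intro dominated_nhd dominated_mem P C vs) auto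
  qed
  have "smooth_on (UNIV \<times> V) (\<lambda>(t, x). comp (D 0 t) x)"
  proof (rule smooth_on_curve_family[where f = "\<lambda>k t. comp (D k t)", OF V sm[OF DE]])
    fix k t x and vs :: "'e list" assume vs: "set vs \<subseteq> Basis" and x: "x \<in> V"
    have DQ: "(1 / h) *\<^sub>R (D k (t + h) - D k t) \<in> \<Union>\<F>" for h
      using E DE'[of k "t + h" k t] unfolding vsub_def by blast
    \<comment> \<open>Over the one-point set {x} the seminorm is the norm of a single partial
      derivative, so its convergence is differentiability in t at x.\<close>
    have "((\<lambda>h. N {x} vs ((1 / h) *\<^sub>R (D k (t + h) - D k t) - D (Suc k) t)) \<longlongrightarrow> 0) (at 0)"
      using x by (intro lim vs) auto
    moreover have eqN: "N {x} vs ((1 / h) *\<^sub>R (D k (t + h) - D k t) - D (Suc k) t) =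
        norm (partials vs (comp (D k (t + h))) x - partials vs (comp (D k t)) x - h *\<^sub>R partials vs (comp (D (Suc k) t)) x) / norm h"
      if "h \<noteq> 0" for h
    proof -
      let ?a = "partials vs (comp (D k (t + h))) x - partials vs (comp (D k t)) x"
      let ?b = "partials vs (comp (D (Suc k) t)) x"
      have "N {x} vs ((1 / h) *\<^sub>R (D k (t + h) - D k t) - D (Suc k) t) = norm ((1 / h) *\<^sub>R ?a - ?b)"
        by (simp add: N_def supn_def pd[OF DQ DE x] ps[OF DE' x] pd[OF DE DE x])
      also have "(1 / h) *\<^sub>R ?a - ?b = (1 / h) *\<^sub>R (?a - h *\<^sub>R ?b)"
        using that by (simp add: algebra_simps)
      also have "norm \<dots> = norm (?a - h *\<^sub>R ?b) / norm h"
        by (simp add: divide_inverse mult.commute)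
      finally show ?thesis .
    qed
    then have ev: "\<forall>\<^sub>F h in at 0. N {x} vs ((1 / h) *\<^sub>R (D k (t + h) - D k t) - D (Suc k) t) =
        norm (partials vs (comp (D k (t + h))) x - partials vs (comp (D k t)) x - h *\<^sub>R partials vs (comp (D (Suc k) t)) x) / norm h"
      unfolding eventually_at_filter by (intro always_eventually allI impI)
    ultimately have "((\<lambda>h. norm (partials vs (comp (D k (t + h))) x - partials vs (comp (D k t)) x -
        h *\<^sub>R partials vs (comp (D (Suc k) t)) x) / norm h) \<longlongrightarrow> 0) (at 0)"
      using Lim_transform_eventually[OF _ ev] by blast
    then show "((\<lambda>t. partials vs (comp (D k t)) x) has_vector_derivative partials vs (comp (D (Suc k) t)) x) (at t)"
      unfolding has_vector_derivative_def has_derivative_at by (simp add: bounded_linear_scaleR_left)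
  next
    fix k and vs :: "'e list" assume vs: "set vs \<subseteq> Basis"
    let ?f = "\<lambda>t x. partials vs (comp (D k t)) x"
    have op: "open (UNIV \<times> V)" by (intro open_Times open_UNIV V)
    show "continuous_on (UNIV \<times> V) (\<lambda>(t, x). ?f t x)"
      unfolding continuous_on_eq_continuous_at[OF op]
    proof (intro ballI)
      fix z0 :: "real \<times> 'e" assume "z0 \<in> UNIV \<times> V"
      then obtain t0 x0 where z0: "z0 = (t0, x0)" and x0: "x0 \<in> V" by auto
      obtain R where R: "R > 0" "cball x0 R \<subseteq> V" using V x0 open_contains_cball by blast
      let ?C = "cball x0 R"
      have C: "compact ?C" "?C \<noteq> {}" "?C \<subseteq> V" using R by auto
      note sN = semi[OF C, of vs]
      have addN: "\<And>x y. x \<in> \<Union>\<F> \<Longrightarrow> y \<in> \<Union>\<F> \<Longrightarrow> N ?C vs (x + y) \<le> N ?C vs x + N ?C vs y"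
        and scN: "\<And>a x. x \<in> \<Union>\<F> \<Longrightarrow> N ?C vs (a *\<^sub>R x) = \<bar>a\<bar> * N ?C vs x"
        using sN unfolding seminorm_on_def by auto
      \<comment> \<open>An increment is h times a difference quotient, and the seminorm of the
        latter is bounded near 0 because the quotient converges; hence g tends to 0.\<close>
      define g where "g h = N ?C vs (D k (t0 + h) - D k t0)" for h
      have g0: "g 0 = 0" using seminorm_on_nonneg(1)[OF E sN DE] by (simp add: g_def)
      have gpos: "g h \<ge> 0" for h unfolding g_def by (rule seminorm_on_nonneg(2)[OF E sN DE'])
      let ?q = "\<lambda>h. N ?C vs ((1 / h) *\<^sub>R (D k (t0 + h) - D k t0) - D (Suc k) t0)"
      have gle: "g h \<le> \<bar>h\<bar> * (?q h + N ?C vs (D (Suc k) t0))" if h: "h \<noteq> 0" for h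
      proof -
        let ?w = "(1 / h) *\<^sub>R (D k (t0 + h) - D k t0)"
        have w: "?w \<in> \<Union>\<F>" using E DE'[of k "t0 + h" k t0] unfolding vsub_def by blast
        have "D k (t0 + h) - D k t0 = h *\<^sub>R ?w" using h by simp
        then have "g h = \<bar>h\<bar> * N ?C vs ?w" unfolding g_def using scN[OF w, of h] by simp
        moreover have "N ?C vs ((?w - D (Suc k) t0) + D (Suc k) t0) \<le> ?q h + N ?C vs (D (Suc k) t0)"
          by (rule addN[OF vsub_diff[OF E w DE] DE])
        ultimately show ?thesis by (simp add: mult_left_mono)
      qed
      have "((\<lambda>h. \<bar>h\<bar> * (?q h + N ?C vs (D (Suc k) t0))) \<longlongrightarrow> \<bar>0\<bar> * (0 + N ?C vs (D (Suc k) t0))) (at 0)"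
        by (intro tendsto_mult tendsto_add lim[OF C vs] tendsto_const tendsto_rabs tendsto_ident_at)
      then have "((\<lambda>h. \<bar>h\<bar> * (?q h + N ?C vs (D (Suc k) t0))) \<longlongrightarrow> 0) (at 0)" by simp
      then have "(g \<longlongrightarrow> 0) (at 0)"
        by (rule tendsto_sandwich[OF _ _ tendsto_const, rotated 2])
           (auto simp: gpos eventually_at_filter gle)
      then have "(g \<longlongrightarrow> g 0) (nhds 0)"
        unfolding tendsto_at_iff_tendsto_nhds[symmetric] by (simp add: g0)
      moreover have "filterlim (\<lambda>z. fst z - t0) (nhds 0) (nhds (t0, x0))"
      proof -
        have "((\<lambda>z. fst z - t0) \<longlongrightarrow> fst (t0, x0) - t0) (nhds (t0, x0))"
          by (intro tendsto_intros filterlim_ident)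
        then show ?thesis by simp
      qed
      ultimately have G: "((\<lambda>z. g (fst z - t0)) \<longlongrightarrow> 0) (nhds (t0, x0))"
        using filterlim_compose[of g "nhds (g 0)" "nhds 0"] g0 by fastforce
      have "isCont (?f t0) x0"
        using smooth_on_continuous_on[OF smooth_on_partials[OF V sm[OF DE]]] V x0
        by (simp add: continuous_on_eq_continuous_at)
      then have "(?f t0 \<longlongrightarrow> ?f t0 x0) (nhds x0)"
        by (simp add: isCont_def tendsto_at_iff_tendsto_nhds)
      moreover have "filterlim snd (nhds x0) (nhds (t0, x0))"
        using tendsto_snd[OF filterlim_ident[of "nhds (t0, x0)"]] by simp
      ultimately have H: "((\<lambda>z. ?f t0 (snd z)) \<longlongrightarrow> ?f t0 x0) (nhds (t0, x0))"
        by (rule filterlim_compose)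
      have H': "((\<lambda>z. norm (?f t0 (snd z) - ?f t0 x0)) \<longlongrightarrow> 0) (nhds (t0, x0))"
        using tendsto_norm[OF tendsto_diff[OF H tendsto_const[of "?f t0 x0"]]] by simp
      have S: "((\<lambda>z. g (fst z - t0) + norm (?f t0 (snd z) - ?f t0 x0)) \<longlongrightarrow> 0) (nhds (t0, x0))"
        using tendsto_add[OF G H'] by simp
      \<comment> \<open>The increment is split at (t0, x): the time part is bounded by the supremum
        over the ball, uniformly in x, and the space part involves the fixed time t0.\<close>
      have ev: "\<forall>\<^sub>F z in nhds (t0, x0). norm ((case z of (t, x) \<Rightarrow> ?f t x) - ?f t0 x0) \<le> g (fst z - t0) + norm (?f t0 (snd z) - ?f t0 x0)"
      proof -
        have "\<forall>\<^sub>F z in nhds (t0, x0). z \<in> UNIV \<times> ball x0 R"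
          by (rule eventually_nhds_in_open) (use R in \<open>auto intro: open_Times\<close>)
        then show ?thesis
        proof eventually_elim
          case (elim z)
          obtain t x where z: "z = (t, x)" by (cases z)
          have x: "x \<in> ?C" "x \<in> V" using elim R(2) by (auto simp: z)
          have "norm (partials vs (comp (D k t - D k t0)) x) \<le> N ?C vs (D k t - D k t0)"
            unfolding N_def by (rule supn_upper[OF C(1) cont[OF DE' C(3)] x(1)])
          then have "norm (?f t x - ?f t0 x) \<le> g (t - t0)"
            by (simp add: pd[OF DE DE x(2)] g_def)
          moreover have "norm (?f t x - ?f t0 x0) \<le> norm (?f t x - ?f t0 x) + norm (?f t0 x - ?f t0 x0)"
            using norm_triangle_ineq[of "?f t x - ?f t0 x" "?f t0 x - ?f t0 x0"] by simp
          ultimately show ?case by (simp add: z)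
        qed
      qed
      have "((\<lambda>z. (case z of (t, x) \<Rightarrow> ?f t x) - ?f t0 x0) \<longlongrightarrow> 0) (nhds (t0, x0))"
        by (rule Lim_null_comparison[OF ev S])
      then have "((\<lambda>(t, x). ?f t x) \<longlongrightarrow> ?f t0 x0) (nhds (t0, x0))"
        by (rule Lim_null[THEN iffD2])
      then show "isCont (\<lambda>(t, x). ?f t x) z0"
        unfolding isCont_def tendsto_at_iff_tendsto_nhds z0 by simp
    qed
  qed
  then show ?thesis by (simp add: D0 case_prod_unfold)
qed

context manifold
begin

lemma tensor_curve_csection: "smooth_curve (tensor_lf \<A> r s w) \<omega> \<Longrightarrow> \<omega> t \<in> tensor_csections \<A> r s w"
  unfolding smooth_curve_def topspace_tensor_lf by blast

lemma tensor_curve_smooth: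
  assumes \<omega>: "smooth_curve (tensor_lf \<A> r s w) \<omega>" and c: "c \<in> \<A>"
  shows "smooth_on (UNIV \<times> img c) (\<lambda>z. \<omega> (fst z) (chart_inv c (snd z)) c I J)"
proof -
  let ?F = "tensor_sections_in \<A> r s w ` {K. compact K}"
  show ?thesis
  proof (rule lf_curve_smooth[where comp = "\<lambda>t x. t (chart_inv c x) c I J" and \<F> = ?F and P = "tensor_seminorms \<A>"])
    show "vsub (\<Union>?F)" using vsub_csections unfolding csections_Union .
    show "open (img c)" by (rule open_chart(2)[OF c])
    show "smooth_on (img c) (\<lambda>x. y (chart_inv c x) c I J)" if "y \<in> \<Union>?F" for y
      by (rule section_smooth[OF _ c]) (use that in \<open>auto simp: tensor_sections_in_def\<close>)
    show "smooth_curve (lf_topology (tensor_seminorms \<A>) ?F) \<omega>"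
      using \<omega> unfolding tensor_lf_def .
    fix C and vs :: "(real^'n) list" assume C: "compact C" "C \<noteq> {}" "C \<subseteq> img c" and vs: "set vs \<subseteq> Basis"
    have "(\<lambda>y. supn C (partials vs (\<lambda>x. y (chart_inv c x) c I J))) = tsn c (chart_inv c ` C) I J vs"
    proof
      fix y
      show "supn C (partials vs (\<lambda>x. y (chart_inv c x) c I J)) = tsn c (chart_inv c ` C) I J vs y"
        unfolding tsn_def supn_def image_image
        by (rule SUP_cong[OF refl]) (simp add: chart_inv_right[OF subsetD[OF C(3)]])
    qed
    moreover have "tsn c (chart_inv c ` C) I J vs \<in> tensor_seminorms \<A>"
    proof (rule tsn_mem[OF c _ _ _ vs])
      show "compact (chart_inv c ` C)"
        by (rule compact_continuous_image[OF continuous_on_subset[OF continuous_on_chart_inv[OF c] C(3)] C(1)])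
      show "chart_inv c ` C \<subseteq> fst c"
        by (rule image_subsetI, rule chart_inv_in, rule subsetD[OF C(3)])
    qed (use C in auto)
    ultimately show "(\<lambda>y. supn C (partials vs (\<lambda>x. y (chart_inv c x) c I J))) \<in> tensor_seminorms \<A>" by simp
  qed auto
qed

section \<open>Curves of two-point tensors\<close>

lemma TO_zero: "0 \<in> TO_sections \<A>"
  by (rule TO_sectionsI[where B = "\<lambda>p q. 0"]) (auto intro!: smooth_on_const open_Times open_chart)

lemma TO_sections_in_iff:
  assumes "closed K"
  shows "A \<in> TO_sections_in \<A> K \<longleftrightarrow> A \<in> TO_sections \<A> \<and> (\<forall>p q. (p, q) \<notin> K \<longrightarrow> A p q = 0)"
  unfolding TO_sections_in_def
  using supp_subsetI[OF assms, of "\<lambda>(p, q). A p q"] not_in_supp[of _ "\<lambda>(p, q). A p q"] by fastforce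

lemma B_hat_iff: "A \<in> B_hat \<A> \<longleftrightarrow> (\<exists>K. compact K \<and> A \<in> TO_sections_in \<A> K)"
proof
  assume "A \<in> B_hat \<A>"
  then show "\<exists>K. compact K \<and> A \<in> TO_sections_in \<A> K"
    unfolding B_hat_def TO_sections_in_def by blast
next
  assume "\<exists>K. compact K \<and> A \<in> TO_sections_in \<A> K"
  then obtain K where K: "compact K" "A \<in> TO_sections_in \<A> K" by blast
  let ?S = "supp (\<lambda>(p, q). A p q)"
  have "compact (K \<inter> ?S)" using K(1) by (intro compact_Int_closed supp_closed)
  moreover have "K \<inter> ?S = ?S" using K(2) unfolding TO_sections_in_def by auto
  ultimately show "A \<in> B_hat \<A>"
    using K(2) unfolding B_hat_def TO_sections_in_def by simp
qed

lemma B_hat_Union: "B_hat \<A> = \<Union> (TO_sections_in \<A> ` {K. compact K})"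
  using B_hat_iff by auto

lemma vsub_B_hat: "vsub (B_hat \<A>)"
  unfolding vsub_def
proof (intro conjI ballI allI)
  show "0 \<in> B_hat \<A>"
    unfolding B_hat_iff by (intro exI[of _ "{}"]) (auto simp: TO_sections_in_iff TO_zero)
  fix A B assume "A \<in> B_hat \<A>" "B \<in> B_hat \<A>"
  then obtain K K' where K: "compact K" "A \<in> TO_sections_in \<A> K" "compact K'" "B \<in> TO_sections_in \<A> K'"
    unfolding B_hat_iff by blast
  then have "A + B \<in> TO_sections_in \<A> (K \<union> K')"
    using TO_sections_in_iff[OF compact_imp_closed[OF compact_Un[OF K(1,3)]]]
    by (simp add: TO_sections_in_iff compact_imp_closed TO_add)
  then show "A + B \<in> B_hat \<A>" using K unfolding B_hat_iff by blast
next
  fix A and a :: real assume "A \<in> B_hat \<A>"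
  then obtain K where "compact K" "A \<in> TO_sections_in \<A> K" unfolding B_hat_iff by blast
  then have "a *\<^sub>R A \<in> TO_sections_in \<A> K"
    by (auto simp: TO_sections_in_iff compact_imp_closed TO_scaleR fun_eq_iff)
  then show "a *\<^sub>R A \<in> B_hat \<A>" using \<open>compact K\<close> unfolding B_hat_iff by blast
qed

lemma B_hat_TO: "A \<in> B_hat \<A> \<Longrightarrow> A \<in> TO_sections \<A>"
  unfolding B_hat_def by blast

lemma TO_curve_B_hat:
  assumes "smooth_curve (TO_lf \<A>) A"
  shows "A t \<in> B_hat \<A>"
proof -
  have "topspace (TO_lf \<A>) = B_hat \<A>"
    unfolding TO_lf_def B_hat_Union by (rule topspace_lf) (rule vsub_B_hat[unfolded B_hat_Union])
  then show ?thesis using assms unfolding smooth_curve_def by blast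
qed

lemma TO_curve_smooth:
  assumes A: "smooth_curve (TO_lf \<A>) A" and c: "c \<in> \<A>" and d: "d \<in> \<A>"
  shows "smooth_on (UNIV \<times> (img c \<times> img d))
    (\<lambda>z. A (fst z) (chart_inv c (fst (snd z))) (chart_inv d (snd (snd z))) c d)"
proof -
  let ?F = "TO_sections_in \<A> ` {K. compact K}"
  let ?V = "img c \<times> img d"
  show ?thesis
  proof (rule lf_curve_smooth[where comp = "\<lambda>A z. A (chart_inv c (fst z)) (chart_inv d (snd z)) c d"
        and \<F> = ?F and P = "TO_seminorms \<A>"])
    show "vsub (\<Union>?F)" using vsub_B_hat unfolding B_hat_Union .
    show "open ?V" by (intro open_Times open_chart c d)
    show "smooth_on ?V (\<lambda>z. y (chart_inv c (fst z)) (chart_inv d (snd z)) c d)" if "y \<in> \<Union>?F" for y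
      by (rule TO_smooth[OF _ c d]) (use that in \<open>auto simp: TO_sections_in_def\<close>)
    show "smooth_curve (lf_topology (TO_seminorms \<A>) ?F) A"
      using A unfolding TO_lf_def .
    fix C and vs :: "((real^'n) \<times> (real^'n)) list"
    assume C: "compact C" "C \<noteq> {}" "C \<subseteq> ?V" and vs: "set vs \<subseteq> Basis"
    let ?m = "\<lambda>z. (chart_inv c (fst z), chart_inv d (snd z))"
    define K where "K = ?m ` C"
    have inV: "fst z \<in> img c" "snd z \<in> img d" if "z \<in> C" for z using C(3) that by auto
    have eq: "(\<lambda>y. supn C (partials vs (\<lambda>z. y (chart_inv c (fst z)) (chart_inv d (snd z)) c d))) =
      (\<lambda>A. SUP (p, q)\<in>K. norm (partials vs (\<lambda>(x, y). A (chart_inv c x) (chart_inv d y) c d) (snd c p, snd d q)))"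
    proof
      fix y
      show "supn C (partials vs (\<lambda>z. y (chart_inv c (fst z)) (chart_inv d (snd z)) c d)) =
        (SUP (p, q)\<in>K. norm (partials vs (\<lambda>(x, y'). y (chart_inv c x) (chart_inv d y') c d) (snd c p, snd d q)))"
        unfolding K_def supn_def image_image case_prod_beta
        by (rule SUP_cong) (auto simp: chart_inv_right inV)
    qed
    have "(\<lambda>A. SUP (p, q)\<in>K. norm (partials vs (\<lambda>(x, y). A (chart_inv c x) (chart_inv d y) c d) (snd c p, snd d q)))
      \<in> TO_seminorms \<A>"
    proof -
      have "continuous_on C ?m"
        by (intro continuous_on_Pair continuous_on_compose2[OF continuous_on_chart_inv[OF c] continuous_on_fst[OF continuous_on_id]]
            continuous_on_compose2[OF continuous_on_chart_inv[OF d] continuous_on_snd[OF continuous_on_id]])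
           (use C(3) in auto)
      then have "compact K" unfolding K_def using C(1) by (rule compact_continuous_image)
      moreover have "K \<subseteq> fst c \<times> fst d"
        unfolding K_def by (intro image_subsetI SigmaI chart_inv_in inV)
      moreover have "K \<noteq> {}" unfolding K_def using C(2) by simp
      ultimately show ?thesis unfolding TO_seminorms_def using c d vs by blast
    qed
    then show "(\<lambda>y. supn C (partials vs (\<lambda>z. y (chart_inv c (fst z)) (chart_inv d (snd z)) c d))) \<in> TO_seminorms \<A>"
      by (rule back_subst[of "\<lambda>f. f \<in> TO_seminorms \<A>", OF _ eq[symmetric]])
  qed auto
qed

text \<open>Closed coordinate balls make the space locally compact, and a locally finite refinement
  of a cover by relatively compact sets is met by a compact set in finitely many members. Such a
  cover detects supports that escape every compact set.\<close>

lemma locally_finite_relatively_compact_cover: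
  assumes "paracompact_space (euclidean :: 'a topology)"
  obtains \<V> :: "'a set set" where "\<And>V. V \<in> \<V> \<Longrightarrow> open V" "\<And>V. V \<in> \<V> \<Longrightarrow> compact (closure V)" "\<Union>\<V> = UNIV"
    "\<And>K. compact K \<Longrightarrow> finite {V \<in> \<V>. V \<inter> K \<noteq> {}}"
proof -
  define \<U> where "\<U> = {U :: 'a set. open U \<and> compact (closure U)}"
  have "p \<in> \<Union>\<U>" for p
  proof -
    obtain c where "c \<in> charts_at \<A> p" using chart_at by blast
    then have c: "c \<in> \<A>" "p \<in> fst c" by (auto simp: charts_at_iff)
    obtain R where R: "R > 0" "cball (snd c p) R \<subseteq> img c"
      using open_chart(2)[OF c(1)] c open_contains_cball by blast
    define U where "U = {q \<in> fst c. snd c q \<in> ball (snd c p) R}"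
    have U: "open U" unfolding U_def by (intro chart_preimage c open_ball)
    let ?K = "chart_inv c ` cball (snd c p) R"
    have K: "compact ?K"
      using continuous_on_subset[OF continuous_on_chart_inv[OF c(1)] R(2)] by (intro compact_continuous_image) auto
    have "U \<subseteq> ?K"
    proof
      fix q assume q: "q \<in> U"
      then have "snd c q \<in> cball (snd c p) R" "q = chart_inv c (snd c q)"
        using chart_inv_left[OF c(1)] by (auto simp: U_def)
      then show "q \<in> ?K" by blast
    qed
    then have "closure U \<subseteq> ?K" using compact_imp_closed[OF K] by (rule closure_minimal)
    then have "compact (closure U)"
      using K compact_Int_closed[OF K closed_closure, of U] by (simp add: Int_absorb1)
    then show ?thesis using U c R by (auto simp: \<U>_def U_def)
  qed
  then have "\<Union>\<U> = UNIV" by blast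
  then have "(\<forall>U\<in>\<U>. openin euclidean U) \<and> \<Union>\<U> = topspace euclidean" by (simp add: \<U>_def)
  from assms[unfolded paracompact_space_def, THEN spec, THEN mp, OF this]
  obtain \<V> where \<V>: "\<forall>V\<in>\<V>. openin euclidean V \<and> (\<exists>U\<in>\<U>. V \<subseteq> U)" "\<Union>\<V> = UNIV"
      "locally_finite_in euclidean \<V>"
    by (elim exE conjE) simp
  show thesis
  proof (rule that[OF _ _ \<V>(2)])
    show "open V" if "V \<in> \<V>" for V using \<V>(1) that by auto
    show "compact (closure V)" if "V \<in> \<V>" for V
    proof -
      obtain U where U: "compact (closure U)" "V \<subseteq> U" using \<V>(1) \<open>V \<in> \<V>\<close> by (auto simp: \<U>_def)
      then show ?thesis
        using compact_Int_closed[OF U(1) closed_closure, of V] closure_mono[OF U(2)] by (simp add: Int_absorb1)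
    qed
    fix K :: "'a set" assume K: "compact K"
    have "\<forall>p. \<exists>W. open W \<and> p \<in> W \<and> finite {V \<in> \<V>. V \<inter> W \<noteq> {}}"
      using \<V>(3) unfolding locally_finite_in_def by auto
    then obtain W where W: "\<And>p. open (W p)" "\<And>p. p \<in> W p" "\<And>p. finite {V \<in> \<V>. V \<inter> W p \<noteq> {}}"
      by metis
    obtain T where T: "finite T" "K \<subseteq> (\<Union>p\<in>T. W p)"
      by (rule compactE_image[OF K, of K W]) (use W in auto)
    have "{V \<in> \<V>. V \<inter> K \<noteq> {}} \<subseteq> (\<Union>p\<in>T. {V \<in> \<V>. V \<inter> W p \<noteq> {}})"
      using T(2) by blast
    moreover have "finite (\<Union>p\<in>T. {V \<in> \<V>. V \<inter> W p \<noteq> {}})" using T(1) W(3) by blast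
    ultimately show "finite {V \<in> \<V>. V \<inter> K \<noteq> {}}" by (rule finite_subset)
  qed
qed

text \<open>A compact set contains p n for finitely many n only, so on each step N is dominated by
  finitely many of the given seminorms, although the weights 1 / a n may grow arbitrarily. This is a
  continuous seminorm that no compact set controls alone.\<close>

lemma discrete_seminorm:
  assumes fin: "\<And>K. compact K \<Longrightarrow> finite {n::nat. p n \<in> K}" and a: "\<And>n. a n > 0"
    and c: "\<And>n. c n \<in> charts_at \<A> (p n)"
  obtains N where "seminorm_on (tensor_csections \<A> r s w) N"
    "\<And>K e. compact K \<Longrightarrow> e > 0 \<Longrightarrow>
      seminorm_nhd_0 (tensor_seminorms \<A>) (tensor_sections_in \<A> r s w K) {y \<in> tensor_csections \<A> r s w. N y < e}"
    "\<And>y n. y \<in> tensor_csections \<A> r s w \<Longrightarrow> \<bar>y (p n) (c n) (I n) (J n)\<bar> \<le> a n * N y"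
proof -
  define f where "f y n = \<bar>y (p n) (c n) (I n) (J n)\<bar> / a n" for y :: "'a \<Rightarrow> ('a, 'n) tensor" and n
  \<comment> \<open>The indices that contribute: finitely many for a compactly supported y, so that
    N is a finite sum.\<close>
  define M where "M y = {n. f y n \<noteq> 0}" for y
  define N where "N y = sum (f y) (M y)" for y
  have f0: "f y n \<ge> 0" for y n using a[of n] by (simp add: f_def)
  have Min: "M y \<subseteq> {n. p n \<in> K}" if "y \<in> tensor_sections_in \<A> r s w K" for y K
  proof -
    have "y (p n) = 0" if "p n \<notin> K" for n
      using not_in_supp[of "p n" y] \<open>y \<in> _\<close> \<open>p n \<notin> K\<close> unfolding tensor_sections_in_def by blast
    then have "f y n = 0" if "p n \<notin> K" for n using that by (simp add: f_def)
    note f_out = this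
    show ?thesis
    proof
      fix n assume "n \<in> M y"
      then show "n \<in> {n. p n \<in> K}" using f_out[of n] by (auto simp: M_def)
    qed
  qed
  have finM: "finite (M y)" if y: "y \<in> tensor_csections \<A> r s w" for y
  proof -
    obtain K where K: "compact K" "y \<in> tensor_sections_in \<A> r s w K"
      using y unfolding csections_iff by blast
    show ?thesis by (rule finite_subset[OF Min[OF K(2)] fin[OF K(1)]])
  qed
  have le_N: "sum (f y) S \<le> N y" if "y \<in> tensor_csections \<A> r s w" "finite S" for y S
  proof -
    have "sum (f y) S = sum (f y) (S \<inter> M y)"
      by (rule sum.mono_neutral_right) (use that in \<open>auto simp: M_def\<close>)
    also have "\<dots> \<le> N y"
      unfolding N_def by (rule sum_mono2[OF finM[OF that(1)]]) (use f0 in auto)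
    finally show ?thesis .
  qed
  show thesis
  proof (rule that[of N])
    show "seminorm_on (tensor_csections \<A> r s w) N"
      unfolding seminorm_on_def
    proof (intro conjI ballI allI)
      fix x y assume x: "x \<in> tensor_csections \<A> r s w" and y: "y \<in> tensor_csections \<A> r s w"
      note xy = finM[OF csections_add[OF x y]]
      have "f (x + y) n \<le> f x n + f y n" for n
        unfolding f_def using a[of n] by (simp add: add_divide_distrib[symmetric] divide_right_mono abs_triangle_ineq)
      then have "N (x + y) \<le> (\<Sum>n\<in>M (x + y). f x n + f y n)"
        unfolding N_def by (rule sum_mono)
      also have "\<dots> \<le> N x + N y"
        unfolding sum.distrib by (intro add_mono le_N x y xy)
      finally show "N (x + y) \<le> N x + N y" .
    next
      fix x and b :: real assume x: "x \<in> tensor_csections \<A> r s w"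
      have fb: "f (b *\<^sub>R x) n = \<bar>b\<bar> * f x n" for n by (simp add: f_def abs_mult)
      show "N (b *\<^sub>R x) = \<bar>b\<bar> * N x"
      proof (cases "b = 0")
        case True
        then have "M (b *\<^sub>R x) = {}" unfolding M_def fb by simp
        then show ?thesis using True by (simp add: N_def)
      next
        case False
        then have "M (b *\<^sub>R x) = M x" by (simp add: M_def fb)
        then show ?thesis by (simp add: N_def fb sum_distrib_left)
      qed
    qed
  next
    fix K :: "'a set" and e :: real assume K: "compact K" and e: "e > 0"
    let ?F = "tensor_sections_in \<A> r s w K"
    have F: "?F \<subseteq> tensor_sections \<A> r s w" unfolding tensor_sections_in_def by blast
    have tsn: "f y n = (1 / a n) * tsn (c n) {p n} (I n) (J n) [] y" for y n
      using c[of n] by (simp add: f_def tsn_def supn_def charts_at_iff chart_inv_left)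
    have "dominated (tensor_seminorms \<A>) ?F (\<lambda>y. \<Sum>n | p n \<in> K. (1 / a n) * tsn (c n) {p n} (I n) (J n) [] y)"
    proof (intro dominated_sum dominated_mult dominated_mem tsn_mem)
      show "c n \<in> \<A>" "{p n} \<subseteq> fst (c n)" "0 \<le> 1 / a n" for n
        using c[of n] a[of n] by (auto simp: charts_at_iff)
    qed (use seminorms_pos F in auto)
    then have "dominated (tensor_seminorms \<A>) ?F N"
    proof (rule dominated_le)
      fix y assume y: "y \<in> ?F"
      show "N y \<le> (\<Sum>n | p n \<in> K. (1 / a n) * tsn (c n) {p n} (I n) (J n) [] y)"
        unfolding N_def tsn[symmetric]
        by (rule sum_mono2[OF fin[OF K] Min[OF y] f0])
    qed
    then show "seminorm_nhd_0 (tensor_seminorms \<A>) ?F {y \<in> tensor_csections \<A> r s w. N y < e}"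
      using e by (rule dominated_nhd) (use K csections_iff in blast)
  next
    fix y n assume "y \<in> tensor_csections \<A> r s w"
    from le_N[OF this, of "{n}"] show "\<bar>y (p n) (c n) (I n) (J n)\<bar> \<le> a n * N y"
      using a[of n] by (simp add: f_def field_simps)
  qed
qed

text \<open>
  Otherwise the family would be nonzero at points \<open>p n\<close> of a discrete closed set, for parameters
  tending to \<open>0\<close>, and the seminorm weighing the values at these points by their inverses would not
  converge.
\<close>

lemma lf_limit_support:
  assumes par: "paracompact_space (euclidean :: 'a topology)"
    and lim: "limitin (tensor_lf \<A> r s w) \<psi> l (at (0::real))"
  obtains K \<delta> where "compact K" "\<delta> > 0" "\<And>h. h \<noteq> 0 \<Longrightarrow> \<bar>h\<bar> < \<delta> \<Longrightarrow> \<psi> h \<in> tensor_sections_in \<A> r s w K"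
proof -
  obtain \<V> :: "'a set set" where \<V>: "\<And>V. V \<in> \<V> \<Longrightarrow> open V" "\<And>V. V \<in> \<V> \<Longrightarrow> compact (closure V)" "\<Union>\<V> = UNIV"
    "\<And>K. compact K \<Longrightarrow> finite {V \<in> \<V>. V \<inter> K \<noteq> {}}"
    using locally_finite_relatively_compact_cover[OF par] by blast
  have l: "l \<in> tensor_csections \<A> r s w" using limitin_topspace[OF lim] topspace_tensor_lf by blast
  have "\<forall>\<^sub>F h in at 0. \<psi> h \<in> tensor_csections \<A> r s w"
    using lim openin_topspace[of "tensor_lf \<A> r s w"] unfolding limitin_def topspace_tensor_lf by blast
  then obtain \<delta>0 where \<delta>0: "\<delta>0 > 0" "\<And>h. h \<noteq> 0 \<Longrightarrow> \<bar>h\<bar> < \<delta>0 \<Longrightarrow> \<psi> h \<in> tensor_csections \<A> r s w"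
    unfolding eventually_at by (auto simp: dist_real_def)
  define S where "S n = {V \<in> \<V>. \<exists>h p. h \<noteq> 0 \<and> \<bar>h\<bar> < \<delta>0 / real (Suc n) \<and> p \<in> V \<and> \<psi> h p \<noteq> 0}" for n
  have \<delta>n: "\<delta>0 / real (Suc n) > 0" "\<delta>0 / real (Suc n) \<le> \<delta>0" for n
    using \<delta>0(1) by (auto simp: field_simps)
  have "\<exists>n. finite (S n)"
  proof (rule ccontr)
    assume "\<not> (\<exists>n. finite (S n))"
    then have inf: "infinite (S n)" for n by blast
    let ?Vl = "{V \<in> \<V>. V \<inter> supp l \<noteq> {}}"
    have finl: "finite ?Vl" using l by (intro \<V>(4)) (simp add: tensor_csections_def)
    \<comment> \<open>Leaving out \<open>?Vl\<close> makes l vanish at the points chosen below;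
      leaving out the earlier members makes V injective, so that a compact set contains p n for
      finitely many n only.\<close>
    have "\<exists>V. \<forall>n. V n \<in> S n - ?Vl \<and> V n \<notin> V ` {..<n::nat}"
    proof (rule dependent_wellorder_choice)
      fix n and V :: "nat \<Rightarrow> 'a set"
      have "infinite (S n - ?Vl - V ` {..<n})"
        by (intro Diff_infinite_finite inf finl finite_imageI finite_lessThan)
      then have "S n - ?Vl - V ` {..<n} \<noteq> {}" by (metis finite.emptyI)
      then show "\<exists>r. r \<in> S n - ?Vl \<and> r \<notin> V ` {..<n}" by blast
    next
      fix r and f g :: "nat \<Rightarrow> 'a set" and x
      assume "\<And>y. y < x \<Longrightarrow> f y = g y"
      then have "f ` {..<x} = g ` {..<x}" by (intro image_cong) auto
      then show "(r \<in> S x - ?Vl \<and> r \<notin> f ` {..<x}) = (r \<in> S x - ?Vl \<and> r \<notin> g ` {..<x})" by simp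
    qed
    then obtain V where V: "\<And>n. V n \<in> S n" "\<And>n. V n \<notin> ?Vl" "\<And>n. V n \<notin> V ` {..<n}" by blast
    have inj: "inj V"
    proof (rule linorder_injI)
      fix m n :: nat assume "m < n"
      then show "V m \<noteq> V n" using V(3)[of n] by (metis imageI lessThan_iff)
    qed
    have "\<forall>n. \<exists>h p. h \<noteq> 0 \<and> \<bar>h\<bar> < \<delta>0 / real (Suc n) \<and> p \<in> V n \<and> \<psi> h p \<noteq> 0"
      using V(1) unfolding S_def by blast
    then obtain h p where h: "\<And>n. h n \<noteq> 0" "\<And>n. \<bar>h n\<bar> < \<delta>0 / real (Suc n)" and p: "\<And>n. p n \<in> V n" "\<And>n. \<psi> (h n) (p n) \<noteq> 0"
      by metis
    have \<psi>c: "\<psi> (h n) \<in> tensor_csections \<A> r s w" for n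
    proof (rule \<delta>0(2)[OF h(1)])
      show "\<bar>h n\<bar> < \<delta>0" using h(2)[of n] \<delta>n(2)[of n] by linarith
    qed
    have lp: "l (p n) = 0" for n
    proof -
      have "V n \<in> \<V>" using V(1)[of n] by (simp add: S_def)
      then have "p n \<notin> supp l" using V(2)[of n] p(1)[of n] by blast
      then show ?thesis by (rule not_in_supp)
    qed
    have "\<forall>n. \<exists>c I J. \<psi> (h n) (p n) c I J \<noteq> 0"
      using p(2) by (auto simp: fun_eq_iff)
    then obtain c I J where cIJ: "\<And>n. \<psi> (h n) (p n) (c n) (I n) (J n) \<noteq> 0" by metis
    have c: "c n \<in> charts_at \<A> (p n)" for n
    proof (rule ccontr)
      assume "c n \<notin> charts_at \<A> (p n)"
      then have "\<psi> (h n) (p n) (c n) = 0"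
        by (rule fibre_outside[OF section_fibre[OF csections_sections[OF \<psi>c]]])
      then show False using cIJ[of n] by simp
    qed
    have fin: "finite {n. p n \<in> K}" if K: "compact K" for K
    proof (rule inj_on_finite[OF inj_on_subset[OF inj subset_UNIV] _ \<V>(4)[OF K]])
      show "V ` {n. p n \<in> K} \<subseteq> {V \<in> \<V>. V \<inter> K \<noteq> {}}"
        using V(1) p(1) unfolding S_def by blast
    qed
    define a where "a n = \<bar>\<psi> (h n) (p n) (c n) (I n) (J n)\<bar>" for n
    have a: "a n > 0" for n using cIJ by (simp add: a_def)
    obtain N where N: "seminorm_on (tensor_csections \<A> r s w) N"
      "\<And>K e. compact K \<Longrightarrow> e > 0 \<Longrightarrow>
        seminorm_nhd_0 (tensor_seminorms \<A>) (tensor_sections_in \<A> r s w K) {y \<in> tensor_csections \<A> r s w. N y < e}"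
      "\<And>y n. y \<in> tensor_csections \<A> r s w \<Longrightarrow> \<bar>y (p n) (c n) (I n) (J n)\<bar> \<le> a n * N y"
    proof (rule discrete_seminorm[of p a c r s w I J], goal_cases)
      case (1 K)
      show ?case by (rule fin) (fact 1)
    next
      case (4 N)
      show ?case by (rule that) (fact 4)+
    qed (use a c in auto)
    have "((\<lambda>h. N (\<psi> h - l)) \<longlongrightarrow> 0) (at 0)"
    proof (rule lf_limit_seminorm[of "tensor_sections_in \<A> r s w ` {K. compact K}" N "tensor_seminorms \<A>"],
        unfold csections_Union[symmetric])
      show "limitin (lf_topology (tensor_seminorms \<A>) (tensor_sections_in \<A> r s w ` {K. compact K})) \<psi> l (at 0)"
        using lim unfolding tensor_lf_def .
    qed (use N(1,2) vsub_csections in auto)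
    then have "\<forall>\<^sub>F h in at 0. dist (N (\<psi> h - l)) 0 < 1" by (rule tendstoD) simp
    then obtain d where d: "d > 0" "\<And>h. h \<noteq> 0 \<Longrightarrow> \<bar>h\<bar> < d \<Longrightarrow> \<bar>N (\<psi> h - l)\<bar> < 1"
      unfolding eventually_at by (auto simp: dist_real_def)
    obtain n where n: "\<delta>0 / real (Suc n) < d"
    proof -
      obtain n where n: "\<delta>0 / d < real n" using reals_Archimedean2 by blast
      have "\<delta>0 / d < real (Suc n)" using n by simp
      then have "\<delta>0 / real (Suc n) < d" using d(1) by (simp add: field_simps)
      then show thesis by (rule that)
    qed
    have "\<bar>N (\<psi> (h n) - l)\<bar> < 1" using d(2)[OF h(1)[of n]] h(2)[of n] n by linarith
    \<comment> \<open>As l vanishes at p n, the left side is a n itself; N of the difference is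
      therefore at least 1, for parameters h n as small as desired.\<close>
    moreover have "\<bar>(\<psi> (h n) - l) (p n) (c n) (I n) (J n)\<bar> \<le> a n * N (\<psi> (h n) - l)"
      by (rule N(3)) (rule vsub_diff[OF vsub_csections \<psi>c l])
    then have "a n * 1 \<le> a n * N (\<psi> (h n) - l)" by (simp add: lp a_def)
    then have "1 \<le> N (\<psi> (h n) - l)" using a[of n] by (simp only: mult_le_cancel_left_pos)
    ultimately show False by simp
  qed
  then obtain n where n: "finite (S n)" by blast
  let ?K = "\<Union>V\<in>S n. closure V"
  show thesis
  proof (rule that)
    show K: "compact ?K" by (intro compact_UN n \<V>(2)) (auto simp: S_def)
    show "\<delta>0 / real (Suc n) > 0" by (rule \<delta>n)
    fix h :: real assume h: "h \<noteq> 0" "\<bar>h\<bar> < \<delta>0 / real (Suc n)"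
    have "\<psi> h p = 0" if p: "p \<notin> ?K" for p
    proof (rule ccontr)
      assume nz: "\<psi> h p \<noteq> 0"
      have "p \<in> \<Union>\<V>" using \<V>(3) by simp
      then obtain V where V: "V \<in> \<V>" "p \<in> V" by (rule UnionE)
      have "V \<in> S n"
        unfolding S_def by (intro CollectI conjI exI[of _ h] exI[of _ p]) (fact V h nz)+
      then show False using p subsetD[OF closure_subset V(2)] by blast
    qed
    moreover have "\<psi> h \<in> tensor_sections \<A> r s w"
    proof (rule csections_sections[OF \<delta>0(2)[OF h(1)]])
      show "\<bar>h\<bar> < \<delta>0" using h(2) \<delta>n(2)[of n] by linarith
    qed
    ultimately show "\<psi> h \<in> tensor_sections_in \<A> r s w ?K"
      by (simp add: sections_in_iff[OF compact_imp_closed[OF K]])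
  qed
qed

text \<open>The difference quotients at t0 converge, so near t0 they have their supports in one
  compact set; the curve is recovered from its value at t0 and a multiple of the quotient.\<close>

lemma tensor_curve_support:
  assumes par: "paracompact_space (euclidean :: 'a topology)"
    and \<omega>: "smooth_curve (tensor_lf \<A> r s w) \<omega>"
  obtains K \<delta> where "compact K" "\<delta> > 0" "\<And>t. \<bar>t - t0\<bar> < \<delta> \<Longrightarrow> \<omega> t \<in> tensor_sections_in \<A> r s w K"
proof -
  obtain D where D: "D (0::nat) = \<omega>"
    "limitin (tensor_lf \<A> r s w) (\<lambda>h. (1 / h) *\<^sub>R (D 0 (t0 + h) - D 0 t0)) (D (Suc 0) t0) (at 0)"
    using \<omega> unfolding smooth_curve_def by blast
  let ?\<psi> = "\<lambda>h. (1 / h) *\<^sub>R (\<omega> (t0 + h) - \<omega> t0)"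
  obtain K \<delta> where K: "compact K" "\<delta> > 0" "\<And>h. h \<noteq> 0 \<Longrightarrow> \<bar>h\<bar> < \<delta> \<Longrightarrow> ?\<psi> h \<in> tensor_sections_in \<A> r s w K"
    using lf_limit_support[OF par D(2)[unfolded D(1)]] by blast
  obtain K0 where K0: "compact K0" "\<omega> t0 \<in> tensor_sections_in \<A> r s w K0"
    using tensor_curve_csection[OF \<omega>, of t0] csections_iff by blast
  have KK: "compact (K \<union> K0)" using K(1) K0(1) by (rule compact_Un)
  have w0: "\<omega> t0 \<in> tensor_sections_in \<A> r s w (K \<union> K0)" using K0(2) sections_in_mono by blast
  show thesis
  proof (rule that[OF KK K(2)])
    fix t assume t: "\<bar>t - t0\<bar> < \<delta>"
    show "\<omega> t \<in> tensor_sections_in \<A> r s w (K \<union> K0)"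
    proof (cases "t = t0")
      case False
      have "?\<psi> (t - t0) \<in> tensor_sections_in \<A> r s w (K \<union> K0)"
        using K(3)[of "t - t0"] False t sections_in_mono[of K "K \<union> K0" r s w] by auto
      then have "\<omega> t0 + (t - t0) *\<^sub>R ?\<psi> (t - t0) \<in> tensor_sections_in \<A> r s w (K \<union> K0)"
        by (rule sections_in_add[OF KK w0 sections_in_scaleR[OF KK]])
      then show ?thesis using False by simp
    qed (use w0 in simp)
  qed
qed

end

section \<open>The embedding in charts\<close>

context manifold
begin

text \<open>
  The section \<open>q \<mapsto> A\<^sup>s\<^sub>r(p,q) e \<otimes> \<omega>(q)\<close>, where \<open>e\<close> is the basis tensor of \<open>(T\<^sup>s\<^sub>r)\<^sub>pM\<close> in the chart \<open>c\<close> dual to the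
  component \<open>(I, J)\<close> of \<open>(T\<^sup>r\<^sub>s)\<^sub>pM\<close>.
\<close>

definition iota_sec :: "nat \<Rightarrow> nat \<Rightarrow> ('a, 'n) chart \<Rightarrow> 'n list \<Rightarrow> 'n list \<Rightarrow>
    ('a \<Rightarrow> 'a \<Rightarrow> ('a, 'n) two_point) \<Rightarrow> 'a \<Rightarrow> ('a \<Rightarrow> ('a, 'n) tensor) \<Rightarrow> 'a \<Rightarrow> ('a, 'n) tensor" where
  "iota_sec r s c I J A p \<omega> q = (\<lambda>d K L.
     if d \<in> charts_at \<A> q then coef s r (A p q c d) (A q p d c) K L J I * \<omega> q d [] [] else 0)"

lemma form_transform:
  assumes "\<omega> q \<in> tensor_fibre \<A> 0 0 1 q" "c \<in> charts_at \<A> q" "d \<in> charts_at \<A> q"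
  shows "\<omega> q d [] [] = 1 / det (jac c d q) * \<omega> q c [] []"
  by (subst fibre_transform[OF assms]) (simp add: tensor_action_apply coef_def wprod_def)

text \<open>A frame change H at q multiplies A(p,q) on the left by H and A(q,p) on the right by its
  inverse, which \<open>coef_mult\<close> identifies with the action on (s,r)-tensors; the form
  contributes the determinant of weight 1.\<close>

lemma iota_sec_fibre:
  assumes A: "A \<in> TO_sections \<A>" and c: "c \<in> charts_at \<A> p" and \<omega>: "\<omega> q \<in> tensor_fibre \<A> 0 0 1 q"
  shows "iota_sec r s c I J A p \<omega> q \<in> tensor_fibre \<A> s r 1 q"
proof (rule fibreI[OF chart_at])
  let ?e = "chart_at \<A> q"
  fix K L :: "'n list" assume "length K \<noteq> s \<or> length L \<noteq> r"
  then show "iota_sec r s c I J A p \<omega> q ?e K L = 0" by (auto simp: iota_sec_def coef_eq_0)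
next
  let ?e = "chart_at \<A> q"
  fix d assume d: "d \<in> charts_at \<A> q"
  let ?H = "jac ?e d q" and ?P = "A p q c ?e" and ?Q = "A q p ?e c"
  have P: "A p q c d = ?H ** ?P"
    using TO_transform[OF A c c chart_at d] by (simp add: jac_self[OF c])
  have Q: "A q p d c = ?Q ** matrix_inv ?H"
    using TO_transform[OF A chart_at d c c] by (simp add: jac_self[OF c] jac_inverse(1)[OF chart_at d])
  show "iota_sec r s c I J A p \<omega> q d = tensor_action s r 1 ?H (iota_sec r s c I J A p \<omega> q ?e)"
  proof (intro ext)
    fix K L
    have "tensor_action s r 1 ?H (iota_sec r s c I J A p \<omega> q ?e) K L =
        1 / det ?H * ((\<Sum>K' | length K' = s. \<Sum>L' | length L' = r.
          coef s r ?H (matrix_inv ?H) K L K' L' * coef s r ?P ?Q K' L' J I) * \<omega> q ?e [] [])"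
      by (simp add: tensor_action_apply iota_sec_def chart_at sum_distrib_right mult.assoc)
    also have "\<dots> = coef s r (A p q c d) (A q p d c) K L J I * (1 / det ?H * \<omega> q ?e [] [])"
      unfolding coef_mult P Q by simp
    also have "\<dots> = iota_sec r s c I J A p \<omega> q d K L"
      using d form_transform[of \<omega> q, OF \<omega> chart_at d] by (simp add: iota_sec_def)
    finally show "iota_sec r s c I J A p \<omega> q d K L = tensor_action s r 1 ?H (iota_sec r s c I J A p \<omega> q ?e) K L" ..
  qed
qed (simp add: iota_sec_def fun_eq_iff)

text \<open>The common compact support is inherited from the form. In a chart d the components are
  polynomial in the entries of A and the coefficient of the form, evaluated along the smooth map
  p.\<close>

lemma iota_sec_family:
  fixes \<Omega> :: "'f::euclidean_space set"
  assumes \<Omega>: "open \<Omega>" and K: "compact K" and c: "c \<in> \<A>"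
    and p: "\<And>\<xi>. \<xi> \<in> \<Omega> \<Longrightarrow> p \<xi> \<in> fst c" "smooth_on \<Omega> (\<lambda>\<xi>. snd c (p \<xi>))"
    and A: "\<And>\<xi>. \<xi> \<in> \<Omega> \<Longrightarrow> A \<xi> \<in> TO_sections \<A>"
    and sA: "\<And>c d. c \<in> \<A> \<Longrightarrow> d \<in> \<A> \<Longrightarrow> smooth_on (\<Omega> \<times> (img c \<times> img d))
      (\<lambda>z. A (fst z) (chart_inv c (fst (snd z))) (chart_inv d (snd (snd z))) c d)"
    and \<omega>: "\<And>\<xi>. \<xi> \<in> \<Omega> \<Longrightarrow> \<omega> \<xi> \<in> tensor_sections_in \<A> 0 0 1 K"
    and s\<omega>: "\<And>d. d \<in> \<A> \<Longrightarrow> smooth_on (\<Omega> \<times> img d) (\<lambda>z. \<omega> (fst z) (chart_inv d (snd z)) d [] [])"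
  shows "smooth_family \<Omega> K s r 1 (\<lambda>\<xi>. iota_sec r s c I J (A \<xi>) (p \<xi>) (\<omega> \<xi>))"
  unfolding smooth_family_def
proof (intro conjI ballI allI impI \<Omega> K)
  fix \<xi> q assume \<xi>: "\<xi> \<in> \<Omega>"
  have w: "\<omega> \<xi> \<in> tensor_sections \<A> 0 0 1" "q \<notin> K \<Longrightarrow> \<omega> \<xi> q = 0"
    using \<omega>[OF \<xi>] sections_in_iff[OF compact_imp_closed[OF K]] by blast+
  show "iota_sec r s c I J (A \<xi>) (p \<xi>) (\<omega> \<xi>) q \<in> tensor_fibre \<A> s r 1 q"
    by (rule iota_sec_fibre[OF A[OF \<xi>] _ section_fibre[OF w(1)]]) (use c p(1)[OF \<xi>] in \<open>simp add: charts_at_iff\<close>)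
  show "iota_sec r s c I J (A \<xi>) (p \<xi>) (\<omega> \<xi>) q = 0" if "q \<notin> K"
    using w(2)[OF that] by (simp add: iota_sec_def fun_eq_iff)
next
  fix d L M assume d: "d \<in> \<A>"
  let ?U = "\<Omega> \<times> img d"
  have op: "open ?U" by (intro open_Times \<Omega> open_chart d)
  have opc: "open (\<Omega> \<times> (img c \<times> img d))" "open (\<Omega> \<times> (img d \<times> img c))"
    by (intro open_Times \<Omega> open_chart c d)+
  have sp: "smooth_on ?U (\<lambda>z. snd c (p (fst z)))"
    by (rule smooth_on_compose[OF op \<Omega> p(2) smooth_on_fst[OF op]]) auto
  have 1: "smooth_on ?U (\<lambda>z. A (fst z) (chart_inv c (snd c (p (fst z)))) (chart_inv d (snd z)) c d)"
    using smooth_on_compose[OF op opc(1) sA[OF c d], of "\<lambda>z. (fst z, (snd c (p (fst z)), snd z))"]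
    by (simp add: smooth_on_Pair smooth_on_fst smooth_on_snd sp op p(1) mem_Times_iff)
  have 2: "smooth_on ?U (\<lambda>z. A (fst z) (chart_inv d (snd z)) (chart_inv c (snd c (p (fst z)))) d c)"
    using smooth_on_compose[OF op opc(2) sA[OF d c], of "\<lambda>z. (fst z, (snd z, snd c (p (fst z))))"]
    by (simp add: smooth_on_Pair smooth_on_fst smooth_on_snd sp op p(1) mem_Times_iff)
  have "smooth_on ?U (\<lambda>z. coef s r (A (fst z) (chart_inv c (snd c (p (fst z)))) (chart_inv d (snd z)) c d)
      (A (fst z) (chart_inv d (snd z)) (chart_inv c (snd c (p (fst z)))) d c) L M J I *
      \<omega> (fst z) (chart_inv d (snd z)) d [] [])"
    by (intro smooth_on_mult op smooth_on_coef 1 2 s\<omega> d)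
  then show "smooth_on ?U (\<lambda>z. iota_sec r s c I J (A (fst z)) (p (fst z)) (\<omega> (fst z)) (chart_inv d (snd z)) d L M)"
  proof (rule iffD2[OF smooth_on_cong[OF op], rotated])
    fix z assume "z \<in> ?U"
    then have "fst z \<in> \<Omega>" "snd z \<in> img d" by auto
    then show "iota_sec r s c I J (A (fst z)) (p (fst z)) (\<omega> (fst z)) (chart_inv d (snd z)) d L M =
        coef s r (A (fst z) (chart_inv c (snd c (p (fst z)))) (chart_inv d (snd z)) c d)
          (A (fst z) (chart_inv d (snd z)) (chart_inv c (snd c (p (fst z)))) d c) L M J I *
        \<omega> (fst z) (chart_inv d (snd z)) d [] []"
      using d p(1) c by (simp add: iota_sec_def chart_inv_charts_at chart_inv_left)
  qed
qed

lemma TO_smooth_const: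
  assumes \<Omega>: "open (\<Omega> :: 'f::euclidean_space set)" and A: "A \<in> TO_sections \<A>" and cd: "c \<in> \<A>" "d \<in> \<A>"
  shows "smooth_on (\<Omega> \<times> (img c \<times> img d)) (\<lambda>z. A (chart_inv c (fst (snd z))) (chart_inv d (snd (snd z))) c d)"
proof -
  have op: "open (\<Omega> \<times> (img c \<times> img d))" by (intro open_Times \<Omega> open_chart cd)
  show ?thesis
    using smooth_on_compose[OF op open_Times[OF open_chart(2)[OF cd(1)] open_chart(2)[OF cd(2)]] TO_smooth[OF A cd] smooth_on_snd[OF op]]
    by (simp add: mem_Times_iff)
qed

lemma section_smooth_const:
  assumes \<Omega>: "open (\<Omega> :: 'f::euclidean_space set)" and t: "t \<in> tensor_sections \<A> r s w" and d: "d \<in> \<A>"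
  shows "smooth_on (\<Omega> \<times> img d) (\<lambda>z. t (chart_inv d (snd z)) d I J)"
proof -
  have op: "open (\<Omega> \<times> img d)" by (intro open_Times \<Omega> open_chart d)
  show ?thesis
    by (rule smooth_on_compose[OF op open_chart(2)[OF d] section_smooth[OF t d] smooth_on_snd[OF op]]) auto
qed

lemma iota_sec_csection:
  assumes A: "A \<in> TO_sections \<A>" and \<omega>: "\<omega> \<in> tensor_csections \<A> 0 0 1" and c: "c \<in> charts_at \<A> p"
  shows "iota_sec r s c I J A p \<omega> \<in> tensor_csections \<A> s r 1"
proof -
  obtain K where K: "compact K" "\<omega> \<in> tensor_sections_in \<A> 0 0 1 K" using \<omega> unfolding csections_iff by blast
  have cA: "c \<in> \<A>" "p \<in> fst c" using c by (auto simp: charts_at_iff)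
  \<comment> \<open>A constant family over the real line, so that the smoothness and support
    argument for families is reused.\<close>
  have "smooth_family (UNIV :: real set) K s r 1 (\<lambda>\<xi>. iota_sec r s c I J A p \<omega>)"
  proof (rule iota_sec_family[OF open_UNIV K(1) cA(1)])
    show "smooth_on ((UNIV :: real set) \<times> (img c \<times> img d))
        (\<lambda>z. A (chart_inv c (fst (snd z))) (chart_inv d (snd (snd z))) c d)" if "c \<in> \<A>" "d \<in> \<A>" for c d
      by (rule TO_smooth_const[OF open_UNIV A that])
    show "smooth_on ((UNIV :: real set) \<times> img d) (\<lambda>z. \<omega> (chart_inv d (snd z)) d [] [])" if "d \<in> \<A>" for d
      by (rule section_smooth_const[OF open_UNIV csections_sections[OF \<omega>] that])
  qed (use K A cA in auto)
  then show ?thesis by (rule family_csection) simp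
qed

text \<open>The explicit candidate for the definite description in \<open>iota\<close>.\<close>

definition iota_comp :: "nat \<Rightarrow> nat \<Rightarrow> (('a \<Rightarrow> ('a, 'n) tensor) \<Rightarrow> real) \<Rightarrow> ('a \<Rightarrow> ('a, 'n) tensor) \<Rightarrow> 'a \<Rightarrow>
    ('a \<Rightarrow> 'a \<Rightarrow> ('a, 'n) two_point) \<Rightarrow> ('a, 'n) tensor" where
  "iota_comp r s v \<omega> p A = (\<lambda>c I J. if c \<in> charts_at \<A> p then v (iota_sec r s c I J A p \<omega>) else 0)"

lemma distribution_sum2:
  assumes v: "v \<in> distributions \<A> r s" and \<sigma>: "\<And>I J. \<sigma> I J \<in> tensor_csections \<A> s r 1"
  shows "v (\<Sum>I\<in>R. \<Sum>J\<in>S. a I J *\<^sub>R \<sigma> I J) = (\<Sum>I\<in>R. \<Sum>J\<in>S. a I J * v (\<sigma> I J))"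
proof -
  have "v (\<Sum>I\<in>R. 1 *\<^sub>R (\<Sum>J\<in>S. a I J *\<^sub>R \<sigma> I J)) = (\<Sum>I\<in>R. 1 * v (\<Sum>J\<in>S. a I J *\<^sub>R \<sigma> I J))"
    by (rule distribution_sum[OF v]) (intro csections_sum csections_scaleR \<sigma>)
  also have "\<dots> = (\<Sum>I\<in>R. \<Sum>J\<in>S. a I J * v (\<sigma> I J))"
  proof (intro sum.cong refl)
    fix I
    have "v (\<Sum>J\<in>S. a I J *\<^sub>R \<sigma> I J) = (\<Sum>J\<in>S. a I J * v (\<sigma> I J))"
      by (rule distribution_sum[OF v \<sigma>])
    then show "1 * v (\<Sum>J\<in>S. a I J *\<^sub>R \<sigma> I J) = (\<Sum>J\<in>S. a I J * v (\<sigma> I J))" by simp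
  qed
  finally show ?thesis by simp
qed

lemma sum_fun_apply: "(\<Sum>i\<in>I. f i) x = (\<Sum>i\<in>I. f i x)"
  by (induction I rule: infinite_finite_induct) auto

text \<open>A change of charts at p combines the sections \<open>iota_sec\<close> linearly with
  coefficients constant in q, by \<open>coef_mult_right\<close>; they can be taken out of v.\<close>

lemma iota_comp_fibre:
  assumes v: "v \<in> distributions \<A> r s" and A: "A \<in> TO_sections \<A>" and \<omega>: "\<omega> \<in> tensor_csections \<A> 0 0 1"
  shows "iota_comp r s v \<omega> p A \<in> tensor_fibre \<A> r s 0 p"
proof (rule fibreI[OF chart_at])
  let ?c = "chart_at \<A> p"
  fix I J :: "'n list" assume "length I \<noteq> r \<or> length J \<noteq> s"
  then have "iota_sec r s ?c I J A p \<omega> = 0"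
    by (auto simp: iota_sec_def coef_eq_0 fun_eq_iff)
  then show "iota_comp r s v \<omega> p A ?c I J = 0"
    by (simp add: iota_comp_def distribution_zero[OF v])
next
  let ?c = "chart_at \<A> p"
  fix d assume d: "d \<in> charts_at \<A> p"
  let ?F = "jac ?c d p"
  show "iota_comp r s v \<omega> p A d = tensor_action r s 0 ?F (iota_comp r s v \<omega> p A ?c)"
  proof (intro ext)
    fix I J
    have "iota_sec r s d I J A p \<omega> = (\<Sum>K | length K = r. \<Sum>L | length L = s.
        coef r s ?F (matrix_inv ?F) I J K L *\<^sub>R iota_sec r s ?c K L A p \<omega>)"
    proof (intro ext)
      fix q e M N
      show "iota_sec r s d I J A p \<omega> q e M N = (\<Sum>K | length K = r. \<Sum>L | length L = s.
        coef r s ?F (matrix_inv ?F) I J K L *\<^sub>R iota_sec r s ?c K L A p \<omega>) q e M N"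
      proof (cases "e \<in> charts_at \<A> q")
        case e: True
        have P: "A p q d e = A p q ?c e ** matrix_inv ?F"
          using TO_transform[OF A chart_at d e e] by (simp add: jac_self[OF e] jac_inverse(1)[OF chart_at d])
        have Q: "A q p e d = ?F ** A q p e ?c"
          using TO_transform[OF A e e chart_at d] by (simp add: jac_self[OF e])
        have "(\<Sum>K | length K = r. \<Sum>L | length L = s.
            coef r s ?F (matrix_inv ?F) I J K L * coef s r (A p q ?c e) (A q p e ?c) M N L K) =
            coef s r (A p q ?c e ** matrix_inv ?F) (?F ** A q p e ?c) M N J I"
          by (subst sum.swap) (rule coef_mult_right)
        then show ?thesis
          using e by (simp add: iota_sec_def sum_fun_apply P Q mult.assoc[symmetric] sum_distrib_right[symmetric])
      qed (simp add: iota_sec_def sum_fun_apply)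
    qed
    then show "iota_comp r s v \<omega> p A d I J = tensor_action r s 0 ?F (iota_comp r s v \<omega> p A ?c) I J"
      using distribution_sum2[OF v iota_sec_csection[OF A \<omega> chart_at]] d chart_at[of p]
      by (simp add: iota_comp_def tensor_action_apply)
  qed
qed (simp add: iota_comp_def fun_eq_iff)

text \<open>Expanding t in the basis tensors at p writes the test section as a combination of the
  sections \<open>iota_sec\<close> with coefficients constant in q.\<close>

lemma iota_comp_contraction:
  assumes v: "v \<in> distributions \<A> r s" and A: "A \<in> TO_sections \<A>" and \<omega>: "\<omega> \<in> tensor_csections \<A> 0 0 1"
  shows "contraction \<A> r s p (iota_comp r s v \<omega> p A) t = v (\<lambda>q. tensor_form (spread \<A> s r A p q t) (\<omega> q))"
proof -
  let ?c = "chart_at \<A> p"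
  have "(\<lambda>q. tensor_form (spread \<A> s r A p q t) (\<omega> q)) =
      (\<Sum>I | length I = r. \<Sum>J | length J = s. t ?c J I *\<^sub>R iota_sec r s ?c I J A p \<omega>)"
  proof (intro ext)
    fix q e M N
    show "tensor_form (spread \<A> s r A p q t) (\<omega> q) e M N =
        (\<Sum>I | length I = r. \<Sum>J | length J = s. t ?c J I *\<^sub>R iota_sec r s ?c I J A p \<omega>) q e M N"
    proof (cases "e \<in> charts_at \<A> q")
      case True
      have "tensor_form (spread \<A> s r A p q t) (\<omega> q) e M N =
          (\<Sum>J | length J = s. \<Sum>I | length I = r. coef s r (A p q ?c e) (A q p e ?c) M N J I * t ?c J I) * \<omega> q e [] []"
        using True by (simp add: tensor_form_def spread_def Let_def tensor_map_coef)
      also have "\<dots> = (\<Sum>I | length I = r. \<Sum>J | length J = s. coef s r (A p q ?c e) (A q p e ?c) M N J I * t ?c J I) * \<omega> q e [] []"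
        by (subst sum.swap) simp
      also have "\<dots> = (\<Sum>I | length I = r. \<Sum>J | length J = s. t ?c J I *\<^sub>R iota_sec r s ?c I J A p \<omega>) q e M N"
        using True by (simp add: sum_fun_apply iota_sec_def sum_distrib_left mult_ac)
      finally show ?thesis .
    qed (simp add: tensor_form_def spread_def iota_sec_def sum_fun_apply)
  qed
  then show ?thesis
    using distribution_sum2[where \<sigma> = "\<lambda>I J. iota_sec r s ?c I J A p \<omega>" and a = "\<lambda>I J. t ?c J I",
        OF v iota_sec_csection[OF A \<omega> chart_at]] chart_at[of p]
    by (simp add: contraction_def iota_comp_def mult.commute)
qed

text \<open>Pairing with a global field that extends a dual basis tensor at p reads off one
  component, so the pairings determine the tensor.\<close>

lemma contraction_unique:
  assumes z: "z \<in> tensor_fibre \<A> r s 0 p" and z': "z' \<in> tensor_fibre \<A> r s 0 p"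
    and eq: "\<And>t. t \<in> tensor_sections \<A> s r 0 \<Longrightarrow> contraction \<A> r s p z (t p) = contraction \<A> r s p z' (t p)"
  shows "z = z'"
proof (rule fibre_eqI[OF z z' chart_at], intro ext)
  let ?c = "chart_at \<A> p"
  fix I J
  show "z ?c I J = z' ?c I J"
  proof (cases "length I = r \<and> length J = s")
    case True
    define \<delta> where "\<delta> K L = (if K = J \<and> L = I then 1 else 0 :: real)" for K L
    define t0 where "t0 d = (if d \<in> charts_at \<A> p then tensor_action s r 0 (jac ?c d p) \<delta> else 0)" for d
    have \<delta>: "tensor_action s r 0 (mat 1) \<delta> = \<delta>"
      by (rule tensor_action_mat_1) (use True in \<open>auto simp: \<delta>_def\<close>)
    have t0c: "t0 ?c = \<delta>" using chart_at[of p] by (simp add: t0_def \<delta>)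
    have "t0 \<in> tensor_fibre \<A> s r 0 p"
    proof (rule fibreI[OF chart_at])
      show "t0 ?c K L = 0" if "length K \<noteq> s \<or> length L \<noteq> r" for K L
        unfolding t0c using that True by (auto simp: \<delta>_def)
      show "t0 d = tensor_action s r 0 (jac ?c d p) (t0 ?c)" if "d \<in> charts_at \<A> p" for d
        unfolding t0c using that by (simp add: t0_def)
    qed (simp add: t0_def)
    then obtain t where t: "t \<in> tensor_sections \<A> s r 0" "t p = t0" by (rule section_extending)
    have "contraction \<A> r s p y t0 = y ?c I J" for y
    proof -
      have "contraction \<A> r s p y t0 = (\<Sum>I' | length I' = r. if I' = I then (\<Sum>J' | length J' = s. if J' = J then y ?c I' J' else 0) else 0)"
        unfolding contraction_def t0c by (intro sum.cong refl) (auto simp: \<delta>_def if_distrib[of "\<lambda>x. _ * x"] cong: if_cong)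
      also have "\<dots> = y ?c I J" using True by (simp add: sum.delta)
      finally show ?thesis .
    qed
    then show ?thesis using eq[OF t(1)] t(2) by simp
  next
    case False
    then show ?thesis using fibre_length[OF z] fibre_length[OF z'] by simp
  qed
qed

lemma iota_eq:
  assumes v: "v \<in> distributions \<A> r s" and A: "A \<in> TO_sections \<A>" and \<omega>: "\<omega> \<in> tensor_csections \<A> 0 0 1"
  shows "iota \<A> r s v \<omega> p A = iota_comp r s v \<omega> p A"
  unfolding iota_def
proof (rule the_equality)
  show "iota_comp r s v \<omega> p A \<in> tensor_fibre \<A> r s 0 p \<and> (\<forall>t\<in>tensor_sections \<A> s r 0.
      contraction \<A> r s p (iota_comp r s v \<omega> p A) (t p) = v (\<lambda>q. tensor_form (spread \<A> s r A p q (t p)) (\<omega> q)))"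
    using iota_comp_fibre[OF assms] iota_comp_contraction[OF assms] by blast
  fix z assume z: "z \<in> tensor_fibre \<A> r s 0 p \<and> (\<forall>t\<in>tensor_sections \<A> s r 0.
      contraction \<A> r s p z (t p) = v (\<lambda>q. tensor_form (spread \<A> s r A p q (t p)) (\<omega> q)))"
  show "z = iota_comp r s v \<omega> p A"
  proof (rule contraction_unique)
    show "contraction \<A> r s p z (t p) = contraction \<A> r s p (iota_comp r s v \<omega> p A) (t p)"
      if "t \<in> tensor_sections \<A> s r 0" for t
      using z that iota_comp_contraction[OF assms] by simp
  qed (use z iota_comp_fibre[OF assms] in auto)
qed

lemma A_hat0_csection: "\<omega> \<in> A_hat0 \<A> \<Longrightarrow> \<omega> \<in> tensor_csections \<A> 0 0 1"
  unfolding A_hat0_def by blast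

lemma iota_basic_space:
  assumes par: "paracompact_space (euclidean :: 'a topology)" and v: "v \<in> distributions \<A> r s"
  shows "iota \<A> r s v \<in> basic_space \<A> r s"
  unfolding basic_space_def
proof (intro CollectI conjI ballI allI impI)
  fix \<omega> p A assume "\<omega> \<in> A_hat0 \<A>" "A \<in> B_hat \<A>"
  then show "iota \<A> r s v \<omega> p A \<in> tensor_fibre \<A> r s 0 p"
    using iota_eq[OF v] iota_comp_fibre[OF v] A_hat0_csection B_hat_TO by metis
next
  fix \<omega> p A c I J
  assume \<omega>: "smooth_curve (tensor_lf \<A> 0 0 1) \<omega>" and p: "smooth_curve_in_manifold \<A> p"
    and A: "smooth_curve (TO_lf \<A>) A" and c: "c \<in> \<A>"
  let ?T = "{t. p t \<in> fst c}"
  have "continuous_on UNIV p" and sp: "smooth_on ?T (\<lambda>t. snd c (p t))"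
    using p c unfolding smooth_curve_in_manifold_def comp_def by auto
  then have "open (p -` fst c)" using open_chart(1)[OF c] by (simp add: continuous_on_open_vimage)
  then have T: "open ?T" by (simp add: vimage_def)
  have At: "A t \<in> TO_sections \<A>" for t by (rule B_hat_TO[OF TO_curve_B_hat[OF A]])
  have \<omega>t: "\<omega> t \<in> tensor_csections \<A> 0 0 1" for t by (rule tensor_curve_csection[OF \<omega>])
  show "smooth_on ?T (\<lambda>t. iota \<A> r s v (\<omega> t) (p t) (A t) c I J)"
  proof (rule smooth_on_local)
    fix t0 assume t0: "t0 \<in> ?T"
    obtain K \<delta> where K: "compact K" "\<delta> > 0" "\<And>t. \<bar>t - t0\<bar> < \<delta> \<Longrightarrow> \<omega> t \<in> tensor_sections_in \<A> 0 0 1 K"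
      using tensor_curve_support[OF par \<omega>, of t0] by blast
    \<comment> \<open>Smoothness is local in time: near t0 the curve p stays in the chart c and the
      forms have supports in one compact set.\<close>
    let ?\<Omega> = "ball t0 \<delta> \<inter> ?T"
    have op: "open ?\<Omega>" by (intro open_Int open_ball T)
    have fam: "smooth_family ?\<Omega> K s r 1 (\<lambda>t. iota_sec r s c I J (A t) (p t) (\<omega> t))"
    proof (rule iota_sec_family[OF op K(1) c])
      show "\<omega> t \<in> tensor_sections_in \<A> 0 0 1 K" if "t \<in> ?\<Omega>" for t
        using that K(3)[of t] by (simp add: dist_real_def abs_minus_commute)
      show "smooth_on (?\<Omega> \<times> (img c \<times> img d))
          (\<lambda>z. A (fst z) (chart_inv c (fst (snd z))) (chart_inv d (snd (snd z))) c d)" if "c \<in> \<A>" "d \<in> \<A>" for c d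
        by (rule smooth_on_subset[OF TO_curve_smooth[OF A that]]) auto
      show "smooth_on (?\<Omega> \<times> img d) (\<lambda>z. \<omega> (fst z) (chart_inv d (snd z)) d [] [])" if "d \<in> \<A>" for d
        by (rule smooth_on_subset[OF tensor_curve_smooth[OF \<omega> that]]) auto
      show "smooth_on ?\<Omega> (\<lambda>t. snd c (p t))" by (rule smooth_on_subset[OF sp]) auto
    qed (use At in auto)
    have "smooth_on ?\<Omega> (\<lambda>t. v (iota_sec r s c I J (A t) (p t) (\<omega> t)))"
      by (rule distribution_family_smooth[OF v fam])
    then have "smooth_on ?\<Omega> (\<lambda>t. iota \<A> r s v (\<omega> t) (p t) (A t) c I J)"
      by (rule iffD2[OF smooth_on_cong[OF op], rotated])
         (use c in \<open>simp add: iota_eq[OF v At \<omega>t] iota_comp_def charts_at_iff\<close>)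
    then show "\<exists>V. t0 \<in> V \<and> smooth_on V (\<lambda>t. iota \<A> r s v (\<omega> t) (p t) (A t) c I J)"
      using t0 K(2) by (intro exI[of _ ?\<Omega>]) simp
  qed
qed

end

section \<open>The Lie derivative of an embedded distribution\<close>

lemma differentiable_bilinear:
  assumes "bounded_bilinear B" "f differentiable (at x)" "g differentiable (at x)"
  shows "(\<lambda>x. B (f x) (g x)) differentiable (at x)"
  using assms(2,3) bounded_bilinear.FDERIV[OF assms(1)] unfolding differentiable_def by blast

lemma differentiable_fst_snd:
  assumes "f differentiable (at (a::'b::real_normed_vector))" "g differentiable (at (b::'c::real_normed_vector))"
  shows "(\<lambda>z. f (fst z)) differentiable (at (a, b))" "(\<lambda>z. g (snd z)) differentiable (at (a, b))"
  using differentiable_compose[of f fst "(a, b)" UNIV] differentiable_compose[of g snd "(a, b)" UNIV] assms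
  by (simp_all add: bounded_linear_imp_differentiable bounded_linear_fst bounded_linear_snd)

text \<open>Reconciles flowing p and q simultaneously, as in the Lie derivative of A, with flowing
  one point at a time; differentiability of G as a function of two variables is what makes the
  partial derivatives add up.\<close>

lemma diagonal_derivative:
  fixes G :: "real \<times> real \<Rightarrow> real"
  assumes G: "G differentiable (at (0, 0))"
    and a: "((\<lambda>a. G (a, 0)) has_real_derivative Da) (at 0)"
    and b: "((\<lambda>b. G (0, b)) has_real_derivative Db) (at 0)"
  shows "((\<lambda>\<tau>. G (\<tau>, \<tau>)) has_real_derivative Da + Db) (at 0)"
proof -
  let ?D = "frechet_derivative G (at (0, 0))"
  have D: "(G has_derivative ?D) (at (0, 0))" using G frechet_derivative_works by blast
  have curve: "((\<lambda>t. G (\<alpha> *\<^sub>R t, \<beta> *\<^sub>R t)) has_real_derivative ?D (\<alpha>, \<beta>)) (at 0)" for \<alpha> \<beta>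
  proof -
    have "((\<lambda>t. (\<alpha> *\<^sub>R t, \<beta> *\<^sub>R t)) has_vector_derivative (\<alpha>, \<beta>)) (at (0::real))"
      by (intro has_vector_derivative_Pair) (auto intro!: derivative_eq_intros)
    from has_vector_derivative_compose_frechet[OF this, of G] G show ?thesis
      by (simp add: has_real_derivative_iff_has_vector_derivative)
  qed
  have "Da = ?D (1, 0)" using DERIV_unique[OF a] curve[of 1 0] by simp
  moreover have "Db = ?D (0, 1)" using DERIV_unique[OF b] curve[of 0 1] by simp
  moreover have "?D (1, 0) + ?D (0, 1) = ?D (1, 1)"
    using linear_add[OF has_derivative_linear[OF D], of "(1, 0)" "(0, 1)"] by simp
  ultimately show ?thesis using curve[of 1 1] by simp
qed

context manifold
begin

text \<open>Varying the point p in a chart, for the Lie derivative of the tensor field given by the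
  embedded distribution.\<close>

lemma iota_sec_point_family:
  assumes A: "A \<in> TO_sections \<A>" and K: "compact K" "\<omega> \<in> tensor_sections_in \<A> 0 0 1 K" and c: "c \<in> \<A>"
  shows "smooth_family (img c) K s r 1 (\<lambda>x. iota_sec r s c I J A (chart_inv c x) \<omega>)"
proof (rule iota_sec_family[OF open_chart(2)[OF c] K(1) c])
  show "smooth_on (img c) (\<lambda>x. snd c (chart_inv c x))"
    by (rule iffD2[OF smooth_on_cong[OF open_chart(2)[OF c]] smooth_on_id[OF open_chart(2)[OF c]]])
       (rule chart_inv_right)
  show "smooth_on (img c \<times> img d) (\<lambda>z. \<omega> (chart_inv d (snd z)) d [] [])" if "d \<in> \<A>" for d
    using K(2) by (intro section_smooth_const open_chart c that) (auto simp: tensor_sections_in_def)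
qed (use A K c in \<open>auto intro: chart_inv_in TO_smooth_const open_chart\<close>)

text \<open>Varying A along a line, for the differential in the third slot; the dependence is
  polynomial rather than affine, since A enters once for every tensor factor.\<close>

lemma iota_sec_line_family:
  assumes A: "A \<in> TO_sections \<A>" and B: "B \<in> TO_sections \<A>"
    and K: "compact K" "\<omega> \<in> tensor_sections_in \<A> 0 0 1 K" and c: "c \<in> charts_at \<A> p"
  shows "smooth_family (UNIV :: real set) K s r 1 (\<lambda>\<epsilon>. iota_sec r s c I J (A + \<epsilon> *\<^sub>R B) p \<omega>)"
proof (rule iota_sec_family[OF open_UNIV K(1)])
  show "c \<in> \<A>" "p \<in> fst c" using c by (auto simp: charts_at_iff)
  show "A + \<epsilon> *\<^sub>R B \<in> TO_sections \<A>" for \<epsilon> by (intro TO_add TO_scaleR A B)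
  show "smooth_on (UNIV \<times> (img c \<times> img d))
      (\<lambda>z. (A + fst z *\<^sub>R B) (chart_inv c (fst (snd z))) (chart_inv d (snd (snd z))) c d)" if cd: "c \<in> \<A>" "d \<in> \<A>" for c d
  proof -
    have op: "open ((UNIV :: real set) \<times> (img c \<times> img d))" by (intro open_Times open_UNIV open_chart cd)
    show ?thesis
      using smooth_on_add[OF op TO_smooth_const[OF open_UNIV A cd]
          smooth_on_scaleR[OF op smooth_on_fst[OF op] TO_smooth_const[OF open_UNIV B cd]]] by simp
  qed
  show "smooth_on (UNIV \<times> img d) (\<lambda>z. \<omega> (chart_inv d (snd z)) d [] [])" if "d \<in> \<A>" for d
    using K(2) by (intro section_smooth_const open_UNIV that) (auto simp: tensor_sections_in_def)
qed (use K in auto)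

end

context manifold_field
begin

text \<open>
  With \<open>G a b\<close> the value at \<open>q\<close> of the section obtained by flowing \<open>p\<close> for time \<open>a\<close> and \<open>q\<close> for time
  \<open>b\<close>, the two sides are \<open>\<partial>\<^sub>aG + \<partial>\<^sub>bG\<close> and the derivative of \<open>\<tau> \<mapsto> G \<tau> \<tau>\<close> at \<open>0\<close>, the latter evaluated by
  the product rule.
\<close>

lemma lie_iota_sec_identity:
  assumes A: "A \<in> TO_sections \<A>" and \<omega>: "\<omega> \<in> tensor_csections \<A> 0 0 1"
    and c: "c \<in> charts_at \<A> p" and d: "d \<in> charts_at \<A> q"
  shows "lie_expr r s 0 (\<lambda>p c I J. iota_sec r s c I J A p \<omega> q d K L) c I J (snd c p) +
      lie \<A> s r 1 X (iota_sec r s c I J A p \<omega>) q d K L =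
    iota_sec r s c I J A p (lie \<A> 0 0 1 X \<omega>) q d K L +
      pder (\<lambda>\<epsilon>::real. iota_sec r s c I J (A + \<epsilon> *\<^sub>R TO_lie \<A> X A) p \<omega>) 1 0 q d K L"
proof -
  have cA: "c \<in> \<A>" "p \<in> fst c" "d \<in> \<A>" "q \<in> fst d" using c d by (auto simp: charts_at_iff)
  obtain C where C: "compact C" "\<omega> \<in> tensor_sections_in \<A> 0 0 1 C" using \<omega> unfolding csections_iff by blast
  obtain \<delta>1 y \<Phi> where fp: "flow_data c p \<delta>1 y \<Phi>" using flow_data_exists[OF c] by blast
  obtain \<delta>2 z \<Psi> where fq: "flow_data d q \<delta>2 z \<Psi>" using flow_data_exists[OF d] by blast
  note pD = flow_dataD[OF fp] and qD = flow_dataD[OF fq]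
  note \<omega>s = csections_sections[OF \<omega>]
  \<comment> \<open>P and Q are A(p,q) and A(q,p) pulled back by the flow with independent times a
    at p and b at q. The coefficient o' of the pulled back form depends on b only.\<close>
  define P where "P a b = matrix_inv (\<Psi> b) ** A (chart_inv c (y a)) (chart_inv d (z b)) c d ** \<Phi> a" for a b
  define Q where "Q a b = matrix_inv (\<Phi> a) ** A (chart_inv d (z b)) (chart_inv c (y a)) d c ** \<Psi> b" for a b
  define o' where "o' b = det (\<Psi> b) * \<omega> (chart_inv d (z b)) d [] []" for b
  define G where "G u = coef s r (P (fst u) (snd u)) (Q (fst u) (snd u)) K L J I * o' (snd u)" for u
  have dy: "y differentiable (at 0)" "\<Phi> differentiable (at 0)" "z differentiable (at 0)" "\<Psi> differentiable (at 0)"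
    using pD(4,6) qD(4,6) differentiableI_vector by blast+
  have dinvs: "(\<lambda>a. matrix_inv (\<Phi> a)) differentiable (at 0)" "(\<lambda>a. matrix_inv (\<Psi> a)) differentiable (at 0)"
    using differentiable_compose[of matrix_inv \<Phi> 0] differentiable_compose[of matrix_inv \<Psi> 0]
      matrix_inv_differentiable[OF invertible_mat_1] dy pD(5) qD(5) by auto
  have dA: "(\<lambda>u. A (chart_inv c (y (fst u))) (chart_inv d (z (snd u))) c d) differentiable (at (0, 0))"
    "(\<lambda>u. A (chart_inv d (z (snd u))) (chart_inv c (y (fst u))) d c) differentiable (at (0, 0))"
  proof -
    have *: "(\<lambda>u. (y (fst u), z (snd u))) differentiable (at (0, 0))" "(\<lambda>u. (z (snd u), y (fst u))) differentiable (at (0, 0))"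
      using differentiable_fst_snd[OF dy(1,3)] by (auto intro!: differentiable_Pair)
    have "(y 0, z 0) \<in> img c \<times> img d" "(z 0, y 0) \<in> img d \<times> img c" using pD(3) qD(3) cA by auto
    then show "(\<lambda>u. A (chart_inv c (y (fst u))) (chart_inv d (z (snd u))) c d) differentiable (at (0, 0))"
      "(\<lambda>u. A (chart_inv d (z (snd u))) (chart_inv c (y (fst u))) d c) differentiable (at (0, 0))"
      using differentiable_compose[OF _ *(1), of "\<lambda>z. A (chart_inv c (fst z)) (chart_inv d (snd z)) c d"]
        differentiable_compose[OF _ *(2), of "\<lambda>z. A (chart_inv d (fst z)) (chart_inv c (snd z)) d c"]
        smooth_on_differentiable[OF TO_smooth[OF A cA(1,3)]] smooth_on_differentiable[OF TO_smooth[OF A cA(3,1)]]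
      by auto
  qed
  have do': "o' differentiable (at 0)"
  proof -
    have "det differentiable (at (\<Psi> 0))"
      using smooth_on_differentiable[OF smooth_on_det[OF open_UNIV smooth_on_id[OF open_UNIV]]] by simp
    moreover have "(\<lambda>x. \<omega> (chart_inv d x) d [] []) differentiable (at (z 0))"
      by (rule smooth_on_differentiable[OF section_smooth[OF \<omega>s cA(3)]]) (use qD(3) cA in simp)
    ultimately show ?thesis
      unfolding o'_def
      using differentiable_compose[of det \<Psi> 0] differentiable_compose[of "\<lambda>x. \<omega> (chart_inv d x) d [] []" z 0] dy
      by (intro differentiable_mult) auto
  qed
  note mm = differentiable_bilinear[OF bounded_bilinear_matrix_mult]
  have dG: "G differentiable (at (0, 0))"
    unfolding G_def P_def Q_def
    by (intro differentiable_mult coef_differentiable mm dA differentiable_fst_snd[OF dy(2) dinvs(2)]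
        differentiable_fst_snd[OF dinvs(1) dy(4)] differentiable_fst_snd[OF dy(1) do'])
  define t where "t p c I J = iota_sec r s c I J A p \<omega> q d K L" for p c I J
  let ?sec = "iota_sec r s c I J A p \<omega>"
  have Ga: "((\<lambda>a. G (a, 0)) has_real_derivative lie_expr r s 0 t c I J (snd c p)) (at 0)"
  proof (rule has_real_derivative_eventually[OF pull_curve_derivative[where t = t, OF fp]])
    show "(\<lambda>x. t (chart_inv c x) c K' L') differentiable (at (snd c p))" for K' L'
      unfolding t_def
      by (rule smooth_on_differentiable[OF family_component[OF iota_sec_point_family[OF A C cA(1)]]]) (use cA in simp)
    show "\<forall>\<^sub>F a in nhds 0. tensor_action r s 0 (matrix_inv (\<Phi> a)) (t (chart_inv c (y a)) c) I J = G (a, 0)"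
      using eventually_abs_less[OF pD(2)]
    proof eventually_elim
      case (elim a)
      let ?x = "chart_inv c (y a)"
      \<comment> \<open>Pulling back at p acts on I and J, which sit in the last slots of the
        coefficient; \<open>coef_mult_right\<close> moves the matrices into P and Q.\<close>
      have "tensor_action r s 0 (matrix_inv (\<Phi> a)) (t ?x c) I J =
          (\<Sum>K' | length K' = r. \<Sum>L' | length L' = s. coef r s (matrix_inv (\<Phi> a)) (\<Phi> a) I J K' L' *
            coef s r (A ?x q c d) (A q ?x d c) K L L' K') * \<omega> q d [] []"
        using d by (simp add: tensor_action_matrix_inv[OF pD(9)[OF elim]] pull_coef_def t_def iota_sec_def
            sum_distrib_right mult.assoc)
      also have "\<dots> = coef s r (A ?x q c d ** \<Phi> a) (matrix_inv (\<Phi> a) ** A q ?x d c) K L J I * \<omega> q d [] []"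
        by (subst sum.swap) (simp add: coef_mult_right)
      also have "\<dots> = G (a, 0)"
        by (simp add: G_def P_def Q_def o'_def qD(3,5,13))
      finally show ?case .
    qed
  qed
  have Gb: "((\<lambda>b. G (0, b)) has_real_derivative lie_expr s r 1 ?sec d K L (snd d q)) (at 0)"
  proof (rule has_real_derivative_eventually[OF pull_curve_derivative[where t = ?sec, OF fq]])
    show "(\<lambda>x. ?sec (chart_inv d x) d K' L') differentiable (at (snd d q))" for K' L'
      by (rule smooth_on_differentiable[OF section_smooth[OF csections_sections[OF iota_sec_csection[OF A \<omega> c]] cA(3)]])
         (use cA in simp)
    show "\<forall>\<^sub>F b in nhds 0. tensor_action s r 1 (matrix_inv (\<Psi> b)) (?sec (chart_inv d (z b)) d) K L = G (0, b)"
      using eventually_abs_less[OF qD(2)]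
    proof eventually_elim
      case (elim b)
      let ?x = "chart_inv d (z b)"
      \<comment> \<open>Pulling back at q acts on K and L in the first slots, hence
        \<open>coef_mult\<close>; the determinant of weight 1 is absorbed in o'.\<close>
      have "tensor_action s r 1 (matrix_inv (\<Psi> b)) (?sec ?x d) K L =
          (\<Sum>K' | length K' = s. \<Sum>L' | length L' = r. coef s r (matrix_inv (\<Psi> b)) (\<Psi> b) K L K' L' *
            coef s r (A p ?x c d) (A ?x p d c) K' L' J I) * o' b"
        using qD(14)[OF elim] by (simp add: tensor_action_matrix_inv[OF qD(9)[OF elim]] pull_coef_def iota_sec_def
            o'_def sum_distrib_left mult_ac)
      also have "\<dots> = G (0, b)"
        by (simp add: coef_mult G_def P_def Q_def pD(3,5,13))
      finally show ?case .
    qed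
  qed
  let ?P0 = "A p q c d" and ?Q0 = "A q p d c" and ?P1 = "TO_lie \<A> X A p q c d" and ?Q1 = "TO_lie \<A> X A q p d c"
  have P0: "P 0 0 = ?P0" "Q 0 0 = ?Q0" by (simp_all add: P_def Q_def pD(3,5,13) qD(3,5,13))
  have Pd: "((\<lambda>\<tau>. (P \<tau> \<tau>, Q \<tau> \<tau>)) has_vector_derivative (?P1, ?Q1)) (at 0)"
    unfolding P_def Q_def TO_lie_eq_self[OF c d A] TO_lie_eq_self[OF d c A]
    by (intro has_vector_derivative_Pair TO_curve_derivative[OF fp fq A] TO_curve_derivative[OF fq fp A])
  \<comment> \<open>The curve of flow pullbacks and the line in the direction of the Lie derivatives
    pass through the same pair of matrices with the same velocity at 0, so E has the same derivative
    E' along both. This replaces a product rule over all tensor factors.\<close>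
  define E where "E M = coef s r (fst M) (snd M) K L J I" for M :: "(real^'n^'n) \<times> (real^'n^'n)"
  have dE: "E differentiable (at M)" for M
    unfolding E_def
    by (intro coef_differentiable bounded_linear_imp_differentiable bounded_linear_fst bounded_linear_snd)
  define E' where "E' = frechet_derivative E (at (?P0, ?Q0)) (?P1, ?Q1)"
  have E1: "((\<lambda>\<tau>. E (P \<tau> \<tau>, Q \<tau> \<tau>)) has_real_derivative E') (at 0)"
    using has_vector_derivative_compose_frechet[OF Pd dE]
    by (simp add: E'_def P0 has_real_derivative_iff_has_vector_derivative)
  have E2: "((\<lambda>\<epsilon>. E (?P0 + \<epsilon> *\<^sub>R ?P1, ?Q0 + \<epsilon> *\<^sub>R ?Q1)) has_real_derivative E') (at 0)"
  proof -
    have "((\<lambda>\<epsilon>. (?P0 + \<epsilon> *\<^sub>R ?P1, ?Q0 + \<epsilon> *\<^sub>R ?Q1)) has_vector_derivative (?P1, ?Q1)) (at 0)"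
      by (intro has_vector_derivative_Pair) (auto intro!: derivative_eq_intros)
    from has_vector_derivative_compose_frechet[OF this dE] show ?thesis
      by (simp add: E'_def has_real_derivative_iff_has_vector_derivative)
  qed
  have od: "(o' has_real_derivative lie \<A> 0 0 1 X \<omega> q d [] []) (at 0)"
  proof -
    have dw: "(\<lambda>x. \<omega> (chart_inv d x) d K' L') differentiable (at (snd d q))" for K' L'
      by (rule smooth_on_differentiable[OF section_smooth[OF \<omega>s cA(3)]]) (use cA in simp)
    have lw: "lie \<A> 0 0 1 X \<omega> q d [] [] = lie_expr 0 0 1 \<omega> d [] [] (snd d q)"
      using lie_section(2)[OF \<omega>s cA(3), of "snd d q" "[]" "[]"] cA by (simp add: chart_inv_left)
    show ?thesis
      unfolding lw
    proof (rule has_real_derivative_eventually[OF pull_curve_derivative[where t = \<omega>, OF fq dw]])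
      show "\<forall>\<^sub>F b in nhds 0. tensor_action 0 0 1 (matrix_inv (\<Psi> b)) (\<omega> (chart_inv d (z b)) d) [] [] = o' b"
        using eventually_abs_less[OF qD(2)]
        by eventually_elim (simp add: tensor_action_matrix_inv[OF qD(9)] pull_coef_def o'_def coef_def wprod_def)
    qed
  qed
  have "((\<lambda>\<tau>. E (P \<tau> \<tau>, Q \<tau> \<tau>) * o' \<tau>) has_real_derivative E' * o' 0 + lie \<A> 0 0 1 X \<omega> q d [] [] * E (P 0 0, Q 0 0)) (at 0)"
    by (rule DERIV_mult[OF E1 od])
  moreover have "((\<lambda>\<tau>. E (P \<tau> \<tau>, Q \<tau> \<tau>) * o' \<tau>) has_real_derivative
      lie_expr r s 0 t c I J (snd c p) + lie_expr s r 1 ?sec d K L (snd d q)) (at 0)"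
    using diagonal_derivative[OF dG Ga Gb] by (simp add: G_def E_def)
  ultimately have eq: "lie_expr r s 0 t c I J (snd c p) + lie_expr s r 1 ?sec d K L (snd d q) =
      E' * \<omega> q d [] [] + lie \<A> 0 0 1 X \<omega> q d [] [] * E (?P0, ?Q0)"
    using DERIV_unique by (fastforce simp: P0 o'_def qD(3,5,13))
  have T4: "lie \<A> s r 1 X ?sec q d K L = lie_expr s r 1 ?sec d K L (snd d q)"
    using lie_section(2)[OF csections_sections[OF iota_sec_csection[OF A \<omega> c]] cA(3), of "snd d q"] cA
    by (simp add: chart_inv_left)
  have T3: "pder (\<lambda>\<epsilon>::real. iota_sec r s c I J (A + \<epsilon> *\<^sub>R TO_lie \<A> X A) p \<omega>) 1 0 q d K L = E' * \<omega> q d [] []"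
  proof -
    have "((\<lambda>\<epsilon>. iota_sec r s c I J (A + \<epsilon> *\<^sub>R TO_lie \<A> X A) p \<omega> q d K L) has_real_derivative E' * \<omega> q d [] []) (at 0)"
      using DERIV_cmult_right[OF E2, of "\<omega> q d [] []"] d by (simp add: iota_sec_def E_def)
    from frechet_derivative_apply[OF this[unfolded has_field_derivative_def], of 1]
    show ?thesis by (simp add: pder_def)
  qed
  show ?thesis
    using eq d unfolding T4 T3 t_def[abs_def] by (simp add: iota_sec_def E_def mult.commute)
qed

text \<open>In the coordinate formula at p the coefficients do not involve q and the derivative
  along the field passes under v, so the whole formula becomes v of one section T, computed
  pointwise in q by the same formula.\<close>

lemma lie_iota:
  assumes v: "v \<in> distributions \<A> r s" and A: "A \<in> TO_sections \<A>" and \<omega>: "\<omega> \<in> tensor_csections \<A> 0 0 1"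
    and c: "c \<in> charts_at \<A> p"
  obtains T where "T \<in> tensor_csections \<A> s r 1" "lie \<A> r s 0 X (\<lambda>q. iota \<A> r s v \<omega> q A) p c I J = v T"
    "\<And>q d K L. d \<in> charts_at \<A> q \<Longrightarrow>
      T q d K L = lie_expr r s 0 (\<lambda>p c I J. iota_sec r s c I J A p \<omega> q d K L) c I J (snd c p)"
proof -
  have cA: "c \<in> \<A>" "p \<in> fst c" "snd c p \<in> img c" "chart_inv c (snd c p) = p"
    using c by (auto simp: charts_at_iff chart_inv_left)
  obtain C where C: "compact C" "\<omega> \<in> tensor_sections_in \<A> 0 0 1 C" using \<omega> unfolding csections_iff by blast
  define \<sigma> where "\<sigma> K L x = iota_sec r s c K L A (chart_inv c x) \<omega>" for K L x
  have fam: "smooth_family (img c) C s r 1 (\<sigma> K L)" for K L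
    unfolding \<sigma>_def[abs_def] by (rule iota_sec_point_family[OF A C cA(1)])
  let ?x = "snd c p"
  \<comment> \<open>The summand of \<open>lie_expr\<close> with v removed: values and parameter
    derivatives of v become the section and its parameter derivative.\<close>
  define S where "S K L = lie_coef r s 0 (dvf c ?x) I J K L *\<^sub>R iota_sec r s c K L A p \<omega> +
      coef r s (mat 1) (mat 1) I J K L *\<^sub>R pder (\<sigma> K L) (vf c ?x) ?x" for K L
  have sec: "iota_sec r s c K L A p \<omega> \<in> tensor_csections \<A> s r 1" for K L
    by (rule iota_sec_csection[OF A \<omega> c])
  have pds: "pder (\<sigma> K L) e ?x \<in> tensor_csections \<A> s r 1" for K L e
    by (rule family_csection[OF pder_family[OF fam] cA(3)])
  have S: "S K L \<in> tensor_csections \<A> s r 1" for K L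
    unfolding S_def by (intro csections_add csections_scaleR sec pds)
  have vS: "v (S K L) = lie_coef r s 0 (dvf c ?x) I J K L * v (iota_sec r s c K L A p \<omega>) +
      coef r s (mat 1) (mat 1) I J K L * v (pder (\<sigma> K L) (vf c ?x) ?x)" for K L
    unfolding S_def distribution_linear(1)[OF v csections_scaleR[OF sec] csections_scaleR[OF pds]]
      distribution_linear(2)[OF v sec] distribution_linear(2)[OF v pds] ..
  have io: "iota \<A> r s v \<omega> (chart_inv c x) A c K L = v (\<sigma> K L x)" if "x \<in> img c" for x K L
    using chart_inv_charts_at[OF cA(1) that] by (simp add: iota_eq[OF v A \<omega>] iota_comp_def \<sigma>_def)
  have hd: "((\<lambda>x. iota \<A> r s v \<omega> (chart_inv c x) A c K L) has_derivative (\<lambda>e. v (pder (\<sigma> K L) e ?x))) (at ?x)" for K L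
    by (rule has_derivative_transform_within_open[OF distribution_family_derivative[OF v fam cA(3)] open_chart(2)[OF cA(1)] cA(3)])
       (simp add: io)
  show thesis
  proof (rule that[of "\<Sum>K | length K = r. \<Sum>L | length L = s. S K L"])
    show "(\<Sum>K | length K = r. \<Sum>L | length L = s. S K L) \<in> tensor_csections \<A> s r 1"
      by (intro csections_sum S)
    have "lie \<A> r s 0 X (\<lambda>q. iota \<A> r s v \<omega> q A) p c I J = lie_expr r s 0 (\<lambda>q. iota \<A> r s v \<omega> q A) c I J ?x"
    proof (rule lie_eq[OF c])
      show "iota \<A> r s v \<omega> q A \<in> tensor_fibre \<A> r s 0 q" for q
        unfolding iota_eq[OF v A \<omega>] by (rule iota_comp_fibre[OF v A \<omega>])
      show "(\<lambda>x. iota \<A> r s v \<omega> (chart_inv c x) A c K L) differentiable (at ?x)" for K L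
        using hd unfolding differentiable_def by blast
    qed
    also have "\<dots> = (\<Sum>K | length K = r. \<Sum>L | length L = s. v (S K L))"
      unfolding lie_expr_def vS frechet_derivative_apply[OF hd] io[OF cA(3)] by (simp add: \<sigma>_def cA(4))
    also have "\<dots> = v (\<Sum>K | length K = r. \<Sum>L | length L = s. S K L)"
      using distribution_sum2[where a = "\<lambda>_ _. 1" and \<sigma> = S, OF v S] by simp
    finally show "lie \<A> r s 0 X (\<lambda>q. iota \<A> r s v \<omega> q A) p c I J = v (\<Sum>K | length K = r. \<Sum>L | length L = s. S K L)" .
    fix q d M N assume "d \<in> charts_at \<A> q"
    show "(\<Sum>K | length K = r. \<Sum>L | length L = s. S K L) q d M N =
        lie_expr r s 0 (\<lambda>p c I J. iota_sec r s c I J A p \<omega> q d M N) c I J ?x"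
      by (simp add: sum_fun_apply lie_expr_def S_def pder_def \<sigma>_def[abs_def] cA(4))
  qed
qed

text \<open>Stated for compactly supported forms of arbitrary integral, so that the line through
  \<omega> in the direction of its Lie derivative stays in the domain without computing the integral
  of that derivative.\<close>

lemma lie_hat_iota:
  assumes v: "v \<in> distributions \<A> r s" and A: "A \<in> TO_sections \<A>" and \<omega>: "\<omega> \<in> tensor_csections \<A> 0 0 1"
  shows "lie_hat \<A> r s X (iota \<A> r s v) \<omega> p A = iota \<A> r s (dist_lie \<A> r s X v) \<omega> p A"
proof (intro ext)
  fix c I J
  let ?\<eta> = "lie \<A> 0 0 1 X \<omega>" and ?B = "TO_lie \<A> X A"
  have \<eta>: "?\<eta> \<in> tensor_csections \<A> 0 0 1" by (rule lie_csection[OF \<omega>])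
  have B: "?B \<in> TO_sections \<A>" by (rule TO_lie_sections[OF A])
  have \<omega>\<eta>: "\<omega> + \<epsilon> *\<^sub>R ?\<eta> \<in> tensor_csections \<A> 0 0 1" for \<epsilon> by (intro csections_add csections_scaleR \<omega> \<eta>)
  have AB: "A + \<epsilon> *\<^sub>R ?B \<in> TO_sections \<A>" for \<epsilon> by (intro TO_add TO_scaleR A B)
  have Lv: "dist_lie \<A> r s X v \<in> distributions \<A> r s" by (rule dist_lie_distribution[OF v])
  show "lie_hat \<A> r s X (iota \<A> r s v) \<omega> p A c I J = iota \<A> r s (dist_lie \<A> r s X v) \<omega> p A c I J"
  proof (cases "c \<in> charts_at \<A> p")
    case False
    then have "d1 (iota \<A> r s v) \<omega> p A ?\<eta> c I J = 0"
      unfolding d1_def iota_eq[OF v A \<omega>\<eta>] by (simp add: iota_comp_def)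
    then show ?thesis
      using False
      by (simp add: lie_hat_def d3_def lie_outside iota_eq[OF v AB \<omega>] iota_eq[OF Lv A \<omega>] iota_comp_def)
  next
    case c: True
    obtain C where C: "compact C" "\<omega> \<in> tensor_sections_in \<A> 0 0 1 C" using \<omega> unfolding csections_iff by blast
    obtain T1 where T1: "T1 \<in> tensor_csections \<A> s r 1"
      "lie \<A> r s 0 X (\<lambda>q. iota \<A> r s v \<omega> q A) p c I J = v T1"
      "\<And>q d K L. d \<in> charts_at \<A> q \<Longrightarrow>
        T1 q d K L = lie_expr r s 0 (\<lambda>p c I J. iota_sec r s c I J A p \<omega> q d K L) c I J (snd c p)"
    proof (rule lie_iota[OF v A \<omega> c, of I J], goal_cases)
      case (1 T)
      show ?case by (rule that) (fact 1)+
    qed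
    let ?sec = "iota_sec r s c I J A p"
    define T2 where "T2 = ?sec ?\<eta>"
    have T2: "T2 \<in> tensor_csections \<A> s r 1" unfolding T2_def by (rule iota_sec_csection[OF A \<eta> c])
    let ?\<sigma> = "\<lambda>\<epsilon>::real. iota_sec r s c I J (A + \<epsilon> *\<^sub>R ?B) p \<omega>"
    have fam: "smooth_family UNIV C s r 1 ?\<sigma>" by (rule iota_sec_line_family[OF A B C c])
    define T3 where "T3 = pder ?\<sigma> 1 0"
    have T3: "T3 \<in> tensor_csections \<A> s r 1"
      unfolding T3_def by (rule family_csection[OF pder_family[OF fam]]) simp
    define T4 where "T4 = lie \<A> s r 1 X (?sec \<omega>)"
    have T4: "T4 \<in> tensor_csections \<A> s r 1"
      unfolding T4_def by (rule lie_csection[OF iota_sec_csection[OF A \<omega> c]])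
    have d1: "d1 (iota \<A> r s v) \<omega> p A ?\<eta> c I J = v T2"
    proof -
      \<comment> \<open>The section is linear in the form, so the differential in the first slot is
        v of the section built with the Lie derivative of \<omega>.\<close>
      have "?sec (\<omega> + \<epsilon> *\<^sub>R ?\<eta>) = ?sec \<omega> + \<epsilon> *\<^sub>R T2" for \<epsilon>
        by (intro ext) (simp add: iota_sec_def T2_def algebra_simps)
      then have "iota \<A> r s v (\<omega> + \<epsilon> *\<^sub>R ?\<eta>) p A c I J = v (?sec \<omega>) + \<epsilon> * v T2" for \<epsilon>
        using c distribution_linear(1)[OF v iota_sec_csection[OF A \<omega> c] csections_scaleR[OF T2]] distribution_linear(2)[OF v T2]
        unfolding iota_eq[OF v A \<omega>\<eta>] by (simp add: iota_comp_def)
      then show ?thesis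
        unfolding d1_def by (auto intro!: DERIV_imp_deriv derivative_eq_intros)
    qed
    have d3: "d3 (iota \<A> r s v) \<omega> p A ?B c I J = v T3"
    proof -
      have "((\<lambda>\<epsilon>. v (?\<sigma> \<epsilon>)) has_derivative (\<lambda>e. v (pder ?\<sigma> e 0))) (at 0)"
        by (rule distribution_family_derivative[OF v fam]) simp
      moreover have "v (pder ?\<sigma> e 0) = v T3 * e" for e
        using linear_cmul[OF has_derivative_linear[OF calculation], of e 1] by (simp add: T3_def)
      ultimately have "((\<lambda>\<epsilon>. v (?\<sigma> \<epsilon>)) has_real_derivative v T3) (at 0)"
        by (simp add: has_field_derivative_def)
      then show ?thesis
        using c unfolding d3_def by (simp add: iota_eq[OF v AB \<omega>] iota_comp_def DERIV_imp_deriv)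
    qed
    \<comment> \<open>The claim reads v T1 - v T2 - v T3 = - v T4. At charts not around q all four
      sections vanish; elsewhere this is the pointwise identity.\<close>
    have "T1 + T4 = T2 + T3"
    proof (intro ext)
      fix q d K L
      show "(T1 + T4) q d K L = (T2 + T3) q d K L"
      proof (cases "d \<in> charts_at \<A> q")
        case True
        then show ?thesis
          using lie_iota_sec_identity[OF A \<omega> c True, of r s K L I J]
          by (simp add: T1(3) T2_def T3_def T4_def)
      next
        case False
        have "T q d = 0" if "T \<in> tensor_csections \<A> s r 1" for T
          by (rule fibre_outside[OF section_fibre[OF csections_sections[OF that]] False])
        then show ?thesis using T1(1) T2 T3 T4 by simp
      qed
    qed
    then have "v (T1 + T4) = v (T2 + T3)" by simp
    then have "v T1 + v T4 = v T2 + v T3"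
      by (simp only: distribution_linear(1)[OF v T1(1) T4] distribution_linear(1)[OF v T2 T3])
    moreover have "iota \<A> r s (dist_lie \<A> r s X v) \<omega> p A c I J = - v T4"
      unfolding iota_eq[OF Lv A \<omega>] using c by (simp add: iota_comp_def dist_lie_def T4_def)
    ultimately show ?thesis
      using T1(2) d1 d3 by (simp add: lie_hat_def)
  qed
qed

lemma lie_hat_iota_basic_eq:
  assumes par: "paracompact_space (euclidean :: 'a topology)" and v: "v \<in> distributions \<A> r s"
  shows "basic_eq \<A> r s (lie_hat \<A> r s X (iota \<A> r s v)) (iota \<A> r s (dist_lie \<A> r s X v))"
proof -
  let ?u = "lie_hat \<A> r s X (iota \<A> r s v)" and ?u' = "iota \<A> r s (dist_lie \<A> r s X v)"
  have u': "?u' \<in> basic_space \<A> r s" by (rule iota_basic_space[OF par dist_lie_distribution[OF v]])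
  have eq: "?u \<omega> p A = ?u' \<omega> p A" if "\<omega> \<in> A_hat0 \<A>" "A \<in> B_hat \<A>" for \<omega> p A
    by (rule lie_hat_iota[OF v B_hat_TO[OF that(2)] A_hat0_csection[OF that(1)]])
  \<comment> \<open>Membership is decided by values on the domain of the basic space alone, where
    both sides agree, so it carries over from \<open>?u'\<close>.\<close>
  have "?u \<in> basic_space \<A> r s"
    unfolding basic_space_def
  proof (intro CollectI conjI ballI allI impI)
    fix \<omega> p A assume "\<omega> \<in> A_hat0 \<A>" "A \<in> B_hat \<A>"
    then show "?u \<omega> p A \<in> tensor_fibre \<A> r s 0 p"
      using u' by (simp add: eq basic_space_def)
  next
    fix \<omega> p A c I J
    assume *: "smooth_curve (tensor_lf \<A> 0 0 1) \<omega>" "\<forall>t. \<omega> t \<in> A_hat0 \<A>" "smooth_curve_in_manifold \<A> p"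
      "smooth_curve (TO_lf \<A>) A" "c \<in> \<A>"
    then have "smooth_on {t. p t \<in> fst c} (\<lambda>t. ?u' (\<omega> t) (p t) (A t) c I J)"
      using u' unfolding basic_space_def by blast
    moreover have "?u (\<omega> t) (p t) (A t) = ?u' (\<omega> t) (p t) (A t)" for t
      by (rule eq) (use * TO_curve_B_hat in auto)
    ultimately show "smooth_on {t. p t \<in> fst c} (\<lambda>t. ?u (\<omega> t) (p t) (A t) c I J)" by simp
  qed
  then show ?thesis unfolding basic_eq_def using u' eq by blast
qed

end

theorem proposition6p8:
  fixes \<A> :: "('a::t2_space, 'n::finite) chart set"
    and r s :: nat
    and X :: "'a \<Rightarrow> ('a, 'n) tensor"
    and v :: "('a \<Rightarrow> ('a, 'n) tensor) \<Rightarrow> real"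
  assumes "paracompact_space (euclidean :: 'a topology)"
    and "oriented_smooth_atlas \<A>"
    and "X \<in> vector_fields \<A>"
    and "v \<in> distributions \<A> r s"
  shows "iota \<A> r s v \<in> basic_space \<A> r s \<and>
    basic_eq \<A> r s (lie_hat \<A> r s X (iota \<A> r s v)) (iota \<A> r s (dist_lie \<A> r s X v))"
proof -
  interpret manifold_field \<A> X
    by unfold_locales (use assms in auto)
  show ?thesis
    using iota_basic_space[OF assms(1,4)] lie_hat_iota_basic_eq[OF assms(1,4)] by blast
qed

end
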